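(* Fix $\theta>0$ and let $\ell=\ell(n)$ be even integers with $\ell(n)\sim 2\theta n$ as $n\to\infty$. Let $\boldsymbol\lambda\vdash n$ be a random partition distributed according to the positive half Plancherel--Hurwitz measure $\mathbb P^+_{n,\ell}$. Then, as $n\to\infty$: (i) $\boldsymbol\lambda_1\left(\frac{2\ell}{\log n}\right)^{-1}\to 1$ in probability; (ii) the partition $\tilde{\boldsymbol\lambda}=(\boldsymbol\lambda_2,\boldsymbol\lambda_3,\ldots)$ satisfies $\sup_{x\in\mathbb R}|\psi_{\tilde{\boldsymbol\lambda}}(x)-\Omega(x)|\to 0$ in probability, where $\Omega(x)=\frac{2}{\pi}\left(x\arcsin\frac{x}{2}+\sqrt{4-x^2}\right)$ for $|x|\le 2$ and $\Omega(x)=|x|$ for $|x|>2$; (iii) $\boldsymbol\lambda_2/\sqrt n\to 2$ and $\ell(\boldsymbol\lambda)/\sqrt n\to 2$ in probability.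
   Context: A partition $\lambda\vdash n$ is a weakly decreasing sequence $\lambda_1\ge\lambda_2\ge\dots\ge\lambda_{\ell(\lambda)}>0$ of integers summing to $n$ (with $\lambda_i=0$ for $i>\ell(\lambda)$); $\ell(\lambda)$ is its number of parts. Its Young diagram consists of boxes $(i,j)$ with $1\le j\le\lambda_i$. $f_\lambda$ denotes the number of standard Young tableaux of shape $\lambda$. The content-sum is $C_\lambda=\sum_{(i,j)\in\lambda}(j-i)=\sum_i \lambda_i(\lambda_i-2i+1)/2$. For $n\ge1$ and even $\ell\ge0$, $H_{n,\ell}$ is the number of tuples $(\tau_1,\dots,\tau_\ell)$ of transpositions in $\mathfrak S_n$ with $\tau_1\cdots\tau_\ell=\mathrm{id}$; by the Frobenius formula $H_{n,\ell}=\frac1{n!}\sum_{\lambda\vdash n}f_\lambda^2C_\lambda^\ell$. The Plancherel--Hurwitz measure on partitions of $n$ is $\mathbb P_{n,\ell}(\lambda)=\frac{f_\lambda^2C_\lambda^\ell}{n!H_{n,\ell}}$, and for $\ell>0$ its positive half is $\mathbb P^+_{n,\ell}(\lambda)=\mathbb P_{n,\ell}(\lambda\mid C_\lambda>0)=2\cdot\mathbf 1_{C_\lambda>0}\mathbb P_{n,\ell}(\lambda)$. Rescaled profile: for a partition $\mu$ of size $m$, $\psi_\mu:\mathbb R\to\mathbb R$ is the continuous piecewise linear function (slopes $\pm1$) such that the region $\{(x,y):|x|\le y\le\psi_\mu(x)\}$ is the union over boxes $(i,j)$ of $\mu$ of the squares $\{(a,b):|a-(j-i)|+|b-(j+i-1)|\le1\}$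 scaled by the factor $1/\sqrt m$ (the Young diagram drawn in "Russian" convention, rescaled by $1/\sqrt m$), and $\psi_\mu(x)=|x|$ outside this region's horizontal extent. *)

theory Defs
  imports
    "HOL-Probability.Probability"
    "HOL-Combinatorics.Transposition"
    "HOL-Library.Landau_Symbols"
    "HOL-Library.More_List"
begin

text \<open>
  An integer partition is the list of its (positive) parts, in weakly decreasing order.
\<close>

definition partitions :: "nat \<Rightarrow> nat list set" where
  "partitions n = {\<mu>. sorted_wrt (\<ge>) \<mu> \<and> (\<forall>p\<in>set \<mu>. 0 < p) \<and> sum_list \<mu> = n}"

text \<open>Parts are numbered from 1; \<open>nth_part \<mu> i = 0\<close> for \<open>i > length \<mu>\<close>.\<close>

definition nth_part :: "nat list \<Rightarrow> nat \<Rightarrow> nat" where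
  "nth_part \<mu> i = nth_default 0 \<mu> (i - 1)"

definition young_diagram :: "nat list \<Rightarrow> (nat \<times> nat) set" where
  "young_diagram \<mu> = {(i, j). 1 \<le> i \<and> i \<le> length \<mu> \<and> 1 \<le> j \<and> j \<le> nth_part \<mu> i}"

text \<open>Fillings are extensional functions on the diagram, so that they can be counted.\<close>

definition standard_young_tableaux :: "nat list \<Rightarrow> (nat \<times> nat \<Rightarrow> nat) set" where
  "standard_young_tableaux \<mu> =
     {T \<in> extensional (young_diagram \<mu>).
        bij_betw T (young_diagram \<mu>) {1..sum_list \<mu>} \<and>
        (\<forall>i j. (i, j) \<in> young_diagram \<mu> \<and> (i, j + 1) \<in> young_diagram \<mu> \<longrightarrow> T (i, j) < T (i, j + 1)) \<and>
        (\<forall>i j. (i, j) \<in> young_diagram \<mu> \<and> (i + 1, j) \<in> young_diagram \<mu> \<longrightarrow> T (i, j) < T (i + 1, j))}"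

definition num_syt :: "nat list \<Rightarrow> nat" where
  "num_syt \<mu> = card (standard_young_tableaux \<mu>)"

definition content_sum :: "nat list \<Rightarrow> int" where
  "content_sum \<mu> = (\<Sum>(i, j)\<in>young_diagram \<mu>. int j - int i)"

definition transpositions :: "nat \<Rightarrow> (nat \<Rightarrow> nat) set" where
  "transpositions n = {Transposition.transpose a b | a b. a \<in> {1..n} \<and> b \<in> {1..n} \<and> a \<noteq> b}"

definition hurwitz_number :: "nat \<Rightarrow> nat \<Rightarrow> nat" where
  "hurwitz_number n l =
     card {\<tau>s. length \<tau>s = l \<and> set \<tau>s \<subseteq> transpositions n \<and> foldr (\<circ>) \<tau>s id = id}"

definition plancherel_hurwitz :: "nat \<Rightarrow> nat \<Rightarrow> nat list measure" where
  "plancherel_hurwitz n l =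
     point_measure (partitions n)
       (\<lambda>\<mu>. ennreal (real (num_syt \<mu>) ^ 2 * real_of_int (content_sum \<mu>) ^ l
                      / (fact n * real (hurwitz_number n l))))"

text \<open>
  \<open>uniform_measure M A\<close> is \<open>M\<close> conditioned on the event \<open>A\<close>.
\<close>

definition plancherel_hurwitz_pos :: "nat \<Rightarrow> nat \<Rightarrow> nat list measure" where
  "plancherel_hurwitz_pos n l =
     uniform_measure (plancherel_hurwitz n l) {\<mu> \<in> partitions n. content_sum \<mu> > 0}"

text \<open>
  The Young diagram in Russian convention, scaled by \<open>1 / sqrt |\<mu>|\<close>.
\<close>

definition russian_region :: "nat list \<Rightarrow> (real \<times> real) set" where
  "russian_region \<mu> =
     (\<lambda>(a, b). (a / sqrt (real (sum_list \<mu>)), b / sqrt (real (sum_list \<mu>)))) `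
       (\<Union>(i, j)\<in>young_diagram \<mu>.
          {(a, b). \<bar>a - (real j - real i)\<bar> + \<bar>b - (real j + real i - 1)\<bar> \<le> 1})"

text \<open>
  The upper boundary of the region, extended by \<open>|x|\<close> where the vertical line at \<open>x\<close>
  misses the region (in particular everywhere if \<open>\<mu>\<close> is empty).
\<close>

definition profile :: "nat list \<Rightarrow> real \<Rightarrow> real" where
  "profile \<mu> x = Sup (insert \<bar>x\<bar> {y. (x, y) \<in> russian_region \<mu>})"

definition limit_shape :: "real \<Rightarrow> real" where
  "limit_shape x =
     (if \<bar>x\<bar> \<le> 2 then 2 / pi * (x * arcsin (x / 2) + sqrt (4 - x\<^sup>2)) else \<bar>x\<bar>)"

text \<open>Convergence in probability to a constant, where the probability space may vary with \<open>n\<close>.\<close>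

definition tendsto_in_prob ::
  "(nat \<Rightarrow> 'a measure) \<Rightarrow> (nat \<Rightarrow> 'a \<Rightarrow> real) \<Rightarrow> real \<Rightarrow> bool" where
  "tendsto_in_prob M X c \<longleftrightarrow>
     (\<forall>\<epsilon>>0. (\<lambda>n. measure (M n) {\<omega> \<in> space (M n). \<bar>X n \<omega> - c\<bar> > \<epsilon>}) \<longlonglongrightarrow> 0)"

end

theory Submission
  imports Defs "HOL-Real_Asymp.Real_Asymp"
begin

text \<open>
  A partition of \<open>n\<close> is split into its first row \<open>k\<close> and the remaining rows \<open>\<mu>\<close>. Bounding \<open>f\<^sub>\<lambda>\<close> by the
  product over the rows of size at least \<open>n / (log n)\<^sup>3\<close> and the content sum by half the sum of their squares
  shows that, with \<open>L = 2 \<ell> / log n\<close>, the weight \<open>f\<^sub>\<lambda>\<^sup>2 C\<^sub>\<lambda>\<^sup>\<ell>\<close> is exponentially smaller than the total mass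
  unless \<open>k\<close> is close to \<open>L\<close> and the second row is \<open>o(L)\<close>.

  For fixed \<open>k\<close> of order \<open>L\<close>, the law of \<open>\<mu>\<close> has a density with respect to the Plancherel measure of size
  \<open>m = n - k\<close> which is controlled by \<open>exp (\<beta> C\<^sub>\<mu>)\<close> with \<open>\<beta>\<close> of order \<open>(log n)\<^sup>2 / n\<close>. Truncated exponential moments of the
  content sum show that this density is subexponential in \<open>sqrt m\<close> on average, so everything that has Plancherel
  probability at most \<open>exp (- c sqrt m)\<close> remains negligible for \<open>\<mu>\<close>.

  The law of large numbers for the Plancherel measure with such a rate is obtained without determinantal
  processes. The expectation of \<open>\<Sum> exp (z c)\<close> over the contents \<open>c\<close> of the boxes is a Laguerre polynomial, computed exactly
  from the commutation relation of adding and removing boxes; this bounds the first row and column. Since the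
  logarithm of the Frobenius formula is strictly concave in the shifted parts, the measure concentrates near a maximiser of
  \<open>f\<close>, hence \<open>\<Sum> exp (z c)\<close> concentrates at its mean. Its limits are the exponential moments of \<open>\<Omega>\<close>, and these
  determine a Lipschitz profile uniformly.
\<close>

section \<open>The Frobenius formula and its branching rule\<close>

text \<open>The scale \<open>L\<close> maximises \<open>2 l ln k - k ln n\<close> in
  \<open>k\<close>: up to factors \<open>exp (o(n))\<close>, a first row \<open>k\<close> costs
  \<open>exp (- k ln n)\<close> in the squared dimension and gains \<open>(k^2 / 2)^l\<close> from
  the content. Competing diagrams lose a factor exponential in \<open>l\<close>, hence in
  \<open>n\<close>, while there are only \<open>exp (O(sqrt n ln n))\<close> partitions, so bounding
  each weight and counting settles the first row.

  The obstacle is the second row. That crude step only shows it to be \<open>o(L)\<close>, far above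
  \<open>sqrt n\<close>, and under this truncation alone the change of measure is controlled by
  \<open>exp (O(n^(1/4) (ln n)^4))\<close>. Hence the Plancherel law of large numbers is needed with
  failure probability \<open>exp (- c sqrt m)\<close>, and the truncation at \<open>L / 64\<close>
  is chosen to keep the power of \<open>n\<close> below \<open>1 / 2\<close>.

  Closeness to a maximiser does not reveal its shape. The exact mean of the exponential sums does:
  concentration makes these sums nearly constant, and the mean then names the constant.\<close>

lemma partial_fraction_prod:
  fixes x :: "'a \<Rightarrow> real"
  assumes "finite I" "inj_on x I" "y \<notin> x ` I"
  shows "(\<Prod>j\<in>I. 1 + t / (y - x j)) =
         1 + (\<Sum>i\<in>I. t / (y - x i) * (\<Prod>j\<in>I - {i}. 1 + t / (x i - x j)))"
  using assms
proof (induction I arbitrary: y rule: finite_induct)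
  case empty
  then show ?case by simp
next
  case (insert k I)
  define A where "A i = (\<Prod>j\<in>I - {i}. 1 + t / (x i - x j))" for i
  have inj: "inj_on x I" and xk: "x k \<notin> x ` I" and yI: "y \<notin> x ` I" and yk: "y \<noteq> x k"
    using insert.prems insert.hyps by auto
  have IHy: "(\<Prod>j\<in>I. 1 + t / (y - x j)) = 1 + (\<Sum>i\<in>I. t / (y - x i) * A i)"
    unfolding A_def using insert.IH[OF inj yI] .
  have IHk: "(\<Prod>j\<in>I. 1 + t / (x k - x j)) = 1 + (\<Sum>i\<in>I. t / (x k - x i) * A i)"
    unfolding A_def using insert.IH[OF inj xk] .
  have A_ins: "(\<Prod>j\<in>insert k I - {i}. 1 + t / (x i - x j)) = (1 + t / (x i - x k)) * A i" if "i \<in> I" for i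
  proof -
    have "insert k I - {i} = insert k (I - {i})" using that insert.hyps by auto
    then show ?thesis unfolding A_def using insert.hyps by simp
  qed
  have Ik: "insert k I - {k} = I" using insert.hyps by auto
  \<comment> \<open>The product of the poles at \<open>x k\<close> and \<open>x i\<close> is split
    into two simple poles in \<open>y\<close>.\<close>
  have key: "(1 + t / (y - x k)) * (t / (y - x i) * A i) =
      t / (y - x k) * (t / (x k - x i) * A i) + t / (y - x i) * ((1 + t / (x i - x k)) * A i)" if "i \<in> I" for i
  proof -
    have ne: "y - x k \<noteq> 0" "y - x i \<noteq> 0" "x k - x i \<noteq> 0" "x i - x k \<noteq> 0"
      using that yk yI xk by (auto simp: image_iff)
    have "(1 + t / (y - x k)) * (t / (y - x i)) =
      t / (y - x k) * (t / (x k - x i)) + t / (y - x i) * (1 + t / (x i - x k))"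
      using ne by (simp add: divide_simps) (simp add: algebra_simps)
    then have "(1 + t / (y - x k)) * (t / (y - x i)) * A i =
      (t / (y - x k) * (t / (x k - x i)) + t / (y - x i) * (1 + t / (x i - x k))) * A i" by simp
    then show ?thesis by (simp only: distrib_right mult.assoc)
  qed
  have "(\<Prod>j\<in>insert k I. 1 + t / (y - x j)) = (1 + t / (y - x k)) * (1 + (\<Sum>i\<in>I. t / (y - x i) * A i))"
    using insert.hyps IHy by simp
  also have "\<dots> = 1 + t / (y - x k) + (\<Sum>i\<in>I. (1 + t / (y - x k)) * (t / (y - x i) * A i))"
    by (simp add: distrib_left sum_distrib_left)
  also have "\<dots> = 1 + t / (y - x k) + (\<Sum>i\<in>I. t / (y - x k) * (t / (x k - x i) * A i) + t / (y - x i) * ((1 + t / (x i - x k)) * A i))"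
    using key by simp
  also have "\<dots> = 1 + t / (y - x k) * (1 + (\<Sum>i\<in>I. t / (x k - x i) * A i)) + (\<Sum>i\<in>I. t / (y - x i) * ((1 + t / (x i - x k)) * A i))"
    by (simp add: sum.distrib sum_distrib_left algebra_simps)
  also have "\<dots> = 1 + t / (y - x k) * (\<Prod>j\<in>I. 1 + t / (x k - x j)) + (\<Sum>i\<in>I. t / (y - x i) * ((1 + t / (x i - x k)) * A i))"
    by (simp only: IHk)
  also have "\<dots> = 1 + (\<Sum>i\<in>insert k I. t / (y - x i) * (\<Prod>j\<in>insert k I - {i}. 1 + t / (x i - x j)))"
    using insert.hyps A_ins by (simp add: Ik)
  finally show ?case .
qed

text \<open>In \<open>partial_fraction_prod\<close> both sides have simple poles at the
  \<open>x i\<close> and tend to 1 at infinity. Comparing the coefficients of \<open>1 / y\<close>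
  and \<open>1 / y^2\<close> there gives these sums; the induction reaches them by evaluating that
  expansion at \<open>y = x k\<close> for each new point \<open>k\<close>.\<close>

lemma partial_fraction_sums:
  fixes x :: "'a \<Rightarrow> real"
  assumes "finite I" "inj_on x I"
  shows "(\<Sum>i\<in>I. \<Prod>j\<in>I - {i}. 1 + t / (x i - x j)) = real (card I)"
    and "(\<Sum>i\<in>I. x i * (\<Prod>j\<in>I - {i}. 1 + t / (x i - x j))) =
         (\<Sum>i\<in>I. x i) + t * real (card I) * (real (card I) - 1) / 2"
  using assms
proof (induction I rule: finite_induct)
  case empty
  { case 1 show ?case by simp }
  { case 2 show ?case by simp }
next
  case (insert k I)
  define A where "A i = (\<Prod>j\<in>I - {i}. 1 + t / (x i - x j))" for i
  have inj: "inj_on x I" if "inj_on x (insert k I)" using that by auto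
  have A_ins: "(\<Prod>j\<in>insert k I - {i}. 1 + t / (x i - x j)) = (1 + t / (x i - x k)) * A i" if "i \<in> I" for i
  proof -
    have "insert k I - {i} = insert k (I - {i})" using that insert.hyps by auto
    then show ?thesis unfolding A_def using insert.hyps by simp
  qed
  have Ik: "insert k I - {k} = I" using insert.hyps by auto
  have prodk: "(\<Prod>j\<in>I. 1 + t / (x k - x j)) = 1 + (\<Sum>i\<in>I. t / (x k - x i) * A i)"
    if "inj_on x (insert k I)"
    unfolding A_def using insert.hyps that by (intro partial_fraction_prod) auto
  have flip: "t / (x i - x k) = - (t / (x k - x i))" for i
    by (metis minus_diff_eq minus_divide_right)
  { case 1
    have "(\<Sum>i\<in>insert k I. \<Prod>j\<in>insert k I - {i}. 1 + t / (x i - x j)) =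
      1 + (\<Sum>i\<in>I. t / (x k - x i) * A i) + (\<Sum>i\<in>I. (1 + t / (x i - x k)) * A i)"
      using insert.hyps A_ins prodk[OF 1] by (simp add: Ik)
    also have "\<dots> = 1 + (\<Sum>i\<in>I. A i)"
      by (simp add: flip sum.distrib[symmetric] algebra_simps)
    also have "\<dots> = real (card (insert k I))"
      using insert.IH(1)[OF inj[OF 1]] insert.hyps by (simp add: A_def)
    finally show ?case . }
  { case 2
    have ne: "x k - x i \<noteq> 0" if "i \<in> I" for i using that 2 insert.hyps by (auto simp: inj_on_def)
    have trm: "x k * (t / (x k - x i) * A i) + x i * ((1 + t / (x i - x k)) * A i) = t * A i + x i * A i" if "i \<in> I" for i
    proof -
      define u where "u = t / (x k - x i)"
      have u: "(x k - x i) * u = t" using ne[OF that] by (simp add: u_def)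
      have "x k * (u * A i) + x i * ((1 + - u) * A i) = ((x k - x i) * u) * A i + x i * A i"
        by (simp add: algebra_simps)
      then show ?thesis unfolding flip u_def[symmetric] u .
    qed
    have "(\<Sum>i\<in>insert k I. x i * (\<Prod>j\<in>insert k I - {i}. 1 + t / (x i - x j))) =
      x k * (1 + (\<Sum>i\<in>I. t / (x k - x i) * A i)) + (\<Sum>i\<in>I. x i * ((1 + t / (x i - x k)) * A i))"
      using insert.hyps A_ins prodk[OF 2] by (simp add: Ik)
    also have "\<dots> = x k + (\<Sum>i\<in>I. x k * (t / (x k - x i) * A i) + x i * ((1 + t / (x i - x k)) * A i))"
      by (simp add: sum.distrib sum_distrib_left distrib_left)
    also have "\<dots> = x k + (\<Sum>i\<in>I. t * A i + x i * A i)"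
      using trm by simp
    also have "\<dots> = x k + t * (\<Sum>i\<in>I. A i) + (\<Sum>i\<in>I. x i * A i)"
      by (simp add: sum.distrib sum_distrib_left)
    also have "\<dots> = (\<Sum>i\<in>insert k I. x i) + t * real (card (insert k I)) * (real (card (insert k I)) - 1) / 2"
      using insert.IH(1)[OF inj[OF 2]] insert.IH(2)[OF inj[OF 2]] insert.hyps
      by (simp add: A_def field_simps)
    finally show ?case . }
qed

section \<open>Vandermonde products, integer partitions and the Frobenius formula\<close>

definition vander :: "nat \<Rightarrow> (nat \<Rightarrow> real) \<Rightarrow> real" where
  "vander d x = (\<Prod>j<d. \<Prod>i<j. x i - x j)"

lemma vander_Suc: "vander (Suc d) x = vander d x * (\<Prod>i<d. x i - x d)"
  by (simp add: vander_def)

text \<open>Moving one point changes only the factors that involve it, with the same signs on both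
  sides. The quotient is cross-multiplied, so that no two points have to be distinct.\<close>

lemma vander_update:
  assumes "r < d"
  shows "vander d (x(r := y)) * (\<Prod>j\<in>{..<d} - {r}. x r - x j) = vander d x * (\<Prod>j\<in>{..<d} - {r}. y - x j)"
  using assms
proof (induction d)
  case 0
  then show ?case by simp
next
  case (Suc d)
  show ?case
  proof (cases "r = d")
    case True
    have "vander d (x(r := y)) = vander d x"
      unfolding vander_def using True by (intro prod.cong refl) auto
    moreover have "{..<Suc d} - {r} = {..<d}" using True by auto
    moreover have "(\<Prod>i<d. (x(r := y)) i - (x(r := y)) d) = (\<Prod>i<d. x i - y)"
      using True by (intro prod.cong refl) auto
    moreover have "(\<Prod>i<d. x i - y) * (\<Prod>j<d. x r - x j) = (\<Prod>i<d. x i - x d) * (\<Prod>j<d. y - x j)"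
      unfolding prod.distrib[symmetric] using True by (intro prod.cong refl) (auto simp: algebra_simps)
    ultimately show ?thesis unfolding vander_Suc by (metis mult.assoc)
  next
    case False
    then have r: "r < d" using Suc by simp
    have s: "{..<Suc d} - {r} = insert d ({..<d} - {r})" using r by auto
    have sr: "(\<Prod>i<d. g i) = g r * (\<Prod>i\<in>{..<d} - {r}. g i)" for g :: "nat \<Rightarrow> real"
      using r by (intro prod.remove) auto
    have e: "(\<Prod>i<d. (x(r := y)) i - (x(r := y)) d) = (y - x d) * (\<Prod>i\<in>{..<d} - {r}. x i - x d)"
      unfolding sr using r by (auto intro!: arg_cong2[where f="(*)"] prod.cong)
    have "vander (Suc d) (x(r := y)) * (\<Prod>j\<in>{..<Suc d} - {r}. x r - x j)
      = (vander d (x(r := y)) * (\<Prod>j\<in>{..<d} - {r}. x r - x j)) * ((y - x d) * (\<Prod>i\<in>{..<d} - {r}. x i - x d)) * (x r - x d)"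
      unfolding vander_Suc e s using r by simp
    also have "\<dots> = (vander d x * (\<Prod>j\<in>{..<d} - {r}. y - x j)) * ((y - x d) * (\<Prod>i\<in>{..<d} - {r}. x i - x d)) * (x r - x d)"
      by (simp only: Suc.IH[OF r])
    also have "\<dots> = vander (Suc d) x * (\<Prod>j\<in>{..<Suc d} - {r}. y - x j)"
      unfolding vander_Suc s sr[of "\<lambda>i. x i - x d"] using r by simp
    finally show ?thesis .
  qed
qed

text \<open>Partitions are encoded as eventually vanishing sequences indexed from 0: \<open>p i\<close> is the part usually
  called \<open>\<lambda>\<close> with index \<open>i + 1\<close>.\<close>

definition young :: "nat \<Rightarrow> (nat \<Rightarrow> nat) set" where
  "young n = {p. (\<forall>i. p (Suc i) \<le> p i) \<and> (\<forall>i\<ge>n. p i = 0) \<and> (\<Sum>i<n. p i) = n}"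

lemma young_antimono: "p \<in> young n \<Longrightarrow> i \<le> j \<Longrightarrow> p j \<le> p i"
  by (rule lift_Suc_antimono_le[of p]) (auto simp: young_def)

lemma young_zero: "p \<in> young n \<Longrightarrow> n \<le> i \<Longrightarrow> p i = 0"
  by (auto simp: young_def)

lemma sum_zero_ext:
  fixes p :: "nat \<Rightarrow> 'a::comm_monoid_add"
  assumes "\<And>i. d \<le> i \<Longrightarrow> i < e \<Longrightarrow> p i = 0" "d \<le> e"
  shows "(\<Sum>i<e. p i) = (\<Sum>i<d. p i)"
  using assms by (intro sum.mono_neutral_right) auto

lemma young_sum: 
  assumes "p \<in> young n" "\<And>i. d \<le> i \<Longrightarrow> p i = 0"
  shows "(\<Sum>i<d. p i) = n"
proof (cases "d \<le> n")
  case True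
  with assms sum_zero_ext[of d n p] show ?thesis by (auto simp: young_def)
next
  case False
  with assms sum_zero_ext[of n d p] show ?thesis by (auto simp: young_def)
qed

text \<open>A decreasing sequence with sum \<open>n\<close> has at most \<open>n\<close> positive
  entries, so the bound on the number of rows that is built into \<open>young\<close> follows from
  any bound \<open>d\<close>.\<close>

lemma youngI:
  assumes "\<And>i. p (Suc i) \<le> p i" "\<And>i. d \<le> i \<Longrightarrow> p i = 0" "(\<Sum>i<d. p i) = n"
  shows "p \<in> young n"
proof -
  have anti: "p j \<le> p i" if "i \<le> j" for i j
    by (rule lift_Suc_antimono_le[of p]) (use assms that in auto)
  have z: "p i = 0" if "n \<le> i" for i
  proof (rule ccontr)
    assume "p i \<noteq> 0"
    then have ge1: "1 \<le> p j" if "j \<le> i" for j using anti[OF that] by simp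
    have "i < d" using assms(2)[of i] \<open>p i \<noteq> 0\<close> by (cases "i < d") auto
    have "Suc i = (\<Sum>j<Suc i. 1)" by simp
    also have "\<dots> \<le> (\<Sum>j<Suc i. p j)" using ge1 by (intro sum_mono) auto
    also have "\<dots> \<le> (\<Sum>j<d. p j)" using \<open>i < d\<close> by (intro sum_mono2) auto
    finally show False using assms(3) that by simp
  qed
  have "(\<Sum>i<n. p i) = n"
  proof (cases "d \<le> n")
    case True
    with assms sum_zero_ext[of d n p] show ?thesis by auto
  next
    case False
    with assms z sum_zero_ext[of n d p] show ?thesis by auto
  qed
  then show ?thesis using assms z by (auto simp: young_def)
qed

definition shifted :: "(nat \<Rightarrow> nat) \<Rightarrow> nat \<Rightarrow> int" where
  "shifted p i = int (p i) - int i"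

text \<open>Frobenius' formula, written with \<open>d\<close> rows. Its value is the same for every \<open>d\<close> beyond the last
  nonzero row, so \<open>fdim\<close> below may use the least one.\<close>

definition dimf :: "nat \<Rightarrow> (nat \<Rightarrow> nat) \<Rightarrow> real" where
  "dimf d p = fact (\<Sum>i<d. p i) * vander d (\<lambda>i. of_int (shifted p i)) / (\<Prod>i<d. fact (p i + (d - 1 - i)))"

text \<open>An extra empty row multiplies the factorial of row \<open>i\<close> by
  \<open>p i + d - i\<close>, which is exactly the new Vandermonde factor of that row.\<close>

lemma dimf_Suc_zero:
  assumes "p d = 0"
  shows "dimf (Suc d) p = dimf d p"
proof -
  have "(\<Prod>i<Suc d. fact (p i + (Suc d - 1 - i)) :: real) = (\<Prod>i<d. real (p i + (d - i)) * fact (p i + (d - 1 - i)))"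
  proof -
    have "(fact (p i + (d - i)) :: real) = real (p i + (d - i)) * fact (p i + (d - 1 - i))" if "i < d" for i
    proof -
      have "p i + (d - i) = Suc (p i + (d - 1 - i))" using that by simp
      then show ?thesis by (metis fact_Suc of_nat_fact of_nat_mult)
    qed
    then have "(\<Prod>i<d. fact (p i + (d - i)) :: real) = (\<Prod>i<d. real (p i + (d - i)) * fact (p i + (d - 1 - i)))" by (intro prod.cong) auto
    then show ?thesis using assms by simp
  qed
  also have "\<dots> = (\<Prod>i<d. of_int (shifted p i) - of_int (shifted p d)) * (\<Prod>i<d. fact (p i + (d - 1 - i)))"
    unfolding prod.distrib using assms by (auto simp: shifted_def of_nat_diff intro!: arg_cong2[where f="(*)"] prod.cong)
  finally have e: "(\<Prod>i<Suc d. fact (p i + (Suc d - 1 - i)) :: real) = \<dots>" .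
  have "(\<Prod>i<d. of_int (shifted p i) - of_int (shifted p d) :: real) \<noteq> 0"
    using assms by (auto simp: shifted_def)
  then show ?thesis unfolding dimf_def e vander_Suc using assms by simp
qed

lemma dimf_extend:
  assumes "\<And>i. d \<le> i \<Longrightarrow> p i = 0" "d \<le> e"
  shows "dimf e p = dimf d p"
  using assms(2)
proof (induction e rule: dec_induct)
  case (step e)
  then show ?case using dimf_Suc_zero[of p e] assms(1)[of e] by simp
qed simp

definition fdim :: "(nat \<Rightarrow> nat) \<Rightarrow> real" where
  "fdim p = dimf (LEAST d. \<forall>i\<ge>d. p i = 0) p"

lemma fdim_eq_dimf:
  assumes "\<And>i. d \<le> i \<Longrightarrow> p i = 0"
  shows "fdim p = dimf d p"
proof -
  let ?P = "\<lambda>d. \<forall>i\<ge>d. p i = 0"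
  have "?P d" using assms by auto
  define e where "e = Least ?P"
  have "?P e" "e \<le> d"
    unfolding e_def by (rule LeastI[of ?P, OF \<open>?P d\<close>], rule Least_le[of ?P, OF \<open>?P d\<close>])
  then have "dimf d p = dimf e p" by (intro dimf_extend) blast+
  then show ?thesis unfolding fdim_def e_def by simp
qed

section \<open>Adding and removing boxes, the branching rule, and prepending a row\<close>

definition addable :: "(nat \<Rightarrow> nat) \<Rightarrow> nat set" where
  "addable p = {i. i = 0 \<or> p i < p (i - 1)}"
definition removable :: "(nat \<Rightarrow> nat) \<Rightarrow> nat set" where
  "removable p = {i. p (Suc i) < p i}"
definition add_box :: "(nat \<Rightarrow> nat) \<Rightarrow> nat \<Rightarrow> nat \<Rightarrow> nat" where
  "add_box p i = p(i := Suc (p i))"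
definition rem_box :: "(nat \<Rightarrow> nat) \<Rightarrow> nat \<Rightarrow> nat \<Rightarrow> nat" where
  "rem_box p i = p(i := p i - 1)"

lemma addable_subset: "p \<in> young n \<Longrightarrow> addable p \<subseteq> {..n}"
proof
  fix i assume p: "p \<in> young n" and "i \<in> addable p"
  then have "i = 0 \<or> p (i - 1) \<noteq> 0" by (auto simp: addable_def)
  then have "i = 0 \<or> i - 1 < n" using young_zero[OF p, of "i - 1"] by (cases "n \<le> i - 1") auto
  then show "i \<in> {..n}" by auto
qed

lemma removable_subset: "p \<in> young n \<Longrightarrow> removable p \<subseteq> {..<n}"
  by (auto simp: removable_def) (metis not_le not_less_zero young_zero)

lemma finite_addable: "p \<in> young n \<Longrightarrow> finite (addable p)"
  using addable_subset finite_subset by blast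

lemma finite_removable: "p \<in> young n \<Longrightarrow> finite (removable p)"
  using removable_subset finite_subset by blast

lemma add_box_young:
  assumes "p \<in> young n" "i \<in> addable p"
  shows "add_box p i \<in> young (Suc n)"
proof (rule youngI[where d = "Suc n"])
  have i: "i \<le> n" using assms addable_subset by blast
  show "add_box p i (Suc j) \<le> add_box p i j" for j
    using assms by (auto simp: add_box_def addable_def young_def le_Suc_eq)
  show "add_box p i j = 0" if "Suc n \<le> j" for j
    using assms i that by (auto simp: add_box_def young_def)
  have "(\<Sum>j<Suc n. add_box p i j) = (\<Sum>j<Suc n. p j + (if j = i then 1 else 0))"
    by (intro sum.cong) (auto simp: add_box_def)
  also have "\<dots> = (\<Sum>j<Suc n. p j) + 1" using i by (subst sum.distrib) (simp del: sum.lessThan_Suc)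
  also have "(\<Sum>j<Suc n. p j) = n" using young_sum[OF assms(1), of "Suc n"] young_zero[OF assms(1)] by simp
  finally show "(\<Sum>j<Suc n. add_box p i j) = Suc n" by simp
qed

lemma rem_box_young:
  assumes "p \<in> young (Suc n)" "i \<in> removable p"
  shows "rem_box p i \<in> young n"
proof (rule youngI[where d = "Suc n"])
  have i: "i < Suc n" using assms removable_subset by blast
  have pi: "p i > 0" using assms by (auto simp: removable_def)
  show "rem_box p i (Suc j) \<le> rem_box p i j" for j
    using assms by (auto simp: rem_box_def removable_def young_def le_Suc_eq intro: le_trans[OF diff_le_self])
  show "rem_box p i j = 0" if "Suc n \<le> j" for j
    using assms i that by (auto simp: rem_box_def young_def)
  have "Suc n = (\<Sum>j<Suc n. p j)" using assms by (simp add: young_def)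
  also have "\<dots> = (\<Sum>j<Suc n. rem_box p i j + (if j = i then 1 else 0))"
    using pi by (intro sum.cong) (auto simp: rem_box_def)
  also have "\<dots> = (\<Sum>j<Suc n. rem_box p i j) + 1" using i by (subst sum.distrib) (simp del: sum.lessThan_Suc)
  finally show "(\<Sum>j<Suc n. rem_box p i j) = n" by simp
qed

lemma shifted_strict: "p \<in> young n \<Longrightarrow> i < j \<Longrightarrow> shifted p j < shifted p i"
  using young_antimono[of p n i j] by (auto simp: shifted_def)

lemma shifted_inj: "p \<in> young n \<Longrightarrow> inj_on (shifted p) A"
  by (rule inj_onI) (metis less_irrefl linorder_neqE_nat shifted_strict)

lemma vander_pos: "p \<in> young n \<Longrightarrow> vander d (\<lambda>i. of_int (shifted p i)) > 0"
  unfolding vander_def by (auto intro!: prod_pos simp: shifted_strict)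

lemma fdim_pos: "p \<in> young n \<Longrightarrow> fdim p > 0"
  using fdim_eq_dimf[of n p] young_zero[of p n] vander_pos[of p n n]
  by (auto simp: dimf_def intro!: divide_pos_pos mult_pos_pos prod_pos)

text \<open>Removing a box from row \<open>i\<close> multiplies \<open>fdim p\<close> by
  \<open>A i * l i / d\<close>: a ratio of Vandermonde products, a factor released by a factorial,
  and the factor lost by \<open>fact d\<close>. Since \<open>l i = x i + d - 1\<close>, the sum over
  \<open>i\<close> is a combination of both formulas of \<open>partial_fraction_sums\<close> at
  \<open>t = - 1\<close>.\<close>

lemma fdim_branching:
  assumes p: "p \<in> young (Suc n)"
  shows "(\<Sum>i\<in>removable p. fdim (rem_box p i)) = fdim p"
proof -
  define d where "d = Suc n"
  define x where "x i = real_of_int (shifted p i)" for i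
  define A where "A i = (\<Prod>j\<in>{..<d} - {i}. 1 + (-1) / (x i - x j))" for i
  define l where "l i = real (p i + (d - 1 - i))" for i
  have inj: "inj_on x {..<d}" using shifted_inj[OF p, of "{..<d}"] by (auto simp: x_def inj_on_def)
  have ne: "x i - x j \<noteq> 0" if "i < d" "j < d" "i \<noteq> j" for i j using inj that by (auto simp: inj_on_def)
  have zero: "p i = 0" if "d \<le> i" for i using young_zero[OF p] that by (simp add: d_def)
  have sumd: "(\<Sum>i<d. p i) = d" using p by (simp add: young_def d_def)
  have fp: "fdim p = dimf d p" by (rule fdim_eq_dimf) (use zero in auto)
  have lx: "l i = x i + real d - 1" if "i < d" for i using that by (simp add: l_def x_def shifted_def of_nat_diff)
  \<comment> \<open>Rows without a removable box drop out by themselves: an equal next row makes a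
    factor of \<open>A i\<close> vanish, and an empty last row makes \<open>l i\<close>
    vanish.\<close>
  have A0: "A i * l i = 0" if "i < d" "i \<notin> removable p" for i
  proof -
    have e: "p (Suc i) = p i" using that p by (auto simp: removable_def young_def intro: antisym)
    show ?thesis
    proof (cases "Suc i < d")
      case True
      then have "(1 + (-1) / (x i - x (Suc i))) = 0" using e by (simp add: x_def shifted_def)
      moreover have "Suc i \<in> {..<d} - {i}" using True by simp
      ultimately have "A i = 0" unfolding A_def by (intro prod_zero) (auto intro!: bexI[of _ "Suc i"])
      then show ?thesis by simp
    next
      case False
      then have "d = Suc i" using that by simp
      then show ?thesis using e zero[of "Suc i"] by (simp add: l_def)
    qed
  qed
  have step: "fdim (rem_box p i) * real d = fdim p * (A i * l i)" if i: "i \<in> removable p" for i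
  proof -
    have id: "i < d" using i removable_subset[OF p] by (auto simp: d_def)
    have pi: "p i > 0" using i by (auto simp: removable_def)
    have q: "rem_box p i \<in> young n" using rem_box_young[OF p i] .
    have fq: "fdim (rem_box p i) = dimf d (rem_box p i)"
      by (rule fdim_eq_dimf) (use q young_zero d_def in auto)
    have sq: "(\<Sum>j<d. rem_box p i j) = n" by (rule young_sum[OF q]) (use q young_zero d_def in auto)
    have vq: "vander d (\<lambda>j. of_int (shifted (rem_box p i) j)) = vander d (x(i := x i - 1))"
      by (rule arg_cong[where f = "vander d"]) (use pi in \<open>auto simp: fun_eq_iff x_def shifted_def rem_box_def of_nat_diff\<close>)
    have "vander d (x(i := x i - 1)) * (\<Prod>j\<in>{..<d} - {i}. x i - x j) = vander d x * (\<Prod>j\<in>{..<d} - {i}. x i - 1 - x j)"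
      by (rule vander_update[OF id])
    also have "(\<Prod>j\<in>{..<d} - {i}. x i - 1 - x j) = A i * (\<Prod>j\<in>{..<d} - {i}. x i - x j)"
      unfolding A_def prod.distrib[symmetric] using ne id by (intro prod.cong) (auto simp: field_simps)
    finally have v: "vander d (x(i := x i - 1)) = vander d x * A i"
      using ne id by (simp add: fun_upd_def)
    have "(\<Prod>j<d. fact (p j + (d - 1 - j)) :: real) = fact (p i + (d - 1 - i)) * (\<Prod>j\<in>{..<d} - {i}. fact (p j + (d - 1 - j)))"
      using id by (intro prod.remove) auto
    also have "\<dots> = l i * (fact (rem_box p i i + (d - 1 - i)) * (\<Prod>j\<in>{..<d} - {i}. fact (rem_box p i j + (d - 1 - j))))"
    proof -
      have "p i + (d - 1 - i) = Suc (rem_box p i i + (d - 1 - i))" using pi by (simp add: rem_box_def)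
      then have "(fact (p i + (d - 1 - i)) :: real) = l i * fact (rem_box p i i + (d - 1 - i))"
        unfolding l_def by (metis fact_Suc)
      moreover have "(\<Prod>j\<in>{..<d} - {i}. fact (p j + (d - 1 - j)) :: real) = (\<Prod>j\<in>{..<d} - {i}. fact (rem_box p i j + (d - 1 - j)))"
        by (intro prod.cong) (auto simp: rem_box_def)
      ultimately show ?thesis by simp
    qed
    also have "\<dots> = l i * (\<Prod>j<d. fact (rem_box p i j + (d - 1 - j)))"
      using id by (subst (2) prod.remove[of _ i]) auto
    finally have f: "(\<Prod>j<d. fact (p j + (d - 1 - j)) :: real) = l i * (\<Prod>j<d. fact (rem_box p i j + (d - 1 - j)))" .
    have l0: "l i \<noteq> 0" using pi by (simp add: l_def)
    have fa: "fact d = real d * fact n" unfolding d_def by simp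
    show ?thesis unfolding fp fq dimf_def f vq v sq sumd fa x_def[symmetric] using l0 by (simp add: field_simps)
  qed
  have "(\<Sum>i<d. A i * l i) = (\<Sum>i<d. x i * A i + (real d - 1) * A i)"
    by (intro sum.cong refl) (simp add: lx algebra_simps)
  also have "\<dots> = (\<Sum>i<d. x i * A i) + (real d - 1) * (\<Sum>i<d. A i)"
    by (simp add: sum.distrib sum_distrib_left)
  also have "\<dots> = (\<Sum>i<d. x i) - real d * (real d - 1) / 2 + (real d - 1) * real d"
    using partial_fraction_sums[OF _ inj, of "-1"] by (simp add: A_def)
  also have "(\<Sum>i<d. x i) = real (\<Sum>i<d. p i) - real (\<Sum>i<d. i)"
    by (simp add: x_def shifted_def sum_subtractf)
  also have "real (\<Sum>i<d. i) = real d * (real d - 1) / 2"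
    by (induction d) (auto simp: field_simps)
  finally have tot: "(\<Sum>i<d. A i * l i) = real d" using sumd by (simp add: field_simps)
  have "(\<Sum>i\<in>removable p. fdim (rem_box p i)) * real d = fdim p * (\<Sum>i\<in>removable p. A i * l i)"
    using step by (simp add: sum_distrib_left sum_distrib_right)
  also have "(\<Sum>i\<in>removable p. A i * l i) = (\<Sum>i<d. A i * l i)"
    using A0 removable_subset[OF p] by (intro sum.mono_neutral_left) (auto simp: d_def)
  finally show ?thesis using tot by (simp add: d_def)
qed

lemma young_case_nat:
  assumes "q \<in> young m" "q 0 \<le> k"
  shows "case_nat k q \<in> young (k + m)"
proof (rule youngI[where d = "Suc m"])
  show "case_nat k q (Suc i) \<le> case_nat k q i" for i
    using assms by (cases i) (auto simp: young_def)
  show "case_nat k q i = 0" if "Suc m \<le> i" for i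
    using assms that by (cases i) (auto simp: young_def)
  show "(\<Sum>i<Suc m. case_nat k q i) = k + m"
    using assms by (simp add: sum.lessThan_Suc_shift young_def del: sum.lessThan_Suc)
qed

lemma young_tail:
  assumes "p \<in> young n"
  shows "p \<circ> Suc \<in> young (n - p 0)" "p 0 \<le> n" "case_nat (p 0) (p \<circ> Suc) = p"
proof -
  have s: "(\<Sum>i<Suc n. p i) = n" by (rule young_sum[OF assms]) (use assms young_zero in auto)
  then have s': "p 0 + (\<Sum>i<n. p (Suc i)) = n" by (simp add: sum.lessThan_Suc_shift del: sum.lessThan_Suc)
  then show "p 0 \<le> n" by simp
  show "p \<circ> Suc \<in> young (n - p 0)"
  proof (rule youngI[where d = n])
    show "(p \<circ> Suc) (Suc i) \<le> (p \<circ> Suc) i" for i using assms by (simp add: young_def)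
    show "(p \<circ> Suc) i = 0" if "n \<le> i" for i using young_zero[OF assms, of "Suc i"] that by simp
    show "(\<Sum>i<n. (p \<circ> Suc) i) = n - p 0" using s' by simp
  qed
  show "case_nat (p 0) (p \<circ> Suc) = p" by (auto simp: fun_eq_iff split: nat.split)
qed

text \<open>A new first row leaves the Vandermonde product and the factorials of \<open>q\<close>
  intact. Its own Vandermonde factors are \<open>k + i + 1 - q i\<close>, and its factorial
  \<open>fact (k + d)\<close> is \<open>fact k\<close> times the product of the
  \<open>k + i + 1\<close>; their quotient is the last product.\<close>

lemma fdim_case_nat:
  assumes q: "q \<in> young m" and k: "q 0 \<le> k" and d: "\<And>i. d \<le> i \<Longrightarrow> q i = 0"
  shows "fdim (case_nat k q) = real ((k + m) choose k) * fdim q * (\<Prod>i<d. 1 - real (q i) / real (k + i + 1))"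
proof -
  let ?p = "case_nat k q"
  have "fdim ?p = dimf (Suc d) ?p"
    by (rule fdim_eq_dimf) (use d in \<open>auto split: nat.split\<close>)
  have sq: "(\<Sum>i<d. q i) = m" by (rule young_sum[OF q]) (use d in auto)
  have sp: "(\<Sum>i<Suc d. ?p i) = k + m" using sq by (simp add: sum.lessThan_Suc_shift del: sum.lessThan_Suc)
  have den: "(\<Prod>i<Suc d. fact (?p i + (Suc d - 1 - i)) :: real) = fact (k + d) * (\<Prod>i<d. fact (q i + (d - 1 - i)))"
    by (simp add: prod.lessThan_Suc_shift del: prod.lessThan_Suc)
  have v: "vander (Suc d) (\<lambda>i. of_int (shifted ?p i)) =
     (\<Prod>i<d. real (k + i + 1) - real (q i)) * vander d (\<lambda>i. of_int (shifted q i))"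
    unfolding vander_def 
    by (simp add: prod.lessThan_Suc_shift prod.distrib shifted_def add.commute add.left_commute diff_diff_eq[symmetric] diff_diff_eq2 del: prod.lessThan_Suc)
  have fk: "fact (k + d) = fact k * (\<Prod>i<d. real (k + i + 1))"
    by (induction d) (auto simp: algebra_simps)
  have pr: "(\<Prod>i<d. real (k + i + 1) - real (q i)) = (\<Prod>i<d. real (k + i + 1)) * (\<Prod>i<d. 1 - real (q i) / real (k + i + 1))"
    unfolding prod.distrib[symmetric] by (intro prod.cong) (auto simp: field_simps)
  have nz: "(\<Prod>i<d. real (k + i + 1)) \<noteq> 0" by simp
  have bin: "real ((k + m) choose k) = fact (k + m) / (fact k * fact m)"
    by (simp add: binomial_fact)
  have "fdim q = dimf d q" by (rule fdim_eq_dimf) (use d in auto)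
  show ?thesis unfolding \<open>fdim ?p = _\<close> \<open>fdim q = _\<close> dimf_def sp sq den v fk pr bin
    using nz by (simp add: field_simps)
qed

section \<open>Exact averages under the Plancherel measure\<close>

definition box_sum :: "(int \<Rightarrow> real) \<Rightarrow> (nat \<Rightarrow> nat) \<Rightarrow> real" where
  "box_sum \<phi> p = (\<Sum>i\<in>{i. p i \<noteq> 0}. \<Sum>j<p i. \<phi> (int j - int i))"

lemma box_sum_eq:
  assumes "\<And>i. d \<le> i \<Longrightarrow> p i = 0"
  shows "box_sum \<phi> p = (\<Sum>i<d. \<Sum>j<p i. \<phi> (int j - int i))"
  unfolding box_sum_def
proof (rule sum.mono_neutral_left)
  show "{i. p i \<noteq> 0} \<subseteq> {..<d}"
  proof
    fix x assume "x \<in> {i. p i \<noteq> 0}"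
    then show "x \<in> {..<d}" using assms[of x] by (cases "d \<le> x") auto
  qed
qed auto

lemma box_sum_add_box:
  assumes p: "p \<in> young n" and i: "i \<in> addable p"
  shows "box_sum \<phi> (add_box p i) = box_sum \<phi> p + \<phi> (shifted p i)"
proof -
  have il: "i \<le> n" using addable_subset[OF p] i by auto
  have zp: "p k = 0" if "Suc n \<le> k" for k using young_zero[OF p] that by auto
  have za: "add_box p i k = 0" if "Suc n \<le> k" for k using young_zero[OF add_box_young[OF p i]] that by auto
  have "(\<Sum>k<Suc n. \<Sum>j<add_box p i k. \<phi> (int j - int k)) =
        (\<Sum>k<Suc n. (\<Sum>j<p k. \<phi> (int j - int k)) + (if k = i then \<phi> (shifted p i) else 0))"
    by (intro sum.cong refl) (auto simp: add_box_def shifted_def)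
  also have "\<dots> = (\<Sum>k<Suc n. \<Sum>j<p k. \<phi> (int j - int k)) + \<phi> (shifted p i)"
    using il by (subst sum.distrib) (simp del: sum.lessThan_Suc)
  finally show ?thesis using box_sum_eq[of "Suc n" p \<phi>] box_sum_eq[of "Suc n" "add_box p i" \<phi>] zp za by simp
qed

text \<open>Here \<open>shifted p i\<close> is the content of the box that row \<open>i\<close>
  would gain and \<open>shifted p i - 1\<close> the content of its last box, so the two sums run
  over the outer and the inner corners.\<close>

definition kerov :: "(int \<Rightarrow> real) \<Rightarrow> (nat \<Rightarrow> nat) \<Rightarrow> real" where
  "kerov \<phi> p = (\<Sum>i\<in>addable p. \<phi> (shifted p i)) - (\<Sum>i\<in>removable p. \<phi> (shifted p i - 1))"

text \<open>Rows that are neither addable nor removable cancel, so the interlacing corner contents may be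
  replaced by all the \<open>shifted p i\<close>.\<close>

lemma kerov_eq_shifted:
  assumes p: "p \<in> young n" and d: "\<And>i. d \<le> i \<Longrightarrow> p i = 0"
  shows "kerov \<phi> p = \<phi> (- int d) + (\<Sum>i<d. \<phi> (shifted p i) - \<phi> (shifted p i - 1))"
proof -
  have sub_add: "addable p \<subseteq> {..d}"
  proof
    fix i assume "i \<in> addable p"
    then have "i = 0 \<or> p (i - 1) \<noteq> 0" by (auto simp: addable_def)
    then have "i = 0 \<or> \<not> d \<le> i - 1" using d[of "i - 1"] by auto
    then show "i \<in> {..d}" by auto
  qed
  have sub_rem: "removable p \<subseteq> {..<d}"
  proof
    fix i assume "i \<in> removable p"
    then show "i \<in> {..<d}" using d[of i] by (cases "d \<le> i") (auto simp: removable_def)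
  qed
  define a where "a i = (if i \<in> addable p then \<phi> (shifted p i) else 0)" for i
  define r where "r i = (if i \<in> removable p then \<phi> (shifted p i - 1) else 0)" for i
  have "(\<Sum>i\<in>addable p. \<phi> (shifted p i)) = (\<Sum>i\<le>d. a i)"
    unfolding a_def using sub_add by (subst sum.If_cases) (auto simp: Int_absorb1)
  also have "\<dots> = a 0 + (\<Sum>i<d. a (Suc i))" by (rule sum.atMost_shift)
  finally have sa: "(\<Sum>i\<in>addable p. \<phi> (shifted p i)) = \<phi> (shifted p 0) + (\<Sum>i<d. a (Suc i))"
    by (simp add: a_def addable_def)
  have sr: "(\<Sum>i\<in>removable p. \<phi> (shifted p i - 1)) = (\<Sum>i<d. r i)"
    unfolding r_def using sub_rem by (subst sum.If_cases) (auto simp: Int_absorb1)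
  have ar: "a (Suc i) - r i = \<phi> (shifted p (Suc i)) - \<phi> (shifted p i - 1)" for i
  proof (cases "i \<in> removable p")
    case True
    then show ?thesis by (simp add: a_def r_def addable_def removable_def)
  next
    case False
    then have "p (Suc i) = p i" using p by (auto simp: removable_def young_def intro: antisym)
    then have "shifted p (Suc i) = shifted p i - 1" by (simp add: shifted_def)
    then show ?thesis using False \<open>p (Suc i) = p i\<close> by (simp add: a_def r_def addable_def)
  qed
  have "kerov \<phi> p = \<phi> (shifted p 0) + (\<Sum>i<d. a (Suc i) - r i)"
    unfolding kerov_def sa sr by (simp add: sum_subtractf)
  also have "\<dots> = \<phi> (shifted p 0) + (\<Sum>i<d. \<phi> (shifted p (Suc i))) - (\<Sum>i<d. \<phi> (shifted p i - 1))"
    by (simp add: ar sum_subtractf)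
  also have "\<phi> (shifted p 0) + (\<Sum>i<d. \<phi> (shifted p (Suc i))) = (\<Sum>i<d. \<phi> (shifted p i)) + \<phi> (shifted p d)"
    using sum.lessThan_Suc_shift[of "\<lambda>i. \<phi> (shifted p i)" d] by simp
  also have "shifted p d = - int d" using d[of d] by (simp add: shifted_def)
  finally show ?thesis by (simp add: sum_subtractf)
qed

text \<open>The second difference telescopes once along each row and once more down the first
  column, leaving only corner terms. For a constant, linear or quadratic \<phi> the right side
  depends on the size alone, and for an exponential \<phi> on \<open>ex_sum\<close>.\<close>

lemma kerov_eq_box_sum:
  assumes p: "p \<in> young n"
  shows "kerov \<phi> p = \<phi> 0 + box_sum (\<lambda>c. \<phi> (c + 1) - 2 * \<phi> c + \<phi> (c - 1)) p"
proof -
  have row: "(\<Sum>j<k. \<phi> (int j - int i + 1) - 2 * \<phi> (int j - int i) + \<phi> (int j - int i - 1)) =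
     \<phi> (int k - int i) - \<phi> (int k - int i - 1) - \<phi> (- int i) + \<phi> (- int i - 1)" for i k
    by (induction k) (auto simp: algebra_simps)
  have tel: "(\<Sum>i<k. \<phi> (- int i - 1) - \<phi> (- int i)) = \<phi> (- int k) - \<phi> 0" for k
  proof (induction k)
    case (Suc k)
    have e: "- int (Suc k) = - int k - 1" by simp
    show ?case using Suc unfolding e by simp
  qed simp
  have "box_sum (\<lambda>c. \<phi> (c + 1) - 2 * \<phi> c + \<phi> (c - 1)) p =
     (\<Sum>i<n. \<phi> (shifted p i) - \<phi> (shifted p i - 1) + (\<phi> (- int i - 1) - \<phi> (- int i)))"
    by (subst box_sum_eq[of n, OF young_zero[OF p]], assumption, unfold row shifted_def) (simp add: algebra_simps)
  also have "\<dots> = (\<Sum>i<n. \<phi> (shifted p i) - \<phi> (shifted p i - 1)) + (\<phi> (- int n) - \<phi> 0)"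
    by (simp only: sum.distrib tel)
  finally show ?thesis using kerov_eq_shifted[OF p young_zero[OF p]] by simp
qed

text \<open>Divided by \<open>(n + 1) * fdim p\<close>, this is the mean of \<phi> at the content of
  the next box in the Plancherel growth process started from a diagram \<open>p\<close> of size
  \<open>n\<close>.\<close>

definition up :: "(int \<Rightarrow> real) \<Rightarrow> (nat \<Rightarrow> nat) \<Rightarrow> real" where
  "up \<phi> p = (\<Sum>i\<in>addable p. \<phi> (shifted p i) * fdim (add_box p i))"

text \<open>Adding then removing a box equals removing then adding, up to the diagonal term, which is Kerov's
  alternating sum over corners. Induction turns this into the transition probabilities and their moments.\<close>

lemma up_commute:
  assumes p: "p \<in> young n"
  shows "up \<phi> p = kerov \<phi> p * fdim p + (\<Sum>j\<in>removable p. up \<phi> (rem_box p j))"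
proof -
  note fa = finite_addable[OF p] and fr = finite_removable[OF p]
  have far: "finite (addable (rem_box p j))" if "j \<in> removable p" for j
  proof (cases n)
    case 0 then show ?thesis using removable_subset[OF p] that by auto
  next
    case (Suc m) then show ?thesis using finite_addable rem_box_young p that by blast
  qed
  have fra: "finite (removable (add_box p i))" if "i \<in> addable p" for i
    using finite_removable add_box_young p that by blast
  have ii: "i \<in> removable (add_box p i)" if "i \<in> addable p" for i
    using p that by (auto simp: removable_def add_box_def young_def le_imp_less_Suc)
  have jj: "j \<in> addable (rem_box p j)" if j: "j \<in> removable p" for j
  proof -
    have "p j - 1 < p (j - 1)" if "j \<noteq> 0"
    proof -
      have "p j \<le> p (j - 1)" using young_antimono[OF p, of "j - 1" j] by simp
      then show ?thesis using j by (auto simp: removable_def)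
    qed
    then show ?thesis by (auto simp: addable_def rem_box_def)
  qed
  have ra: "rem_box (add_box p i) i = p" for i by (auto simp: rem_box_def add_box_def)
  have ar: "add_box (rem_box p j) j = p" if "j \<in> removable p" for j
    using that by (auto simp: rem_box_def add_box_def removable_def fun_eq_iff)
  have comm: "rem_box (add_box p i) j = add_box (rem_box p j) i" if "i \<noteq> j" for i j
    using that by (auto simp: rem_box_def add_box_def fun_eq_iff)
  have sets: "(i \<in> addable p \<and> j \<in> removable (add_box p i)) \<longleftrightarrow> (j \<in> removable p \<and> i \<in> addable (rem_box p j))"
    if "i \<noteq> j" for i j
    using that p by (cases i) (auto simp: removable_def addable_def add_box_def rem_box_def young_def)
  have sh: "shifted (rem_box p j) i = shifted p i" if "i \<noteq> j" for i j
    using that by (auto simp: shifted_def rem_box_def)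
  have shj: "shifted (rem_box p j) j = shifted p j - 1" if "j \<in> removable p" for j
    using that by (auto simp: shifted_def rem_box_def removable_def)
  \<comment> \<open>Off-diagonal pairs: add in row \<open>i\<close> and remove in row
    \<open>j\<close>. Both iterated operators give the same sum over them, so only the terms with
    \<open>i = j\<close> make a difference.\<close>
  let ?S = "{(i, j). i \<noteq> j \<and> i \<in> addable p \<and> j \<in> removable (add_box p i)}"
  have "up \<phi> p = (\<Sum>i\<in>addable p. \<phi> (shifted p i) * (\<Sum>j\<in>removable (add_box p i). fdim (rem_box (add_box p i) j)))"
    unfolding up_def using fdim_branching[OF add_box_young[OF p]] by (intro sum.cong) auto
  also have "\<dots> = (\<Sum>i\<in>addable p. \<phi> (shifted p i) * fdim p + (\<Sum>j\<in>removable (add_box p i) - {i}. \<phi> (shifted p i) * fdim (rem_box (add_box p i) j)))"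
  proof (intro sum.cong refl)
    fix i assume i: "i \<in> addable p"
    show "\<phi> (shifted p i) * (\<Sum>j\<in>removable (add_box p i). fdim (rem_box (add_box p i) j)) =
      \<phi> (shifted p i) * fdim p + (\<Sum>j\<in>removable (add_box p i) - {i}. \<phi> (shifted p i) * fdim (rem_box (add_box p i) j))"
      unfolding sum_distrib_left[symmetric] sum.remove[OF fra[OF i] ii[OF i], of "\<lambda>j. fdim (rem_box (add_box p i) j)"]
      by (simp add: ra distrib_left)
  qed
  also have "\<dots> = (\<Sum>i\<in>addable p. \<phi> (shifted p i)) * fdim p +
      (\<Sum>(i, j)\<in>(SIGMA i:addable p. removable (add_box p i) - {i}). \<phi> (shifted p i) * fdim (rem_box (add_box p i) j))"
    using fa fra by (simp add: sum.distrib sum_distrib_right sum.Sigma)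
  also have "(SIGMA i:addable p. removable (add_box p i) - {i}) = ?S" by auto
  also have "(\<Sum>(i, j)\<in>?S. \<phi> (shifted p i) * fdim (rem_box (add_box p i) j)) =
     (\<Sum>(i, j)\<in>?S. \<phi> (shifted (rem_box p j) i) * fdim (add_box (rem_box p j) i))"
    by (intro sum.cong) (auto simp: comm sh)
  finally have L: "up \<phi> p = (\<Sum>i\<in>addable p. \<phi> (shifted p i)) * fdim p +
     (\<Sum>(i, j)\<in>?S. \<phi> (shifted (rem_box p j) i) * fdim (add_box (rem_box p j) i))" .
  have "(\<Sum>j\<in>removable p. up \<phi> (rem_box p j)) = (\<Sum>j\<in>removable p. \<phi> (shifted p j - 1) * fdim p +
     (\<Sum>i\<in>addable (rem_box p j) - {j}. \<phi> (shifted (rem_box p j) i) * fdim (add_box (rem_box p j) i)))"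
  proof (intro sum.cong refl)
    fix j assume j: "j \<in> removable p"
    show "up \<phi> (rem_box p j) = \<phi> (shifted p j - 1) * fdim p +
      (\<Sum>i\<in>addable (rem_box p j) - {j}. \<phi> (shifted (rem_box p j) i) * fdim (add_box (rem_box p j) i))"
      unfolding up_def sum.remove[OF far[OF j] jj[OF j], of "\<lambda>i. \<phi> (shifted (rem_box p j) i) * fdim (add_box (rem_box p j) i)"]
      by (simp add: ar[OF j] shj[OF j])
  qed
  also have "\<dots> = (\<Sum>j\<in>removable p. \<phi> (shifted p j - 1)) * fdim p +
      (\<Sum>(j, i)\<in>(SIGMA j:removable p. addable (rem_box p j) - {j}). \<phi> (shifted (rem_box p j) i) * fdim (add_box (rem_box p j) i))"
    using fr far by (simp add: sum.distrib sum_distrib_right sum.Sigma)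
  also have "(\<Sum>(j, i)\<in>(SIGMA j:removable p. addable (rem_box p j) - {j}). \<phi> (shifted (rem_box p j) i) * fdim (add_box (rem_box p j) i))
     = (\<Sum>(i, j)\<in>?S. \<phi> (shifted (rem_box p j) i) * fdim (add_box (rem_box p j) i))"
    by (rule sum.reindex_bij_witness[of _ "\<lambda>(i, j). (j, i)" "\<lambda>(i, j). (j, i)"]) (use sets in auto)
  finally show ?thesis unfolding L kerov_def by (simp add: algebra_simps)
qed

text \<open>If Kerov's sum is constant on every level, the commutation relation makes
  \<open>fdim\<close> an eigenvector, and the constants add up over the levels below.\<close>

lemma up_eval:
  assumes "\<And>n p. p \<in> young n \<Longrightarrow> kerov \<phi> p = c n" and "p \<in> young n"
  shows "up \<phi> p = (\<Sum>k\<le>n. c k) * fdim p"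
  using assms(2)
proof (induction n arbitrary: p)
  case 0
  have "removable p = {}" using removable_subset[OF 0] by auto
  then show ?case using up_commute[OF 0, of \<phi>] assms(1)[OF 0] by simp
next
  case (Suc n)
  have "up \<phi> p = c (Suc n) * fdim p + (\<Sum>j\<in>removable p. (\<Sum>k\<le>n. c k) * fdim (rem_box p j))"
    using up_commute[OF Suc.prems, of \<phi>] assms(1)[OF Suc.prems] Suc.IH[OF rem_box_young[OF Suc.prems]] by simp
  also have "\<dots> = c (Suc n) * fdim p + (\<Sum>k\<le>n. c k) * fdim p"
    by (simp only: sum_distrib_left[symmetric] fdim_branching[OF Suc.prems])
  finally show ?case by (simp add: algebra_simps)
qed

lemma box_sum_const: "p \<in> young n \<Longrightarrow> box_sum (\<lambda>_. a) p = a * real n"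
  by (subst box_sum_eq[of n]) (auto simp: young_def sum_distrib_left[symmetric] sum_distrib_right[symmetric] simp flip: of_nat_sum)

lemma up_one: "p \<in> young n \<Longrightarrow> up (\<lambda>_. 1) p = real (Suc n) * fdim p"
  by (subst up_eval[where c = "\<lambda>_. 1"]) (auto simp: kerov_eq_box_sum box_sum_const)

lemma up_content: "p \<in> young n \<Longrightarrow> up of_int p = 0"
  by (subst up_eval[where c = "\<lambda>_. 0"]) (auto simp: kerov_eq_box_sum box_sum_const)

lemma up_content_sq:
  assumes "p \<in> young n"
  shows "up (\<lambda>c. (of_int c)\<^sup>2) p = real n * real (Suc n) * fdim p"
proof -
  have "(of_int (c + 1))\<^sup>2 - 2 * (of_int c)\<^sup>2 + (of_int (c - 1))\<^sup>2 = (2::real)" for c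
    by (simp add: power2_eq_square algebra_simps)
  then have "up (\<lambda>c. (of_int c)\<^sup>2) p = (\<Sum>k\<le>n. 2 * real k) * fdim p"
    using up_eval[OF _ assms, of "\<lambda>c. (of_int c)\<^sup>2" "\<lambda>k. 2 * real k"]
    by (simp only: kerov_eq_box_sum box_sum_const) simp
  also have "(\<Sum>k\<le>n. 2 * real k) = real n * real (Suc n)"
    by (induction n) (auto simp: algebra_simps)
  finally show ?thesis .
qed

section \<open>Plancherel averages and the variance of the content sum\<close>

lemma finite_young: "finite (young n)"
proof (rule finite_subset)
  show "young n \<subseteq> {f. \<forall>x. (x \<in> {..<n} \<longrightarrow> f x \<in> {..n}) \<and> (x \<notin> {..<n} \<longrightarrow> f x = 0)}"
  proof (intro subsetI CollectI allI conjI impI)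
    fix p x assume p: "p \<in> young n"
    { assume "x \<in> {..<n}"
      then have "p x \<le> (\<Sum>i<n. p i)" by (intro member_le_sum) auto
      then show "p x \<in> {..n}" using p by (simp add: young_def) }
    { assume "x \<notin> {..<n}"
      then show "p x = 0" using young_zero[OF p] by simp }
  qed
  show "finite {f::nat \<Rightarrow> nat. \<forall>x. (x \<in> {..<n} \<longrightarrow> f x \<in> {..n}) \<and> (x \<notin> {..<n} \<longrightarrow> f x = 0)}"
    by (rule finite_set_of_finite_funs) auto
qed

lemma young_le: "p \<in> young n \<Longrightarrow> p i \<le> n"
proof (cases "i < n")
  assume p: "p \<in> young n" and "i < n"
  then have "p i \<le> (\<Sum>i<n. p i)" by (intro member_le_sum) auto
  then show ?thesis using p by (simp add: young_def)
qed (simp add: young_zero)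

text \<open>Unnormalised Plancherel expectation: its total mass is \<open>fact n\<close>, by
  \<open>planch_one\<close>, so every probability bound below carries the factor
  \<open>fact m\<close>.\<close>

definition planch :: "nat \<Rightarrow> ((nat \<Rightarrow> nat) \<Rightarrow> real) \<Rightarrow> real" where
  "planch n H = (\<Sum>p\<in>young n. (fdim p)\<^sup>2 * H p)"

lemma sum_young_Suc:
  "(\<Sum>p\<in>young (Suc n). \<Sum>j\<in>removable p. g (rem_box p j) p) =
   (\<Sum>q\<in>young n. \<Sum>i\<in>addable q. g q (add_box q i))"
proof -
  have "(\<Sum>p\<in>young (Suc n). \<Sum>j\<in>removable p. g (rem_box p j) p) =
    (\<Sum>(p, j)\<in>(SIGMA p:young (Suc n). removable p). g (rem_box p j) p)"
    using finite_young finite_removable by (subst sum.Sigma) auto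
  also have "\<dots> = (\<Sum>(q, i)\<in>(SIGMA q:young n. addable q). g q (add_box q i))"
  proof -
    have f1: "add_box (rem_box p j) j = p" if "j \<in> removable p" for p j
      using that by (auto simp: add_box_def rem_box_def removable_def fun_eq_iff)
    have f2: "j \<in> addable (rem_box p j)" if p: "p \<in> young (Suc n)" and j: "j \<in> removable p" for p j
    proof -
      have "p j - 1 < p (j - 1)" if "j \<noteq> 0"
      proof -
        have "p j \<le> p (j - 1)" using young_antimono[OF p, of "j - 1" j] by simp
        then show ?thesis using j by (auto simp: removable_def)
      qed
      then show ?thesis by (auto simp: addable_def rem_box_def)
    qed
    have f3: "rem_box (add_box q i) i = q" for q i by (auto simp: add_box_def rem_box_def)
    have f4: "i \<in> removable (add_box q i)" if "q \<in> young n" for q i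
      using that by (auto simp: removable_def add_box_def young_def le_imp_less_Suc)
    show ?thesis
      by (rule sum.reindex_bij_witness[of _ "\<lambda>(q, i). (add_box q i, i)" "\<lambda>(p, j). (rem_box p j, j)"])
        (auto simp: f1 f2 f3 f4 rem_box_young add_box_young)
  qed
  also have "\<dots> = (\<Sum>q\<in>young n. \<Sum>i\<in>addable q. g q (add_box q i))"
    using finite_young finite_addable by (subst sum.Sigma) auto
  finally show ?thesis .
qed

text \<open>One of the two factors \<open>fdim p\<close> is replaced by its branching sum, and the
  edges between the two levels are then counted from the smaller diagram: this is Plancherel
  growth.\<close>

lemma planch_Suc:
  "planch (Suc n) H = (\<Sum>q\<in>young n. fdim q * (\<Sum>i\<in>addable q. fdim (add_box q i) * H (add_box q i)))"
proof -
  have "planch (Suc n) H = (\<Sum>p\<in>young (Suc n). \<Sum>j\<in>removable p. fdim (rem_box p j) * (fdim p * H p))"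
    unfolding planch_def sum_distrib_right[symmetric]
    by (intro sum.cong refl) (simp add: fdim_branching power2_eq_square)
  also have "\<dots> = (\<Sum>q\<in>young n. \<Sum>i\<in>addable q. fdim q * (fdim (add_box q i) * H (add_box q i)))"
    by (rule sum_young_Suc)
  finally show ?thesis by (simp add: sum_distrib_left)
qed

lemma young_0: "young 0 = {\<lambda>_. 0}"
  by (auto simp: young_def)

lemma fdim_zero: "fdim (\<lambda>_. 0) = 1"
  by (subst fdim_eq_dimf[of 0]) (auto simp: dimf_def vander_def)

lemma planch_0: "planch 0 H = H (\<lambda>_. 0)"
  by (simp add: planch_def young_0 fdim_zero)

lemma planch_one: "planch n (\<lambda>_. 1) = fact n"
proof (induction n)
  case 0
  then show ?case by (simp add: planch_0)
next
  case (Suc n)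
  have "planch (Suc n) (\<lambda>_. 1) = (\<Sum>q\<in>young n. fdim q * (real (Suc n) * fdim q))"
    unfolding planch_Suc using up_one by (intro sum.cong) (auto simp: up_def)
  also have "\<dots> = real (Suc n) * planch n (\<lambda>_. 1)"
    by (simp add: planch_def sum_distrib_left power2_eq_square mult.left_commute)
  finally show ?case using Suc by simp
qed

definition csum :: "(nat \<Rightarrow> nat) \<Rightarrow> real" where
  "csum p = box_sum of_int p"

lemma csum_add_box: "p \<in> young n \<Longrightarrow> i \<in> addable p \<Longrightarrow> csum (add_box p i) = csum p + of_int (shifted p i)"
  by (simp add: csum_def box_sum_add_box)

text \<open>Along Plancherel growth the content sum is a martingale whose increment at size
  \<open>n\<close> has variance \<open>n\<close>; the variances add up to
  \<open>n (n - 1) / 2\<close>.\<close>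

lemma planch_content_sq: "planch n (\<lambda>p. (csum p)\<^sup>2) = fact n * (real n * (real n - 1) / 2)"
proof (induction n)
  case 0
  then show ?case by (simp add: planch_0 csum_def box_sum_def)
next
  case (Suc n)
  have "(\<Sum>i\<in>addable q. fdim (add_box q i) * (csum (add_box q i))\<^sup>2) =
     real (Suc n) * fdim q * ((csum q)\<^sup>2 + real n)" if q: "q \<in> young n" for q
  proof -
    have "(\<Sum>i\<in>addable q. fdim (add_box q i) * (csum (add_box q i))\<^sup>2) =
      (csum q)\<^sup>2 * up (\<lambda>_. 1) q + 2 * csum q * up of_int q + up (\<lambda>c. (of_int c)\<^sup>2) q"
      unfolding up_def sum_distrib_left sum.distrib[symmetric]
      by (intro sum.cong refl) (simp add: csum_add_box[OF q] power2_eq_square algebra_simps)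
    then show ?thesis unfolding up_one[OF q] up_content[OF q] up_content_sq[OF q] by (simp add: algebra_simps)
  qed
  then have "planch (Suc n) (\<lambda>p. (csum p)\<^sup>2) = (\<Sum>q\<in>young n. fdim q * (real (Suc n) * fdim q * ((csum q)\<^sup>2 + real n)))"
    unfolding planch_Suc by (intro sum.cong) auto
  also have "\<dots> = (\<Sum>q\<in>young n. real (Suc n) * ((fdim q)\<^sup>2 * (csum q)\<^sup>2) + real (Suc n) * real n * ((fdim q)\<^sup>2 * 1))"
    by (intro sum.cong refl) (simp add: power2_eq_square algebra_simps)
  also have "\<dots> = real (Suc n) * planch n (\<lambda>p. (csum p)\<^sup>2) + real (Suc n) * real n * planch n (\<lambda>_. 1)"
    unfolding planch_def sum.distrib sum_distrib_left ..
  also have "\<dots> = fact (Suc n) * (real (Suc n) * (real (Suc n) - 1) / 2)"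
    unfolding Suc.IH planch_one by (simp add: field_simps)
  finally show ?case .
qed

section \<open>Exponential content sums and Laguerre polynomials\<close>

definition ex_sum :: "real \<Rightarrow> (nat \<Rightarrow> nat) \<Rightarrow> real" where
  "ex_sum z p = box_sum (\<lambda>c. exp (z * of_int c)) p"

text \<open>This is \<open>4 sinh (z / 2)^2\<close>, the eigenvalue of the second difference on
  \<open>exp (z c)\<close>.\<close>

definition sh2 :: "real \<Rightarrow> real" where
  "sh2 z = exp z - 2 + exp (- z)"

lemma kerov_exp:
  assumes "p \<in> young n"
  shows "kerov (\<lambda>c. exp (z * of_int c)) p = 1 + sh2 z * ex_sum z p"
proof -
  have "(\<lambda>c::int. exp (z * of_int (c + 1)) - 2 * exp (z * of_int c) + exp (z * of_int (c - 1))) =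
        (\<lambda>c. sh2 z * exp (z * of_int c))"
    by (auto simp: sh2_def algebra_simps exp_add[symmetric])
  moreover have "box_sum (\<lambda>c. sh2 z * exp (z * of_int c)) p = sh2 z * ex_sum z p"
    by (simp add: ex_sum_def box_sum_def sum_distrib_left)
  ultimately show ?thesis using kerov_eq_box_sum[OF assms, of "\<lambda>c. exp (z * of_int c)"] by simp
qed

text \<open>The right side is \<open>fact n\<close> times the Laguerre polynomial of degree
  \<open>n\<close> at \<open>- sh2 z\<close>. The mean of \<open>ex_sum\<close> and the sum
  \<open>A\<close> of \<open>fdim p * up p\<close> determine each other from level to level; they
  match the recursions linking the Laguerre sums \<open>E\<close> with the associated ones
  \<open>G\<close> (parameter 1). Keeping the factor \<open>sh2 z\<close> makes the identity hold at
  \<open>z = 0\<close> as well.\<close>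

theorem planch_ex_sum:
  "fact n + sh2 z * planch n (ex_sum z) = fact n * (\<Sum>k\<le>n. real (n choose k) * sh2 z ^ k / fact k)"
proof -
  define s where "s = sh2 z"
  let ?\<phi> = "\<lambda>c::int. exp (z * of_int c)"
  define A where "A n = (\<Sum>p\<in>young n. fdim p * up ?\<phi> p)" for n
  define E where "E n = (\<Sum>k\<le>n. real (n choose k) * s ^ k / fact k)" for n
  define G where "G n = (\<Sum>k\<le>n. real (Suc n choose Suc k) * s ^ k / fact k)" for n
  have B_Suc: "planch (Suc n) (ex_sum z) = real (Suc n) * planch n (ex_sum z) + A n" for n
  proof -
    have "(\<Sum>i\<in>addable q. fdim (add_box q i) * ex_sum z (add_box q i)) = real (Suc n) * fdim q * ex_sum z q + up ?\<phi> q"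
      if q: "q \<in> young n" for q
    proof -
      have "(\<Sum>i\<in>addable q. fdim (add_box q i) * ex_sum z (add_box q i)) = up (\<lambda>_. 1) q * ex_sum z q + up ?\<phi> q"
        unfolding up_def sum_distrib_right sum.distrib[symmetric]
        by (intro sum.cong refl) (simp add: ex_sum_def box_sum_add_box[OF q] algebra_simps)
      then show ?thesis by (simp add: up_one[OF q])
    qed
    then have "planch (Suc n) (ex_sum z) = (\<Sum>q\<in>young n. fdim q * (real (Suc n) * fdim q * ex_sum z q + up ?\<phi> q))"
      unfolding planch_Suc by (intro sum.cong) auto
    also have "\<dots> = (\<Sum>q\<in>young n. real (Suc n) * ((fdim q)\<^sup>2 * ex_sum z q) + fdim q * up ?\<phi> q)"
      by (intro sum.cong refl) (simp add: power2_eq_square algebra_simps)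
    also have "\<dots> = real (Suc n) * planch n (ex_sum z) + A n"
      unfolding planch_def A_def sum.distrib sum_distrib_left ..
    finally show ?thesis .
  qed
  have ker: "planch n (kerov ?\<phi>) = fact n + s * planch n (ex_sum z)" for n
  proof -
    have "planch n (kerov ?\<phi>) = (\<Sum>p\<in>young n. (fdim p)\<^sup>2 * 1 + s * ((fdim p)\<^sup>2 * ex_sum z p))"
      unfolding planch_def by (intro sum.cong refl) (simp add: kerov_exp s_def algebra_simps)
    also have "\<dots> = planch n (\<lambda>_. 1) + s * planch n (ex_sum z)"
      unfolding planch_def sum.distrib sum_distrib_left ..
    finally show ?thesis by (simp add: planch_one)
  qed
  have A_Suc: "A (Suc n) = planch (Suc n) (kerov ?\<phi>) + real (Suc n) * A n" for n
  proof -
    have "A (Suc n) = (\<Sum>p\<in>young (Suc n). (fdim p)\<^sup>2 * kerov ?\<phi> p + (\<Sum>j\<in>removable p. up ?\<phi> (rem_box p j) * fdim p))"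
      unfolding A_def
      by (intro sum.cong refl, subst up_commute, assumption) (simp add: power2_eq_square algebra_simps sum_distrib_left)
    also have "\<dots> = planch (Suc n) (kerov ?\<phi>) + (\<Sum>q\<in>young n. \<Sum>i\<in>addable q. up ?\<phi> q * fdim (add_box q i))"
      unfolding planch_def sum.distrib sum_young_Suc[of "\<lambda>q p. up ?\<phi> q * fdim p"] ..
    also have "(\<Sum>q\<in>young n. \<Sum>i\<in>addable q. up ?\<phi> q * fdim (add_box q i)) = real (Suc n) * A n"
    proof -
      have "(\<Sum>i\<in>addable q. up ?\<phi> q * fdim (add_box q i)) = real (Suc n) * (fdim q * up ?\<phi> q)" if q: "q \<in> young n" for q
        using up_one[OF q] by (simp add: up_def[of "\<lambda>_. 1"] sum_distrib_left[symmetric])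
      then show ?thesis unfolding A_def sum_distrib_left by (intro sum.cong) auto
    qed
    finally show ?thesis .
  qed
  have G_ext: "G n = (\<Sum>k\<le>Suc n. real (Suc n choose Suc k) * s ^ k / fact k)" for n
    by (simp add: G_def binomial_eq_0 del: binomial_Suc_Suc)
  have E_ext: "E n = (\<Sum>k\<le>Suc n. real (n choose k) * s ^ k / fact k)" for n
    by (simp add: E_def binomial_eq_0)
  have G_Suc: "G (Suc n) = E (Suc n) + G n" for n
    unfolding G_ext[of n] unfolding G_def E_def sum.distrib[symmetric]
    by (intro sum.cong refl) (simp add: add_divide_distrib distrib_right)
  have E_Suc: "E (Suc n) = E n + s * G n / real (Suc n)" for n
  proof -
    have c: "real (Suc n choose Suc k) / real (Suc n) = real (n choose k) / real (Suc k)" for k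
      using Suc_times_binomial_eq[of n k] by (simp add: field_simps flip: of_nat_mult) 
    have "E (Suc n) = 1 + (\<Sum>k\<le>n. real (Suc n choose Suc k) * s ^ Suc k / fact (Suc k))"
      unfolding E_def by (subst sum.atMost_Suc_shift) simp
    also have "(\<Sum>k\<le>n. real (Suc n choose Suc k) * s ^ Suc k / fact (Suc k)) =
       (\<Sum>k\<le>n. real (n choose Suc k) * s ^ Suc k / fact (Suc k)) + (\<Sum>k\<le>n. real (n choose k) * s ^ Suc k / fact (Suc k))"
      unfolding sum.distrib[symmetric] by (intro sum.cong refl) (simp add: add_divide_distrib distrib_right)
    also have "1 + ((\<Sum>k\<le>n. real (n choose Suc k) * s ^ Suc k / fact (Suc k)) + (\<Sum>k\<le>n. real (n choose k) * s ^ Suc k / fact (Suc k)))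
       = E n + (\<Sum>k\<le>n. real (n choose k) * s ^ Suc k / fact (Suc k))"
      unfolding E_ext by (subst sum.atMost_Suc_shift) simp
    also have "(\<Sum>k\<le>n. real (n choose k) * s ^ Suc k / fact (Suc k)) = s * G n / real (Suc n)"
    proof -
      have "real (n choose k) * s ^ Suc k / fact (Suc k) = s * (real (Suc n choose Suc k) * s ^ k / fact k) / real (Suc n)" for k
      proof -
        have "s * (real (Suc n choose Suc k) * s ^ k / fact k) / real (Suc n) = (real (Suc n choose Suc k) / real (Suc n)) * (s ^ Suc k / fact k)"
          by (simp add: mult.commute mult.left_commute del: binomial_Suc_Suc of_nat_Suc)
        also have "\<dots> = real (n choose k) * s ^ Suc k / fact (Suc k)" unfolding c by simp
        finally show ?thesis by simp
      qed
      then show ?thesis unfolding G_def sum_distrib_left sum_divide_distrib by simp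
    qed
    finally show ?thesis .
  qed
  have "fact n + s * planch n (ex_sum z) = fact n * E n \<and> A n = fact n * G n"
  proof (induction n)
    case 0
    have "ex_sum z (\<lambda>_. 0) = 0" by (simp add: ex_sum_def box_sum_def)
    moreover have "up ?\<phi> (\<lambda>_. 0) = 1"
    proof -
      have p: "(\<lambda>_. 0) \<in> young 0" by (simp add: young_0)
      have "removable (\<lambda>_. 0) = {}" by (auto simp: removable_def)
      then show ?thesis using up_commute[OF p, of ?\<phi>] kerov_exp[OF p, of z] \<open>ex_sum z (\<lambda>_. 0) = 0\<close> by (simp add: fdim_zero)
    qed
    ultimately show ?case by (simp add: planch_0 E_def G_def A_def young_0 fdim_zero)
  next
    case (Suc n)
    have "fact (Suc n) + s * planch (Suc n) (ex_sum z) = real (Suc n) * (fact n + s * planch n (ex_sum z)) + s * A n"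
      unfolding B_Suc by (simp add: algebra_simps)
    also have "\<dots> = fact (Suc n) * (E n + s * G n / real (Suc n))"
      using Suc.IH by (simp add: algebra_simps del: of_nat_Suc)
    finally have 1: "fact (Suc n) + s * planch (Suc n) (ex_sum z) = fact (Suc n) * E (Suc n)"
      unfolding E_Suc .
    have "A (Suc n) = fact (Suc n) * G (Suc n)"
      unfolding A_Suc ker 1 G_Suc using Suc.IH by (simp add: algebra_simps)
    with 1 show ?case by simp
  qed
  then show ?thesis by (simp add: E_def s_def)
qed

lemma sh2_eq: "sh2 z = (exp (z / 2) - exp (- z / 2))\<^sup>2"
  by (simp add: sh2_def power2_eq_square algebra_simps exp_add[symmetric])

lemma sh2_nonneg: "sh2 z \<ge> 0" by (simp add: sh2_eq)

text \<open>With \<open>y = sqrt (n s)\<close> each term is at most \<open>(y^k / fact k)^2\<close>,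
  and a sum of squares of nonnegative numbers is at most the square of their sum. The resulting rate
  \<open>2 sqrt (n s)\<close> is what places the edge at \<open>2 sqrt n\<close>.\<close>

lemma laguerre_bound:
  assumes "s \<ge> 0"
  shows "(\<Sum>k\<le>n. real (n choose k) * s ^ k / fact k) \<le> exp (2 * sqrt (real n * s))"
proof -
  define y where "y = sqrt (real n * s)"
  have y0: "y \<ge> 0" using assms by (simp add: y_def)
  have y2: "y ^ k * y ^ k = (real n * s) ^ k" for k
    using assms by (simp add: y_def power_mult_distrib[symmetric])
  define a where "a k = y ^ k / fact k" for k
  have a0: "a k \<ge> 0" for k using y0 by (simp add: a_def)
  have "(\<Sum>k\<le>n. real (n choose k) * s ^ k / fact k) \<le> (\<Sum>k\<le>n. a k * a k)"
  proof (rule sum_mono)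
    fix k assume "k \<in> {..n}"
    have "real (n choose k) * fact k \<le> real n ^ k"
    proof -
      have "fact k * (n choose k) \<le> n ^ k" by (rule binomial_fact_pow[THEN order_trans[OF eq_refl[OF mult.commute]]])
      then have "real (fact k * (n choose k)) \<le> real (n ^ k)" by (simp only: of_nat_le_iff)
      then show ?thesis by (simp add: mult.commute)
    qed
    then have "real (n choose k) * fact k * s ^ k \<le> real n ^ k * s ^ k"
      using assms by (intro mult_right_mono) auto
    then have "real (n choose k) * fact k * s ^ k / (fact k * fact k) \<le> real n ^ k * s ^ k / (fact k * fact k)"
      by (intro divide_right_mono) auto
    moreover have "a k * a k = real n ^ k * s ^ k / (fact k * fact k)"
      by (simp add: a_def y2 power_mult_distrib)
    ultimately show "real (n choose k) * s ^ k / fact k \<le> a k * a k" by simp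
  qed
  also have "\<dots> \<le> (\<Sum>k\<le>n. a k * (\<Sum>j\<le>n. a j))"
    using a0 by (intro sum_mono mult_left_mono member_le_sum) auto
  also have "\<dots> = (\<Sum>k\<le>n. a k)\<^sup>2" by (simp add: sum_distrib_right power2_eq_square)
  also have "\<dots> \<le> (exp y)\<^sup>2"
  proof (rule power_mono)
    have sums: "a sums exp y" using exp_converges[of y] by (simp add: a_def[abs_def] divide_inverse mult.commute)
    then show "(\<Sum>k\<le>n. a k) \<le> exp y"
      using sum_le_suminf[of a "{..n}"] a0 by (simp add: sums_iff)
  qed (use a0 in \<open>auto intro: sum_nonneg\<close>)
  also have "\<dots> = exp (2 * y)" by (simp add: power2_eq_square exp_add[symmetric])
  finally show ?thesis by (simp add: y_def)
qed

lemma planch_ex_sum_bound: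
  "sh2 z * planch n (ex_sum z) \<le> fact n * exp (2 * sqrt (real n * sh2 z))"
proof -
  have "sh2 z * planch n (ex_sum z) \<le> fact n * (\<Sum>k\<le>n. real (n choose k) * sh2 z ^ k / fact k)"
    using planch_ex_sum[of n z] by (simp add: flip: planch_ex_sum)
  also have "\<dots> \<le> fact n * exp (2 * sqrt (real n * sh2 z))"
    using laguerre_bound[OF sh2_nonneg, of n z] by (intro mult_left_mono) auto
  finally show ?thesis .
qed

lemma planch_mono: "(\<And>p. p \<in> young n \<Longrightarrow> H p \<le> H' p) \<Longrightarrow> planch n H \<le> planch n H'"
  unfolding planch_def by (intro sum_mono mult_left_mono) auto

lemma planch_nonneg: "(\<And>p. p \<in> young n \<Longrightarrow> 0 \<le> H p) \<Longrightarrow> 0 \<le> planch n H"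
  unfolding planch_def by (intro sum_nonneg mult_nonneg_nonneg) auto

text \<open>The truncation to \<open>p 0 \<le> R\<close> makes the second-order Taylor remainder of the exponential
  uniform; the transition probabilities have mean \<open>0\<close> and variance \<open>n\<close> for every diagram.\<close>

lemma planch_exp_content_bound:
  assumes g: "g \<ge> 0" and R: "R \<ge> 0"
  shows "planch n (\<lambda>p. if real (p 0) \<le> R then exp (g * csum p) else 0) \<le> fact n * exp (g\<^sup>2 * exp (g * R) * (real n)\<^sup>2)"
proof -
  define b where "b = g\<^sup>2 * exp (g * R)"
  have b0: "b \<ge> 0" by (simp add: b_def)
  let ?H = "\<lambda>p. if real (p 0) \<le> R then exp (g * csum p) else 0"
  have step: "planch (Suc n) ?H \<le> real (Suc n) * (1 + b * real n) * planch n ?H" for n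
  proof -
    have "(\<Sum>i\<in>addable q. fdim (add_box q i) * ?H (add_box q i)) \<le> ?H q * (real (Suc n) * (1 + b * real n) * fdim q)"
      if q: "q \<in> young n" for q
    proof (cases "real (q 0) \<le> R")
      case False
      \<comment> \<open>Growth never shortens the first row, so a truncated weight that is zero
        stays zero.\<close>
      then have "\<not> real (add_box q i 0) \<le> R" for i by (auto simp: add_box_def)
      then show ?thesis using False by simp
    next
      case True
      have "(\<Sum>i\<in>addable q. fdim (add_box q i) * ?H (add_box q i)) \<le>
        (\<Sum>i\<in>addable q. fdim (add_box q i) * (exp (g * csum q) * (1 + g * of_int (shifted q i) + b * (of_int (shifted q i))\<^sup>2)))"
      proof (intro sum_mono mult_left_mono)
        fix i assume i: "i \<in> addable q"
        let ?x = "real_of_int (shifted q i)"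
        have x: "?x \<le> R" using True young_antimono[OF q, of 0 i] by (simp add: shifted_def)
        have e: "exp (g * ?x) \<le> 1 + g * ?x + b * ?x\<^sup>2"
        proof -
          obtain t where t: "\<bar>t\<bar> \<le> \<bar>g * ?x\<bar>" "exp (g * ?x) = (\<Sum>m<2. (g * ?x) ^ m / fact m) + exp t / fact 2 * (g * ?x) ^ 2"
            using Maclaurin_exp_le[of "g * ?x" 2] by blast
          show ?thesis
          proof (cases "?x \<ge> 0")
            case True
            have "t \<le> g * R" using t(1) True x g mult_left_mono[OF x g] by (simp add: abs_mult)
            then have "exp t / 2 * (g * ?x)\<^sup>2 \<le> exp (g * R) * (g * ?x)\<^sup>2"
            proof (intro mult_right_mono)
              assume "t \<le> g * R"
              then have "exp t \<le> exp (g * R)" by simp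
              then show "exp t / 2 \<le> exp (g * R)" using exp_gt_zero[of t] by linarith
            qed auto
            then show ?thesis using t(2) by (simp add: numeral_2_eq_2 b_def power_mult_distrib mult.commute mult.left_commute)
          next
            case False
            \<comment> \<open>For negative contents the bound \<open>R\<close> says nothing about
              the size of the exponent, but \<open>exp (- u) \<le> 1 - u + u^2\<close> holds for
              every \<open>u \<ge> 0\<close>.\<close>
            define u where "u = - (g * ?x)"
            have u: "u \<ge> 0" using False g by (simp add: u_def mult_nonneg_nonpos)
            have "exp (- u) \<le> 1 - u + u\<^sup>2"
            proof -
              have "1 + u \<le> exp u" by (rule exp_ge_add_one_self)
              then have "exp (- u) \<le> 1 / (1 + u)" using u by (simp add: exp_minus field_simps)
              also have "\<dots> \<le> 1 - u + u\<^sup>2"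
                using u by (simp add: field_simps power2_eq_square)
              finally show ?thesis .
            qed
            then have "exp (g * ?x) \<le> 1 + g * ?x + g\<^sup>2 * ?x\<^sup>2" by (simp add: u_def power_mult_distrib)
            moreover have "g\<^sup>2 * ?x\<^sup>2 \<le> b * ?x\<^sup>2"
            proof (rule mult_right_mono)
              have "1 \<le> exp (g * R)" using g R by simp
              then show "g\<^sup>2 \<le> b" unfolding b_def using mult_left_mono[of 1 "exp (g * R)" "g\<^sup>2"] by simp
            qed simp
            ultimately show ?thesis by linarith
          qed
        qed
        have "?H (add_box q i) \<le> exp (g * csum (add_box q i))" by simp
        also have "\<dots> = exp (g * csum q) * exp (g * ?x)"
          by (simp add: csum_add_box[OF q i] distrib_left exp_add)
        also have "\<dots> \<le> exp (g * csum q) * (1 + g * ?x + b * ?x\<^sup>2)"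
          using e by (intro mult_left_mono) auto
        finally show "?H (add_box q i) \<le> exp (g * csum q) * (1 + g * ?x + b * ?x\<^sup>2)" .
        show "fdim (add_box q i) \<ge> 0" using fdim_pos[OF add_box_young[OF q i]] by simp
      qed
      also have "\<dots> = exp (g * csum q) * (up (\<lambda>_. 1) q + g * up of_int q + b * up (\<lambda>c. (of_int c)\<^sup>2) q)"
        unfolding up_def sum_distrib_left sum.distrib[symmetric]
        by (intro sum.cong refl) (simp add: algebra_simps)
      also have "\<dots> = ?H q * (real (Suc n) * (1 + b * real n) * fdim q)"
        unfolding up_one[OF q] up_content[OF q] up_content_sq[OF q] using True by (simp add: algebra_simps)
      finally show ?thesis .
    qed
    then have "planch (Suc n) ?H \<le> (\<Sum>q\<in>young n. fdim q * (?H q * (real (Suc n) * (1 + b * real n) * fdim q)))"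
      unfolding planch_Suc using fdim_pos by (intro sum_mono mult_left_mono) (auto intro: less_imp_le)
    also have "\<dots> = real (Suc n) * (1 + b * real n) * planch n ?H"
      unfolding planch_def sum_distrib_left by (intro sum.cong refl) (simp add: power2_eq_square)
    finally show ?thesis .
  qed
  \<comment> \<open>The auxiliary bound \<open>m\<close> freezes the factor
    \<open>1 + b * n\<close>, so that the steps multiply to a plain power; it becomes
    \<open>n\<close> afterwards.\<close>
  have "planch n ?H \<le> fact n * (1 + b * real m) ^ n" if "n \<le> m" for m
    using that
  proof (induction n)
    case 0
    then show ?case using R by (simp add: planch_0 csum_def box_sum_def)
  next
    case (Suc n)
    have "planch (Suc n) ?H \<le> real (Suc n) * (1 + b * real n) * planch n ?H" by (rule step)
    also have "\<dots> \<le> real (Suc n) * (1 + b * real m) * (fact n * (1 + b * real m) ^ n)"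
      using Suc b0 by (intro mult_mono mult_nonneg_nonneg planch_nonneg) (auto intro!: mult_left_mono)
    finally show ?case by (simp add: mult.assoc mult.left_commute)
  qed
  from this[of n] have "planch n ?H \<le> fact n * (1 + b * real n) ^ n" by simp
  also have "\<dots> \<le> fact n * exp (b * real n) ^ n"
    using b0 exp_ge_add_one_self[of "b * real n"] by (intro mult_left_mono power_mono) auto
  also have "exp (b * real n) ^ n = exp (b * (real n)\<^sup>2)"
    by (simp add: exp_of_nat_mult[symmetric] power2_eq_square mult.commute)
  finally show ?thesis by (simp add: b_def)
qed

section \<open>Concentration of the Plancherel measure around a maximiser\<close>

text \<open>At the exact midpoint \<open>s / 2\<close> one has
  \<open>a b / (s / 2)^2 = 1 - (a - b)^2 / s^2\<close>, which is the gain;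
  \<open>s \<le> 4 d\<close> makes it uniform. The rounded value \<open>e\<close> may fall short of
  the midpoint by \<open>1 / 2\<close>, which costs at most \<open>2 / g\<close>.\<close>

lemma midpoint_log_gain:
  fixes a b e g d :: real
  assumes "g \<ge> 1" "a \<ge> g" "b \<ge> g" "e \<ge> (a + b - 1) / 2" "a + b \<le> 4 * d"
  shows "ln a + ln b + (a - b)\<^sup>2 / (16 * d\<^sup>2) - 2 / g \<le> 2 * ln e"
proof -
  define s where "s = a + b"
  have s: "s \<ge> 2 * g" "s > 0" "s - 1 > 0" "a > 0" "b > 0" using assms by (auto simp: s_def)
  have "ln (s / 2) - ln e \<le> ln (s / 2) - ln ((s - 1) / 2)"
  proof -
    have "ln ((s - 1) / 2) \<le> ln e" using assms s by (subst ln_le_cancel_iff) (auto simp: s_def)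
    then show ?thesis by simp
  qed
  also have "\<dots> = ln (1 + 1 / (s - 1))"
  proof -
    have "1 + 1 / (s - 1) = (s / 2) / ((s - 1) / 2)" using s by (simp add: field_simps)
    then show ?thesis using s by (simp add: ln_div)
  qed
  also have "\<dots> \<le> 1 / (s - 1)" using s by (intro ln_add_one_self_le_self) auto
  also have "\<dots> \<le> 1 / g" using s assms by (intro divide_left_mono) auto
  finally have 1: "ln (s / 2) \<le> ln e + 1 / g" by simp
  have "ln a + ln b - 2 * ln (s / 2) = ln (a * b / (s / 2)\<^sup>2)"
    using s by (simp add: ln_div ln_mult ln_realpow)
  also have "\<dots> \<le> a * b / (s / 2)\<^sup>2 - 1"
    using s by (intro ln_le_minus_one) auto
  also have "\<dots> = - ((a - b)\<^sup>2 / s\<^sup>2)"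
  proof -
    have "s\<^sup>2 \<noteq> 0" using s by simp
    have "a * b / (s / 2)\<^sup>2 - 1 = (4 * (a * b) - s\<^sup>2) / s\<^sup>2"
      using \<open>s\<^sup>2 \<noteq> 0\<close> by (simp add: power_divide diff_divide_distrib)
    also have "4 * (a * b) - s\<^sup>2 = - ((a - b)\<^sup>2)" by (simp add: s_def power2_eq_square algebra_simps)
    finally show ?thesis by simp
  qed
  also have "\<dots> \<le> - ((a - b)\<^sup>2 / (16 * d\<^sup>2))"
  proof -
    have "s\<^sup>2 \<le> (4 * d)\<^sup>2" using s assms by (intro power_mono) (auto simp: s_def)
    then have "(a - b)\<^sup>2 / (16 * d\<^sup>2) \<le> (a - b)\<^sup>2 / s\<^sup>2"
      using s by (intro divide_left_mono) (auto simp: power_mult_distrib intro!: mult_pos_pos)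
    then show ?thesis by simp
  qed
  finally have "ln a + ln b + (a - b)\<^sup>2 / (16 * d\<^sup>2) \<le> 2 * ln (s / 2)" by simp
  then show ?thesis using 1 by simp
qed

lemma harmonic_sum_le:
  assumes "d \<ge> 1" "j \<le> d"
  shows "(\<Sum>i<j. 1 / real (j - i)) \<le> 1 + ln (real d)"
proof -
  have "(\<Sum>i<j. 1 / real (j - i)) = (\<Sum>k<j. 1 / real (Suc k))"
    by (rule sum.reindex_bij_witness[of _ "\<lambda>k. j - Suc k" "\<lambda>i. j - Suc i"]) (auto simp: of_nat_diff)
  also have "\<dots> \<le> 1 + ln (real (max 1 j))"
  proof (induction j)
    case (Suc j)
    show ?case
    proof (cases "j = 0")
      case False
      have "ln (real j / real (Suc j)) \<le> real j / real (Suc j) - 1" using False by (intro ln_le_minus_one) auto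
      also have "\<dots> = - (1 / real (Suc j))" by (simp add: field_simps)
      finally have "1 / real (Suc j) \<le> ln (real (Suc j)) - ln (real j)" using False by (simp add: ln_div del: of_nat_Suc)
      moreover have "max 1 j = j" using False by simp
      ultimately show ?thesis using Suc by (simp del: of_nat_Suc)
    qed simp
  qed simp
  also have "\<dots> \<le> 1 + ln (real d)" using assms by simp
  finally show ?thesis .
qed

text \<open>Lagrange's identity. It converts gains over pairs of rows into a distance between
  diagrams, the subtracted square being zero for diagrams of equal size.\<close>

lemma sum_sq_diff:
  fixes y :: "nat \<Rightarrow> real"
  shows "(\<Sum>j<d. \<Sum>i<j. (y i - y j)\<^sup>2) = real d * (\<Sum>i<d. (y i)\<^sup>2) - (\<Sum>i<d. y i)\<^sup>2"
proof (induction d)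
  case (Suc d)
  have "(\<Sum>i<d. (y i - y d)\<^sup>2) = (\<Sum>i<d. (y i)\<^sup>2 - 2 * y d * y i + (y d)\<^sup>2)"
    by (intro sum.cong refl) (simp add: power2_eq_square algebra_simps)
  also have "\<dots> = (\<Sum>i<d. (y i)\<^sup>2) - 2 * y d * (\<Sum>i<d. y i) + real d * (y d)\<^sup>2"
    by (simp add: sum.distrib sum_subtractf sum_distrib_left)
  finally show ?case using Suc by (simp add: power2_eq_square algebra_simps)
qed simp

text \<open>Discrete log-convexity of the factorial: a central binomial coefficient is the largest
  in its row.\<close>

lemma fact_midpoint: "fact ((a + b) div 2) * fact ((a + b) div 2) \<le> (fact a * fact b :: real)"
proof -
  define h where "h = (a + b) div 2"
  have "real ((a + b) choose a) \<le> real ((a + b) choose h)"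
    unfolding h_def using binomial_maximum[of "a + b" a] by simp
  then have "fact (a + b) / (fact a * fact b) \<le> (fact (a + b) / (fact h * fact (a + b - h)) :: real)"
    by (simp add: binomial_fact h_def)
  then have "fact h * fact (a + b - h) \<le> (fact a * fact b :: real)"
    by (simp add: divide_simps split: if_splits)
  moreover have "fact h * fact h \<le> (fact h * fact (a + b - h) :: real)"
    by (intro mult_left_mono fact_mono) (auto simp: h_def)
  ultimately show ?thesis unfolding h_def by (rule order_trans[rotated])
qed

lemma ln_fdim:
  assumes p: "p \<in> young m" and d: "\<And>i. d \<le> i \<Longrightarrow> p i = 0"
  shows "ln (fdim p) = ln (fact m) + (\<Sum>j<d. \<Sum>i<j. ln (of_int (shifted p i) - of_int (shifted p j)))
     - (\<Sum>i<d. ln (fact (p i + (d - 1 - i))))"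
proof -
  have f: "fdim p = dimf d p" by (rule fdim_eq_dimf) (use d in auto)
  have s: "(\<Sum>i<d. p i) = m" by (rule young_sum[OF p]) (use d in auto)
  have pos: "of_int (shifted p i) - of_int (shifted p j) > (0::real)" if "i < j" for i j
    using shifted_strict[OF p that] by simp
  have v: "ln (vander d (\<lambda>i. of_int (shifted p i))) = (\<Sum>j<d. \<Sum>i<j. ln (of_int (shifted p i) - of_int (shifted p j)))"
  proof -
    have "ln (\<Prod>i<j. real_of_int (shifted p i) - real_of_int (shifted p j)) =
      (\<Sum>i<j. ln (real_of_int (shifted p i) - real_of_int (shifted p j)))" for j
      by (intro ln_prod) (auto dest!: shifted_strict[OF p])
    moreover have "ln (vander d (\<lambda>i. real_of_int (shifted p i))) =
      (\<Sum>j<d. ln (\<Prod>i<j. real_of_int (shifted p i) - real_of_int (shifted p j)))"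
      unfolding vander_def by (intro ln_prod) (auto dest!: shifted_strict[OF p])
    ultimately show ?thesis by simp
  qed
  have w: "ln (\<Prod>i<d. fact (p i + (d - 1 - i)) :: real) = (\<Sum>i<d. ln (fact (p i + (d - 1 - i))))"
    by (subst ln_prod) auto
  have "(\<Prod>i<d. fact (p i + (d - 1 - i)) :: real) > 0" by (intro prod_pos) auto
  then show ?thesis unfolding f dimf_def s v[symmetric] w[symmetric]
    using vander_pos[OF p, of d] by (simp add: ln_div ln_mult)
qed

lemma fdim_sq_le: "p \<in> young n \<Longrightarrow> (fdim p)\<^sup>2 \<le> fact n"
  using member_le_sum[of p "young n" "\<lambda>p. (fdim p)\<^sup>2"] planch_one[of n] finite_young[of n]
  by (simp add: planch_def)

text \<open>The first summand collects the rounding losses \<open>2 / (j - i)\<close> over all pairs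
  of rows, the second is twice the factorial cost of the boxes returned to the first row after
  rounding down.\<close>

definition conc_err :: "nat \<Rightarrow> real" where
  "conc_err d = 2 * real d * (1 + ln (real d)) + 2 * real d * ln (3 * real d)"

text \<open>The logarithm of the Frobenius formula is concave in the numbers \<open>shifted p i\<close>; the rounded
  midpoint of two diagrams loses only \<open>O (d ln d)\<close> and gains the square of the distance.\<close>

lemma fdim_mult_le:
  assumes p: "p \<in> young m" and q: "q \<in> young m" and d1: "d \<ge> 1"
    and dp: "\<And>i. d \<le> i \<Longrightarrow> p i = 0" and dq: "\<And>i. d \<le> i \<Longrightarrow> q i = 0"
    and p0: "p 0 \<le> d" and q0: "q 0 \<le> d"
  shows "fdim p * fdim q \<le> fact m * exp (conc_err d - (\<Sum>i<d. \<bar>real (p i) - real (q i)\<bar>)\<^sup>2 / (16 * (real d)\<^sup>2))"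
proof -
  \<comment> \<open>The midpoint is rounded down row by row. At most \<open>d\<close> boxes are then
    missing; all of them go to the first row, which keeps the sequence decreasing and can only
    enlarge the Vandermonde factors.\<close>
  define k where "k i = (p i + q i) div 2" for i
  define x where "x = m - (\<Sum>i<d. k i)"
  define r where "r = k(0 := k 0 + x)"
  have sp: "(\<Sum>i<d. p i) = m" by (rule young_sum[OF p]) (use dp in auto)
  have sq: "(\<Sum>i<d. q i) = m" by (rule young_sum[OF q]) (use dq in auto)
  have kle: "2 * k i \<le> p i + q i" and kge: "p i + q i \<le> 2 * k i + 1" for i by (auto simp: k_def)
  have ksum_le: "2 * (\<Sum>i<d. k i) \<le> 2 * m"
  proof -
    have "2 * (\<Sum>i<d. k i) = (\<Sum>i<d. 2 * k i)" by (simp add: sum_distrib_left)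
    also have "\<dots> \<le> (\<Sum>i<d. p i + q i)" using kle by (intro sum_mono) auto
    finally show ?thesis using sp sq by (simp add: sum.distrib)
  qed
  have x_le: "x \<le> d"
  proof -
    have "2 * m = (\<Sum>i<d. p i + q i)" using sp sq by (simp add: sum.distrib)
    also have "\<dots> \<le> (\<Sum>i<d. 2 * k i + 1)" using kge by (intro sum_mono) auto
    also have "\<dots> = 2 * (\<Sum>i<d. k i) + d" by (simp add: sum_distrib_left sum.distrib del: One_nat_def)
    finally show ?thesis by (simp add: x_def)
  qed
  have kanti: "k (Suc i) \<le> k i" for i
    unfolding k_def using young_antimono[OF p, of i "Suc i"] young_antimono[OF q, of i "Suc i"] by (intro div_le_mono) auto
  have rz: "r i = 0" if "d \<le> i" for i using that dp[of i] dq[of i] d1 by (auto simp: r_def k_def)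
  have r: "r \<in> young m"
  proof (rule youngI[where d = d])
    show "r (Suc i) \<le> r i" for i using kanti[of i] by (auto simp: r_def)
    show "r i = 0" if "d \<le> i" for i using rz that by auto
    have "(\<Sum>i<d. r i) = (\<Sum>i<d. k i + (if i = 0 then x else 0))" by (intro sum.cong) (auto simp: r_def)
    also have "\<dots> = (\<Sum>i<d. k i) + x" using d1 by (subst sum.distrib) auto
    finally show "(\<Sum>i<d. r i) = m" using ksum_le by (simp add: x_def)
  qed
  define D where "D = (\<lambda>(s :: nat \<Rightarrow> nat) i j. real_of_int (shifted s i) - real_of_int (shifted s j))"
  define L where "L = (\<lambda>(s :: nat \<Rightarrow> nat) i. ln (fact (s i + (d - 1 - i)) :: real))"
  define y where "y i = real (p i) - real (q i)" for i
  have pair: "ln (D p i j) + ln (D q i j) + (y i - y j)\<^sup>2 / (16 * (real d)\<^sup>2) - 2 / real (j - i) \<le> 2 * ln (D r i j)"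
    if ij: "i < j" "j < d" for i j
  proof -
    have a: "D p i j \<ge> real (j - i)" "D q i j \<ge> real (j - i)"
      using ij young_antimono[OF p, of i j] young_antimono[OF q, of i j] by (auto simp: D_def shifted_def of_nat_diff)
    have "r j = k j" using ij by (simp add: r_def)
    moreover have "k i \<le> r i" by (simp add: r_def)
    moreover have "2 * real (k j) \<le> real (p j) + real (q j)" using kle[of j] by linarith
    moreover have "real (p i) + real (q i) \<le> 2 * real (k i) + 1" using kge[of i] by linarith
    ultimately have e: "D r i j \<ge> (D p i j + D q i j - 1) / 2"
      by (simp add: D_def shifted_def)
    have "p i \<le> d" "q i \<le> d" using p0 q0 young_antimono[OF p, of 0 i] young_antimono[OF q, of 0 i] by auto
    then have u: "D p i j + D q i j \<le> 4 * real d" using ij by (simp add: D_def shifted_def)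
    have "D p i j - D q i j = y i - y j" by (simp add: D_def shifted_def y_def)
    then show ?thesis using midpoint_log_gain[OF _ a e u] ij by simp
  qed
  have facts: "2 * (\<Sum>i<d. L r i) \<le> (\<Sum>i<d. L p i) + (\<Sum>i<d. L q i) + 2 * real d * ln (3 * real d)"
  proof -
    have Lk: "2 * L k i \<le> L p i + L q i" if "i < d" for i
    proof -
      have e: "k i + (d - 1 - i) = ((p i + (d - 1 - i)) + (q i + (d - 1 - i))) div 2" by (simp add: k_def)
      have "2 * L k i = ln (fact (k i + (d - 1 - i)) * fact (k i + (d - 1 - i)))" by (simp add: L_def ln_mult)
      also have "\<dots> \<le> ln (fact (p i + (d - 1 - i)) * fact (q i + (d - 1 - i)))"
        unfolding e by (subst ln_le_cancel_iff) (use fact_midpoint in auto)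
      also have "\<dots> = L p i + L q i" by (simp add: L_def ln_mult)
      finally show ?thesis .
    qed
    have Lr0: "L r 0 \<le> L k 0 + real d * ln (3 * real d)"
    proof -
      have "fact (a + b) \<le> (fact a * real (a + b) ^ b :: real)" for a b
      proof (induction b)
        case (Suc b)
        have "fact (a + Suc b) = real (a + Suc b) * fact (a + b)" by simp
        also have "\<dots> \<le> real (a + Suc b) * (fact a * real (a + b) ^ b)" using Suc by (intro mult_left_mono) auto
        also have "\<dots> \<le> real (a + Suc b) * (fact a * real (a + Suc b) ^ b)" by (intro mult_left_mono power_mono) auto
        finally show ?case by (simp add: mult.commute mult.left_commute)
      qed simp
      from this[of "k 0 + (d - 1)" x]
      have "fact (r 0 + (d - 1)) \<le> (fact (k 0 + (d - 1)) * real (r 0 + (d - 1)) ^ x :: real)"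
        by (simp add: r_def add.commute add.left_commute)
      also have "\<dots> \<le> fact (k 0 + (d - 1)) * (3 * real d) ^ x"
      proof (intro mult_left_mono power_mono)
        have "k 0 \<le> d" using p0 q0 by (simp add: k_def)
        then show "real (r 0 + (d - 1)) \<le> 3 * real d" using x_le d1 by (simp add: r_def)
      qed auto
      also have "\<dots> \<le> fact (k 0 + (d - 1)) * (3 * real d) ^ d"
        using x_le d1 by (intro mult_left_mono power_increasing) auto
      finally have "ln (fact (r 0 + (d - 1)) :: real) \<le> ln (fact (k 0 + (d - 1)) * (3 * real d) ^ d)"
        using d1 by (subst ln_le_cancel_iff) auto
      then show ?thesis using d1 by (simp add: L_def ln_mult ln_realpow distrib_left)
    qed
    have "(\<Sum>i<d. L r i) \<le> (\<Sum>i<d. L k i + (if i = 0 then real d * ln (3 * real d) else 0))"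
      using Lr0 by (intro sum_mono) (auto simp: r_def L_def)
    also have "\<dots> = (\<Sum>i<d. L k i) + real d * ln (3 * real d)"
      using d1 by (subst sum.distrib) auto
    finally have "2 * (\<Sum>i<d. L r i) \<le> (\<Sum>i<d. 2 * L k i) + 2 * real d * ln (3 * real d)"
      by (simp add: sum_distrib_left[symmetric])
    also have "(\<Sum>i<d. 2 * L k i) \<le> (\<Sum>i<d. L p i + L q i)" using Lk by (intro sum_mono) auto
    finally show ?thesis by (simp add: sum.distrib)
  qed
  have harm: "(\<Sum>j<d. \<Sum>i<j. 2 / real (j - i)) \<le> 2 * real d * (1 + ln (real d))"
  proof -
    have "(\<Sum>j<d. \<Sum>i<j. 2 / real (j - i)) = (\<Sum>j<d. 2 * (\<Sum>i<j. 1 / real (j - i)))"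
      by (simp add: sum_distrib_left)
    also have "\<dots> \<le> (\<Sum>j<d. 2 * (1 + ln (real d)))"
      using harmonic_sum_le[OF d1] by (intro sum_mono mult_left_mono) auto
    finally show ?thesis by (simp add: mult.commute mult.left_commute)
  qed
  define \<Delta> where "\<Delta> = (\<Sum>i<d. \<bar>y i\<bar>)"
  \<comment> \<open>Equal sizes make the sum of the \<open>y i\<close> vanish, so the pair sum is
    \<open>d\<close> times the squared norm. The same identity for the absolute values serves as
    Cauchy-Schwarz.\<close>
  have gain: "\<Delta>\<^sup>2 \<le> (\<Sum>j<d. \<Sum>i<j. (y i - y j)\<^sup>2)"
  proof -
    have "(\<Sum>i<d. y i) = real (\<Sum>i<d. p i) - real (\<Sum>i<d. q i)" by (simp add: y_def sum_subtractf)
    then have "(\<Sum>i<d. y i) = 0" using sp sq by simp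
    then have "(\<Sum>j<d. \<Sum>i<j. (y i - y j)\<^sup>2) = real d * (\<Sum>i<d. (y i)\<^sup>2)" by (simp add: sum_sq_diff)
    moreover have "\<Delta>\<^sup>2 \<le> real d * (\<Sum>i<d. (y i)\<^sup>2)"
    proof -
      have "0 \<le> (\<Sum>j<d. \<Sum>i<j. (\<bar>y i\<bar> - \<bar>y j\<bar>)\<^sup>2)" by (intro sum_nonneg) auto
      then show ?thesis unfolding sum_sq_diff[of "\<lambda>i. \<bar>y i\<bar>"] by (simp add: \<Delta>_def)
    qed
    ultimately show ?thesis by simp
  qed
  have "(\<Sum>j<d. \<Sum>i<j. ln (D p i j)) + (\<Sum>j<d. \<Sum>i<j. ln (D q i j)) + (\<Sum>j<d. \<Sum>i<j. (y i - y j)\<^sup>2) / (16 * (real d)\<^sup>2) - (\<Sum>j<d. \<Sum>i<j. 2 / real (j - i))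
     = (\<Sum>j<d. \<Sum>i<j. ln (D p i j) + ln (D q i j) + (y i - y j)\<^sup>2 / (16 * (real d)\<^sup>2) - 2 / real (j - i))"
    by (simp add: sum.distrib sum_subtractf sum_divide_distrib)
  also have "\<dots> \<le> (\<Sum>j<d. \<Sum>i<j. 2 * ln (D r i j))"
    using pair by (intro sum_mono) auto
  also have "\<dots> = 2 * (\<Sum>j<d. \<Sum>i<j. ln (D r i j))" by (simp add: sum_distrib_left)
  finally have V: "(\<Sum>j<d. \<Sum>i<j. ln (D p i j)) + (\<Sum>j<d. \<Sum>i<j. ln (D q i j)) + (\<Sum>j<d. \<Sum>i<j. (y i - y j)\<^sup>2) / (16 * (real d)\<^sup>2) - (\<Sum>j<d. \<Sum>i<j. 2 / real (j - i))
     \<le> 2 * (\<Sum>j<d. \<Sum>i<j. ln (D r i j))" .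
  have g': "\<Delta>\<^sup>2 / (16 * (real d)\<^sup>2) \<le> (\<Sum>j<d. \<Sum>i<j. (y i - y j)\<^sup>2) / (16 * (real d)\<^sup>2)"
    using gain by (intro divide_right_mono) auto
  \<comment> \<open>The midpoint diagram enters only through the trivial bound
    \<open>(fdim r)^2 \<le> fact m\<close>; no extremality is used here.\<close>
  have lr: "2 * ln (fdim r) \<le> ln (fact m)"
  proof -
    have "2 * ln (fdim r) = ln ((fdim r)\<^sup>2)" using fdim_pos[OF r] by (simp add: ln_realpow)
    also have "\<dots> \<le> ln (fact m)" using fdim_sq_le[OF r] fdim_pos[OF r] by (subst ln_le_cancel_iff) auto
    finally show ?thesis .
  qed
  have lp: "ln (fdim p) = ln (fact m) + (\<Sum>j<d. \<Sum>i<j. ln (D p i j)) - (\<Sum>i<d. L p i)"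
    unfolding D_def L_def by (rule ln_fdim[OF p]) (use dp in auto)
  have lq: "ln (fdim q) = ln (fact m) + (\<Sum>j<d. \<Sum>i<j. ln (D q i j)) - (\<Sum>i<d. L q i)"
    unfolding D_def L_def by (rule ln_fdim[OF q]) (use dq in auto)
  have lr': "ln (fdim r) = ln (fact m) + (\<Sum>j<d. \<Sum>i<j. ln (D r i j)) - (\<Sum>i<d. L r i)"
    unfolding D_def L_def by (rule ln_fdim[OF r]) (use rz in auto)
  have "ln (fdim p) + ln (fdim q) \<le> ln (fact m) + (conc_err d - \<Delta>\<^sup>2 / (16 * (real d)\<^sup>2))"
    using V g' harm facts lr lp lq lr' unfolding conc_err_def by linarith
  then have "exp (ln (fdim p) + ln (fdim q)) \<le> exp (ln (fact m) + (conc_err d - \<Delta>\<^sup>2 / (16 * (real d)\<^sup>2)))" by simp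
  then show ?thesis using fdim_pos[OF p] fdim_pos[OF q] by (simp add: exp_add \<Delta>_def y_def)
qed

text \<open>A diagram with at most \<open>s * s\<close> boxes cannot contain the box in row
  \<open>s + 1\<close> and column \<open>s + 1\<close>, so its first \<open>s\<close> rows and first
  \<open>s\<close> columns determine it. With \<open>s\<close> near \<open>sqrt n\<close> this gives
  \<open>exp (O(sqrt n ln n))\<close>, small enough for all union bounds.\<close>

lemma card_young_le:
  assumes "n \<le> s * s"
  shows "card (young n) \<le> (n + 1) ^ (2 * s)"
proof -
  define col where "col p j = card {i. j < p i}" for p :: "nat \<Rightarrow> nat" and j
  define h where "h p = (restrict p {..<s}, restrict (col p) {..<s})" for p
  let ?B = "PiE {..<s} (\<lambda>_. {..n})"
  have sub: "{i. j < p i} \<subseteq> {..<n}" if "p \<in> young n" for p j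
    using young_zero[OF that] by (metis (mono_tags, lifting) lessThan_iff mem_Collect_eq not_le not_less_zero subsetI)
  have colset: "j < p i \<longleftrightarrow> i < col p j" if p: "p \<in> young n" for p i j
  proof
    assume "j < p i"
    then have "{..i} \<subseteq> {i. j < p i}" using young_antimono[OF p] by (auto intro: less_le_trans)
    then have "card {..i} \<le> col p j" unfolding col_def using finite_subset[OF sub[OF p, of j]] by (intro card_mono) auto
    then show "i < col p j" by simp
  next
    assume a: "i < col p j"
    show "j < p i"
    proof (rule ccontr)
      assume "\<not> j < p i"
      have "{i. j < p i} \<subseteq> {..<i}"
      proof
        fix i' assume "i' \<in> {i. j < p i}"
        then show "i' \<in> {..<i}" using \<open>\<not> j < p i\<close> young_antimono[OF p, of i i'] by (cases "i \<le> i'") auto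
      qed
      then have "col p j \<le> card {..<i}" unfolding col_def by (intro card_mono) auto
      then show False using a by simp
    qed
  qed
  have small: "p i \<le> s" if p: "p \<in> young n" and i: "s \<le> i" for p i
  proof (rule ccontr)
    assume "\<not> p i \<le> s"
    then have big: "Suc s \<le> p k" if "k \<le> i" for k using young_antimono[OF p that] by simp
    have "i < n" using \<open>\<not> p i \<le> s\<close> young_zero[OF p, of i] by (cases "i < n") auto
    have "Suc i * Suc s = (\<Sum>k<Suc i. Suc s)" by simp
    also have "\<dots> \<le> (\<Sum>k<Suc i. p k)" using big by (intro sum_mono) auto
    also have "\<dots> \<le> (\<Sum>k<n. p k)" using \<open>i < n\<close> by (intro sum_mono2) auto
    also have "\<dots> = n" using p by (simp add: young_def)
    finally have "Suc i * Suc s \<le> s * s" using assms by simp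
    moreover have "Suc s * Suc s \<le> Suc i * Suc s" using i by (intro mult_right_mono) auto
    ultimately show False by simp
  qed
  have "inj_on h (young n)"
  proof (rule inj_onI)
    fix p q assume p: "p \<in> young n" and q: "q \<in> young n" and e: "h p = h q"
    have e1: "p i = q i" if "i < s" for i
      using e that unfolding h_def by (metis fst_conv lessThan_iff restrict_apply')
    have e2: "col p j = col q j" if "j < s" for j
      using e that unfolding h_def by (metis snd_conv lessThan_iff restrict_apply')
    have e3: "j < p i \<longleftrightarrow> j < q i" for i j
    proof (cases "i < s")
      case False
      show ?thesis
      proof (cases "j < s")
        case True
        then show ?thesis using colset[OF p] colset[OF q] e2 by simp
      next
        case F: False
        then show ?thesis using small[OF p, of i] small[OF q, of i] False by simp
      qed
    qed (simp add: e1)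
    show "p = q"
    proof
      fix i show "p i = q i" using e3[of "p i" i] e3[of "q i" i] by simp
    qed
  qed
  moreover have "h ` young n \<subseteq> ?B \<times> ?B"
  proof
    fix y assume "y \<in> h ` young n"
    then obtain p where p: "p \<in> young n" and y: "y = h p" by auto
    have "col p j \<le> n" for j unfolding col_def using card_mono[OF _ sub[OF p, of j]] by simp
    then show "y \<in> ?B \<times> ?B" using young_le[OF p] by (auto simp: y h_def PiE_def extensional_def)
  qed
  moreover have "finite (?B \<times> ?B)" by (intro finite_cartesian_product finite_PiE) auto
  ultimately have "card (young n) \<le> card (?B \<times> ?B)" by (metis card_inj_on_le)
  also have "\<dots> = (n + 1) ^ (2 * s)"
    by (simp add: card_cartesian_product card_PiE mult_2 power_add)
  finally show ?thesis .
qed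

definition boxed :: "nat \<Rightarrow> nat \<Rightarrow> (nat \<Rightarrow> nat) set" where
  "boxed m d = {p \<in> young m. p 0 \<le> d \<and> p d = 0}"

text \<open>A maximiser \<open>p0\<close> of \<open>fdim\<close> carries at least the average mass,
  so \<open>(fdim p0)^2\<close> is at least \<open>fact m / (2 N)\<close> with \<open>N\<close> the
  number of partitions. Dividing the product bound \<open>fdim_mult_le\<close> by this value bounds
  every diagram far from \<open>p0\<close>, and a second factor \<open>N\<close> counts
  them.\<close>

lemma planch_concentrated:
  assumes d: "d \<ge> 1" and mass: "planch m (indicator (boxed m d)) \<ge> fact m / 2" and eta: "\<eta> \<ge> 0"
  obtains p0 where "p0 \<in> boxed m d"
    "planch m (indicator {p \<in> boxed m d. (\<Sum>i<d. \<bar>real (p i) - real (p0 i)\<bar>) \<ge> \<eta> * real m})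
      \<le> fact m * (2 * (real (card (young m)))\<^sup>2 * exp (2 * conc_err d - 2 * ((\<eta> * real m)\<^sup>2 / (16 * (real d)\<^sup>2))))"
proof -
  let ?Y = "boxed m d"
  have Ysub: "?Y \<subseteq> young m" by (auto simp: boxed_def)
  have fin: "finite ?Y" using finite_young Ysub finite_subset by blast
  have zero: "p i = 0" if "p \<in> ?Y" "d \<le> i" for p i using that young_antimono[of p m d i] by (auto simp: boxed_def)
  have mass': "fact m / 2 \<le> (\<Sum>p\<in>?Y. (fdim p)\<^sup>2)"
  proof -
    have "planch m (indicator ?Y) = (\<Sum>p\<in>?Y. (fdim p)\<^sup>2)"
      unfolding planch_def using Ysub finite_young
      by (intro sum.mono_neutral_cong_right) (auto simp: indicator_def)
    then show ?thesis using mass by simp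
  qed
  have ne: "?Y \<noteq> {}"
  proof
    assume "?Y = {}"
    then have "fact m / 2 \<le> (0::real)" using mass' by simp
    then show False using fact_gt_zero[of m, where 'a = real] by linarith
  qed
  obtain p0 where p0: "p0 \<in> ?Y" and max: "\<And>p. p \<in> ?Y \<Longrightarrow> fdim p \<le> fdim p0"
  proof -
    have "Max (fdim ` ?Y) \<in> fdim ` ?Y" using fin ne by (intro Max_in) auto
    then obtain p0 where "p0 \<in> ?Y" "Max (fdim ` ?Y) = fdim p0" by auto
    moreover have "fdim p \<le> Max (fdim ` ?Y)" if "p \<in> ?Y" for p using that fin by (intro Max_ge) auto
    ultimately show ?thesis using that[of p0] by metis
  qed
  define N where "N = real (card (young m))"
  have cY: "real (card ?Y) \<le> N" unfolding N_def using card_mono[OF finite_young Ysub] by simp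
  have N0: "N \<ge> 0" by (simp add: N_def)
  have "fact m / 2 \<le> (\<Sum>p\<in>?Y. (fdim p0)\<^sup>2)"
    proof -
    have "0 \<le> fdim p" if "p \<in> ?Y" for p using fdim_pos[of p m] that Ysub by auto
    then have "(\<Sum>p\<in>?Y. (fdim p)\<^sup>2) \<le> (\<Sum>p\<in>?Y. (fdim p0)\<^sup>2)" using max by (intro sum_mono power_mono) auto
    then show ?thesis using mass' by linarith
  qed
  also have "\<dots> = real (card ?Y) * (fdim p0)\<^sup>2" by simp
  also have "\<dots> \<le> N * (fdim p0)\<^sup>2" using cY by (intro mult_right_mono) auto
  finally have f0: "fact m \<le> 2 * N * (fdim p0)\<^sup>2" by simp
  define Ex where "Ex = exp (conc_err d - (\<eta> * real m)\<^sup>2 / (16 * (real d)\<^sup>2))"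
  let ?Far = "{p \<in> ?Y. (\<Sum>i<d. \<bar>real (p i) - real (p0 i)\<bar>) \<ge> \<eta> * real m}"
  have far: "(fdim p)\<^sup>2 \<le> fact m * (2 * N * Ex\<^sup>2)" if p: "p \<in> ?Far" for p
  proof -
    have pY: "p \<in> young m" "p0 \<in> young m" using p p0 Ysub by auto
    have zp: "p i = 0" "p0 i = 0" if "d \<le> i" for i using zero[OF _ that] p p0 by auto
    have bp: "p 0 \<le> d" "p0 0 \<le> d" using p p0 by (simp_all add: boxed_def)
    have "fdim p * fdim p0 \<le> fact m * exp (conc_err d - (\<Sum>i<d. \<bar>real (p i) - real (p0 i)\<bar>)\<^sup>2 / (16 * (real d)\<^sup>2))"
      by (rule fdim_mult_le[OF pY d zp bp])
    also have "\<dots> \<le> fact m * Ex"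
    proof -
      have "(\<eta> * real m)\<^sup>2 / (16 * (real d)\<^sup>2) \<le> (\<Sum>i<d. \<bar>real (p i) - real (p0 i)\<bar>)\<^sup>2 / (16 * (real d)\<^sup>2)"
        using p eta by (intro divide_right_mono power_mono) auto
      then show ?thesis unfolding Ex_def by (intro mult_left_mono) auto
    qed
    finally have "(fdim p * fdim p0)\<^sup>2 \<le> (fact m * Ex)\<^sup>2"
      using fdim_pos[OF pY(1)] fdim_pos[OF pY(2)] by (intro power_mono) auto
    then have a: "(fdim p)\<^sup>2 * (fdim p0)\<^sup>2 \<le> fact m * (fact m * Ex\<^sup>2)" by (simp add: power_mult_distrib power2_eq_square mult.assoc mult.left_commute)
    also have "\<dots> \<le> (2 * N * (fdim p0)\<^sup>2) * (fact m * Ex\<^sup>2)" using f0 by (intro mult_right_mono) auto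
    finally have "(fdim p)\<^sup>2 * (fdim p0)\<^sup>2 \<le> (fact m * (2 * N * Ex\<^sup>2)) * (fdim p0)\<^sup>2" by (simp add: mult.assoc mult.left_commute mult.commute)
    then show ?thesis using fdim_pos[OF pY(2)] by (simp add: mult_le_cancel_right)
  qed
  have "planch m (indicator ?Far) = (\<Sum>p\<in>?Far. (fdim p)\<^sup>2)"
    unfolding planch_def using Ysub finite_young
    by (intro sum.mono_neutral_cong_right) (auto simp: indicator_def)
  also have "\<dots> \<le> (\<Sum>p\<in>?Far. fact m * (2 * N * Ex\<^sup>2))" using far by (intro sum_mono)
  also have "\<dots> = real (card ?Far) * (fact m * (2 * N * Ex\<^sup>2))" by simp
  also have "\<dots> \<le> N * (fact m * (2 * N * Ex\<^sup>2))"
  proof (rule mult_right_mono)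
    have "card ?Far \<le> card ?Y" by (intro card_mono fin) auto
    then show "real (card ?Far) \<le> N" using cY by linarith
  qed (use N0 in auto)
  also have "Ex\<^sup>2 = exp (2 * conc_err d - 2 * ((\<eta> * real m)\<^sup>2 / (16 * (real d)\<^sup>2)))"
    by (simp add: Ex_def power2_eq_square exp_add[symmetric])
  finally show ?thesis using p0 by (intro that[of p0]) (auto simp: N_def power2_eq_square mult.assoc mult.left_commute)
qed

section \<open>Russian profiles\<close>

text \<open>The Russian profile before rescaling: its slopes change exactly at the corner contents.\<close>

definition rpro :: "(nat \<Rightarrow> nat) \<Rightarrow> real \<Rightarrow> real" where
  "rpro p u = kerov (\<lambda>c. \<bar>u - of_int c\<bar>) p"

definition tent :: "real \<Rightarrow> real" where
  "tent v = max 0 (1 - \<bar>v\<bar>)"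

text \<open>The second difference in \<open>c\<close> of the absolute value of \<open>u - c\<close>
  is twice a tent of width 2: every box lifts the profile by such a tent over its content. In this
  form exponential moments of the profile reduce to \<open>ex_sum\<close>.\<close>

lemma rpro_tent:
  assumes "p \<in> young n"
  shows "rpro p u = \<bar>u\<bar> + 2 * box_sum (\<lambda>c. tent (u - of_int c)) p"
proof -
  have "(\<lambda>c. \<bar>u - of_int (c + 1)\<bar> - 2 * \<bar>u - of_int c\<bar> + \<bar>u - of_int (c - 1)\<bar>) = (\<lambda>c. 2 * tent (u - of_int c))"
  proof
    fix c :: int
    show "\<bar>u - of_int (c + 1)\<bar> - 2 * \<bar>u - of_int c\<bar> + \<bar>u - of_int (c - 1)\<bar> = 2 * tent (u - of_int c)"
    proof -
      have "\<bar>y - 1\<bar> - 2 * \<bar>y\<bar> + \<bar>y + 1\<bar> = 2 * max 0 (1 - \<bar>y\<bar>)" for y :: real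
        by (auto simp: max_def abs_if)
      from this[of "u - of_int c"] show ?thesis by (simp add: tent_def algebra_simps)
    qed
  qed
  moreover have "box_sum (\<lambda>c. 2 * tent (u - of_int c)) p = 2 * box_sum (\<lambda>c. tent (u - of_int c)) p"
    by (simp add: box_sum_def sum_distrib_left)
  ultimately show ?thesis using kerov_eq_box_sum[OF assms, of "\<lambda>c. \<bar>u - of_int c\<bar>"] by (simp add: rpro_def)
qed

lemma rpro_ge: "p \<in> young n \<Longrightarrow> \<bar>u\<bar> \<le> rpro p u"
  by (auto simp: rpro_tent box_sum_def tent_def intro!: sum_nonneg)

text \<open>Maya diagram picture: \<open>r\<close> counts the beads \<open>shifted p i\<close> to
  the right of \<open>u\<close>. On the unit interval containing \<open>u\<close> the profile is
  linear; it descends if there is a bead at the right endpoint, floor of \<open>u\<close> plus 1,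
  and ascends otherwise.\<close>

lemma rpro_explicit:
  assumes p: "p \<in> young n"
  shows "\<exists>r. (\<forall>i<r. shifted p i \<ge> \<lfloor>u\<rfloor> + 1) \<and> (\<forall>i\<ge>r. shifted p i \<le> \<lfloor>u\<rfloor>) \<and>
    ((r = 0 \<or> shifted p (r - 1) \<ge> \<lfloor>u\<rfloor> + 2) \<longrightarrow> rpro p u = u + 2 * real r) \<and>
    (r > 0 \<longrightarrow> shifted p (r - 1) = \<lfloor>u\<rfloor> + 1 \<longrightarrow> rpro p u = u + 2 * real r - 2 * (u - of_int \<lfloor>u\<rfloor>))"
proof -
  define c where "c = \<lfloor>u\<rfloor>"
  define x where "x = shifted p"
  define t where "t = u - of_int c"
  have t: "0 \<le> t" "t < 1" unfolding t_def c_def by linarith+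
  have dec: "x j < x i" if "i < j" for i j using shifted_strict[OF p that] by (simp add: x_def)
  have ex: "x (n + nat \<bar>c\<bar>) \<le> c" using young_zero[OF p, of "n + nat \<bar>c\<bar>"] by (simp add: x_def shifted_def)
  define r where "r = (LEAST i. x i \<le> c)"
  have r1: "x r \<le> c" unfolding r_def using ex by (rule LeastI[of "\<lambda>i. x i \<le> c"])
  have r2: "x i \<ge> c + 1" if "i < r" for i using not_less_Least[of i "\<lambda>i. x i \<le> c"] that by (simp add: r_def)
  have r3: "x i \<le> c" if "r \<le> i" for i using dec[of r i] r1 that by (cases "i = r") auto
  \<comment> \<open>Large enough that all later rows are empty, that \<open>r \<le> d\<close>, and
    that \<open>u + d \<ge> 0\<close>, which opens the absolute value at \<open>- d\<close>.\<close>
  define d where "d = n + r + nat \<bar>c\<bar>"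
  have zd: "p i = 0" if "d \<le> i" for i using young_zero[OF p] that by (simp add: d_def)
  have ud: "u + real d \<ge> 0" using t by (simp add: d_def t_def)
  define \<tau> where "\<tau> i = \<bar>u - of_int (x i)\<bar> - \<bar>u - of_int (x i - 1)\<bar>" for i
  have ku: "rpro p u = u + real d + (\<Sum>i<d. \<tau> i)"
    unfolding rpro_def using kerov_eq_shifted[OF p zd, of d "\<lambda>c. \<bar>u - of_int c\<bar>"] ud
    by (simp add: \<tau>_def x_def)
  have t1: "\<tau> i = -1" if "r \<le> i" for i
  proof -
    have "real_of_int (x i) \<le> u" using r3[OF that] t by (simp add: t_def)
    then show ?thesis by (simp add: \<tau>_def)
  qed
  have t2: "\<tau> i = 1" if "x i \<ge> c + 2" for i
  proof -
    have "real_of_int (x i) \<ge> real_of_int (c + 2)" using that by (simp only: of_int_le_iff)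
    then have "real_of_int (x i) - 1 \<ge> u" using t by (simp add: t_def)
    then show ?thesis by (simp add: \<tau>_def)
  qed
  have t3: "\<tau> i = 1 - 2 * t" if "x i = c + 1" for i
    using that t by (simp add: \<tau>_def t_def abs_if)
  have split: "(\<Sum>i<d. \<tau> i) = (\<Sum>i<r. \<tau> i) - real (d - r)"
  proof -
    have "(\<Sum>i<d. \<tau> i) = (\<Sum>i<r. \<tau> i) + (\<Sum>i\<in>{r..<d}. \<tau> i)"
      using sum.atLeastLessThan_concat[of 0 r d \<tau>] by (simp add: d_def atLeast0LessThan)
    also have "(\<Sum>i\<in>{r..<d}. \<tau> i) = (\<Sum>i\<in>{r..<d}. -1)" using t1 by (intro sum.cong) auto
    finally show ?thesis by simp
  qed
  have dr: "real (d - r) = real d - real r" by (simp add: d_def)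
  have A: "rpro p u = u + 2 * real r" if "r = 0 \<or> x (r - 1) \<ge> c + 2"
  proof -
    have "\<tau> i = 1" if "i < r" for i
    proof (rule t2)
      have x2: "x (r - 1) \<ge> c + 2" using \<open>r = 0 \<or> x (r - 1) \<ge> c + 2\<close> that by simp
      show "x i \<ge> c + 2"
      proof (cases "i = r - 1")
        case False
        then have "i < r - 1" using that by simp
        from dec[OF this] show ?thesis using x2 by simp
      qed (use x2 in simp)
    qed
    then have "(\<Sum>i<r. \<tau> i) = real r" by simp
    then show ?thesis using ku split dr by simp
  qed
  have B: "rpro p u = u + 2 * real r - 2 * t" if rp: "r > 0" "x (r - 1) = c + 1"
  proof -
    obtain r' where r': "r = Suc r'" using rp(1) gr0_implies_Suc by blast
    have "\<tau> i = 1" if "i < r'" for i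
    proof (rule t2)
      show "x i \<ge> c + 2" using \<open>x (r - 1) = c + 1\<close> dec[OF that] by (simp add: r')
    qed
    then have "(\<Sum>i<r. \<tau> i) = real r' + (1 - 2 * t)" using t3[of r'] rp by (simp add: r')
    then show ?thesis using ku split dr by (simp add: r')
  qed
  show ?thesis
    by (rule exI[of _ r]) (use A B r2 r3 in \<open>simp add: x_def c_def t_def\<close>)
qed

text \<open>The unscaled union of squares with rows counted from 0, hence the content
  \<open>j - i - 1\<close> instead of \<open>j - i\<close>.\<close>

definition uregion :: "(nat \<Rightarrow> nat) \<Rightarrow> (real \<times> real) set" where
  "uregion p = {(a, b). \<exists>i j. 1 \<le> j \<and> j \<le> p i \<and> \<bar>a - (real j - real i - 1)\<bar> + \<bar>b - (real j + real i)\<bar> \<le> 1}"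

lemma uregion_le:
  assumes p: "p \<in> young n" and "(u, b) \<in> uregion p"
  shows "b \<le> rpro p u"
proof -
  obtain i j where j: "1 \<le> j" "j \<le> p i" and ineq: "\<bar>u - (real j - real i - 1)\<bar> + \<bar>b - (real j + real i)\<bar> \<le> 1"
    using assms(2) by (auto simp: uregion_def)
  define c where "c = \<lfloor>u\<rfloor>"
  define t where "t = u - of_int c"
  have t: "0 \<le> t" "t < 1" unfolding t_def c_def by linarith+
  define k where "k = int j - int i - 1"
  have kx: "k + 1 \<le> shifted p i" using j by (simp add: k_def shifted_def)
  have rk: "real_of_int k = real j - real i - 1" by (simp add: k_def)
  have ub: "b \<le> real j + real i + 1 - \<bar>u - of_int k\<bar>" using ineq rk by linarith
  have jk: "real j + real i = of_int k + 2 * real i + 1" by (simp add: rk)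
  obtain r where r: "\<And>i. i < r \<Longrightarrow> shifted p i \<ge> c + 1" "\<And>i. r \<le> i \<Longrightarrow> shifted p i \<le> c"
    and A: "(r = 0 \<or> shifted p (r - 1) \<ge> c + 2) \<Longrightarrow> rpro p u = u + 2 * real r"
    and B: "r > 0 \<Longrightarrow> shifted p (r - 1) = c + 1 \<Longrightarrow> rpro p u = u + 2 * real r - 2 * t"
    using rpro_explicit[OF p, of u, folded c_def, folded t_def] by metis
  have AB: "r = 0 \<or> shifted p (r - 1) \<ge> c + 2 \<or> shifted p (r - 1) = c + 1"
    using r(1)[of "r - 1"] by (cases "r = 0") auto
  have low: "rpro p u \<ge> u + 2 * real r - 2 * t"
    using AB A B t by (cases "r = 0") auto
  have "\<bar>u - of_int k\<bar> \<le> 1" using ineq rk by linarith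
  then have "real_of_int k \<le> of_int c + t + 1" "of_int c + t - 1 \<le> real_of_int k" unfolding t_def by linarith+
  then have "real_of_int k < of_int (c + 2)" "of_int (c - 2) < real_of_int k" using t by auto
  then have "k < c + 2" "c - 2 < k" by (simp_all only: of_int_less_iff)
  \<comment> \<open>A square can meet the vertical line at \<open>u\<close> only for these three
    contents. For \<open>k = c - 1\<close> it touches the line with a single corner, and only if
    \<open>u\<close> is an integer.\<close>
  then consider "k = c" | "k = c + 1" | "k = c - 1" by linarith
  then show ?thesis
  proof cases
    case 1
    then have "i < r" using r(2)[of i] kx by (cases "i < r") auto
    have "b \<le> of_int c + 2 * real i + 2 - t" using ub jk t 1 by (simp add: t_def)
    also have "\<dots> \<le> of_int c + 2 * real r - t" using \<open>i < r\<close> by simp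
    finally show ?thesis using low by (simp add: t_def)
  next
    case 2
    then have ir: "i < r" using r(2)[of i] kx by (cases "i < r") auto
    have b: "b \<le> u + 2 * real i + 2" using ub jk t 2 by (simp add: t_def)
    show ?thesis
    proof (cases "shifted p (r - 1) = c + 1")
      case True
      then have "i \<noteq> r - 1" using kx 2 by auto
      then have "i + 2 \<le> r" using ir by simp
      then have "real i + 2 \<le> real r" by linarith
      then show ?thesis using b low t by linarith
    next
      case False
      then have "rpro p u = u + 2 * real r" using A AB ir by auto
      then show ?thesis using b ir by simp
    qed
  next
    case 3
    then have "of_int c + t - 1 \<le> real_of_int c - 1" using \<open>of_int c + t - 1 \<le> real_of_int k\<close> by simp
    then have t0: "t = 0" using t by simp
    have "i \<le> r"
    proof (rule ccontr)
      assume "\<not> i \<le> r"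
      then have "shifted p i < shifted p r" using shifted_strict[OF p, of r i] by simp
      then show False using r(2)[of r] kx 3 by simp
    qed
    have "b \<le> of_int c + 2 * real i" using ub jk t0 3 by (simp add: t_def)
    then show ?thesis using low \<open>i \<le> r\<close> t0 by (simp add: t_def)
  qed
qed

text \<open>The witness lies in row \<open>r - 1\<close>. On a descending piece it is the last box
  of that row; on an ascending piece it is the box of content \<open>c + 1\<close>. If the row has
  no such box, the profile already equals the absolute value of \<open>u\<close>.\<close>

lemma rpro_attained:
  assumes p: "p \<in> young n"
  shows "rpro p u = \<bar>u\<bar> \<or> (u, rpro p u) \<in> uregion p"
proof -
  define c where "c = \<lfloor>u\<rfloor>"
  define t where "t = u - of_int c"
  have t: "0 \<le> t" "t < 1" unfolding t_def c_def by linarith+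
  have u: "u = of_int c + t" by (simp add: t_def)
  obtain r where r: "\<And>i. i < r \<Longrightarrow> shifted p i \<ge> c + 1" "\<And>i. r \<le> i \<Longrightarrow> shifted p i \<le> c"
    and A: "(r = 0 \<or> shifted p (r - 1) \<ge> c + 2) \<Longrightarrow> rpro p u = u + 2 * real r"
    and B: "r > 0 \<Longrightarrow> shifted p (r - 1) = c + 1 \<Longrightarrow> rpro p u = u + 2 * real r - 2 * t"
    using rpro_explicit[OF p, of u, folded c_def, folded t_def] by metis
  have ge: "\<bar>u\<bar> \<le> rpro p u" by (rule rpro_ge[OF p])
  show ?thesis
  proof (cases "r = 0")
    case True
    then show ?thesis using A ge by auto
  next
    case r0: False
    then obtain i where ri: "r = Suc i" by (cases r) auto
    have xi: "shifted p i \<ge> c + 1" using r(1)[of i] ri by simp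
    show ?thesis
    proof (cases "shifted p i = c + 1")
      case True
      have val: "rpro p u = of_int c + 2 * real i + 2 - t" using B r0 True by (simp add: ri u)
      have pi: "int (p i) = c + 1 + int i" using True by (simp add: shifted_def)
      show ?thesis
      proof (cases "p i = 0")
        case True
        then have "real_of_int c = - 1 - real i" using pi by linarith
        then have "rpro p u = - u" using val u by simp
        then show ?thesis using ge by auto
      next
        case False
        have "real (p i) = of_int c + 1 + real i" using pi by linarith
        then show ?thesis unfolding uregion_def using False val t u
          by (intro disjI2 CollectI case_prodI exI[of _ i] exI[of _ "p i"]) auto
      qed
    next
      case False
      then have x2: "shifted p i \<ge> c + 2" using xi by simp
      have val: "rpro p u = u + 2 * real i + 2" using A x2 ri by simp
      show ?thesis
      proof (cases "c + int i + 2 \<ge> 1")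
        case True
        define j where "j = nat (c + int i + 2)"
        have j: "int j = c + int i + 2" using True by (simp add: j_def)
        have rj: "real j = of_int c + real i + 2" using j by linarith
        have "1 \<le> j" using True j by linarith
        moreover have "j \<le> p i" using x2 j by (simp add: shifted_def)
        ultimately show ?thesis unfolding uregion_def using val t u rj
          by (intro disjI2 CollectI case_prodI exI[of _ i] exI[of _ j]) auto
      next
        case False
        then have "c \<le> - int i - 2" by linarith
        then have "real_of_int c \<le> - real i - 2" by linarith
        then have "u + 2 * real i + 2 \<le> - u" using u t by linarith
        then show ?thesis using ge val by auto
      qed
    qed
  qed
qed

text \<open>\<open>w u k\<close> is the length of the part of \<open>[k - 1, k]\<close> to the left
  of \<open>u\<close>. The shifted parts are distinct, so their unit intervals do not overlap, and
  they cover a part of \<open>[u, v]\<close> whose length lies between 0 and \<open>v - u\<close>.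
  The increment of the profile is \<open>v - u\<close> minus twice that length.\<close>

lemma rpro_lipschitz:
  assumes p: "p \<in> young n"
  shows "\<bar>rpro p u - rpro p v\<bar> \<le> \<bar>u - v\<bar>"
proof -
  have main: "rpro p v - rpro p u \<le> v - u \<and> rpro p u - rpro p v \<le> v - u" if uv: "u \<le> v" for u v
  proof -
    define M where "M = n + nat \<lceil>\<bar>u\<bar>\<rceil> + nat \<lceil>\<bar>v\<bar>\<rceil> + 1"
    have M: "\<bar>u\<bar> \<le> real M" "\<bar>v\<bar> \<le> real M" unfolding M_def by linarith+
    define w where "w = (\<lambda>(u::real) (k::int). min (max u (of_int k - 1)) (of_int k) - (of_int k - 1))"
    have z: "p i = 0" if "M \<le> i" for i using young_zero[OF p] that by (simp add: M_def)
    have tau: "\<bar>u - of_int k\<bar> - \<bar>u - of_int (k - 1)\<bar> = 1 - 2 * w u k" for u and k :: int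
      by (auto simp: w_def abs_if min_def max_def)
    have mono: "w u k \<le> w v k" for k using uv by (auto simp: w_def)
    have ru: "rpro p u = u + real M + (\<Sum>i<M. 1 - 2 * w u (shifted p i))" if "\<bar>u\<bar> \<le> real M" for u
      unfolding rpro_def using kerov_eq_shifted[OF p z, of M "\<lambda>c. \<bar>u - of_int c\<bar>", unfolded tau] that by simp
    have inj: "inj_on (shifted p) {..<M}" by (rule shifted_inj[OF p])
    have sub: "shifted p ` {..<M} \<subseteq> {- int M<..int M}"
    proof
      fix k assume "k \<in> shifted p ` {..<M}"
      then obtain i where "i < M" "k = shifted p i" by auto
      moreover have "p i \<le> M" using young_le[OF p, of i] by (simp add: M_def)
      ultimately show "k \<in> {- int M<..int M}" by (auto simp: shifted_def)
    qed
    have tel: "(\<Sum>k\<in>{- int M<..- int M + int N}. w u k) = min (max u (- real M)) (- real M + real N) + real M" for u N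
    proof (induction N)
      case (Suc N)
      have "{- int M<..- int M + int (Suc N)} = insert (- int M + int (Suc N)) {- int M<..- int M + int N}" by auto
      then show ?case using Suc by (auto simp: w_def min_def max_def)
    qed auto
    have tel': "(\<Sum>k\<in>{- int M<..int M}. w u k) = u + real M" if "\<bar>u\<bar> \<le> real M" for u
      using tel[of u "2 * M"] that by (auto simp: min_def max_def)
    have "0 \<le> (\<Sum>i<M. w v (shifted p i) - w u (shifted p i))" using mono by (intro sum_nonneg) auto
    moreover have "(\<Sum>i<M. w v (shifted p i) - w u (shifted p i)) \<le> v - u"
    proof -
      have "(\<Sum>i<M. w v (shifted p i) - w u (shifted p i)) = (\<Sum>k\<in>shifted p ` {..<M}. w v k - w u k)"
        using sum.reindex[OF inj, of "\<lambda>k. w v k - w u k"] by simp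
      also have "\<dots> \<le> (\<Sum>k\<in>{- int M<..int M}. w v k - w u k)" using sub mono by (intro sum_mono2) auto
      also have "\<dots> = v - u" using tel'[OF M(1)] tel'[OF M(2)] by (simp add: sum_subtractf)
      finally show ?thesis .
    qed
    moreover have "rpro p v - rpro p u = (v - u) - 2 * (\<Sum>i<M. w v (shifted p i) - w u (shifted p i))"
      unfolding ru[OF M(1)] ru[OF M(2)] by (simp add: sum_subtractf sum_distrib_left[symmetric])
    ultimately show ?thesis by simp
  qed
  show ?thesis using main[of u v] main[of v u] by (cases "u \<le> v") auto
qed

section \<open>Partitions as lists and standard Young tableaux\<close>

definition pfun :: "nat list \<Rightarrow> nat \<Rightarrow> nat" where
  "pfun \<mu> = nth_default 0 \<mu>"

lemma pfun_nth: "pfun \<mu> i = (if i < length \<mu> then \<mu> ! i else 0)"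
  by (simp add: pfun_def nth_default_def)

lemma pfun_pos_iff: "\<mu> \<in> partitions n \<Longrightarrow> 0 < pfun \<mu> i \<longleftrightarrow> i < length \<mu>"
  by (auto simp: pfun_nth partitions_def)

lemma sum_pfun: "(\<Sum>i<length \<mu>. pfun \<mu> i) = sum_list \<mu>"
  by (simp add: sum_list_sum_nth pfun_nth atLeast0LessThan)

lemma pfun_young: "\<mu> \<in> partitions n \<Longrightarrow> pfun \<mu> \<in> young n"
proof (rule youngI[where d = "length \<mu>"])
  assume \<mu>: "\<mu> \<in> partitions n"
  then have "sorted_wrt (\<ge>) \<mu>" by (simp add: partitions_def)
  then show "pfun \<mu> (Suc i) \<le> pfun \<mu> i" for i
    by (auto simp: pfun_nth sorted_wrt_iff_nth_less)
  show "(\<Sum>i<length \<mu>. pfun \<mu> i) = n" using \<mu> by (simp add: sum_pfun partitions_def)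
qed (simp add: pfun_nth)

lemma inj_on_pfun: "inj_on pfun (partitions n)"
proof (rule inj_onI)
  fix \<mu> \<nu> assume m: "\<mu> \<in> partitions n" and v: "\<nu> \<in> partitions n" and e: "pfun \<mu> = pfun \<nu>"
  have "i < length \<mu> \<longleftrightarrow> i < length \<nu>" for i using pfun_pos_iff[OF m, of i] pfun_pos_iff[OF v, of i] e by simp
  then have l: "length \<mu> = length \<nu>" by (metis linorder_neq_iff)
  show "\<mu> = \<nu>"
  proof (rule nth_equalityI[OF l])
    fix i assume "i < length \<mu>"
    then show "\<mu> ! i = \<nu> ! i" using fun_cong[OF e, of i] l by (simp add: pfun_nth)
  qed
qed

lemma pfun_image: "pfun ` partitions n = young n"
proof
  show "pfun ` partitions n \<subseteq> young n" using pfun_young by auto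
  show "young n \<subseteq> pfun ` partitions n"
  proof
    fix p assume p: "p \<in> young n"
    define k where "k = (LEAST k. p k = 0)"
    have k0: "p k = 0" unfolding k_def by (rule LeastI[of "\<lambda>k. p k = 0" n]) (use young_zero[OF p] in simp)
    have kp: "0 < p i" if "i < k" for i using not_less_Least[of i "\<lambda>k. p k = 0"] that by (auto simp: k_def)
    have z: "p i = 0" if "k \<le> i" for i using young_antimono[OF p that] k0 by simp
    let ?m = "map p [0..<k]"
    have e: "pfun ?m = p" using z by (auto simp: pfun_nth fun_eq_iff)
    have "sum_list ?m = n"
      using sum_pfun[of ?m] young_sum[OF p z] by (simp add: e)
    moreover have "sorted_wrt (\<ge>) ?m" using young_antimono[OF p] by (auto simp: sorted_wrt_iff_nth_less)
    ultimately have "?m \<in> partitions n" using kp by (auto simp: partitions_def)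
    then show "p \<in> pfun ` partitions n" using e by (metis imageI)
  qed
qed

lemma finite_partitions: "finite (partitions n)"
  using finite_imageD[OF _ inj_on_pfun[of n]] pfun_image finite_young by metis

lemma sum_partitions: "(\<Sum>\<mu>\<in>partitions n. h (pfun \<mu>)) = (\<Sum>p\<in>young n. h p)"
  using sum.reindex[OF inj_on_pfun[of n], of h] by (simp add: pfun_image)

section \<open>Standard Young tableaux counted by the branching rule\<close>

definition dg :: "(nat \<Rightarrow> nat) \<Rightarrow> (nat \<times> nat) set" where
  "dg p = {(i, j). 1 \<le> i \<and> 1 \<le> j \<and> j \<le> p (i - 1)}"

lemma young_diagram_eq: "young_diagram \<mu> = dg (pfun \<mu>)"
  unfolding young_diagram_def dg_def nth_part_def pfun_def[symmetric]
  by (auto simp: pfun_nth split: if_splits)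

lemma finite_dg: "p \<in> young n \<Longrightarrow> finite (dg p)"
proof (rule finite_subset[of _ "{..n} \<times> {..n}"])
  assume p: "p \<in> young n"
  show "dg p \<subseteq> {..n} \<times> {..n}"
  proof
    fix b assume "b \<in> dg p"
    then obtain i j where b: "b = (i, j)" "1 \<le> i" "1 \<le> j" "j \<le> p (i - 1)" by (auto simp: dg_def)
    then have "i - 1 < n" using young_zero[OF p, of "i - 1"] by (cases "n \<le> i - 1") auto
    then show "b \<in> {..n} \<times> {..n}" using b young_le[OF p, of "i - 1"] by auto
  qed
qed simp

text \<open>Stated for an arbitrary set of boxes, so that deleting a corner stays within the same
  notion.\<close>

definition tabs :: "(nat \<times> nat) set \<Rightarrow> nat \<Rightarrow> (nat \<times> nat \<Rightarrow> nat) set" where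
  "tabs D n = {T \<in> extensional D. bij_betw T D {1..n} \<and>
     (\<forall>i j. (i, j) \<in> D \<and> (i, j + 1) \<in> D \<longrightarrow> T (i, j) < T (i, j + 1)) \<and>
     (\<forall>i j. (i, j) \<in> D \<and> (i + 1, j) \<in> D \<longrightarrow> T (i, j) < T (i + 1, j))}"

lemma finite_tabs: "finite D \<Longrightarrow> finite (tabs D n)"
proof (rule finite_subset[of _ "PiE D (\<lambda>_. {1..n})"])
  show "tabs D n \<subseteq> PiE D (\<lambda>_. {1..n})"
    by (auto simp: tabs_def PiE_def bij_betw_def)
qed (auto intro: finite_PiE)

text \<open>Restriction to the remaining boxes and extension by \<open>Suc n\<close> are mutually
  inverse. The maximum can be inserted freely because the box has no neighbour to the right or
  below.\<close>

lemma card_tabs_corner: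
  assumes b: "(r, c) \<in> D" and out: "(r, c + 1) \<notin> D" "(r + 1, c) \<notin> D"
  shows "card {T \<in> tabs D (Suc n). T (r, c) = Suc n} = card (tabs (D - {(r, c)}) n)"
proof -
  let ?b = "(r, c)" and ?E = "D - {(r, c)}"
  let ?f = "\<lambda>T. restrict T ?E" and ?g = "\<lambda>T. T(?b := Suc n)"
  have "bij_betw ?f {T \<in> tabs D (Suc n). T ?b = Suc n} (tabs ?E n)"
  proof (rule bij_betw_byWitness[where f' = ?g])
  show "\<forall>T\<in>{T \<in> tabs D (Suc n). T ?b = Suc n}. ?g (?f T) = T"
    using b by (auto simp: tabs_def fun_eq_iff extensional_def restrict_def)
  show "\<forall>T\<in>tabs ?E n. ?f (?g T) = T"
    by (auto simp: tabs_def fun_eq_iff extensional_def restrict_def)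
  show "?f ` {T \<in> tabs D (Suc n). T ?b = Suc n} \<subseteq> tabs ?E n"
  proof
    fix S assume "S \<in> ?f ` {T \<in> tabs D (Suc n). T ?b = Suc n}"
    then obtain T where T: "T \<in> tabs D (Suc n)" "T ?b = Suc n" and S: "S = ?f T" by auto
    have "bij_betw T D {1..Suc n}" using T by (simp add: tabs_def)
    then have "bij_betw T (D - {?b}) ({1..Suc n} - {Suc n})" 
      using inj_on_image_set_diff[of T D D "{?b}"] b T(2) by (auto simp: bij_betw_def inj_on_diff)
    moreover have "{1..Suc n} - {Suc n} = {1..n}" by auto
    ultimately have "bij_betw T ?E {1..n}" by simp
    then have "bij_betw S ?E {1..n}" unfolding S by (subst bij_betw_cong[where g = T]) auto
    then show "S \<in> tabs ?E n" using T(1) by (auto simp: tabs_def S)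
  qed
  show "?g ` tabs ?E n \<subseteq> {T \<in> tabs D (Suc n). T ?b = Suc n}"
  proof
    fix S assume "S \<in> ?g ` tabs ?E n"
    then obtain T where T: "T \<in> tabs ?E n" and S: "S = ?g T" by auto
    have bT: "bij_betw T ?E {1..n}" using T by (simp add: tabs_def)
    have "bij_betw S ?E {1..n}" using bT unfolding S by (subst bij_betw_cong[where g = T]) auto
    then have "bij_betw S (?E \<union> {?b}) ({1..n} \<union> {Suc n})"
      using notIn_Un_bij_betw[of ?b ?E S "{1..n}"] by (simp add: S)
    moreover have "?E \<union> {?b} = D" "{1..n} \<union> {Suc n} = {1..Suc n}" using b by auto
    ultimately have bS: "bij_betw S D {1..Suc n}" by simp
    have le: "T x \<le> n" if "x \<in> ?E" for x using bT that by (auto simp: bij_betw_def)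
    have "S (i, j) < S (i, j + 1)" if "(i, j) \<in> D" "(i, j + 1) \<in> D" for i j
    proof -
      have "(i, j) \<noteq> ?b" using that out by auto
      then have E: "(i, j) \<in> ?E" using that by auto
      show ?thesis
      proof (cases "(i, j + 1) = ?b")
        case True then show ?thesis using le[OF E] \<open>(i, j) \<noteq> ?b\<close> by (simp add: S)
      next
        case False
        then have "(i, j + 1) \<in> ?E" using that by auto
        then have "T (i, j) < T (i, j + 1)" using T E unfolding tabs_def by blast
        then show ?thesis using False \<open>(i, j) \<noteq> ?b\<close> unfolding S by auto
      qed
    qed
    moreover have "S (i, j) < S (i + 1, j)" if "(i, j) \<in> D" "(i + 1, j) \<in> D" for i j
    proof -
      have "(i, j) \<noteq> ?b" using that out by auto
      then have E: "(i, j) \<in> ?E" using that by auto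
      show ?thesis
      proof (cases "(i + 1, j) = ?b")
        case True then show ?thesis using le[OF E] \<open>(i, j) \<noteq> ?b\<close> by (simp add: S)
      next
        case False
        then have "(i + 1, j) \<in> ?E" using that by auto
        then have "T (i, j) < T (i + 1, j)" using T E unfolding tabs_def by blast
        then show ?thesis using False \<open>(i, j) \<noteq> ?b\<close> unfolding S by auto
      qed
    qed
    moreover have "S \<in> extensional D" using T b by (auto simp: S tabs_def extensional_def)
    ultimately show "S \<in> {T \<in> tabs D (Suc n). T ?b = Suc n}" using bS by (simp add: tabs_def S)
  qed
  qed
  then show ?thesis by (rule bij_betw_same_card)
qed

text \<open>The largest entry must occupy a corner, and injectivity of a tableau makes the cases for
  different corners disjoint.\<close>

lemma card_tabs_branching:
  assumes p: "p \<in> young (Suc n)"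
  shows "card (tabs (dg p) (Suc n)) = (\<Sum>r\<in>removable p. card (tabs (dg (rem_box p r)) n))"
proof -
  let ?A = "\<lambda>r. {T \<in> tabs (dg p) (Suc n). T (Suc r, p r) = Suc n}"
  have fin: "finite (tabs (dg p) (Suc n))" by (rule finite_tabs[OF finite_dg[OF p]])
  have indg: "(Suc r, p r) \<in> dg p" if "r \<in> removable p" for r using that by (auto simp: dg_def removable_def)
  have cover: "tabs (dg p) (Suc n) = (\<Union>r\<in>removable p. ?A r)"
  proof (intro equalityI subsetI)
    fix T assume T: "T \<in> tabs (dg p) (Suc n)"
    then have "bij_betw T (dg p) {1..Suc n}" by (simp add: tabs_def)
    then have "Suc n \<in> T ` dg p" by (simp add: bij_betw_def)
    then obtain i j where ij: "(i, j) \<in> dg p" "T (i, j) = Suc n" by auto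
    have le: "T x \<le> Suc n" if "x \<in> dg p" for x using \<open>bij_betw T (dg p) {1..Suc n}\<close> that by (auto simp: bij_betw_def)
    have o1: "(i, j + 1) \<notin> dg p"
    proof
      assume a: "(i, j + 1) \<in> dg p"
      then have "T (i, j) < T (i, j + 1)" using T ij(1) unfolding tabs_def by blast
      then show False using le[OF a] ij by simp
    qed
    have o2: "(i + 1, j) \<notin> dg p"
    proof
      assume a: "(i + 1, j) \<in> dg p"
      then have "T (i, j) < T (i + 1, j)" using T ij(1) unfolding tabs_def by blast
      then show False using le[OF a] ij by simp
    qed
    obtain r where r: "i = Suc r" using ij by (cases i) (auto simp: dg_def)
    have "j = p r" using o1 ij r by (auto simp: dg_def)
    moreover have "r \<in> removable p" using o2 ij r \<open>j = p r\<close> by (auto simp: dg_def removable_def)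
    ultimately show "T \<in> (\<Union>r\<in>removable p. ?A r)" using T ij r by auto
  qed auto
  have disj: "?A r \<inter> ?A s = {}" if "r \<in> removable p" "s \<in> removable p" "r \<noteq> s" for r s
  proof -
    { fix T assume T: "T \<in> ?A r" "T \<in> ?A s"
      then have "inj_on T (dg p)" by (simp add: tabs_def bij_betw_def)
      then have "(Suc r, p r) = (Suc s, p s)"
        using inj_onD[of T "dg p" "(Suc r, p r)" "(Suc s, p s)"] T indg[OF that(1)] indg[OF that(2)] by simp
      then have False using that by simp }
    then show ?thesis by blast
  qed
  have "card (tabs (dg p) (Suc n)) = card (\<Union>r\<in>removable p. ?A r)" using cover by simp
  also have "\<dots> = (\<Sum>r\<in>removable p. card (?A r))"
    using finite_removable[OF p] fin disj by (intro card_UN_disjoint) auto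
  also have "\<dots> = (\<Sum>r\<in>removable p. card (tabs (dg (rem_box p r)) n))"
  proof (rule sum.cong[OF refl])
    fix r assume r: "r \<in> removable p"
    have "dg p - {(Suc r, p r)} = dg (rem_box p r)"
      by (auto simp: dg_def rem_box_def split: if_splits)
    moreover have "(Suc r, p r + 1) \<notin> dg p" "(Suc r + 1, p r) \<notin> dg p" using r by (auto simp: dg_def removable_def)
    ultimately show "card (?A r) = card (tabs (dg (rem_box p r)) n)"
      using card_tabs_corner[OF indg[OF r], of n] by simp
  qed
  finally show ?thesis .
qed

text \<open>The number of tableaux and the Frobenius formula satisfy the same branching rule and
  agree on the empty diagram.\<close>

lemma card_tabs: "p \<in> young n \<Longrightarrow> real (card (tabs (dg p) n)) = fdim p"
proof (induction n arbitrary: p)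
  case 0
  then have p: "p = (\<lambda>_. 0)" by (simp add: young_0)
  have "dg p = {}" by (auto simp: dg_def p)
  then have "tabs (dg p) 0 = {\<lambda>_. undefined}" by (auto simp: tabs_def bij_betw_def)
  then show ?case by (simp add: p fdim_zero)
next
  case (Suc n)
  then show ?case
    using card_tabs_branching[OF Suc.prems] fdim_branching[OF Suc.prems] rem_box_young[OF Suc.prems] by simp
qed

lemma num_syt_eq: "\<mu> \<in> partitions n \<Longrightarrow> real (num_syt \<mu>) = fdim (pfun \<mu>)"
proof -
  assume m: "\<mu> \<in> partitions n"
  have "standard_young_tableaux \<mu> = tabs (dg (pfun \<mu>)) n"
    unfolding standard_young_tableaux_def tabs_def young_diagram_eq using m by (simp add: partitions_def)
  then show ?thesis unfolding num_syt_def using card_tabs[OF pfun_young[OF m]] by simp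
qed

lemma sum_dg:
  assumes p: "p \<in> young n"
  shows "(\<Sum>(i, j)\<in>dg p. h (int j - int i)) = (\<Sum>i<n. \<Sum>j<p i. h (int j - int i))"
proof -
  have "(\<Sum>i<n. \<Sum>j<p i. h (int j - int i)) = (\<Sum>(i, j)\<in>(SIGMA i:{..<n}. {..<p i}). h (int j - int i))"
    by (subst sum.Sigma) auto
  also have "\<dots> = (\<Sum>(i, j)\<in>dg p. h (int j - int i))"
  proof (rule sum.reindex_bij_witness[of _ "\<lambda>(i, j). (i - 1, j - 1)" "\<lambda>(i, j). (Suc i, Suc j)"])
    fix b assume "b \<in> dg p"
    then obtain i j where b: "b = (i, j)" "1 \<le> i" "1 \<le> j" "j \<le> p (i - 1)" by (auto simp: dg_def)
    then have "i - 1 < n" using young_zero[OF p, of "i - 1"] by (cases "n \<le> i - 1") auto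
    then show "(case b of (i, j) \<Rightarrow> (i - 1, j - 1)) \<in> (SIGMA i:{..<n}. {..<p i})" using b by auto
    show "(case case b of (i, j) \<Rightarrow> (i - 1, j - 1) of (i, j) \<Rightarrow> (Suc i, Suc j)) = b" using b by auto
  qed (auto simp: dg_def)
  finally show ?thesis by simp
qed

lemma content_sum_eq: "\<mu> \<in> partitions n \<Longrightarrow> real_of_int (content_sum \<mu>) = csum (pfun \<mu>)"
proof -
  assume m: "\<mu> \<in> partitions n"
  note p = pfun_young[OF m]
  have "csum (pfun \<mu>) = (\<Sum>(i, j)\<in>dg (pfun \<mu>). real_of_int (int j - int i))"
    unfolding csum_def sum_dg[OF p] by (rule box_sum_eq) (use young_zero[OF p] in auto)
  then show ?thesis unfolding content_sum_def young_diagram_eq by (simp add: case_prod_unfold)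
qed

lemma pfun_tl: "pfun (tl \<mu>) = pfun \<mu> \<circ> Suc"
  by (cases \<mu>) (auto simp: pfun_nth fun_eq_iff)

lemma tl_partitions: "\<mu> \<in> partitions n \<Longrightarrow> tl \<mu> \<in> partitions (n - pfun \<mu> 0)"
  by (cases \<mu>) (auto simp: partitions_def pfun_nth)

section \<open>Exponential moments of the limit shape\<close>

text \<open>Wallis' recursion, by differentiating \<open>- cos t * sin t ^ (n + 1)\<close>, which
  vanishes at both endpoints.\<close>

lemma sin_power_rec:
  assumes "((\<lambda>t. sin t ^ n) has_integral W) {- pi / 2..pi / 2}"
  shows "((\<lambda>t. sin t ^ (n + 2)) has_integral (real (n + 1) / real (n + 2) * W)) {- pi / 2..pi / 2}"
proof -
  have "((\<lambda>t. real (n + 2) * sin t ^ (n + 2) - real (n + 1) * sin t ^ n) has_integral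
     (- cos (pi / 2) * sin (pi / 2) ^ (n + 1)) - (- cos (- pi / 2) * sin (- pi / 2) ^ (n + 1))) {- pi / 2..pi / 2}"
  proof (rule fundamental_theorem_of_calculus)
    fix t :: real
    have "((\<lambda>t. - cos t * sin t ^ (n + 1)) has_real_derivative sin t * sin t ^ (n + 1) - real (n + 1) * (sin t ^ n * (cos t * cos t))) (at t within {- pi / 2..pi / 2})"
      by (rule derivative_eq_intros refl)+ (simp add: algebra_simps)
    moreover have cc: "cos t * cos t = 1 - sin t * sin t" using sin_cos_squared_add[of t] by (simp add: power2_eq_square)
    have "sin t * sin t ^ (n + 1) - real (n + 1) * (sin t ^ n * (cos t * cos t)) = real (n + 2) * sin t ^ (n + 2) - real (n + 1) * sin t ^ n"
      unfolding cc by (simp add: algebra_simps)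
    ultimately show "((\<lambda>t. - cos t * sin t ^ (n + 1)) has_vector_derivative (real (n + 2) * sin t ^ (n + 2) - real (n + 1) * sin t ^ n)) (at t within {- pi / 2..pi / 2})"
      by (simp add: has_real_derivative_iff_has_vector_derivative)
  qed (use pi_gt_zero in linarith)
  then have "((\<lambda>t. real (n + 2) * sin t ^ (n + 2) - real (n + 1) * sin t ^ n) has_integral 0) {- pi / 2..pi / 2}"
    by simp
  from has_integral_add[OF this has_integral_mult_right[OF assms, of "real (n + 1)"]]
  have "((\<lambda>t. real (n + 2) * sin t ^ (n + 2)) has_integral (real (n + 1) * W)) {- pi / 2..pi / 2}" by simp
  note i = has_integral_mult_right[OF this, of "1 / real (n + 2)"]
  have "(\<lambda>t. 1 / real (n + 2) * (real (n + 2) * sin t ^ (n + 2))) = (\<lambda>t::real. sin t ^ (n + 2))"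
    by (rule ext) (simp only: mult.assoc[symmetric], simp)
  moreover have "1 / real (n + 2) * (real (n + 1) * W) = real (n + 1) / real (n + 2) * W" by simp
  ultimately show ?thesis using i by (simp only:)
qed

lemma sin_power_even:
  "((\<lambda>t. sin t ^ (2 * k)) has_integral (pi * fact (2 * k) / (4 ^ k * (fact k)\<^sup>2))) {- pi / 2..pi / 2}"
proof (induction k)
  case 0
  show ?case using has_integral_const_real[of "1::real" "- pi / 2" "pi / 2"] pi_gt_zero by simp
next
  case (Suc k)
  have "real (2 * k + 1) / real (2 * k + 2) * (pi * fact (2 * k) / (4 ^ k * (fact k)\<^sup>2)) = pi * fact (2 * Suc k) / (4 ^ Suc k * (fact (Suc k))\<^sup>2)"
    by (simp add: power2_eq_square divide_simps) (simp add: algebra_simps)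
  then show ?case using sin_power_rec[OF Suc] by simp
qed

lemma sin_power_odd: "((\<lambda>t. sin t ^ (2 * k + 1)) has_integral 0) {- pi / 2..pi / 2}"
proof (induction k)
  case 0
  have "((\<lambda>t. sin t) has_integral (- cos (pi / 2)) - (- cos (- pi / 2))) {- pi / 2..pi / 2}"
    by (rule fundamental_theorem_of_calculus)
      (use pi_gt_zero in \<open>auto intro!: derivative_eq_intros simp: has_real_derivative_iff_has_vector_derivative[symmetric]\<close>)
  then show ?case by simp
next
  case (Suc k)
  then show ?case using sin_power_rec[OF Suc] by simp
qed

text \<open>The modified Bessel function of order 0 at \<open>2 a\<close>.\<close>

definition bessel :: "real \<Rightarrow> real" where
  "bessel a = (\<Sum>k. (a ^ k / fact k)\<^sup>2)"

lemma bessel_sums: "(\<lambda>k. (a ^ k / fact k)\<^sup>2) sums bessel a"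
proof -
  have "summable (\<lambda>k. (a ^ k / fact k)\<^sup>2)"
  proof (rule summable_comparison_test)
    show "summable (\<lambda>k. inverse (fact k) * (a\<^sup>2) ^ k)" by (rule summable_exp)
    have "(a ^ k / fact k)\<^sup>2 \<le> inverse (fact k) * (a\<^sup>2) ^ k" for k
    proof -
      have "(1::real) \<le> fact k" by (rule fact_ge_1)
      then have "(a ^ k)\<^sup>2 / (fact k * fact k) \<le> (a ^ k)\<^sup>2 / (fact k)"
        by (intro divide_left_mono) auto
      moreover have "(a\<^sup>2) ^ k = (a ^ k)\<^sup>2" by (metis power_mult mult.commute)
      moreover have "(a ^ k / fact k)\<^sup>2 = (a ^ k)\<^sup>2 / (fact k * fact k)" by (simp add: power_divide power2_eq_square)
      ultimately show ?thesis by (simp add: divide_inverse mult.commute)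
    qed
    then show "\<exists>N. \<forall>n\<ge>N. norm ((a ^ n / fact n)\<^sup>2) \<le> inverse (fact n) * (a\<^sup>2) ^ n" by auto
  qed
  then show ?thesis by (simp add: bessel_def summable_sums)
qed

text \<open>The exponential series converges uniformly and is integrated term by term: odd powers of
  the sine contribute nothing and the Wallis integrals turn the even ones into the Bessel
  terms.\<close>

lemma exp_sin_integral:
  "((\<lambda>t. exp (2 * a * sin t)) has_integral (pi * bessel a)) {- pi / 2..pi / 2}"
proof -
  define f where "f n t = (2 * a * sin t) ^ n /\<^sub>R fact n" for n t
  have lim: "uniform_limit {- pi / 2..pi / 2} (\<lambda>n t. \<Sum>i<n. f i t) (\<lambda>t. \<Sum>i. f i t) sequentially"
  proof (rule Weierstrass_m_test)
    show "summable (\<lambda>n. inverse (fact n) * (2 * \<bar>a\<bar>) ^ n)" by (rule summable_exp)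
    fix n t
    have "\<bar>2 * a * sin t\<bar> ^ n \<le> (2 * \<bar>a\<bar>) ^ n"
      by (intro power_mono) (auto simp: abs_mult mult_left_le)
    then show "norm (f n t) \<le> inverse (fact n) * (2 * \<bar>a\<bar>) ^ n"
      by (simp add: f_def power_abs abs_mult)
  qed
  have e: "(\<Sum>i. f i t) = exp (2 * a * sin t)" for t by (simp add: exp_def f_def)
  obtain I J where I: "\<And>n. ((\<lambda>t. \<Sum>i<n. f i t) has_integral I n) {- pi / 2..pi / 2}"
    and J: "((\<lambda>t. \<Sum>i. f i t) has_integral J) {- pi / 2..pi / 2}" and IJ: "I \<longlonglongrightarrow> J"
    by (rule uniform_limit_integral[OF lim]) (auto intro!: continuous_intros simp: f_def)
  \<comment> \<open>Partial sums are compared at even lengths only, so that even and odd powers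
    enter in pairs.\<close>
  have I2: "I (2 * N) = pi * (\<Sum>k<N. (a ^ k / fact k)\<^sup>2)" for N
  proof (rule has_integral_unique[OF I])
    show "((\<lambda>t. \<Sum>i<2 * N. f i t) has_integral pi * (\<Sum>k<N. (a ^ k / fact k)\<^sup>2)) {- pi / 2..pi / 2}"
    proof (induction N)
      case (Suc N)
      have 1: "((\<lambda>t. f (2 * N) t) has_integral pi * (a ^ N / fact N)\<^sup>2) {- pi / 2..pi / 2}"
      proof -
        have "((\<lambda>t. ((2 * a) ^ (2 * N) / fact (2 * N)) * sin t ^ (2 * N)) has_integral
          ((2 * a) ^ (2 * N) / fact (2 * N)) * (pi * fact (2 * N) / (4 ^ N * (fact N)\<^sup>2))) {- pi / 2..pi / 2}"
          by (intro has_integral_mult_right sin_power_even)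
        moreover have "((2 * a) ^ (2 * N) / fact (2 * N)) * (pi * fact (2 * N) / (4 ^ N * (fact N)\<^sup>2)) = pi * (a ^ N / fact N)\<^sup>2"
        proof -
          have "(2 * a) ^ (2 * N) = ((2 * a)\<^sup>2) ^ N" by (rule power_mult)
          also have "\<dots> = 4 ^ N * (a\<^sup>2) ^ N" by (simp add: power_mult_distrib)
          also have "(a\<^sup>2) ^ N = (a ^ N)\<^sup>2" by (metis power_mult mult.commute)
          finally show ?thesis by (simp add: power_divide)
        qed
        moreover have "(\<lambda>t. ((2 * a) ^ (2 * N) / fact (2 * N)) * sin t ^ (2 * N)) = f (2 * N)"
          by (simp add: f_def fun_eq_iff power_mult_distrib divide_inverse mult.commute mult.left_commute)
        ultimately show ?thesis by simp
      qed
      have 2: "((\<lambda>t. f (2 * N + 1) t) has_integral 0) {- pi / 2..pi / 2}"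
      proof -
        have "((\<lambda>t. ((2 * a) ^ (2 * N + 1) / fact (2 * N + 1)) * sin t ^ (2 * N + 1)) has_integral
          ((2 * a) ^ (2 * N + 1) / fact (2 * N + 1)) * 0) {- pi / 2..pi / 2}"
          by (intro has_integral_mult_right sin_power_odd)
        moreover have "(\<lambda>t. ((2 * a) ^ (2 * N + 1) / fact (2 * N + 1)) * sin t ^ (2 * N + 1)) = f (2 * N + 1)"
          unfolding f_def fun_eq_iff power_mult_distrib by (simp add: divide_inverse mult.commute mult.left_commute del: fact_Suc power_Suc)
        ultimately show ?thesis by simp
      qed
      from has_integral_add[OF has_integral_add[OF Suc 1] 2] show ?case
        by (simp add: distrib_left)
    qed simp
  qed
  have "(\<lambda>N. I (2 * N)) \<longlonglongrightarrow> J"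
    using LIMSEQ_subseq_LIMSEQ[OF IJ, of "\<lambda>N. 2 * N"] by (simp add: o_def strict_mono_def)
  moreover have "(\<lambda>N. I (2 * N)) \<longlonglongrightarrow> pi * bessel a"
    unfolding I2 using bessel_sums[of a] by (intro tendsto_intros) (simp add: sums_def)
  ultimately have "J = pi * bessel a" by (rule LIMSEQ_unique)
  then show ?thesis using J by (simp add: e)
qed

section \<open>The limit shape: exponential moments and Lipschitz bound\<close>

lemma limit_shape_sin:
  assumes "t \<in> {- pi / 2..pi / 2}"
  shows "limit_shape (2 * sin t) = 4 / pi * (t * sin t + cos t)"
proof -
  have "cos t \<ge> 0" using assms by (intro cos_ge_zero) auto
  have "4 - (2 * sin t)\<^sup>2 = (2 * cos t)\<^sup>2" by (simp add: power_mult_distrib cos_squared_eq)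
  then have "sqrt (4 - (2 * sin t)\<^sup>2) = \<bar>2 * cos t\<bar>" by (simp only: real_sqrt_abs)
  then have "sqrt (4 - (2 * sin t)\<^sup>2) = 2 * cos t" using \<open>cos t \<ge> 0\<close> by simp
  moreover have "arcsin (sin t) = t" using assms by (intro arcsin_sin) auto
  moreover have "\<bar>2 * sin t\<bar> \<le> 2" using abs_sin_le_one[of t] by (simp add: abs_mult)
  ultimately show ?thesis by (simp add: limit_shape_def field_simps)
qed

lemma limit_shape_cont_inner: "continuous_on {-2..2} limit_shape"
proof -
  have "continuous_on {-2..2} (\<lambda>x. 2 / pi * (x * arcsin (x / 2) + sqrt (4 - x\<^sup>2)))"
    by (intro continuous_intros) auto
  then show ?thesis
    by (rule continuous_on_eq) (auto simp: limit_shape_def)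
qed

lemma limit_shape_integral_inner:
  assumes "a > 0"
  shows "((\<lambda>x. (limit_shape x - \<bar>x\<bar>) * exp (a * x)) has_integral (2 * (bessel a - 1) / a\<^sup>2)) {-2..2}"
proof -
  let ?T = "{- pi / 2..pi / 2}"
  have pi2: "- pi / 2 \<le> pi / 2" using pi_gt_zero by linarith
  have si: "sin ` ?T \<subseteq> {-1..1}" by auto
  have s1: "((\<lambda>t. (2 * cos t) *\<^sub>R (limit_shape (2 * sin t) * exp (a * (2 * sin t)))) has_integral
     integral {2 * sin (- pi / 2)..2 * sin (pi / 2)} (\<lambda>x. limit_shape x * exp (a * x))) ?T"
    by (rule has_integral_substitution[where c = "-2" and d = 2])
      (use pi2 in \<open>auto intro!: derivative_eq_intros continuous_intros limit_shape_cont_inner\<close>)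
  \<comment> \<open>Integration by parts after the substitution \<open>x = 2 sin t\<close>: the
    derivative of the limit shape is \<open>2 t / pi\<close>, so a second integration by parts
    leaves only a multiple of \<open>exp (2 a sin t)\<close>, whose integral is known.\<close>
  define \<Phi> where "\<Phi> t = 4 / pi * (t * sin t + cos t) * exp (2 * a * sin t) / a - 2 / (pi * a\<^sup>2) * (t * exp (2 * a * sin t))" for t
  have s2: "((\<lambda>t. (2 * cos t) * (4 / pi * (t * sin t + cos t)) * exp (2 * a * sin t) - 2 / (pi * a\<^sup>2) * exp (2 * a * sin t)) has_integral \<Phi> (pi / 2) - \<Phi> (- pi / 2)) ?T"
  proof (rule fundamental_theorem_of_calculus[OF pi2])
    fix t :: real
    have "(\<Phi> has_real_derivative
       (4 / pi * (sin t + t * cos t - sin t) * exp (2 * a * sin t) + 4 / pi * (t * sin t + cos t) * (exp (2 * a * sin t) * (2 * a * cos t))) / a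
       - 2 / (pi * a\<^sup>2) * (exp (2 * a * sin t) + t * (exp (2 * a * sin t) * (2 * a * cos t)))) (at t within ?T)"
      unfolding \<Phi>_def using assms by (auto intro!: derivative_eq_intros) (simp add: field_simps power2_eq_square)
    also have "(4 / pi * (sin t + t * cos t - sin t) * exp (2 * a * sin t) + 4 / pi * (t * sin t + cos t) * (exp (2 * a * sin t) * (2 * a * cos t))) / a
       - 2 / (pi * a\<^sup>2) * (exp (2 * a * sin t) + t * (exp (2 * a * sin t) * (2 * a * cos t)))
      = (2 * cos t) * (4 / pi * (t * sin t + cos t)) * exp (2 * a * sin t) - 2 / (pi * a\<^sup>2) * exp (2 * a * sin t)"
      using assms by (simp add: field_simps power2_eq_square)
    finally show "(\<Phi> has_vector_derivative ((2 * cos t) * (4 / pi * (t * sin t + cos t)) * exp (2 * a * sin t) - 2 / (pi * a\<^sup>2) * exp (2 * a * sin t))) (at t within ?T)"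
      by (simp add: has_real_derivative_iff_has_vector_derivative)
  qed
  have "((\<lambda>t. (2 * cos t) * (4 / pi * (t * sin t + cos t)) * exp (2 * a * sin t)) has_integral
     \<Phi> (pi / 2) - \<Phi> (- pi / 2) + 2 / (pi * a\<^sup>2) * (pi * bessel a)) ?T"
    using has_integral_add[OF s2 has_integral_mult_right[OF exp_sin_integral[of a], of "2 / (pi * a\<^sup>2)"]] by simp
  then have s3: "((\<lambda>t. (2 * cos t) *\<^sub>R (limit_shape (2 * sin t) * exp (a * (2 * sin t)))) has_integral
     \<Phi> (pi / 2) - \<Phi> (- pi / 2) + 2 / (pi * a\<^sup>2) * (pi * bessel a)) ?T"
    by (rule has_integral_eq[rotated]) (subst limit_shape_sin, assumption, simp add: mult.commute mult.left_commute)
  have "integral {-2..2} (\<lambda>x. limit_shape x * exp (a * x)) = \<Phi> (pi / 2) - \<Phi> (- pi / 2) + 2 / (pi * a\<^sup>2) * (pi * bessel a)"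
    using has_integral_unique[OF s1 s3] by simp
  moreover have "(\<lambda>x. limit_shape x * exp (a * x)) integrable_on {-2..2}"
    by (intro integrable_continuous_real continuous_intros limit_shape_cont_inner)
  ultimately have O: "((\<lambda>x. limit_shape x * exp (a * x)) has_integral \<Phi> (pi / 2) - \<Phi> (- pi / 2) + 2 / (pi * a\<^sup>2) * (pi * bessel a)) {-2..2}"
    by (metis integrable_integral)
  have A1: "((\<lambda>x. \<bar>x\<bar> * exp (a * x)) has_integral (2 * exp (a * 2) / a - exp (a * 2) / a\<^sup>2) - (0 * exp (a * 0) / a - exp (a * 0) / a\<^sup>2)) {0..2}"
  proof (rule has_integral_eq[rotated], rule fundamental_theorem_of_calculus)
    fix x :: real
    have "((\<lambda>x. x * exp (a * x) / a - exp (a * x) / a\<^sup>2) has_real_derivative (x * exp (a * x))) (at x within {0..2})"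
      using assms by (auto intro!: derivative_eq_intros simp: field_simps power2_eq_square)
    then show "((\<lambda>x. x * exp (a * x) / a - exp (a * x) / a\<^sup>2) has_vector_derivative (x * exp (a * x))) (at x within {0..2})"
      by (simp add: has_real_derivative_iff_has_vector_derivative)
  qed auto
  have A2: "((\<lambda>x. \<bar>x\<bar> * exp (a * x)) has_integral (- (0 * exp (a * 0) / a) + exp (a * 0) / a\<^sup>2) - (- (- 2 * exp (a * - 2) / a) + exp (a * - 2) / a\<^sup>2)) {-2..0}"
  proof (rule has_integral_eq[rotated], rule fundamental_theorem_of_calculus)
    fix x :: real
    have "((\<lambda>x. - (x * exp (a * x) / a) + exp (a * x) / a\<^sup>2) has_real_derivative (- x * exp (a * x))) (at x within {-2..0})"
      using assms by (auto intro!: derivative_eq_intros simp: field_simps power2_eq_square)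
    then show "((\<lambda>x. - (x * exp (a * x) / a) + exp (a * x) / a\<^sup>2) has_vector_derivative (- x * exp (a * x))) (at x within {-2..0})"
      by (simp add: has_real_derivative_iff_has_vector_derivative)
  qed auto
  define V where "V = \<Phi> (pi / 2) - \<Phi> (- pi / 2) + 2 / (pi * a\<^sup>2) * (pi * bessel a) -
    (((- (0 * exp (a * 0) / a) + exp (a * 0) / a\<^sup>2) - (- (- 2 * exp (a * - 2) / a) + exp (a * - 2) / a\<^sup>2)) +
     ((2 * exp (a * 2) / a - exp (a * 2) / a\<^sup>2) - (0 * exp (a * 0) / a - exp (a * 0) / a\<^sup>2)))"
  have "((\<lambda>x. limit_shape x * exp (a * x) - \<bar>x\<bar> * exp (a * x)) has_integral V) {-2..2}"
    unfolding V_def by (rule has_integral_diff[OF O has_integral_combine[OF _ _ A2 A1]]) auto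
  moreover have "V = 2 * (bessel a - 1) / a\<^sup>2"
    unfolding V_def \<Phi>_def using assms by (simp add: field_simps power2_eq_square)
  ultimately show ?thesis by (simp add: left_diff_distrib)
qed

lemma limit_shape_outer: "\<bar>x\<bar> \<ge> 2 \<Longrightarrow> limit_shape x = \<bar>x\<bar>"
proof (cases "\<bar>x\<bar> = 2")
  case True
  then have "x = 2 \<or> x = -2" by linarith
  then show ?thesis by (auto simp: limit_shape_def)
qed (simp add: limit_shape_def)

text \<open>The derivative \<open>2 / pi * arcsin (x / 2)\<close> has absolute value at most 1
  inside the support. Points outside are clamped to the endpoints, where the function continues with
  slopes 1 and -1.\<close>

lemma limit_shape_lipschitz: "\<bar>limit_shape x - limit_shape y\<bar> \<le> \<bar>x - y\<bar>"
proof -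
  let ?F = "\<lambda>x::real. 2 / pi * (x * arcsin (x / 2) + sqrt (4 - x\<^sup>2))"
  have der: "(?F has_real_derivative (2 / pi * arcsin (z / 2))) (at z)" if z: "-2 < z" "z < 2" for z
  proof -
    have "z\<^sup>2 < 2\<^sup>2" using z by (intro power2_strict_mono) auto
    then have z4: "4 - z\<^sup>2 > 0" by simp
    have e: "1 - (z / 2)\<^sup>2 = (4 - z\<^sup>2) / 2\<^sup>2" by (simp add: power_divide diff_divide_distrib)
    have r: "sqrt (1 - (z / 2)\<^sup>2) = sqrt (4 - z\<^sup>2) / 2" unfolding e real_sqrt_divide by simp
    have s0: "sqrt (4 - z\<^sup>2) \<noteq> 0" using z4 by simp
    have d1: "((\<lambda>z. arcsin (z / 2)) has_real_derivative (inverse (sqrt (1 - (z / 2)\<^sup>2)) * (1 / 2))) (at z)"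
      by (rule DERIV_chain2[OF DERIV_arcsin]) (use z in \<open>auto intro!: derivative_eq_intros\<close>)
    have d2: "((\<lambda>z. sqrt (4 - z\<^sup>2)) has_real_derivative (inverse (sqrt (4 - z\<^sup>2)) / 2 * (- (2 * z)))) (at z)"
      by (rule DERIV_chain2[where f = sqrt and g = "\<lambda>z. 4 - z\<^sup>2", OF DERIV_real_sqrt[OF z4]]) (auto intro!: derivative_eq_intros)
    have "(?F has_real_derivative (2 / pi * ((1 * arcsin (z / 2) + inverse (sqrt (1 - (z / 2)\<^sup>2)) * (1 / 2) * z) + inverse (sqrt (4 - z\<^sup>2)) / 2 * (- (2 * z))))) (at z)"
      by (rule DERIV_cmult[OF DERIV_add[OF DERIV_mult[OF DERIV_ident d1] d2]])
    moreover have z0: "inverse (sqrt (1 - (z / 2)\<^sup>2)) * (1 / 2) * z + inverse (sqrt (4 - z\<^sup>2)) / 2 * (- (2 * z)) = 0"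
      unfolding r using s0 by (simp add: field_simps)
    have "2 / pi * ((1 * arcsin (z / 2) + inverse (sqrt (1 - (z / 2)\<^sup>2)) * (1 / 2) * z) + inverse (sqrt (4 - z\<^sup>2)) / 2 * (- (2 * z))) = 2 / pi * arcsin (z / 2)"
      unfolding add.assoc z0 by simp
    ultimately show ?thesis by (simp only:)
  qed
  have Fc: "continuous_on {-2..2} ?F" by (intro continuous_intros) auto
  have inner: "\<bar>limit_shape y - limit_shape x\<bar> \<le> y - x" if xy: "x < y" "-2 \<le> x" "y \<le> 2" for x y
  proof -
    have "\<exists>l z. x < z \<and> z < y \<and> (?F has_real_derivative l) (at z) \<and> ?F y - ?F x = (y - x) * l"
    proof (rule MVT[OF xy(1)])
      show "continuous_on {x..y} ?F" by (rule continuous_on_subset[OF Fc]) (use xy in auto)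
      show "?F differentiable at z" if "x < z" "z < y" for z
        using der[of z] that xy by (auto simp: real_differentiable_def)
    qed
    then obtain l z where z: "x < z" "z < y" and l: "(?F has_real_derivative l) (at z)" "?F y - ?F x = (y - x) * l" by blast
    have le: "l = 2 / pi * arcsin (z / 2)" using DERIV_unique[OF l(1) der[of z]] z xy by simp
    have "- pi / 2 \<le> arcsin (z / 2)" "arcsin (z / 2) \<le> pi / 2"
      using arcsin_bounded[of "z / 2"] z xy by auto
    then have "\<bar>l\<bar> \<le> 2 / pi * (pi / 2)"
      unfolding le abs_mult by (intro mult_mono) (auto simp: abs_le_iff)
    then have "\<bar>l\<bar> \<le> 1" by simp
    then have "\<bar>?F y - ?F x\<bar> \<le> y - x" unfolding l(2) using xy mult_left_mono[of "\<bar>l\<bar>" 1 "y - x"] by (simp add: abs_mult)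
    moreover have "\<bar>x\<bar> \<le> 2" "\<bar>y\<bar> \<le> 2" using xy by auto
    ultimately show ?thesis by (simp add: limit_shape_def)
  qed
  have main: "\<bar>limit_shape y - limit_shape x\<bar> \<le> y - x" if xy: "x < y" for x y
  proof -
    define cl where "cl = (\<lambda>u::real. max (- 2) (min 2 u))"
    have e: "limit_shape u = limit_shape (cl u) + \<bar>u - cl u\<bar>" for u
    proof (cases "\<bar>u\<bar> \<le> 2")
      case True
      then have "cl u = u" by (auto simp: cl_def)
      then show ?thesis by simp
    next
      case False
      then consider "u > 2" | "u < -2" by linarith
      then show ?thesis using limit_shape_outer[of 2] limit_shape_outer[of "-2"] limit_shape_outer[of u]
        by cases (auto simp: cl_def)
    qed
    have "cl x \<le> cl y" "cl y - cl x + \<bar>\<bar>y - cl y\<bar> - \<bar>x - cl x\<bar>\<bar> \<le> y - x" using xy by (auto simp: cl_def min_def max_def)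
    moreover have "\<bar>limit_shape (cl y) - limit_shape (cl x)\<bar> \<le> cl y - cl x"
    proof (cases "cl x = cl y")
      case False
      have "-2 \<le> cl x" "cl y \<le> 2" by (simp_all add: cl_def)
      then show ?thesis using inner[of "cl x" "cl y"] \<open>cl x \<le> cl y\<close> False by simp
    qed simp
    ultimately show ?thesis using e[of x] e[of y] by linarith
  qed
  show ?thesis using main[of x y] main[of y x] by (cases x y rule: linorder_cases) auto
qed

lemma limit_shape_integral:
  assumes "a > 0"
  shows "((\<lambda>x. (limit_shape x - \<bar>x\<bar>) * exp (a * x)) has_integral (2 * (bessel a - 1) / a\<^sup>2)) {-5..5}"
proof -
  let ?f = "\<lambda>x. (limit_shape x - \<bar>x\<bar>) * exp (a * x)"
  have 1: "(?f has_integral 0) {-5..-2}" and 2: "(?f has_integral 0) {2..5}"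
    by (rule has_integral_is_0; simp add: limit_shape_outer)+
  have "(?f has_integral (0 + 2 * (bessel a - 1) / a\<^sup>2) + 0) {-5..5}"
    by (rule has_integral_combine[OF _ _ has_integral_combine[OF _ _ 1 limit_shape_integral_inner[OF assms]] 2]) auto
  then show ?thesis by simp
qed

text \<open>Two integrations by parts move to the second derivative of the tent, point masses in the
  proportion 1, -2, 1 at \<open>c - 1\<close>, \<open>c\<close> and \<open>c + 1\<close> over
  \<open>r\<close>. This reproduces the factor \<open>sh2\<close> and reduces the moment to an
  exponential at the content.\<close>

lemma tent_integral:
  assumes r: "r > 0" and a: "a > 0" and c: "\<bar>c\<bar> + 1 \<le> 5 * r"
  shows "((\<lambda>x. tent (x * r - c) * exp (a * x)) has_integral (r / a\<^sup>2 * (exp (a / r * c) * sh2 (a / r)))) {-5..5}"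
proof -
  let ?f = "\<lambda>x. tent (x * r - c) * exp (a * x)"
  have b: "-5 \<le> (c - 1) / r" "(c - 1) / r \<le> c / r" "c / r \<le> (c + 1) / r" "(c + 1) / r \<le> 5"
    using r c by (auto simp: field_simps)
  have 1: "(?f has_integral 0) {-5..(c - 1) / r}"
    by (rule has_integral_is_0) (use r in \<open>auto simp: tent_def field_simps\<close>)
  have 4: "(?f has_integral 0) {(c + 1) / r..5}"
    by (rule has_integral_is_0) (use r in \<open>auto simp: tent_def field_simps\<close>)
  have 2: "(?f has_integral ((c / r * r - c + 1) * exp (a * (c / r)) / a - r * exp (a * (c / r)) / a\<^sup>2) -
      (((c - 1) / r * r - c + 1) * exp (a * ((c - 1) / r)) / a - r * exp (a * ((c - 1) / r)) / a\<^sup>2)) {(c - 1) / r..c / r}"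
  proof (rule has_integral_eq[rotated], rule fundamental_theorem_of_calculus)
    fix x :: real
    have "((\<lambda>x. (x * r - c + 1) * exp (a * x) / a - r * exp (a * x) / a\<^sup>2) has_real_derivative ((x * r - c + 1) * exp (a * x))) (at x within {(c - 1) / r..c / r})"
      using a by (auto intro!: derivative_eq_intros simp: field_simps power2_eq_square)
    then show "((\<lambda>x. (x * r - c + 1) * exp (a * x) / a - r * exp (a * x) / a\<^sup>2) has_vector_derivative ((x * r - c + 1) * exp (a * x))) (at x within {(c - 1) / r..c / r})"
      by (simp add: has_real_derivative_iff_has_vector_derivative)
  next
    fix x assume "x \<in> {(c - 1) / r..c / r}"
    then have "c - 1 \<le> x * r" "x * r \<le> c" using r by (auto simp: field_simps)
    then show "(x * r - c + 1) * exp (a * x) = ?f x" by (simp add: tent_def)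
  qed (rule b)
  have 3: "(?f has_integral ((1 + c - (c + 1) / r * r) * exp (a * ((c + 1) / r)) / a + r * exp (a * ((c + 1) / r)) / a\<^sup>2) -
      ((1 + c - c / r * r) * exp (a * (c / r)) / a + r * exp (a * (c / r)) / a\<^sup>2)) {c / r..(c + 1) / r}"
  proof (rule has_integral_eq[rotated], rule fundamental_theorem_of_calculus)
    fix x :: real
    have "((\<lambda>x. (1 + c - x * r) * exp (a * x) / a + r * exp (a * x) / a\<^sup>2) has_real_derivative ((1 + c - x * r) * exp (a * x))) (at x within {c / r..(c + 1) / r})"
      using a by (auto intro!: derivative_eq_intros simp: field_simps power2_eq_square)
    then show "((\<lambda>x. (1 + c - x * r) * exp (a * x) / a + r * exp (a * x) / a\<^sup>2) has_vector_derivative ((1 + c - x * r) * exp (a * x))) (at x within {c / r..(c + 1) / r})"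
      by (simp add: has_real_derivative_iff_has_vector_derivative)
  next
    fix x assume "x \<in> {c / r..(c + 1) / r}"
    then have "c \<le> x * r" "x * r \<le> c + 1" using r by (auto simp: field_simps)
    then show "(1 + c - x * r) * exp (a * x) = ?f x" by (simp add: tent_def)
  qed (rule b)
  have e: "exp (a * ((c + 1) / r)) = exp (a / r * c) * exp (a / r)" "exp (a * ((c - 1) / r)) = exp (a / r * c) * exp (- (a / r))"
    "exp (a * (c / r)) = exp (a / r * c)"
    by (simp_all add: exp_add[symmetric] add_divide_distrib diff_divide_distrib algebra_simps)
  have "(?f has_integral (((0 + (((c / r * r - c + 1) * exp (a * (c / r)) / a - r * exp (a * (c / r)) / a\<^sup>2) -
      (((c - 1) / r * r - c + 1) * exp (a * ((c - 1) / r)) / a - r * exp (a * ((c - 1) / r)) / a\<^sup>2)))) +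
      (((1 + c - (c + 1) / r * r) * exp (a * ((c + 1) / r)) / a + r * exp (a * ((c + 1) / r)) / a\<^sup>2) -
      ((1 + c - c / r * r) * exp (a * (c / r)) / a + r * exp (a * (c / r)) / a\<^sup>2))) + 0) {-5..5}"
    by (rule has_integral_combine[OF _ _ has_integral_combine[OF _ _ has_integral_combine[OF b(1,2) 1 2] 3] 4]) (use b in linarith)+
  then show ?thesis unfolding e using r a by (simp add: sh2_def algebra_simps add_divide_distrib diff_divide_distrib)
qed

text \<open>Meant for the rescaled profile minus the limit shape: each is 1-Lipschitz, hence the
  constant 2. Contents are at most \<open>3 sqrt m\<close> outside a rare event, so the difference
  vanishes from 4 on, and the interval up to 5 leaves room for a bump of width at most 1 around any
  point of \<open>[-4, 4]\<close>.\<close>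

definition small_moments :: "nat \<Rightarrow> real \<Rightarrow> (real \<Rightarrow> real) \<Rightarrow> bool" where
  "small_moments J \<delta> g \<longleftrightarrow> (\<forall>x y. \<bar>g x - g y\<bar> \<le> 2 * \<bar>x - y\<bar>) \<and> (\<forall>x. 4 \<le> \<bar>x\<bar> \<longrightarrow> g x = 0) \<and>
     (\<forall>j\<in>{1..J}. \<bar>integral {-5..5} (\<lambda>x. g x * exp (real j * x))\<bar> \<le> \<delta>)"

text \<open>Polynomials in \<open>exp x\<close> are dense in the continuous functions on an interval, so a Lipschitz function with
  small moments against \<open>exp (j x)\<close>, \<open>j \<ge> 1\<close>, is uniformly small.\<close>

lemma exp_moments_determine_point:
  assumes x0: "\<bar>x0\<bar> \<le> 4" and k: "0 < k" "k \<le> 1"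
  shows "\<exists>J \<delta>. \<delta> > 0 \<and> (\<forall>g. small_moments J \<delta> g \<longrightarrow> \<bar>g x0\<bar> \<le> 3 * k)"
proof -
  let ?I = "{-5..5::real}"
  \<comment> \<open>A bump of width \<open>k\<close> at \<open>x0\<close>: there \<open>g\<close>
    differs from \<open>g x0\<close> by at most \<open>2 k\<close>, so the integral of
    \<open>g h\<close> is nearly \<open>g x0 * H\<close>.\<close>
  define h where "h x = max 0 (k - \<bar>x - x0\<bar>)" for x
  have hc: "continuous_on S h" for S unfolding h_def by (intro continuous_intros)
  have h0: "h x \<ge> 0" for x by (simp add: h_def)
  define H where "H = integral ?I h"
  have hi: "h integrable_on ?I" by (rule integrable_continuous_real[OF hc])
  have H: "H > 0"
  proof -
    have "H \<noteq> 0"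
    proof
      assume "H = 0"
      then have "\<forall>x\<in>?I. h x = 0" using integral_eq_0_iff[of "-5" 5 h] hc h0 by (auto simp: H_def)
      moreover have "x0 \<in> ?I" using x0 by auto
      ultimately have "h x0 = 0" by blast
      then show False using k by (simp add: h_def)
    qed
    moreover have "H \<ge> 0" unfolding H_def using h0 by (intro integral_nonneg hi) auto
    ultimately show ?thesis by simp
  qed
  \<comment> \<open>Here 18 bounds \<open>g\<close> on the interval, 10 is its length and
    \<open>exp 5\<close> bounds \<open>exp x\<close>, so replacing \<open>h\<close> by
    \<open>q\<close> costs \<open>k H / 2\<close>. The moments cost another \<open>k H / 2\<close>
    through \<delta>, and with the \<open>2 k H\<close> of the bump the total is
    \<open>3 k H\<close>.\<close>
  define \<eta> where "\<eta> = k * H / (2 * (18 * 10 * exp 5))"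
  have \<eta>: "\<eta> > 0" using k H by (simp add: \<eta>_def)
  \<comment> \<open>In the variable \<open>y = exp x\<close> the bump is divided by \<open>y\<close>
    before the approximation, so that \<open>q\<close> contains only exponents
    \<open>j \<ge> 1\<close>.\<close>
  have "continuous_on {exp (-5)..exp 5::real} (\<lambda>y. h (ln y) / y)"
  proof (intro continuous_intros continuous_on_compose2[OF hc[of UNIV]])
    show "\<forall>y\<in>{exp (-5)..exp 5::real}. y \<noteq> 0" using exp_gt_zero[of "-5::real"] by (metis atLeastAtMost_iff not_le)
    then show "\<forall>y\<in>{exp (-5)..exp 5::real}. y \<noteq> 0" .
  qed auto
  then obtain P where "real_polynomial_function P" and P: "\<And>y. y \<in> {exp (-5)..exp 5} \<Longrightarrow> \<bar>h (ln y) / y - P y\<bar> < \<eta>"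
    using Stone_Weierstrass_real_polynomial_function[of "{exp (-5)..exp 5}" "\<lambda>y. h (ln y) / y" \<eta>] \<eta> by auto
  then obtain b n where Pb: "P = (\<lambda>x. \<Sum>i\<le>n. b i * x ^ i)" by (auto simp: real_polynomial_function_iff_sum)
  define q where "q x = (\<Sum>i\<le>n. b i * exp (real (Suc i) * x))" for x
  have qP: "q x = exp x * P (exp x)" for x
    unfolding q_def Pb sum_distrib_left by (intro sum.cong refl) (simp add: exp_of_nat_mult[symmetric] exp_add[symmetric] algebra_simps)
  have hq: "\<bar>h x - q x\<bar> \<le> \<eta> * exp 5" if "x \<in> ?I" for x
  proof -
    have "\<bar>h x / exp x - P (exp x)\<bar> < \<eta>" using P[of "exp x"] that by simp
    then have "exp x * \<bar>h x / exp x - P (exp x)\<bar> \<le> exp 5 * \<eta>" using that by (intro mult_mono) auto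
    moreover have "exp x * \<bar>h x / exp x - P (exp x)\<bar> = \<bar>exp x * (h x / exp x - P (exp x))\<bar>" by (simp add: abs_mult)
    moreover have "exp x * (h x / exp x - P (exp x)) = h x - q x" by (simp add: qP right_diff_distrib)
    ultimately show ?thesis by (simp add: mult.commute)
  qed
  define B where "B = 1 + (\<Sum>i\<le>n. \<bar>b i\<bar>)"
  have B: "B > 0" unfolding B_def by (intro add_pos_nonneg sum_nonneg) auto
  define \<delta> where "\<delta> = k * H / (2 * B)"
  have \<delta>: "\<delta> > 0" using k H B by (simp add: \<delta>_def)
  show ?thesis
  proof (intro exI conjI allI impI)
    show "\<delta> > 0" by (rule \<delta>)
    fix g assume sm: "small_moments (Suc n) \<delta> g"
    have lip: "\<And>x y. \<bar>g x - g y\<bar> \<le> 2 * \<bar>x - y\<bar>" and supp: "\<And>x. \<bar>x\<bar> \<ge> 4 \<Longrightarrow> g x = 0"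
      and mom: "\<And>j. 1 \<le> j \<Longrightarrow> j \<le> Suc n \<Longrightarrow> \<bar>integral ?I (\<lambda>x. g x * exp (real j * x))\<bar> \<le> \<delta>"
      using sm by (auto simp: small_moments_def)
    have gc: "continuous_on S g" for S
      by (rule lipschitz_on_continuous_on[of 2]) (auto intro!: lipschitz_onI simp: dist_real_def lip)
    have gb: "\<bar>g x\<bar> \<le> 18" if "x \<in> ?I" for x
    proof -
      have "\<bar>x - 4\<bar> \<le> 9" using that by (auto simp: abs_le_iff)
      then show ?thesis using lip[of x 4] supp[of 4] by simp
    qed
    have qc: "continuous_on S q" for S unfolding q_def by (intro continuous_intros)
    have i1: "(\<lambda>x. g x * h x) integrable_on ?I" by (intro integrable_continuous_real continuous_intros gc hc)
    have i2: "(\<lambda>x. g x * q x) integrable_on ?I" by (intro integrable_continuous_real continuous_intros gc qc)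
    have i3: "(\<lambda>x. g x0 * h x) integrable_on ?I" by (intro integrable_continuous_real continuous_intros hc)
    have i4: "(\<lambda>x. g x * exp (real j * x)) integrable_on ?I" for j by (intro integrable_continuous_real continuous_intros gc)
    have b1: "\<bar>integral ?I (\<lambda>x. g x0 * h x - g x * h x)\<bar> \<le> integral ?I (\<lambda>x. 2 * k * h x)"
      unfolding real_norm_def[symmetric]
    proof (rule integral_norm_bound_integral)
      fix x
      show "norm (g x0 * h x - g x * h x) \<le> 2 * k * h x"
      proof (cases "\<bar>x - x0\<bar> < k")
        case True
        have "norm (g x0 * h x - g x * h x) = \<bar>g x0 - g x\<bar> * h x" using h0[of x] by (simp add: left_diff_distrib[symmetric] abs_mult)
        also have "\<dots> \<le> 2 * k * h x"
        proof (rule mult_right_mono[OF _ h0])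
          have "\<bar>x0 - x\<bar> < k" using True by (simp add: abs_minus_commute)
          then show "\<bar>g x0 - g x\<bar> \<le> 2 * k" by (intro order_trans[OF lip]) simp
        qed
        finally show ?thesis .
      qed (simp add: h_def)
    qed (auto intro!: integrable_continuous_real continuous_intros hc gc)
    have b2: "\<bar>integral ?I (\<lambda>x. g x * h x - g x * q x)\<bar> \<le> integral ?I (\<lambda>x. 18 * (\<eta> * exp 5))"
      unfolding real_norm_def[symmetric]
    proof (rule integral_norm_bound_integral)
      fix x assume x: "x \<in> ?I"
      have "norm (g x * h x - g x * q x) = \<bar>g x\<bar> * \<bar>h x - q x\<bar>" by (simp add: right_diff_distrib[symmetric] abs_mult)
      also have "\<dots> \<le> 18 * (\<eta> * exp 5)" using gb[OF x] hq[OF x] by (intro mult_mono) auto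
      finally show "norm (g x * h x - g x * q x) \<le> 18 * (\<eta> * exp 5)" .
    qed (auto intro!: integrable_continuous_real continuous_intros hc gc qc)
    have b3: "\<bar>integral ?I (\<lambda>x. g x * q x)\<bar> \<le> k * H / 2"
    proof -
      have "integral ?I (\<lambda>x. g x * q x) = integral ?I (\<lambda>x. \<Sum>i\<le>n. b i * (g x * exp (real (Suc i) * x)))"
        by (intro integral_cong) (simp add: q_def sum_distrib_left mult.left_commute)
      also have "\<dots> = (\<Sum>i\<le>n. integral ?I (\<lambda>x. b i * (g x * exp (real (Suc i) * x))))"
        by (rule integral_sum) (auto intro!: integrable_continuous_real continuous_intros gc)
      also have "\<dots> = (\<Sum>i\<le>n. b i * integral ?I (\<lambda>x. g x * exp (real (Suc i) * x)))" by simp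
      finally have "\<bar>integral ?I (\<lambda>x. g x * q x)\<bar> \<le> (\<Sum>i\<le>n. \<bar>b i * integral ?I (\<lambda>x. g x * exp (real (Suc i) * x))\<bar>)" by simp
      also have "\<dots> \<le> (\<Sum>i\<le>n. \<bar>b i\<bar> * \<delta>)" unfolding abs_mult by (intro sum_mono mult_left_mono mom) auto
      also have "\<dots> \<le> B * \<delta>" using \<delta> by (simp add: B_def sum_distrib_right[symmetric] distrib_right)
      also have "\<dots> = k * H / 2" using B by (simp add: \<delta>_def)
      finally show ?thesis .
    qed
    have "g x0 * H = integral ?I (\<lambda>x. g x0 * h x)" by (simp add: H_def)
    also have "\<dots> = integral ?I (\<lambda>x. g x0 * h x - g x * h x) + integral ?I (\<lambda>x. g x * h x - g x * q x) + integral ?I (\<lambda>x. g x * q x)"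
      by (simp add: integral_diff[OF i3 i1] integral_diff[OF i1 i2])
    finally have "\<bar>g x0 * H\<bar> \<le> 2 * k * H + 10 * (18 * (\<eta> * exp 5)) + k * H / 2"
      using b1 b2 b3 by (simp add: H_def)
    also have "10 * (18 * (\<eta> * exp 5)) = k * H / 2" by (simp add: \<eta>_def)
    finally have "\<bar>g x0\<bar> * H \<le> 3 * k * H" using H by (simp add: abs_mult)
    then show "\<bar>g x0\<bar> \<le> 3 * k" using H by (simp add: mult_le_cancel_right)
  qed
qed

section \<open>Law of large numbers for the Plancherel measure\<close>

lemma ex_sum_ge:
  assumes p: "p \<in> young m" and j: "j < p i"
  shows "exp (z * (real j - real i)) \<le> ex_sum z p"
proof -
  have i: "i < m" using j young_zero[OF p, of i] by (cases "m \<le> i") auto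
  have "exp (z * (real j - real i)) \<le> (\<Sum>j<p i. exp (z * of_int (int j - int i)))"
    using member_le_sum[of j "{..<p i}" "\<lambda>j. exp (z * of_int (int j - int i))"] j by simp
  also have "\<dots> \<le> (\<Sum>i<m. \<Sum>j<p i. exp (z * of_int (int j - int i)))"
    using i by (intro member_le_sum[of i "{..<m}" "\<lambda>i. \<Sum>j<p i. exp (z * of_int (int j - int i))"]) (auto intro: sum_nonneg)
  also have "\<dots> = ex_sum z p" unfolding ex_sum_def using young_zero[OF p] by (intro box_sum_eq[symmetric]) auto
  finally show ?thesis .
qed

lemma planch_cmult: "planch m (\<lambda>p. a * H p) = a * planch m H"
  by (simp add: planch_def sum_distrib_left mult.left_commute)

text \<open>Exponential Markov inequality: the last box of a long first row alone makes
  \<open>ex_sum z\<close> at least \<open>exp (z y)\<close>. The factor \<open>sh2 z\<close> is kept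
  because the exact mean comes with it.\<close>

lemma planch_tail_row:
  assumes "z > 0" "y \<ge> 0"
  shows "sh2 z * planch m (indicator {p. real (p 0) \<ge> y + 1}) \<le> fact m * exp (2 * sqrt (real m * sh2 z) - z * y)"
proof -
  have "planch m (indicator {p. real (p 0) \<ge> y + 1}) \<le> planch m (\<lambda>p. exp (- z * y) * ex_sum z p)"
  proof (rule planch_mono)
    fix p assume p: "p \<in> young m"
    show "indicator {p. real (p 0) \<ge> y + 1} p \<le> exp (- z * y) * ex_sum z p"
    proof (cases "real (p 0) \<ge> y + 1")
      case True
      have "exp (z * y) \<le> exp (z * (real (p 0 - 1) - real 0))"
        using True assms by (simp add: of_nat_diff)
      also have "\<dots> \<le> ex_sum z p" using True assms by (intro ex_sum_ge[OF p]) auto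
      finally have "exp (- z * y) * exp (z * y) \<le> exp (- z * y) * ex_sum z p" by (intro mult_left_mono) auto
      then show ?thesis using True by (simp add: exp_add[symmetric])
    qed (simp add: ex_sum_def box_sum_def sum_nonneg)
  qed
  also have "\<dots> = exp (- z * y) * planch m (ex_sum z)" by (rule planch_cmult)
  finally have "sh2 z * planch m (indicator {p. real (p 0) \<ge> y + 1}) \<le> exp (- z * y) * (sh2 z * planch m (ex_sum z))"
    using mult_left_mono[OF _ sh2_nonneg[of z]] by (simp add: mult.left_commute)
  also have "\<dots> \<le> exp (- z * y) * (fact m * exp (2 * sqrt (real m * sh2 z)))"
    using planch_ex_sum_bound by (intro mult_left_mono) auto
  finally show ?thesis by (simp add: exp_diff exp_minus field_simps)
qed

lemma sh2_minus: "sh2 (- z) = sh2 z" by (simp add: sh2_def)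

lemma planch_tail_col:
  assumes "z > 0"
  shows "sh2 z * planch m (indicator {p. \<exists>i. real i \<ge> y \<and> p i \<noteq> 0}) \<le> fact m * exp (2 * sqrt (real m * sh2 z) - z * y)"
proof -
  have "planch m (indicator {p. \<exists>i. real i \<ge> y \<and> p i \<noteq> 0}) \<le> planch m (\<lambda>p. exp (- z * y) * ex_sum (- z) p)"
  proof (rule planch_mono)
    fix p assume p: "p \<in> young m"
    show "indicator {p. \<exists>i. real i \<ge> y \<and> p i \<noteq> 0} p \<le> exp (- z * y) * ex_sum (- z) p"
    proof (cases "\<exists>i. real i \<ge> y \<and> p i \<noteq> 0")
      case True
      then obtain i where i: "real i \<ge> y" "p i \<noteq> 0" by auto
      have "exp (z * y) \<le> exp (- z * (real 0 - real i))"
        using i assms by simp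
      also have "\<dots> \<le> ex_sum (- z) p" using i by (intro ex_sum_ge[OF p]) auto
      finally have "exp (- z * y) * exp (z * y) \<le> exp (- z * y) * ex_sum (- z) p" by (intro mult_left_mono) auto
      then show ?thesis using True by (simp add: exp_add[symmetric])
    qed (simp add: ex_sum_def box_sum_def sum_nonneg)
  qed
  also have "\<dots> = exp (- z * y) * planch m (ex_sum (- z))" by (rule planch_cmult)
  finally have "sh2 z * planch m (indicator {p. \<exists>i. real i \<ge> y \<and> p i \<noteq> 0}) \<le> exp (- z * y) * (sh2 (- z) * planch m (ex_sum (- z)))"
    using mult_left_mono[OF _ sh2_nonneg[of z]] by (simp add: mult.left_commute sh2_minus)
  also have "\<dots> \<le> exp (- z * y) * (fact m * exp (2 * sqrt (real m * sh2 (- z))))"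
    using planch_ex_sum_bound by (intro mult_left_mono) auto
  finally show ?thesis by (simp add: exp_diff exp_minus field_simps sh2_minus)
qed

definition outlier :: "real \<Rightarrow> (nat \<Rightarrow> nat) \<Rightarrow> bool" where
  "outlier y p \<longleftrightarrow> real (p 0) > y \<or> (\<exists>i. real i \<ge> y \<and> p i \<noteq> 0)"

text \<open>The Chernoff exponent is \<open>2 sqrt (m sh2 z) - z y\<close>, and
  \<open>sqrt (sh2 z)\<close> is asymptotic to \<open>z\<close> at 0, so every \<open>y\<close>
  beyond \<open>2 sqrt m\<close> is reached with a fixed small \<open>z\<close>. Half of the
  resulting rate is spent on the constant \<open>K\<close>.\<close>

lemma planch_outlier:
  assumes "\<epsilon> > 0"
  obtains c where "c > 0" "eventually (\<lambda>m. planch m (indicator {p. outlier ((2 + \<epsilon>) * sqrt (real m)) p}) \<le> fact m * exp (- c * sqrt (real m))) sequentially"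
proof -
  have "((\<lambda>z::real. 2 * (exp (z / 2) - exp (- z / 2)) / z) \<longlongrightarrow> 2) (at_right 0)" by real_asymp
  then have "eventually (\<lambda>z::real. 2 * (exp (z / 2) - exp (- z / 2)) / z < 2 + \<epsilon> / 2) (at_right 0)"
    using assms by (intro order_tendstoD(2)) auto
  then have "eventually (\<lambda>z::real. z > 0 \<and> 2 * (exp (z / 2) - exp (- z / 2)) / z < 2 + \<epsilon> / 2) (at_right 0)"
    using eventually_at_right_less[of "0::real"] by eventually_elim auto
  then obtain z :: real where z: "z > 0" "2 * (exp (z / 2) - exp (- z / 2)) / z < 2 + \<epsilon> / 2"
    using eventually_happens'[OF trivial_limit_at_right_real] by blast
  have z2: "2 * (exp (z / 2) - exp (- z / 2)) \<le> (2 + \<epsilon> / 2) * z" using z by (simp add: field_simps)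
  have s: "sh2 z > 0" using z by (simp add: sh2_eq)
  have sq: "sqrt (real m * sh2 z) = sqrt (real m) * (exp (z / 2) - exp (- z / 2))" for m
    using z by (simp add: sh2_eq real_sqrt_mult)
  define K where "K = (exp z + 1) / sh2 z"
  define c where "c = \<epsilon> * z / 4"
  have c: "c > 0" using assms z by (simp add: c_def)
  have "eventually (\<lambda>m. 1 \<le> (2 + \<epsilon>) * sqrt (real m)) sequentially" using assms by real_asymp
  moreover have "eventually (\<lambda>m. K \<le> exp (c * sqrt (real m))) sequentially" using c by real_asymp
  ultimately have "eventually (\<lambda>m. planch m (indicator {p. outlier ((2 + \<epsilon>) * sqrt (real m)) p}) \<le> fact m * exp (- c * sqrt (real m))) sequentially"
  proof eventually_elim
    case (elim m)
    define y where "y = (2 + \<epsilon>) * sqrt (real m)"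
    have "planch m (indicator {p. outlier y p}) \<le> planch m (\<lambda>p. indicator {p. real (p 0) \<ge> (y - 1) + 1} p + indicator {p. \<exists>i. real i \<ge> y \<and> p i \<noteq> 0} p)"
      by (rule planch_mono) (auto simp: outlier_def indicator_def)
    also have "\<dots> = planch m (indicator {p. real (p 0) \<ge> (y - 1) + 1}) + planch m (indicator {p. \<exists>i. real i \<ge> y \<and> p i \<noteq> 0})"
      by (simp add: planch_def sum.distrib distrib_left)
    finally have "sh2 z * planch m (indicator {p. outlier y p}) \<le> sh2 z * planch m (indicator {p. real (p 0) \<ge> (y - 1) + 1}) + sh2 z * planch m (indicator {p. \<exists>i. real i \<ge> y \<and> p i \<noteq> 0})"
      using s by (simp add: distrib_left[symmetric])
    also have "\<dots> \<le> fact m * exp (2 * sqrt (real m * sh2 z) - z * (y - 1)) + fact m * exp (2 * sqrt (real m * sh2 z) - z * y)"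
      using elim(1) z by (intro add_mono planch_tail_row planch_tail_col) (auto simp: y_def)
    also have "\<dots> = fact m * ((exp z + 1) * exp (2 * sqrt (real m * sh2 z) - z * y))"
      by (simp add: algebra_simps exp_diff exp_add add_divide_distrib)
    also have "\<dots> \<le> fact m * ((exp z + 1) * exp (- (2 * c) * sqrt (real m)))"
    proof -
      have "2 * sqrt (real m * sh2 z) - z * y \<le> sqrt (real m) * ((2 + \<epsilon> / 2) * z) - z * y"
        unfolding sq using mult_left_mono[OF z2, of "sqrt (real m)"] by (simp add: algebra_simps)
      also have "\<dots> = - (2 * c) * sqrt (real m)" by (simp add: y_def c_def algebra_simps)
      finally show ?thesis by (intro mult_left_mono) auto
    qed
    finally have "planch m (indicator {p. outlier y p}) \<le> fact m * (K * exp (- (2 * c) * sqrt (real m)))"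
      using s by (simp add: K_def field_simps)
    also have "K * exp (- (2 * c) * sqrt (real m)) \<le> exp (c * sqrt (real m)) * exp (- (2 * c) * sqrt (real m))"
      using elim(2) by (intro mult_right_mono) auto
    also have "\<dots> = exp (- c * sqrt (real m))" by (simp add: exp_add[symmetric])
    finally show ?case by (simp add: y_def)
  qed
  then show ?thesis using that c by blast
qed

text \<open>Since \<open>m * sh2 (a / sqrt m)\<close> tends to the square of \<open>a\<close>, the
  \<open>k\<close>-th term tends to the Bessel term. Tannery's theorem applies with the exponential
  series of a slightly larger constant as dominating series.\<close>

lemma laguerre_tendsto_bessel:
  assumes a: "a > 0"
  shows "(\<lambda>m. \<Sum>k\<le>m. real (m choose k) * sh2 (a / sqrt (real m)) ^ k / fact k) \<longlonglongrightarrow> bessel a"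
proof -
  define s where "s m = sh2 (a / sqrt (real m))" for m :: nat
  have ms: "(\<lambda>m. real m * s m) \<longlonglongrightarrow> a\<^sup>2"
    unfolding s_def sh2_def power2_eq_square using a by real_asymp
  have s0: "s m \<ge> 0" for m by (simp add: s_def sh2_nonneg)
  define t where "t k m = real (m choose k) * s m ^ k / fact k" for k m
  have lim: "(\<lambda>m. t k m) \<longlonglongrightarrow> (a ^ k / fact k)\<^sup>2" for k
  proof -
    have "(\<lambda>m. \<Prod>i<k. (real m - real i) / real m / real (Suc i)) \<longlonglongrightarrow> (\<Prod>i<k. 1 / real (Suc i))"
    proof (intro tendsto_prod tendsto_divide tendsto_const)
      fix i show "(\<lambda>m. (real m - real i) / real m) \<longlonglongrightarrow> 1" by real_asymp
    qed simp
    also have "(\<Prod>i<k. 1 / real (Suc i)) = 1 / fact k"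
      by (simp add: prod_dividef fact_prod_Suc atLeast0LessThan)
    finally have 1: "(\<lambda>m. \<Prod>i<k. (real m - real i) / real m / real (Suc i)) \<longlonglongrightarrow> 1 / fact k" .
    have l1: "(\<lambda>m. (\<Prod>i<k. (real m - real i) / real m / real (Suc i)) * (real m * s m) ^ k / fact k) \<longlonglongrightarrow> 1 / fact k * (a\<^sup>2) ^ k / fact k"
      by (intro tendsto_intros 1 ms) auto
    have l2: "1 / fact k * (a\<^sup>2) ^ k / fact k = (a ^ k / fact k)\<^sup>2"
    proof -
      have "(a\<^sup>2) ^ k = (a ^ k)\<^sup>2" by (metis power_mult mult.commute)
      then show ?thesis by (simp add: power_divide power2_eq_square[of "fact k"])
    qed
    have l3: "eventually (\<lambda>m. (\<Prod>i<k. (real m - real i) / real m / real (Suc i)) * (real m * s m) ^ k / fact k = t k m) sequentially"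
      using eventually_ge_at_top[of "max 1 k"]
    proof eventually_elim
      case (elim m)
      have "real (m choose k) = (\<Prod>i<k. real (m - i) / real (k - i))"
        using binomial_altdef_of_nat[of k m, where 'a = real] elim by (simp add: atLeast0LessThan)
      also have "\<dots> = (\<Prod>i<k. real m - real i) / (\<Prod>i<k. real (k - i))"
        using elim by (auto simp: prod_dividef of_nat_diff intro!: arg_cong2[where f = "(/)"] prod.cong)
      also have "(\<Prod>i<k. real (k - i)) = (\<Prod>i<k. real (Suc i))"
        by (rule prod.reindex_bij_witness[of _ "\<lambda>i. k - Suc i" "\<lambda>i. k - Suc i"]) auto
      also have "(\<Prod>i<k. real m - real i) / (\<Prod>i<k. real (Suc i)) = (\<Prod>i<k. (real m - real i) / real m / real (Suc i)) * real m ^ k"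
        using elim by (simp add: prod_dividef prod.distrib)
      finally show ?case by (simp add: t_def power_mult_distrib)
    qed
    show ?thesis using Lim_transform_eventually[OF l1 l3] by (simp only: l2)
  qed
  define C where "C = a\<^sup>2 + 1"
  have evC: "eventually (\<lambda>m. real m * s m \<le> C) sequentially"
    using order_tendstoD(2)[OF ms, of C] by (auto simp: C_def elim: eventually_mono)
  have pw: "norm (t k m) \<le> inverse (fact k) * C ^ k" if C: "real m * s m \<le> C" for k m
  proof -
    have "real (m choose k) * fact k \<le> real m ^ k"
    proof -
      have "fact k * (m choose k) \<le> m ^ k" by (rule binomial_fact_pow[THEN order_trans[OF eq_refl[OF mult.commute]]])
      then have "real (fact k * (m choose k)) \<le> real (m ^ k)" by (simp only: of_nat_le_iff)
      then show ?thesis by (simp add: mult.commute)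
    qed
    moreover have "real (m choose k) * 1 \<le> real (m choose k) * fact k" by (intro mult_left_mono) (auto simp: fact_ge_1)
    ultimately have "real (m choose k) \<le> real m ^ k" by linarith
    then have "real (m choose k) * s m ^ k \<le> real m ^ k * s m ^ k" using s0 by (intro mult_right_mono) auto
    also have "\<dots> \<le> C ^ k" unfolding power_mult_distrib[symmetric] using C s0 by (intro power_mono) auto
    finally show ?thesis
      using s0 by (simp add: t_def divide_inverse mult.commute)
  qed
  have bnd: "eventually (\<lambda>(k, m). norm (t k m) \<le> inverse (fact k) * C ^ k) (at_top \<times>\<^sub>F sequentially)"
    unfolding eventually_prod_filter
    by (rule exI[of _ "\<lambda>_. True"], rule exI[of _ "\<lambda>m. real m * s m \<le> C"]) (use evC pw in auto)
  have "(\<lambda>m. \<Sum>k. t k m) \<longlonglongrightarrow> (\<Sum>k. (a ^ k / fact k)\<^sup>2)"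
    using tannerys_theorem[OF lim bnd summable_exp] by simp
  moreover have "(\<Sum>k. t k m) = (\<Sum>k\<le>m. t k m)" for m
    by (rule suminf_finite) (auto simp: t_def binomial_eq_0)
  ultimately show ?thesis by (simp add: bessel_def t_def s_def)
qed

text \<open>Half of the exponential moment of the limit shape minus the absolute value; it is also
  the limiting mean of \<open>ex_sum / m\<close>, and this agreement identifies the limit
  shape.\<close>

definition shape_moment :: "real \<Rightarrow> real" where
  "shape_moment a = (bessel a - 1) / a\<^sup>2"

lemma mean_ex_sum_tendsto:
  assumes a: "a > 0"
  shows "(\<lambda>m. planch m (ex_sum (a / sqrt (real m))) / (fact m * real m)) \<longlonglongrightarrow> shape_moment a"
proof -
  let ?E = "\<lambda>m. \<Sum>k\<le>m. real (m choose k) * sh2 (a / sqrt (real m)) ^ k / fact k"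
  have ms: "(\<lambda>m. real m * sh2 (a / sqrt (real m))) \<longlonglongrightarrow> a\<^sup>2"
    unfolding sh2_def power2_eq_square using a by real_asymp
  have "(\<lambda>m. (?E m - 1) / (real m * sh2 (a / sqrt (real m)))) \<longlonglongrightarrow> (bessel a - 1) / a\<^sup>2"
    using a by (intro tendsto_intros laguerre_tendsto_bessel ms) auto
  moreover have "eventually (\<lambda>m. (?E m - 1) / (real m * sh2 (a / sqrt (real m))) = planch m (ex_sum (a / sqrt (real m))) / (fact m * real m)) sequentially"
    using eventually_gt_at_top[of 0]
  proof eventually_elim
    case (elim m)
    have "exp (a / sqrt (real m) / 2) > exp (- (a / sqrt (real m)) / 2)" using a elim by simp
    then have "exp (a / sqrt (real m) / 2) - exp (- (a / sqrt (real m)) / 2) \<noteq> 0" by linarith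
    then have s: "sh2 (a / sqrt (real m)) \<noteq> 0" unfolding sh2_eq power_eq_0_iff by blast
    have "sh2 (a / sqrt (real m)) * planch m (ex_sum (a / sqrt (real m))) = fact m * (?E m - 1)"
      using planch_ex_sum[of m "a / sqrt (real m)"] by (simp add: right_diff_distrib)
    then have "planch m (ex_sum (a / sqrt (real m))) = fact m * (?E m - 1) / sh2 (a / sqrt (real m))"
      using s by (simp add: field_simps)
    then show ?case by simp
  qed
  ultimately show ?thesis unfolding shape_moment_def by (rule Lim_transform_eventually)
qed

lemma planch_cauchy_schwarz:
  "(planch m (\<lambda>p. G p * H p))\<^sup>2 \<le> planch m (\<lambda>p. (G p)\<^sup>2) * planch m (\<lambda>p. (H p)\<^sup>2)"
  using Cauchy_Schwarz_ineq_sum[of "\<lambda>p. fdim p * G p" "\<lambda>p. fdim p * H p" "young m"]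
  by (simp add: planch_def power_mult_distrib power2_eq_square mult.assoc mult.left_commute)

text \<open>Cauchy-Schwarz over the \<open>m\<close> boxes bounds the square by the same statistic
  at \<open>2 z\<close>, whose Plancherel mean is again explicit.\<close>

lemma ex_sum_sq_le:
  assumes p: "p \<in> young m"
  shows "(ex_sum z p)\<^sup>2 \<le> real m * ex_sum (2 * z) p"
proof -
  let ?S = "SIGMA i:{..<m}. {..<p i}"
  have e: "ex_sum w p = (\<Sum>(i, j)\<in>?S. exp (w * of_int (int j - int i)))" for w
    unfolding ex_sum_def by (subst box_sum_eq[of m]) (auto simp: young_zero[OF p] sum.Sigma)
  have c: "card ?S = m" using p by (simp add: young_def)
  have "(\<Sum>b\<in>?S. 1 * exp (z * of_int (int (snd b) - int (fst b))))\<^sup>2 \<le> (\<Sum>b\<in>?S. 1\<^sup>2) * (\<Sum>b\<in>?S. (exp (z * of_int (int (snd b) - int (fst b))))\<^sup>2)"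
    by (rule Cauchy_Schwarz_ineq_sum)
  then show ?thesis unfolding e using c
    by (simp add: case_prod_unfold power2_eq_square exp_add[symmetric] algebra_simps)
qed

text \<open>Diagrams at L1 distance \<open>D\<close> between rows differ in \<open>D\<close> boxes,
  and within the box of side \<open>d\<close> every content is at most \<open>d\<close>.\<close>

lemma ex_sum_diff_le:
  assumes p: "p \<in> boxed m d" and q: "q \<in> boxed m d" and z: "z \<ge> 0"
  shows "\<bar>ex_sum z p - ex_sum z q\<bar> \<le> (\<Sum>i<d. \<bar>real (p i) - real (q i)\<bar>) * exp (z * real d)"
proof -
  have pY: "p \<in> young m" "q \<in> young m" using p q by (auto simp: boxed_def)
  have zero: "p i = 0" "q i = 0" if "d \<le> i" for i
    using that p q young_antimono[OF pY(1), of d i] young_antimono[OF pY(2), of d i] by (auto simp: boxed_def)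
  have le: "p i \<le> d" "q i \<le> d" for i
    using p q young_antimono[OF pY(1), of 0 i] young_antimono[OF pY(2), of 0 i] by (auto simp: boxed_def)
  have row: "\<bar>(\<Sum>j<b. exp (z * of_int (int j - int i))) - (\<Sum>j<c. exp (z * of_int (int j - int i)))\<bar> \<le> (real b - real c) * exp (z * real d)"
    if "c \<le> b" "b \<le> d" for b c i :: nat
  proof -
    have "(\<Sum>j<b. exp (z * of_int (int j - int i))) - (\<Sum>j<c. exp (z * of_int (int j - int i))) = (\<Sum>j\<in>{c..<b}. exp (z * of_int (int j - int i)))"
      using sum_diff_nat_ivl[of 0 c b "\<lambda>j. exp (z * of_int (int j - int i))"] that by (simp add: atLeast0LessThan)
    moreover have "(\<Sum>j\<in>{c..<b}. exp (z * of_int (int j - int i))) \<le> (\<Sum>j\<in>{c..<b}. exp (z * real d))"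
      using that z by (intro sum_mono) (auto intro!: mult_left_mono)
    moreover have "(\<Sum>j\<in>{c..<b}. exp (z * of_int (int j - int i))) \<ge> 0" by (intro sum_nonneg) auto
    ultimately show ?thesis using that by (simp add: of_nat_diff)
  qed
  have "\<bar>ex_sum z p - ex_sum z q\<bar> = \<bar>\<Sum>i<d. (\<Sum>j<p i. exp (z * of_int (int j - int i))) - (\<Sum>j<q i. exp (z * of_int (int j - int i)))\<bar>"
    unfolding ex_sum_def by (subst (1 2) box_sum_eq[of d]) (auto simp: zero sum_subtractf)
  also have "\<dots> \<le> (\<Sum>i<d. \<bar>real (p i) - real (q i)\<bar> * exp (z * real d))"
  proof (rule order_trans[OF sum_abs], rule sum_mono)
    fix i
    show "\<bar>(\<Sum>j<p i. exp (z * of_int (int j - int i))) - (\<Sum>j<q i. exp (z * of_int (int j - int i)))\<bar> \<le> \<bar>real (p i) - real (q i)\<bar> * exp (z * real d)"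
      using row[of "q i" "p i" i] row[of "p i" "q i" i] le[of i]
      by (cases "q i \<le> p i") (auto simp: abs_minus_commute)
  qed
  finally show ?thesis by (simp add: sum_distrib_right)
qed

lemma planch_union:
  assumes "\<And>p. p \<in> young m \<Longrightarrow> p \<in> A \<Longrightarrow> p \<in> B \<or> p \<in> C"
  shows "planch m (indicator A) \<le> planch m (indicator B) + planch m (indicator C)"
proof -
  have "planch m (indicator A) \<le> planch m (\<lambda>p. indicator B p + indicator C p)"
    by (rule planch_mono) (use assms in \<open>auto simp: indicator_def\<close>)
  then show ?thesis by (simp add: planch_def distrib_left sum.distrib)
qed

lemma eventually_sum_exp_sqrt:
  assumes "c > 0" "c' > 0"
  shows "eventually (\<lambda>m. exp (- c * sqrt (real m)) + exp (- c' * sqrt (real m)) \<le> exp (- (min c c' / 2) * sqrt (real m))) sequentially"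
proof -
  define b where "b = min c c'"
  have b: "b > 0" using assms by (simp add: b_def)
  have "eventually (\<lambda>m. 2 * exp (- b * sqrt (real m)) \<le> exp (- (b / 2) * sqrt (real m))) sequentially"
    using b by real_asymp
  then show ?thesis
  proof eventually_elim
    case (elim m)
    have "exp (- c * sqrt (real m)) \<le> exp (- b * sqrt (real m))" "exp (- c' * sqrt (real m)) \<le> exp (- b * sqrt (real m))"
      by (auto simp: b_def intro!: mult_right_mono)
    then show ?case using elim unfolding b_def by linarith
  qed
qed

definition dbox :: "nat \<Rightarrow> nat" where
  "dbox m = nat \<lceil>3 * sqrt (real m)\<rceil>"

lemma dbox_bounds: "3 * sqrt (real m) \<le> real (dbox m)" "real (dbox m) \<le> 3 * sqrt (real m) + 1"
  unfolding dbox_def by (auto simp: of_nat_nat ceiling_correct)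

lemma not_outlier_boxed:
  assumes "p \<in> young m" "\<not> outlier (3 * sqrt (real m)) p"
  shows "p \<in> boxed m (dbox m)"
  using assms dbox_bounds(1)[of m] unfolding outlier_def boxed_def
  by (auto simp: not_less)

text \<open>The number of partitions and \<open>conc_err\<close> contribute
  \<open>exp (O(sqrt m ln m))\<close>, while the concavity gain is of order \<open>m\<close>. The
  constant 128 comes from \<open>d \<le> 4 sqrt m\<close>.\<close>

lemma planch_far_small:
  assumes \<eta>: "\<eta> > 0"
  shows "eventually (\<lambda>m. 2 * (real (card (young m)))\<^sup>2 * exp (2 * conc_err (dbox m) - 2 * ((\<eta> * real m)\<^sup>2 / (16 * (real (dbox m))\<^sup>2))) \<le> exp (- 1 * sqrt (real m))) sequentially"
proof -
  have "eventually (\<lambda>m. ln 2 + 4 * (sqrt (real m) + 1) * ln (real m + 1)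
      + 2 * (2 * (4 * sqrt (real m)) * (1 + ln (4 * sqrt (real m))) + 2 * (4 * sqrt (real m)) * ln (3 * (4 * sqrt (real m))))
      - \<eta>\<^sup>2 / 128 * real m \<le> - 1 * sqrt (real m)) sequentially"
    using \<eta> by real_asymp
  then show ?thesis using eventually_ge_at_top[of 1]
  proof eventually_elim
    case (elim m)
    define r where "r = sqrt (real m)"
    define d where "d = real (dbox m)"
    have r1: "r \<ge> 1" using elim(2) by (simp add: r_def)
    have "3 * r \<le> d" "d \<le> 3 * r + 1" using dbox_bounds[of m] by (auto simp: d_def r_def)
    then have d: "3 * r \<le> d" "d \<le> 4 * r" "d \<ge> 1" using r1 by linarith+
    have err: "conc_err (dbox m) \<le> 2 * (4 * r) * (1 + ln (4 * r)) + 2 * (4 * r) * ln (3 * (4 * r))"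
      unfolding conc_err_def d_def[symmetric] using d r1
      by (intro add_mono mult_mono) (auto intro!: add_nonneg_nonneg)
    define s where "s = nat \<lceil>r\<rceil>"
    have s: "r \<le> real s" "real s \<le> r + 1" using r1 unfolding s_def by (auto simp: of_nat_nat ceiling_correct)
    have "real m = r * r" by (simp add: r_def)
    also have "\<dots> \<le> real s * real s" using s r1 by (intro mult_mono) auto
    finally have "m \<le> s * s" by (simp flip: of_nat_mult)
    then have card: "real (card (young m)) \<le> (real m + 1) ^ (2 * s)"
      using card_young_le[of m s] by (metis of_nat_1 of_nat_add of_nat_le_iff of_nat_power)
    have "(real (card (young m)))\<^sup>2 \<le> ((real m + 1) ^ (2 * s))\<^sup>2" using card by (intro power_mono) auto
    also have "\<dots> = (real m + 1) ^ (4 * s)" by (simp add: power_mult[symmetric])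
    also have "\<dots> = exp (real (4 * s) * ln (real m + 1))" by (subst exp_of_nat_mult) simp
    also have "\<dots> \<le> exp (4 * (r + 1) * ln (real m + 1))" using s by (auto intro!: mult_right_mono)
    finally have c2: "(real (card (young m)))\<^sup>2 \<le> exp (4 * (r + 1) * ln (real m + 1))" .
    have quad: "\<eta>\<^sup>2 / 128 * real m \<le> 2 * ((\<eta> * real m)\<^sup>2 / (16 * d\<^sup>2))"
    proof -
      have "d\<^sup>2 \<le> (4 * r)\<^sup>2" using d by (intro power_mono) auto
      also have "\<dots> = 16 * real m" by (simp add: power_mult_distrib r_def)
      finally have dd: "d\<^sup>2 \<le> 16 * real m" .
      have d0: "d\<^sup>2 > 0" using d by simp
      have "(\<eta> * real m)\<^sup>2 / (16 * (16 * real m)) \<le> (\<eta> * real m)\<^sup>2 / (16 * d\<^sup>2)"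
        using dd d0 elim(2) by (intro divide_left_mono) auto
      moreover have "2 * ((\<eta> * real m)\<^sup>2 / (16 * (16 * real m))) = \<eta>\<^sup>2 / 128 * real m"
        using elim(2) by (simp add: power_mult_distrib power2_eq_square)
      ultimately show ?thesis by linarith
    qed
    have "2 * (real (card (young m)))\<^sup>2 * exp (2 * conc_err (dbox m) - 2 * ((\<eta> * real m)\<^sup>2 / (16 * d\<^sup>2)))
      \<le> exp (ln 2) * exp (4 * (r + 1) * ln (real m + 1)) * exp (2 * (2 * (4 * r) * (1 + ln (4 * r)) + 2 * (4 * r) * ln (3 * (4 * r))) - \<eta>\<^sup>2 / 128 * real m)"
      using c2 err quad by (intro mult_mono) auto
    also have "\<dots> \<le> exp (- 1 * sqrt (real m))"
      unfolding exp_add[symmetric] using elim(1) by (simp add: r_def)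
    finally show ?case by (simp add: d_def)
  qed
qed

lemma ex_sum_nonneg: "ex_sum z p \<ge> 0"
  by (simp add: ex_sum_def box_sum_def sum_nonneg)

lemma ex_sum_boxed_le:
  assumes p: "p \<in> boxed m d" and z: "z \<ge> 0"
  shows "ex_sum z p \<le> real m * exp (z * real d)"
proof -
  have pY: "p \<in> young m" using p by (auto simp: boxed_def)
  have le: "p i \<le> d" for i using p young_antimono[OF pY, of 0 i] by (auto simp: boxed_def)
  have "ex_sum z p = (\<Sum>i<m. \<Sum>j<p i. exp (z * of_int (int j - int i)))"
    unfolding ex_sum_def by (rule box_sum_eq) (use young_zero[OF pY] in auto)
  also have "\<dots> \<le> (\<Sum>i<m. \<Sum>j<p i. exp (z * real d))"
  proof (intro sum_mono)
    fix i j assume "j \<in> {..<p i}"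
    then have "real_of_int (int j - int i) \<le> real d" using le[of i] by simp
    then show "exp (z * of_int (int j - int i)) \<le> exp (z * real d)" using z by (simp add: mult_left_mono)
  qed
  also have "\<dots> = real (\<Sum>i<m. p i) * exp (z * real d)" by (simp add: sum_distrib_right)
  also have "(\<Sum>i<m. p i) = m" using pY by (simp add: young_def)
  finally show ?thesis .
qed

text \<open>Since every typical diagram is close to one maximiser of \<open>fdim\<close>, the exponential statistic
  is nearly constant on typical diagrams, hence close to its (explicitly known) mean.\<close>

lemma ex_sum_concentrated:
  assumes a: "a > 0" and \<eta>: "\<eta> > 0"
  obtains c where "c > 0" "eventually (\<lambda>m. planch m (indicator {p. outlier (3 * sqrt (real m)) p \<or> \<bar>ex_sum (a / sqrt (real m)) p / real m - shape_moment a\<bar> > \<eta>}) \<le> fact m * exp (- c * sqrt (real m))) sequentially"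
proof -
  obtain c1 where c1: "c1 > 0" and tail: "eventually (\<lambda>m. planch m (indicator {p. outlier (3 * sqrt (real m)) p}) \<le> fact m * exp (- c1 * sqrt (real m))) sequentially"
    using planch_outlier[of 1] by auto
  \<comment> \<open>A unit of row distance changes \<open>ex_sum\<close> by at most
    \<open>exp (z d)\<close>, and \<open>z d \<le> 4 a\<close> inside the box, so distance
    \<open>\<eta>1 m\<close> changes it by at most \<open>\<eta> m / 4\<close>.\<close>
  define \<eta>1 where "\<eta>1 = \<eta> / 4 * exp (- (4 * a))"
  have \<eta>1: "\<eta>1 > 0" using \<eta> by (simp add: \<eta>1_def)
  define c where "c = min c1 1 / 2"
  have c: "c > 0" using c1 by (simp add: c_def)
  define M where "M = shape_moment (2 * a) + 1"
  have ev_mean: "eventually (\<lambda>m. \<bar>planch m (ex_sum (a / sqrt (real m))) / (fact m * real m) - shape_moment a\<bar> < \<eta> / 8) sequentially"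
    using mean_ex_sum_tendsto[OF a] \<eta> by (auto simp: tendsto_iff dist_real_def dest!: spec[of _ "\<eta> / 8"])
  have ev_mean2: "eventually (\<lambda>m. planch m (ex_sum (2 * a / sqrt (real m))) / (fact m * real m) \<le> M) sequentially"
    using order_tendstoD(2)[OF mean_ex_sum_tendsto[of "2 * a"], of M] a by (auto simp: M_def elim: eventually_mono)
  have ev_half: "eventually (\<lambda>m. exp (- c1 * sqrt (real m)) \<le> 1 / 2) sequentially" using c1 by real_asymp
  have ev_bad: "eventually (\<lambda>m. sqrt (\<bar>M\<bar> * exp (- c * sqrt (real m))) + exp (4 * a) * exp (- c * sqrt (real m)) \<le> \<eta> / 4) sequentially"
  proof -
    have "((\<lambda>m. exp (- c * sqrt (real m))) \<longlongrightarrow> 0) sequentially" using c by real_asymp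
    then have "((\<lambda>m. sqrt (\<bar>M\<bar> * exp (- c * sqrt (real m))) + exp (4 * a) * exp (- c * sqrt (real m))) \<longlongrightarrow> sqrt (\<bar>M\<bar> * 0) + exp (4 * a) * 0) sequentially"
      by (intro tendsto_intros)
    from order_tendstoD(2)[OF this, of "\<eta> / 4"] show ?thesis using \<eta> by (auto elim: eventually_mono)
  qed
  have "eventually (\<lambda>m. planch m (indicator {p. outlier (3 * sqrt (real m)) p \<or> \<bar>ex_sum (a / sqrt (real m)) p / real m - shape_moment a\<bar> > \<eta>}) \<le> fact m * exp (- c * sqrt (real m))) sequentially"
    using tail planch_far_small[OF \<eta>1] eventually_sum_exp_sqrt[OF c1 zero_less_one] ev_mean ev_mean2 ev_half ev_bad eventually_ge_at_top[of 1]
  proof eventually_elim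
    case (elim m)
    define z where "z = a / sqrt (real m)"
    define d where "d = dbox m"
    have m1: "sqrt (real m) \<ge> 1" using elim(8) by simp
    have m0: "real m > 0" using elim(8) by simp
    have z0: "z \<ge> 0" using a by (simp add: z_def)
    have "real d \<ge> 1" using dbox_bounds(1)[of m] m1 unfolding d_def by linarith
    then have d1: "d \<ge> 1" by simp
    have zd: "z * real d \<le> 4 * a"
    proof -
      have "real d \<le> 4 * sqrt (real m)" using dbox_bounds(2)[of m] m1 unfolding d_def by linarith
      then have "z * real d \<le> z * (4 * sqrt (real m))" using z0 by (intro mult_left_mono) auto
      then show ?thesis using m1 by (simp add: z_def)
    qed
    let ?out = "{p. outlier (3 * sqrt (real m)) p}"
    have mass: "planch m (indicator (boxed m d)) \<ge> fact m / 2"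
    proof -
      have "fact m = planch m (indicator UNIV)" using planch_one[of m] by (simp add: indicator_def)
      also have "\<dots> \<le> planch m (indicator (boxed m d)) + planch m (indicator ?out)"
        by (rule planch_union) (use not_outlier_boxed in \<open>auto simp: d_def\<close>)
      also have "planch m (indicator ?out) \<le> fact m * (1 / 2)"
        by (rule order_trans[OF elim(1) mult_left_mono[OF elim(6)]]) simp
      finally show ?thesis by simp
    qed
    obtain p0 where p0: "p0 \<in> boxed m d" and far0:
      "planch m (indicator {p \<in> boxed m d. (\<Sum>i<d. \<bar>real (p i) - real (p0 i)\<bar>) \<ge> \<eta>1 * real m})
      \<le> fact m * (2 * (real (card (young m)))\<^sup>2 * exp (2 * conc_err d - 2 * ((\<eta>1 * real m)\<^sup>2 / (16 * (real d)\<^sup>2))))"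
      using planch_concentrated[OF d1 mass, of \<eta>1] \<eta>1 by auto
    let ?far = "{p \<in> boxed m d. (\<Sum>i<d. \<bar>real (p i) - real (p0 i)\<bar>) \<ge> \<eta>1 * real m}"
    have far: "planch m (indicator ?far) \<le> fact m * exp (- 1 * sqrt (real m))"
      by (rule order_trans[OF far0 mult_left_mono[OF elim(2)[folded d_def]]]) simp
    define bad where "bad = ?out \<union> ?far"
    have "planch m (indicator bad) \<le> planch m (indicator ?out) + planch m (indicator ?far)"
      by (rule planch_union) (auto simp: bad_def)
    also have "\<dots> \<le> fact m * (exp (- c1 * sqrt (real m)) + exp (- 1 * sqrt (real m)))"
      unfolding distrib_left by (rule add_mono[OF elim(1) far])
    also have "\<dots> \<le> fact m * exp (- c * sqrt (real m))"
      using elim(3) by (intro mult_left_mono) (auto simp: c_def)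
    finally have Pbad: "planch m (indicator bad) \<le> fact m * exp (- c * sqrt (real m))" .
    have close: "\<bar>ex_sum z p - ex_sum z p0\<bar> \<le> \<eta> / 4 * real m" if p: "p \<in> young m" "p \<notin> bad" for p
    proof -
      have pb: "p \<in> boxed m d" using p not_outlier_boxed[of p m] by (auto simp: bad_def d_def)
      then have "(\<Sum>i<d. \<bar>real (p i) - real (p0 i)\<bar>) \<le> \<eta>1 * real m" using p by (auto simp: bad_def)
      then have "(\<Sum>i<d. \<bar>real (p i) - real (p0 i)\<bar>) * exp (z * real d) \<le> \<eta>1 * real m * exp (4 * a)"
        using zd \<eta>1 by (intro mult_mono) auto
      also have "\<dots> = \<eta> / 4 * real m" by (simp add: \<eta>1_def exp_minus)
      finally show ?thesis using ex_sum_diff_le[OF pb p0 z0] by linarith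
    qed
    have p0le: "ex_sum z p0 \<le> real m * exp (4 * a)"
    proof -
      have "real m * exp (z * real d) \<le> real m * exp (4 * a)" using zd by (intro mult_left_mono) auto
      then show ?thesis using ex_sum_boxed_le[OF p0 z0] by linarith
    qed
    \<comment> \<open>On bad diagrams \<open>ex_sum\<close> has no useful pointwise bound;
      Cauchy-Schwarz with its second moment keeps their contribution to the mean small.\<close>
    have bad1: "planch m (\<lambda>p. indicator bad p * ex_sum z p) \<le> fact m * real m * sqrt (\<bar>M\<bar> * exp (- c * sqrt (real m)))"
    proof -
      have "fact m * real m > 0" using m0 by simp
      then have "planch m (ex_sum (2 * a / sqrt (real m))) \<le> M * (fact m * real m)"
        using elim(5) by (simp only: pos_divide_le_eq)
      also have "\<dots> \<le> \<bar>M\<bar> * (fact m * real m)" by (intro mult_right_mono) auto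
      finally have s2: "planch m (ex_sum (2 * z)) \<le> \<bar>M\<bar> * (fact m * real m)" by (simp add: z_def)
      have "planch m (\<lambda>p. (ex_sum z p)\<^sup>2) \<le> planch m (\<lambda>p. real m * ex_sum (2 * z) p)"
        by (rule planch_mono) (rule ex_sum_sq_le)
      also have "\<dots> \<le> real m * (\<bar>M\<bar> * (fact m * real m))"
        unfolding planch_cmult by (intro mult_left_mono s2) simp
      finally have S2: "planch m (\<lambda>p. (ex_sum z p)\<^sup>2) \<le> real m * (\<bar>M\<bar> * (fact m * real m))" .
      have ind: "(\<lambda>p. (indicator bad p)\<^sup>2) = (indicator bad :: _ \<Rightarrow> real)" by (auto simp: indicator_def)
      have "(planch m (\<lambda>p. indicator bad p * ex_sum z p))\<^sup>2 \<le> planch m (indicator bad) * planch m (\<lambda>p. (ex_sum z p)\<^sup>2)"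
        using planch_cauchy_schwarz[of m "indicator bad" "ex_sum z"] unfolding ind .
      also have "\<dots> \<le> (fact m * exp (- c * sqrt (real m))) * (real m * (\<bar>M\<bar> * (fact m * real m)))"
        by (intro mult_mono Pbad S2 planch_nonneg) auto
      also have "\<dots> = (fact m * real m)\<^sup>2 * (\<bar>M\<bar> * exp (- c * sqrt (real m)))"
        by (simp add: power2_eq_square)
      finally have "(planch m (\<lambda>p. indicator bad p * ex_sum z p))\<^sup>2 \<le> (fact m * real m)\<^sup>2 * (\<bar>M\<bar> * exp (- c * sqrt (real m)))" .
      then have "planch m (\<lambda>p. indicator bad p * ex_sum z p) \<le> sqrt ((fact m * real m)\<^sup>2 * (\<bar>M\<bar> * exp (- c * sqrt (real m))))"
        by (rule real_le_rsqrt)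
      then show ?thesis by (simp add: real_sqrt_mult)
    qed
    have mean: "\<bar>planch m (ex_sum z) - fact m * ex_sum z p0\<bar> \<le> fact m * (\<eta> / 2 * real m)"
    proof -
      have "planch m (ex_sum z) - fact m * ex_sum z p0 = planch m (\<lambda>p. ex_sum z p - ex_sum z p0)"
        unfolding planch_one[symmetric] by (simp add: planch_def right_diff_distrib sum_subtractf sum_distrib_right)
      also have "\<bar>\<dots>\<bar> \<le> planch m (\<lambda>p. \<bar>ex_sum z p - ex_sum z p0\<bar>)"
        unfolding planch_def by (rule order_trans[OF sum_abs]) (simp add: abs_mult)
      also have "\<dots> \<le> planch m (\<lambda>p. \<eta> / 4 * real m * 1 + (indicator bad p * ex_sum z p + real m * exp (4 * a) * indicator bad p))"
      proof (rule planch_mono)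
        fix p assume p: "p \<in> young m"
        show "\<bar>ex_sum z p - ex_sum z p0\<bar> \<le> \<eta> / 4 * real m * 1 + (indicator bad p * ex_sum z p + real m * exp (4 * a) * indicator bad p)"
        proof (cases "p \<in> bad")
          case True
          have "\<bar>ex_sum z p - ex_sum z p0\<bar> \<le> ex_sum z p + real m * exp (4 * a)"
            using p0le ex_sum_nonneg[of z p] ex_sum_nonneg[of z p0] by linarith
          then show ?thesis using True \<eta> by (simp add: add_increasing)
        qed (use close[OF p] in simp)
      qed
      also have "\<dots> = \<eta> / 4 * real m * planch m (\<lambda>_. 1) + (planch m (\<lambda>p. indicator bad p * ex_sum z p) + real m * exp (4 * a) * planch m (indicator bad))"
        unfolding planch_cmult[symmetric] by (simp only: planch_def distrib_left sum.distrib)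
      also have "\<dots> \<le> \<eta> / 4 * real m * fact m + (fact m * real m * sqrt (\<bar>M\<bar> * exp (- c * sqrt (real m))) + real m * exp (4 * a) * (fact m * exp (- c * sqrt (real m))))"
        using bad1 Pbad \<eta> by (intro add_mono mult_left_mono) (auto simp: planch_one)
      also have "\<dots> = fact m * real m * (\<eta> / 4 + (sqrt (\<bar>M\<bar> * exp (- c * sqrt (real m))) + exp (4 * a) * exp (- c * sqrt (real m))))"
        by (simp add: algebra_simps)
      also have "\<dots> \<le> fact m * real m * (\<eta> / 4 + \<eta> / 4)"
        using elim(7) by (intro mult_left_mono add_mono) auto
      finally show ?thesis by (simp add: mult.commute mult.left_commute)
    qed
    have mean': "\<bar>planch m (ex_sum z) / (fact m * real m) - ex_sum z p0 / real m\<bar> \<le> \<eta> / 2"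
    proof -
      have "planch m (ex_sum z) / (fact m * real m) - ex_sum z p0 / real m = (planch m (ex_sum z) - fact m * ex_sum z p0) / (fact m * real m)"
        by (simp add: diff_divide_distrib)
      also have "\<bar>\<dots>\<bar> = \<bar>planch m (ex_sum z) - fact m * ex_sum z p0\<bar> / (fact m * real m)" by (simp add: abs_divide)
      also have "\<dots> \<le> fact m * (\<eta> / 2 * real m) / (fact m * real m)" using mean by (intro divide_right_mono) auto
      also have "\<dots> = \<eta> / 2" using m0 by simp
      finally show ?thesis .
    qed
    \<comment> \<open>Error budget for a good diagram: \<open>\<eta> / 4\<close> to the maximiser,
      \<open>\<eta> / 2\<close> from there to the mean, \<open>\<eta> / 8\<close> from the mean to
      its limit, together less than \<eta>.\<close>
    have incl: "p \<in> bad" if p: "p \<in> young m" and "outlier (3 * sqrt (real m)) p \<or> \<bar>ex_sum z p / real m - shape_moment a\<bar> > \<eta>" for p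
    proof (rule ccontr)
      assume nb: "p \<notin> bad"
      then have "\<bar>ex_sum z p / real m - shape_moment a\<bar> > \<eta>" using that by (auto simp: bad_def)
      moreover have "\<bar>ex_sum z p / real m - ex_sum z p0 / real m\<bar> \<le> \<eta> / 4"
        unfolding diff_divide_distrib[symmetric] abs_divide using close[OF p nb] m0 by (simp add: field_simps)
      ultimately show False using mean' elim(4) unfolding z_def[symmetric] using \<eta> by linarith
    qed
    have "planch m (indicator {p. outlier (3 * sqrt (real m)) p \<or> \<bar>ex_sum z p / real m - shape_moment a\<bar> > \<eta>}) \<le> planch m (indicator bad)"
      by (rule planch_mono) (use incl in \<open>auto simp: indicator_def\<close>)
    then show ?case using Pbad by (simp add: z_def)
  qed
  then show ?thesis using that c by blast
qed

lemma small_moments_mono: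
  assumes sm: "small_moments J' \<delta>' g" and le: "J \<le> J'" "\<delta>' \<le> \<delta>"
  shows "small_moments J \<delta> g"
proof -
  have "\<bar>integral {-5..5} (\<lambda>x. g x * exp (real j * x))\<bar> \<le> \<delta>" if "j \<in> {1..J}" for j
  proof -
    have "j \<in> {1..J'}" using that le(1) by simp
    then have "\<bar>integral {-5..5} (\<lambda>x. g x * exp (real j * x))\<bar> \<le> \<delta>'" using sm unfolding small_moments_def by blast
    then show ?thesis using le(2) by linarith
  qed
  then show ?thesis using sm unfolding small_moments_def by blast
qed

text \<open>Finitely many points at spacing \<open>k\<close> suffice: \<open>3 k\<close> at the
  nearest one and \<open>2 k\<close> from the Lipschitz bound add up to \<open>5 k\<close>.\<close>

lemma exp_moments_determine:
  assumes \<epsilon>: "\<epsilon> > 0"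
  shows "\<exists>J \<delta>. \<delta> > 0 \<and> (\<forall>g. small_moments J \<delta> g \<longrightarrow> (\<forall>x. \<bar>g x\<bar> \<le> \<epsilon>))"
proof -
  define k where "k = min 1 (\<epsilon> / 5)"
  have k: "0 < k" "k \<le> 1" "5 * k \<le> \<epsilon>" using \<epsilon> by (auto simp: k_def)
  have fin: "\<exists>J \<delta>. \<delta> > 0 \<and> (\<forall>g. small_moments J \<delta> g \<longrightarrow> (\<forall>x0\<in>X. \<bar>g x0\<bar> \<le> 3 * k))" if "finite X" "X \<subseteq> {-4..4}" for X
    using that
  proof (induction X rule: finite_induct)
    case empty
    show ?case by (rule exI[of _ 0], rule exI[of _ 1]) simp
  next
    case (insert x X)
    then have "X \<subseteq> {-4..4}" by simp
    from insert.IH[OF this] obtain J1 \<delta>1 where 1: "\<delta>1 > 0" "\<And>g. small_moments J1 \<delta>1 g \<Longrightarrow> \<forall>x0\<in>X. \<bar>g x0\<bar> \<le> 3 * k" by blast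
    have "\<bar>x\<bar> \<le> 4" using insert.prems by auto
    from exp_moments_determine_point[OF this k(1,2)]
    obtain J2 \<delta>2 where 2: "\<delta>2 > 0" "\<And>g. small_moments J2 \<delta>2 g \<Longrightarrow> \<bar>g x\<bar> \<le> 3 * k" by blast
    have 3: "small_moments J1 \<delta>1 g \<and> small_moments J2 \<delta>2 g" if "small_moments (max J1 J2) (min \<delta>1 \<delta>2) g" for g
      using small_moments_mono[OF that] by simp
    show ?case
    proof (rule exI[of _ "max J1 J2"], rule exI[of _ "min \<delta>1 \<delta>2"], intro conjI allI impI)
      show "min \<delta>1 \<delta>2 > 0" using 1(1) 2(1) by simp
      fix g assume "small_moments (max J1 J2) (min \<delta>1 \<delta>2) g"
      from 3[OF this] show "\<forall>x0\<in>insert x X. \<bar>g x0\<bar> \<le> 3 * k" using 1(2) 2(2) by blast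
    qed
  qed
  define N where "N = nat \<lceil>8 / k\<rceil>"
  define X where "X = (\<lambda>i. - 4 + real i * k) ` {i. i \<le> N \<and> - 4 + real i * k \<le> 4}"
  have "finite X" unfolding X_def by (rule finite_imageI, rule finite_subset[of _ "{..N}"]) auto
  moreover have "X \<subseteq> {-4..4}" using k by (auto simp: X_def)
  ultimately obtain J \<delta> where J: "\<delta> > 0" "\<And>g. small_moments J \<delta> g \<Longrightarrow> \<forall>x0\<in>X. \<bar>g x0\<bar> \<le> 3 * k" using fin by blast
  have net: "\<exists>x0\<in>X. \<bar>x - x0\<bar> \<le> k" if "\<bar>x\<bar> \<le> 4" for x
  proof -
    define i where "i = nat \<lfloor>(x + 4) / k\<rfloor>"
    have nn: "(x + 4) / k \<ge> 0" using that k by (auto simp: divide_nonneg_pos)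
    have i: "real i \<le> (x + 4) / k" "(x + 4) / k < real i + 1" using nn unfolding i_def by linarith+
    have i1: "real i * k \<le> x + 4" "x + 4 < real i * k + k" using i k by (simp_all add: field_simps)
    have "real i \<le> 8 / k" using i(1) that k by (intro order_trans[OF i(1)] divide_right_mono) auto
    then have "i \<le> N" unfolding N_def by linarith
    moreover have "- 4 + real i * k \<le> 4" using i1 that by linarith
    ultimately have "- 4 + real i * k \<in> X" by (auto simp: X_def)
    moreover have "\<bar>x - (- 4 + real i * k)\<bar> \<le> k" using i1 by linarith
    ultimately show ?thesis by blast
  qed
  show ?thesis
  proof (intro exI conjI allI impI)
    show "\<delta> > 0" by (rule J(1))
    fix g x assume gd: "small_moments J \<delta> g"
    have g: "\<And>x y. \<bar>g x - g y\<bar> \<le> 2 * \<bar>x - y\<bar>" "\<And>x. \<bar>x\<bar> \<ge> 4 \<Longrightarrow> g x = 0"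
      using gd by (auto simp: small_moments_def)
    show "\<bar>g x\<bar> \<le> \<epsilon>"
    proof (cases "\<bar>x\<bar> \<le> 4")
      case True
      then obtain x0 where x0: "x0 \<in> X" "\<bar>x - x0\<bar> \<le> k" using net by blast
      have a: "\<bar>g x0\<bar> \<le> 3 * k" using J(2)[OF gd] x0 by blast
      have b: "\<bar>g x - g x0\<bar> \<le> 2 * k" using x0(2) by (intro order_trans[OF g(1)]) simp
      have "\<bar>g x\<bar> \<le> \<bar>g x0\<bar> + \<bar>g x - g x0\<bar>" by linarith
      also have "\<dots> \<le> 3 * k + 2 * k" by (rule add_mono[OF a b])
      finally show ?thesis using k(3) by simp
    qed (use g(2)[of x] \<epsilon> in auto)
  qed
qed

text \<open>The rate \<open>exp (- c sqrt m)\<close> is strong enough to survive the change of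
  measure in \<open>rare_tail_event\<close>; leaving \<open>c\<close> open makes finite unions of
  rare events rare.\<close>

definition rare :: "(nat \<Rightarrow> (nat \<Rightarrow> nat) \<Rightarrow> bool) \<Rightarrow> bool" where
  "rare B \<longleftrightarrow> (\<exists>c>0. eventually (\<lambda>m. planch m (indicator {p. B m p}) \<le> fact m * exp (- c * sqrt (real m))) sequentially)"

lemma rare_mono:
  assumes "rare B" "eventually (\<lambda>m. \<forall>p\<in>young m. A m p \<longrightarrow> B m p) sequentially"
  shows "rare A"
proof -
  obtain c where c: "c > 0" "eventually (\<lambda>m. planch m (indicator {p. B m p}) \<le> fact m * exp (- c * sqrt (real m))) sequentially"
    using assms(1) by (auto simp: rare_def)
  have "eventually (\<lambda>m. planch m (indicator {p. A m p}) \<le> fact m * exp (- c * sqrt (real m))) sequentially"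
    using c(2) assms(2)
  proof eventually_elim
    case (elim m)
    have "planch m (indicator {p. A m p}) \<le> planch m (indicator {p. B m p})"
      by (rule planch_mono) (use elim(2) in \<open>auto simp: indicator_def\<close>)
    then show ?case using elim(1) by linarith
  qed
  then show ?thesis using c(1) by (auto simp: rare_def)
qed

lemma rare_or:
  assumes "rare A" "rare B"
  shows "rare (\<lambda>m p. A m p \<or> B m p)"
proof -
  obtain c where c: "c > 0" "eventually (\<lambda>m. planch m (indicator {p. A m p}) \<le> fact m * exp (- c * sqrt (real m))) sequentially"
    using assms(1) by (auto simp: rare_def)
  obtain c' where c': "c' > 0" "eventually (\<lambda>m. planch m (indicator {p. B m p}) \<le> fact m * exp (- c' * sqrt (real m))) sequentially"
    using assms(2) by (auto simp: rare_def)
  have "eventually (\<lambda>m. planch m (indicator {p. A m p \<or> B m p}) \<le> fact m * exp (- (min c c' / 2) * sqrt (real m))) sequentially"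
    using c(2) c'(2) eventually_sum_exp_sqrt[OF c(1) c'(1)]
  proof eventually_elim
    case (elim m)
    have "planch m (indicator {p. A m p \<or> B m p}) \<le> planch m (indicator {p. A m p}) + planch m (indicator {p. B m p})"
      by (rule planch_union) auto
    also have "\<dots> \<le> fact m * (exp (- c * sqrt (real m)) + exp (- c' * sqrt (real m)))" using elim by (simp add: distrib_left)
    also have "\<dots> \<le> fact m * exp (- (min c c' / 2) * sqrt (real m))" using elim(3) by (intro mult_left_mono) auto
    finally show ?case .
  qed
  then show ?thesis unfolding rare_def using c(1) c'(1) by (intro exI[of _ "min c c' / 2"]) auto
qed

lemma rare_False: "rare (\<lambda>m p. False)"
  by (auto simp: rare_def planch_def intro!: exI[of _ 1])

lemma rare_bex:
  assumes "finite I" "\<And>j. j \<in> I \<Longrightarrow> rare (B j)"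
  shows "rare (\<lambda>m p. \<exists>j\<in>I. B j m p)"
  using assms
proof (induction I rule: finite_induct)
  case empty
  then show ?case using rare_False by simp
next
  case (insert j I)
  have "rare (\<lambda>m p. B j m p \<or> (\<exists>j\<in>I. B j m p))" by (rule rare_or) (use insert in auto)
  then show ?case by simp
qed

lemma rare_outlier:
  assumes "\<epsilon> > 0"
  shows "rare (\<lambda>m. outlier ((2 + \<epsilon>) * sqrt (real m)))"
proof -
  obtain c where "c > 0" "eventually (\<lambda>m. planch m (indicator {p. outlier ((2 + \<epsilon>) * sqrt (real m)) p}) \<le> fact m * exp (- c * sqrt (real m))) sequentially"
    by (rule planch_outlier[OF assms])
  then show ?thesis unfolding rare_def by blast
qed

lemma rare_ex_sum:
  assumes "a > 0" "\<eta> > 0"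
  shows "rare (\<lambda>m p. outlier (3 * sqrt (real m)) p \<or> \<bar>ex_sum (a / sqrt (real m)) p / real m - shape_moment a\<bar> > \<eta>)"
proof -
  obtain c where "c > 0" "eventually (\<lambda>m. planch m (indicator {p. outlier (3 * sqrt (real m)) p \<or> \<bar>ex_sum (a / sqrt (real m)) p / real m - shape_moment a\<bar> > \<eta>}) \<le> fact m * exp (- c * sqrt (real m))) sequentially"
    by (rule ex_sum_concentrated[OF assms])
  then show ?thesis unfolding rare_def by blast
qed

section \<open>From moments to the uniform law of large numbers and the edges\<close>

lemma not_outlier_content:
  assumes "p \<in> young m" "\<not> outlier y p" "j < p i"
  shows "\<bar>real_of_int (int j - int i)\<bar> \<le> y"
proof -
  have "real (p 0) \<le> y" "real i < y" using assms(2,3) by (auto simp: outlier_def not_less not_le)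
  moreover have "p i \<le> p 0" using young_antimono[OF assms(1), of 0 i] by simp
  then have "real j \<le> real (p 0)" using assms(3) by simp
  ultimately show ?thesis by (simp add: abs_le_iff)
qed

lemma box_sum_cong:
  assumes "\<And>i j. j < p i \<Longrightarrow> \<phi> (int j - int i) = \<psi> (int j - int i)"
  shows "box_sum \<phi> p = box_sum \<psi> p"
  unfolding box_sum_def using assms by (intro sum.cong refl) auto

lemma box_sum_zero: "box_sum (\<lambda>_. 0) p = 0" by (simp add: box_sum_def)

lemma rpro_far:
  assumes p: "p \<in> young m" and far: "\<And>i j. j < p i \<Longrightarrow> \<bar>u - of_int (int j - int i)\<bar> \<ge> 1"
  shows "rpro p u = \<bar>u\<bar>"
proof -
  have "box_sum (\<lambda>c. tent (u - of_int c)) p = box_sum (\<lambda>_. 0) p"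
  proof (rule box_sum_cong)
    fix i j assume "j < p i"
    from far[OF this] show "tent (u - of_int (int j - int i)) = 0"
      unfolding tent_def by (intro max_absorb1) linarith
  qed
  then show ?thesis using rpro_tent[OF p, of u] by (simp add: box_sum_zero)
qed

lemma tent_box_integral:
  assumes p: "p \<in> young m" and r: "r > 0" and a: "a > 0"
    and c: "\<And>i j. j < p i \<Longrightarrow> \<bar>real_of_int (int j - int i)\<bar> + 1 \<le> 5 * r"
  shows "((\<lambda>x. box_sum (\<lambda>c. tent (x * r - of_int c)) p * exp (a * x)) has_integral (r / a\<^sup>2 * sh2 (a / r) * ex_sum (a / r) p)) {-5..5}"
proof -
  have z: "p i = 0" if "m \<le> i" for i using young_zero[OF p that] .
  have "((\<lambda>x. \<Sum>i<m. \<Sum>j<p i. tent (x * r - of_int (int j - int i)) * exp (a * x)) has_integral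
     (\<Sum>i<m. \<Sum>j<p i. r / a\<^sup>2 * (exp (a / r * of_int (int j - int i)) * sh2 (a / r)))) {-5..5}"
    by (intro has_integral_sum tent_integral r a) (use c in auto)
  moreover have "(\<lambda>x. \<Sum>i<m. \<Sum>j<p i. tent (x * r - of_int (int j - int i)) * exp (a * x)) = (\<lambda>x. box_sum (\<lambda>c. tent (x * r - of_int c)) p * exp (a * x))"
    by (rule ext, subst box_sum_eq[of m], rule z) (simp_all add: sum_distrib_right)
  moreover have "(\<Sum>i<m. \<Sum>j<p i. r / a\<^sup>2 * (exp (a / r * of_int (int j - int i)) * sh2 (a / r))) = r / a\<^sup>2 * sh2 (a / r) * ex_sum (a / r) p"
    unfolding ex_sum_def by (subst box_sum_eq[of m], rule z) (simp_all add: sum_distrib_left mult_ac)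
  ultimately show ?thesis by simp
qed

text \<open>Outside finitely many rare events the deviation \<open>g\<close> of the rescaled profile
  satisfies \<open>small_moments\<close>: its moments are differences between
  \<open>ex_sum / m\<close>, up to a factor tending to 1, and \<open>shape_moment\<close>. Being
  close on finitely many \<open>j\<close> then forces uniform closeness.\<close>

theorem rare_shape:
  assumes \<epsilon>: "\<epsilon> > 0"
  shows "rare (\<lambda>m p. \<exists>x. \<bar>rpro p (x * sqrt (real m)) / sqrt (real m) - limit_shape x\<bar> > \<epsilon>)"
proof -
  obtain J :: nat and \<delta> :: real where \<delta>: "\<delta> > 0" and J: "\<And>g x. small_moments J \<delta> g \<Longrightarrow> \<bar>g x\<bar> \<le> \<epsilon>"
    using exp_moments_determine[OF \<epsilon>] by blast
  define \<eta> where "\<eta> = \<delta> / 4"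
  have \<eta>: "\<eta> > 0" using \<delta> by (simp add: \<eta>_def)
  have ratio: "eventually (\<lambda>m. \<forall>j\<in>{1..J}. \<bar>real m * sh2 (real j / sqrt (real m)) / (real j)\<^sup>2 - 1\<bar> * (\<bar>shape_moment (real j)\<bar> + \<eta>) \<le> \<delta> / 4) sequentially"
  proof (rule eventually_ball_finite, simp, rule ballI)
    fix j :: nat assume "j \<in> {1..J}"
    then have j: "real j > 0" by simp
    have "(\<lambda>m. real m * sh2 (real j / sqrt (real m))) \<longlonglongrightarrow> (real j)\<^sup>2"
      unfolding sh2_def power2_eq_square using j by real_asymp
    then have "(\<lambda>m. \<bar>real m * sh2 (real j / sqrt (real m)) / (real j)\<^sup>2 - 1\<bar> * (\<bar>shape_moment (real j)\<bar> + \<eta>)) \<longlonglongrightarrow> \<bar>(real j)\<^sup>2 / (real j)\<^sup>2 - 1\<bar> * (\<bar>shape_moment (real j)\<bar> + \<eta>)"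
      using j by (intro tendsto_intros) auto
    then have "(\<lambda>m. \<bar>real m * sh2 (real j / sqrt (real m)) / (real j)\<^sup>2 - 1\<bar> * (\<bar>shape_moment (real j)\<bar> + \<eta>)) \<longlonglongrightarrow> 0"
      using j by simp
    from order_tendstoD(2)[OF this, of "\<delta> / 4"]
    show "eventually (\<lambda>m. \<bar>real m * sh2 (real j / sqrt (real m)) / (real j)\<^sup>2 - 1\<bar> * (\<bar>shape_moment (real j)\<bar> + \<eta>) \<le> \<delta> / 4) sequentially"
      using \<delta> by (auto elim: eventually_mono)
  qed
  have "rare (\<lambda>m p. outlier ((2 + 1) * sqrt (real m)) p \<or> (\<exists>j\<in>{1..J}. outlier (3 * sqrt (real m)) p \<or> \<bar>ex_sum (real j / sqrt (real m)) p / real m - shape_moment (real j)\<bar> > \<eta>))"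
    by (intro rare_or rare_bex rare_outlier rare_ex_sum) (use \<eta> in auto)
  then show ?thesis
  proof (rule rare_mono)
    show "eventually (\<lambda>m. \<forall>p\<in>young m. (\<exists>x. \<bar>rpro p (x * sqrt (real m)) / sqrt (real m) - limit_shape x\<bar> > \<epsilon>) \<longrightarrow>
      outlier ((2 + 1) * sqrt (real m)) p \<or> (\<exists>j\<in>{1..J}. outlier (3 * sqrt (real m)) p \<or> \<bar>ex_sum (real j / sqrt (real m)) p / real m - shape_moment (real j)\<bar> > \<eta>)) sequentially"
      using ratio eventually_ge_at_top[of 1]
    proof eventually_elim
      case (elim m)
      show ?case
      proof (intro ballI impI, rule ccontr)
        fix p assume p: "p \<in> young m" and big: "\<exists>x. \<bar>rpro p (x * sqrt (real m)) / sqrt (real m) - limit_shape x\<bar> > \<epsilon>"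
          and "\<not> (outlier ((2 + 1) * sqrt (real m)) p \<or> (\<exists>j\<in>{1..J}. outlier (3 * sqrt (real m)) p \<or> \<bar>ex_sum (real j / sqrt (real m)) p / real m - shape_moment (real j)\<bar> > \<eta>))"
        then have out: "\<not> outlier (3 * sqrt (real m)) p"
          and mom: "\<And>j. j \<in> {1..J} \<Longrightarrow> \<bar>ex_sum (real j / sqrt (real m)) p / real m - shape_moment (real j)\<bar> \<le> \<eta>"
          by (auto simp: not_less)
        define r where "r = sqrt (real m)"
        have r1: "r \<ge> 1" using elim(2) by (simp add: r_def)
        have rr: "r * r = real m" by (simp add: r_def)
        have cb: "\<bar>real_of_int (int j - int i)\<bar> \<le> 3 * r" if "j < p i" for i j
          using not_outlier_content[OF p out that] by (simp add: r_def)
        define g where "g x = rpro p (x * r) / r - limit_shape x" for x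
        have "\<bar>g x\<bar> \<le> \<epsilon>" for x
        proof (rule J[of g], unfold small_moments_def, intro conjI allI impI ballI)
          fix x y
          have "\<bar>rpro p (x * r) / r - rpro p (y * r) / r\<bar> \<le> \<bar>x - y\<bar>"
          proof -
            have "\<bar>rpro p (x * r) / r - rpro p (y * r) / r\<bar> = \<bar>rpro p (x * r) - rpro p (y * r)\<bar> / r"
              using r1 by (simp add: diff_divide_distrib[symmetric])
            also have "\<dots> \<le> \<bar>x * r - y * r\<bar> / r" using r1 by (intro divide_right_mono rpro_lipschitz[OF p]) auto
            also have "\<dots> = \<bar>x - y\<bar>" using r1 by (simp add: left_diff_distrib[symmetric] abs_mult)
            finally show ?thesis .
          qed
          from add_mono[OF this limit_shape_lipschitz[of x y]]
          have s: "\<bar>rpro p (x * r) / r - rpro p (y * r) / r\<bar> + \<bar>limit_shape x - limit_shape y\<bar> \<le> 2 * \<bar>x - y\<bar>" by simp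
          have "\<bar>g x - g y\<bar> \<le> \<bar>rpro p (x * r) / r - rpro p (y * r) / r\<bar> + \<bar>limit_shape x - limit_shape y\<bar>"
            unfolding g_def by linarith
          then show "\<bar>g x - g y\<bar> \<le> 2 * \<bar>x - y\<bar>" using s by (rule order_trans)
        next
          fix x :: real assume x: "\<bar>x\<bar> \<ge> 4"
          have "4 * r \<le> \<bar>x\<bar> * r" using x r1 by (intro mult_right_mono) auto
          then have xr: "4 * r \<le> \<bar>x * r\<bar>" using r1 by (simp add: abs_mult)
          have "rpro p (x * r) = \<bar>x * r\<bar>"
          proof (rule rpro_far[OF p])
            fix i j assume "j < p i"
            from cb[OF this] show "1 \<le> \<bar>x * r - real_of_int (int j - int i)\<bar>" using xr r1 by linarith
          qed
          then show "g x = 0" using r1 x limit_shape_outer[of x] by (simp add: g_def abs_mult)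
        next
          fix j :: nat assume "j \<in> {1..J}"
          then have j: "1 \<le> j" "j \<le> J" by auto
          define a where "a = real j"
          have a: "a > 0" using j by (simp add: a_def)
          have c5: "\<bar>real_of_int (int k - int i)\<bar> + 1 \<le> 5 * r" if "k < p i" for i k
            using cb[OF that] r1 by linarith
          have i1: "((\<lambda>x. 2 / r * (box_sum (\<lambda>c. tent (x * r - of_int c)) p * exp (a * x))) has_integral (2 / r * (r / a\<^sup>2 * sh2 (a / r) * ex_sum (a / r) p))) {-5..5}"
            by (intro has_integral_mult_right tent_box_integral[OF p] a c5) (use r1 in auto)
          have i2: "((\<lambda>x. g x * exp (a * x)) has_integral (2 / r * (r / a\<^sup>2 * sh2 (a / r) * ex_sum (a / r) p) - 2 * (bessel a - 1) / a\<^sup>2)) {-5..5}"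
          proof (rule has_integral_eq[OF _ has_integral_diff[OF i1 limit_shape_integral[OF a]]])
            fix x :: real
            have "rpro p (x * r) / r = \<bar>x\<bar> + 2 / r * box_sum (\<lambda>c. tent (x * r - of_int c)) p"
              using rpro_tent[OF p, of "x * r"] r1 by (simp add: add_divide_distrib abs_mult)
            then show "2 / r * (box_sum (\<lambda>c. tent (x * r - of_int c)) p * exp (a * x)) - (limit_shape x - \<bar>x\<bar>) * exp (a * x) = g x * exp (a * x)"
              by (simp add: g_def algebra_simps)
          qed
          \<comment> \<open>Discretisation factor: the profile produces
            \<open>m * sh2 (a / r)\<close> where the limit shape has the square of \<open>a\<close>.
            It tends to 1, and \<open>ratio\<close> bounds its effect.\<close>
          define \<rho> where "\<rho> = real m * sh2 (a / r) / a\<^sup>2"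
          define S where "S = ex_sum (a / r) p / real m"
          have val: "2 / r * (r / a\<^sup>2 * sh2 (a / r) * ex_sum (a / r) p) - 2 * (bessel a - 1) / a\<^sup>2 = 2 * (\<rho> * S - shape_moment a)"
            using r1 elim(2) by (simp add: \<rho>_def S_def shape_moment_def right_diff_distrib diff_divide_distrib)
          have S: "\<bar>S - shape_moment a\<bar> \<le> \<eta>" using mom[of j] j by (simp add: S_def a_def r_def)
          have \<rho>: "\<bar>\<rho> - 1\<bar> * (\<bar>shape_moment a\<bar> + \<eta>) \<le> \<delta> / 4" using elim(1) j by (simp add: \<rho>_def a_def r_def)
          have "\<rho> * S - shape_moment a = (\<rho> - 1) * S + (S - shape_moment a)" by (simp add: algebra_simps)
          also have "\<bar>\<dots>\<bar> \<le> \<bar>\<rho> - 1\<bar> * \<bar>S\<bar> + \<bar>S - shape_moment a\<bar>" by (metis abs_mult abs_triangle_ineq)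
          also have "\<dots> \<le> \<bar>\<rho> - 1\<bar> * (\<bar>shape_moment a\<bar> + \<eta>) + \<eta>" using S by (intro add_mono mult_left_mono) auto
          also have "\<dots> \<le> \<delta> / 2" using \<rho> by (simp add: \<eta>_def)
          finally have "\<bar>2 * (\<rho> * S - shape_moment a)\<bar> \<le> \<delta>" unfolding abs_mult by simp
          then show "\<bar>integral {-5..5} (\<lambda>x. g x * exp (real j * x))\<bar> \<le> \<delta>"
            using integral_unique[OF i2] val by (simp add: a_def)
        qed
        then show False using big by (auto simp: g_def r_def not_less[symmetric])
      qed
    qed
  qed
qed

lemma rpro_right:
  assumes p: "p \<in> young m" and u: "real (p 0) \<le> u"
  shows "rpro p u = u"
proof -
  have "rpro p u = \<bar>u\<bar>"
  proof (rule rpro_far[OF p])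
    fix i j assume "j < p i"
    then have "int j - int i + 1 \<le> int (p 0)" using young_antimono[OF p, of 0 i] by simp
    then have "real_of_int (int j - int i) + 1 \<le> real (p 0)" by linarith
    then show "1 \<le> \<bar>u - real_of_int (int j - int i)\<bar>" using u by linarith
  qed
  then show ?thesis using u of_nat_0_le_iff[of "p 0", where 'a = real] by linarith
qed

lemma rpro_left:
  assumes p: "p \<in> young m" and u: "0 \<le> u" "\<And>i. real i + 1 > u \<Longrightarrow> p i = 0"
  shows "rpro p (- u) = u"
proof -
  have "rpro p (- u) = \<bar>- u\<bar>"
  proof (rule rpro_far[OF p])
    fix i j assume j: "j < p i"
    then have "\<not> real i + 1 > u" using u(2)[of i] by auto
    then have "real i + 1 \<le> u" by simp
    then show "1 \<le> \<bar>- u - real_of_int (int j - int i)\<bar>" by simp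
  qed
  then show ?thesis using u by simp
qed

text \<open>With \<open>x = 2 sin t\<close> and \<open>s = pi / 2 - t\<close> the claim becomes
  \<open>sin s > s cos s\<close>. Strictness up to the edge is what lets the uniform law bound the
  first row and column from below.\<close>

lemma limit_shape_gt:
  assumes "0 \<le> x" "x < 2"
  shows "limit_shape x > x"
proof -
  define t where "t = arcsin (x / 2)"
  have t: "0 \<le> t" "t < pi / 2" using assms arcsin_lt_bounded[of "x / 2"] arcsin_le_arcsin[of 0 "x / 2"] by (auto simp: t_def)
  have x: "x = 2 * sin t" using assms by (simp add: t_def)
  define s where "s = pi / 2 - t"
  have s: "0 < s" "s \<le> pi / 2" using t by (auto simp: s_def)
  have "sin 0 - 0 * cos 0 < sin s - s * cos s"
  proof (rule DERIV_pos_imp_increasing_open[OF s(1)])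
    fix y assume y: "0 < y" "y < s"
    have "((\<lambda>y. sin y - y * cos y) has_real_derivative y * sin y) (at y)"
      by (auto intro!: derivative_eq_intros)
    moreover have "y * sin y > 0" using y s by (intro mult_pos_pos sin_gt_zero) auto
    ultimately show "\<exists>z. ((\<lambda>y. sin y - y * cos y) has_real_derivative z) (at y) \<and> 0 < z" by blast
  qed (auto intro!: continuous_intros)
  then have "cos t > (pi / 2 - t) * sin t" by (simp add: s_def sin_diff cos_diff)
  then have "4 / pi * (t * sin t + cos t) > 4 / pi * (pi / 2 * sin t)" by (intro mult_strict_left_mono) (auto simp: algebra_simps)
  moreover have "t \<in> {- pi / 2..pi / 2}" using t by auto
  ultimately show ?thesis unfolding x using limit_shape_sin[of t] by simp
qed

lemma limit_shape_even: "limit_shape (- x) = limit_shape x"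
proof (cases "\<bar>x\<bar> \<le> 2")
  case True
  then have "arcsin (- (x / 2)) = - arcsin (x / 2)" by (intro arcsin_minus) auto
  then show ?thesis by (simp add: limit_shape_def)
qed (simp add: limit_shape_def)

text \<open>Rows are counted from 0, so the last clause says that there are at least
  \<open>(2 - \<epsilon>) sqrt m\<close> nonempty rows.\<close>

definition typical :: "real \<Rightarrow> nat \<Rightarrow> (nat \<Rightarrow> nat) \<Rightarrow> bool" where
  "typical \<epsilon> m p \<longleftrightarrow> (\<forall>x. \<bar>rpro p (x * sqrt (real m)) / sqrt (real m) - limit_shape x\<bar> \<le> \<epsilon>) \<and>
     \<bar>real (p 0) / sqrt (real m) - 2\<bar> \<le> \<epsilon> \<and>
     (\<forall>i. real i \<ge> (2 + \<epsilon>) * sqrt (real m) \<longrightarrow> p i = 0) \<and> (\<exists>i. real i + 1 \<ge> (2 - \<epsilon>) * sqrt (real m) \<and> p i \<noteq> 0)"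

text \<open>The upper bounds at the edges are \<open>rare_outlier\<close>. If the first row or
  column were too short, the profile would coincide with the absolute value at distance
  \<open>2 - \<epsilon>\<close> from 0, where the limit shape exceeds it by more than
  \<kappa>.\<close>

lemma rare_not_typical:
  assumes \<epsilon>: "0 < \<epsilon>" "\<epsilon> \<le> 1"
  shows "rare (\<lambda>m p. \<not> typical \<epsilon> m p)"
proof -
  define \<kappa> where "\<kappa> = min \<epsilon> ((limit_shape (2 - \<epsilon>) - (2 - \<epsilon>)) / 2)"
  have gt: "limit_shape (2 - \<epsilon>) > 2 - \<epsilon>" using limit_shape_gt[of "2 - \<epsilon>"] \<epsilon> by simp
  have \<kappa>: "\<kappa> > 0" "\<kappa> \<le> \<epsilon>" "\<kappa> < limit_shape (2 - \<epsilon>) - (2 - \<epsilon>)" using \<epsilon> gt by (auto simp: \<kappa>_def min_def)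
  have "rare (\<lambda>m p. (\<exists>x. \<bar>rpro p (x * sqrt (real m)) / sqrt (real m) - limit_shape x\<bar> > \<kappa>) \<or> outlier ((2 + \<epsilon>) * sqrt (real m)) p)"
    by (intro rare_or rare_shape rare_outlier \<kappa> \<epsilon>)
  then show ?thesis
  proof (rule rare_mono)
    show "eventually (\<lambda>m. \<forall>p\<in>young m. \<not> typical \<epsilon> m p \<longrightarrow>
       (\<exists>x. \<bar>rpro p (x * sqrt (real m)) / sqrt (real m) - limit_shape x\<bar> > \<kappa>) \<or> outlier ((2 + \<epsilon>) * sqrt (real m)) p) sequentially"
      using eventually_ge_at_top[of 1]
    proof eventually_elim
     case m: (elim m)
     show ?case
     proof (intro ballI impI, rule ccontr)
      fix p assume p: "p \<in> young m" and nt: "\<not> typical \<epsilon> m p"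
        and "\<not> ((\<exists>x. \<bar>rpro p (x * sqrt (real m)) / sqrt (real m) - limit_shape x\<bar> > \<kappa>) \<or> outlier ((2 + \<epsilon>) * sqrt (real m)) p)"
      then have sh: "\<And>x. \<bar>rpro p (x * sqrt (real m)) / sqrt (real m) - limit_shape x\<bar> \<le> \<kappa>"
        and out: "\<not> outlier ((2 + \<epsilon>) * sqrt (real m)) p" by (auto simp: not_less)
      define r where "r = sqrt (real m)"
      have r0: "r > 0" using m by (simp add: r_def)
      have o1: "real (p 0) \<le> (2 + \<epsilon>) * r" "\<And>i. real i \<ge> (2 + \<epsilon>) * r \<Longrightarrow> p i = 0"
        using out by (auto simp: outlier_def r_def not_less)
      have low1: "real (p 0) \<ge> (2 - \<epsilon>) * r"
      proof (rule ccontr)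
        assume "\<not> ?thesis"
        then have "rpro p ((2 - \<epsilon>) * r) = (2 - \<epsilon>) * r" by (intro rpro_right[OF p]) auto
        then show False using sh[of "2 - \<epsilon>"] \<kappa>(3) r0 by (simp add: r_def[symmetric])
      qed
      have low2: "\<exists>i. real i + 1 \<ge> (2 - \<epsilon>) * r \<and> p i \<noteq> 0"
      proof (rule ccontr)
        assume "\<not> ?thesis"
        then have "\<And>i. real i + 1 > (2 - \<epsilon>) * r \<Longrightarrow> p i = 0" by (auto intro: less_imp_le)
        then have "rpro p (- ((2 - \<epsilon>) * r)) = (2 - \<epsilon>) * r" using r0 \<epsilon> by (intro rpro_left[OF p]) auto
        then have "rpro p ((- (2 - \<epsilon>)) * r) = (2 - \<epsilon>) * r" by (simp add: algebra_simps)
        then show False using sh[of "- (2 - \<epsilon>)"] \<kappa>(3) r0 unfolding limit_shape_even r_def[symmetric] by simp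
      qed
      have "\<bar>real (p 0) / r - 2\<bar> \<le> \<epsilon>"
        using o1(1) low1 r0 by (simp add: abs_le_iff field_simps)
      then have "typical \<epsilon> m p"
        unfolding typical_def r_def[symmetric] using sh \<kappa>(2) o1(2) low2 by (auto simp: r_def[symmetric] intro: order_trans)
      then show False using nt by simp
     qed
    qed
  qed
qed

section \<open>Splitting off the first row\<close>

lemma csum_case_nat:
  assumes q: "q \<in> young m"
  shows "csum (case_nat k q) = real k * (real k - 1) / 2 - real m + csum q"
proof -
  have z: "q i = 0" if "m \<le> i" for i using young_zero[OF q that] .
  have z': "case_nat k q i = 0" if "Suc m \<le> i" for i using z that by (cases i) auto
  have "csum (case_nat k q) = (\<Sum>i<Suc m. \<Sum>j<case_nat k q i. real_of_int (int j - int i))"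
    unfolding csum_def by (rule box_sum_eq) (use z' in auto)
  also have "\<dots> = (\<Sum>j<k. real j) + (\<Sum>i<m. \<Sum>j<q i. real_of_int (int j - int i) - 1)"
    by (simp add: sum.lessThan_Suc_shift algebra_simps del: sum.lessThan_Suc)
  also have "(\<Sum>j<k. real j) = real k * (real k - 1) / 2"
    by (induction k) (auto simp: field_simps)
  also have "(\<Sum>i<m. \<Sum>j<q i. real_of_int (int j - int i) - 1) = (\<Sum>i<m. (\<Sum>j<q i. real_of_int (int j - int i)) - real (q i))"
    by (simp add: sum_subtractf)
  also have "\<dots> = csum q - real (\<Sum>i<m. q i)"
    unfolding csum_def by (subst box_sum_eq[of m], rule z) (simp_all add: sum_subtractf)
  also have "(\<Sum>i<m. q i) = m" using q by (simp add: young_def)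
  finally show ?thesis by simp
qed

lemma sum_young_first_row:
  assumes "k \<le> n"
  shows "(\<Sum>p\<in>{p \<in> young n. p 0 = k}. h p) = (\<Sum>q\<in>{q \<in> young (n - k). q 0 \<le> k}. h (case_nat k q))"
proof (rule sum.reindex_bij_witness[of _ "\<lambda>q. case_nat k q" "\<lambda>p. p \<circ> Suc"])
  fix p assume p: "p \<in> {p \<in> young n. p 0 = k}"
  then show "case_nat k (p \<circ> Suc) = p" using young_tail(3)[of p n] by auto
  then show "h (case_nat k (p \<circ> Suc)) = h p" by simp
  show "p \<circ> Suc \<in> {q \<in> young (n - k). q 0 \<le> k}" using p young_tail(1)[of p n] young_antimono[of p n 0 1] by auto
next
  fix q assume q: "q \<in> {q \<in> young (n - k). q 0 \<le> k}"
  show "case_nat k q \<circ> Suc = q" by auto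
  show "case_nat k q \<in> {p \<in> young n. p 0 = k}" using q young_case_nat[of q "n - k" k] assms by auto
qed

lemma fdim_case_nat_le:
  assumes q: "q \<in> young m" and k: "q 0 \<le> k"
  shows "fdim (case_nat k q) \<le> real ((k + m) choose k) * fdim q"
proof -
  have "(\<Prod>i<m. 1 - real (q i) / real (k + i + 1)) \<le> 1"
  proof (rule prod_le_1)
    fix i
    have "q i \<le> k" using young_antimono[OF q, of 0 i] k by simp
    then show "0 \<le> 1 - real (q i) / real (k + i + 1) \<and> 1 - real (q i) / real (k + i + 1) \<le> 1" by (simp add: field_simps)
  qed
  then have "real ((k + m) choose k) * fdim q * (\<Prod>i<m. 1 - real (q i) / real (k + i + 1)) \<le> real ((k + m) choose k) * fdim q * 1"
    using fdim_pos[OF q] by (intro mult_left_mono) auto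
  then show ?thesis using fdim_case_nat[OF q k young_zero[OF q]] by simp
qed

text \<open>The condition \<open>2 * q 0 \<le> k\<close> keeps every ratio below
  \<open>1 / 2\<close>, where \<open>1 - x \<ge> exp (- 2 x)\<close>; the exponents then add up to
  \<open>2 m / k\<close> because the rows of \<open>q\<close> sum to \<open>m\<close>.\<close>

lemma fdim_case_nat_ge:
  assumes q: "q \<in> young m" and k: "2 * q 0 \<le> k" "k \<ge> 1"
  shows "fdim (case_nat k q) \<ge> real ((k + m) choose k) * fdim q * exp (- 2 * real m / real k)"
proof -
  have "exp (- 2 * real m / real k) = (\<Prod>i<m. exp (- 2 * real (q i) / real k))"
  proof -
    have "(\<Prod>i<m. exp (- 2 * real (q i) / real k)) = exp (\<Sum>i<m. - 2 * real (q i) / real k)" by (simp add: exp_sum)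
    also have "(\<Sum>i<m. - 2 * real (q i) / real k) = - 2 * real (\<Sum>i<m. q i) / real k"
      by (simp add: sum_divide_distrib[symmetric] sum_distrib_left[symmetric] sum_negf)
    also have "(\<Sum>i<m. q i) = m" using q by (simp add: young_def)
    finally show ?thesis by simp
  qed
  also have "\<dots> \<le> (\<Prod>i<m. 1 - real (q i) / real (k + i + 1))"
  proof (rule prod_mono, intro conjI)
    fix i
    define x where "x = real (q i) / real (k + i + 1)"
    have xk: "x \<le> real (q i) / real k" unfolding x_def using k by (intro divide_left_mono) auto
    have "q i \<le> q 0" using young_antimono[OF q, of 0 i] by simp
    then have "2 * real (q i) \<le> real k" using k by linarith
    then have h: "real (q i) / real k \<le> 1 / 2" using k by (simp add: field_simps)
    have x: "0 \<le> x" "x \<le> 1 / 2" by (simp add: x_def, rule order_trans[OF xk h])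
    have "- 2 * x \<le> - x - 2 * x\<^sup>2"
      using mult_left_mono[OF x(2) x(1)] by (simp add: power2_eq_square)
    also have "\<dots> \<le> ln (1 - x)" using x by (rule ln_one_minus_pos_lower_bound)
    finally have "exp (- 2 * x) \<le> exp (ln (1 - x))" by (simp only: exp_le_cancel_iff)
    then have "exp (- 2 * x) \<le> 1 - x" using x by simp
    moreover have "exp (- 2 * real (q i) / real k) \<le> exp (- 2 * x)" using xk by simp
    ultimately show "exp (- 2 * real (q i) / real k) \<le> 1 - real (q i) / real (k + i + 1)" unfolding x_def by (rule order_trans[rotated])
  qed simp
  finally have "real ((k + m) choose k) * fdim q * exp (- 2 * real m / real k) \<le> real ((k + m) choose k) * fdim q * (\<Prod>i<m. 1 - real (q i) / real (k + i + 1))"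
    using fdim_pos[OF q] by (intro mult_left_mono) auto
  moreover have "q 0 \<le> k" using k by simp
  ultimately show ?thesis using fdim_case_nat[OF q _ young_zero[OF q]] by simp
qed

text \<open>The unnormalised density of the positive half measure. The Hurwitz number cancels on conditioning, so
  the Frobenius character formula for it plays no role.\<close>

definition weight :: "nat \<Rightarrow> (nat \<Rightarrow> nat) \<Rightarrow> real" where
  "weight l p = (if csum p > 0 then (fdim p)\<^sup>2 * csum p ^ l else 0)"

lemma weight_nonneg: "weight l p \<ge> 0" by (simp add: weight_def)

definition ph_total :: "nat \<Rightarrow> nat \<Rightarrow> real" where
  "ph_total n l = (\<Sum>p\<in>young n. weight l p)"

definition row_total :: "nat \<Rightarrow> nat \<Rightarrow> nat \<Rightarrow> real" where
  "row_total n l k = (\<Sum>p\<in>{p \<in> young n. p 0 = k}. weight l p)"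

text \<open>Content sum of a first row of length \<open>k\<close>, minus 1 for each of the
  \<open>m\<close> boxes that it pushes down; only \<open>csum q\<close> has to be added.\<close>

definition row_content :: "nat \<Rightarrow> nat \<Rightarrow> real" where
  "row_content k m = real k * (real k - 1) / 2 - real m"

text \<open>Only remaining shapes with short first row and content at least \<open>- 2 m\<close> are
  kept. For them the dimension loses \<open>exp (- 2 m / k)\<close>, squared in the weight, and the
  content power loses a factor \<open>(1 - 2 m / K)^l\<close>. The term \<open>- 1\<close> in the
  exponent pays for their having half the mass.\<close>

lemma row_total_lower:
  assumes k: "1 \<le> k" "k \<le> n" and m: "m = n - k" and K: "4 * real m \<le> row_content k m" "0 < row_content k m"
    and mass: "planch m (indicator {q. 2 * q 0 \<le> k \<and> - 2 * real m \<le> csum q}) \<ge> fact m / 2"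
  shows "row_total n l k \<ge> (real (n choose k))\<^sup>2 * fact m * row_content k m ^ l * exp (- 1 - 4 * real m / real k - 4 * real m * real l / row_content k m)"
proof -
  define K where "K = row_content k m"
  have n: "n = k + m" using k m by simp
  have K0: "K > 0" and Km: "4 * real m \<le> K" using K by (auto simp: K_def)
  let ?G = "{q. 2 * q 0 \<le> k \<and> - 2 * real m \<le> csum q}"
  define x where "x = 2 * real m / K"
  have x: "0 \<le> x" "x \<le> 1 / 2" using K0 Km by (auto simp: x_def field_simps)
  have "- 2 * x \<le> - x - 2 * x\<^sup>2"
    using mult_left_mono[OF x(2) x(1)] by (simp add: power2_eq_square)
  also have "\<dots> \<le> ln (1 - x)" using x by (rule ln_one_minus_pos_lower_bound)
  finally have "exp (- 2 * x) \<le> exp (ln (1 - x))" by (simp only: exp_le_cancel_iff)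
  then have ex: "exp (- 2 * x) \<le> 1 - x" using x by simp
  have Kl: "K ^ l * exp (- 4 * real m * real l / K) \<le> (K - 2 * real m) ^ l"
  proof -
    have "K ^ l * exp (- 4 * real m * real l / K) = (K * exp (- 2 * x)) ^ l"
      by (simp add: power_mult_distrib exp_of_nat_mult[symmetric] x_def mult.commute mult.left_commute)
    also have "\<dots> \<le> (K * (1 - x)) ^ l" using K0 ex by (intro power_mono mult_left_mono) auto
    also have "K * (1 - x) = K - 2 * real m" using K0 by (simp add: x_def right_diff_distrib)
    finally show ?thesis .
  qed
  define B where "B = real (n choose k)"
  have term_ge: "B\<^sup>2 * exp (- 4 * real m / real k) * (K ^ l * exp (- 4 * real m * real l / K)) * ((fdim q)\<^sup>2 * indicator ?G q) \<le> (if q 0 \<le> k then weight l (case_nat k q) else 0)"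
    if q: "q \<in> young m" for q
  proof (cases "q \<in> ?G")
    case True
    then have q0: "2 * q 0 \<le> k" and c: "- 2 * real m \<le> csum q" by auto
    have cs: "csum (case_nat k q) = K + csum q" using csum_case_nat[OF q, of k] by (simp add: K_def row_content_def)
    have cpos: "csum (case_nat k q) \<ge> K - 2 * real m" "K - 2 * real m \<ge> 0" using cs c Km K0 by auto
    have K2: "K - 2 * real m > 0" using Km K0 by (cases "m = 0") auto
    have f: "B * fdim q * exp (- 2 * real m / real k) \<le> fdim (case_nat k q)"
      using fdim_case_nat_ge[OF q q0 k(1)] by (simp add: B_def n)
    have "(B * fdim q * exp (- 2 * real m / real k))\<^sup>2 \<le> (fdim (case_nat k q))\<^sup>2"
      using f fdim_pos[OF q] by (intro power_mono) (auto simp: B_def)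
    moreover have "(B * fdim q * exp (- 2 * real m / real k))\<^sup>2 = B\<^sup>2 * exp (- 4 * real m / real k) * (fdim q)\<^sup>2"
      by (simp add: power_mult_distrib exp_double[symmetric] power2_eq_square exp_add[symmetric])
    moreover have "K ^ l * exp (- 4 * real m * real l / K) \<le> csum (case_nat k q) ^ l"
      using cpos by (intro order_trans[OF Kl] power_mono) auto
    ultimately have "(B\<^sup>2 * exp (- 4 * real m / real k) * (fdim q)\<^sup>2) * (K ^ l * exp (- 4 * real m * real l / K)) \<le> (fdim (case_nat k q))\<^sup>2 * csum (case_nat k q) ^ l"
      using K0 by (intro mult_mono) auto
    then show ?thesis using True q0 cpos(1) K2 by (simp add: weight_def mult.assoc mult.left_commute mult.commute)
  qed (simp add: weight_nonneg)
  have "B\<^sup>2 * exp (- 4 * real m / real k) * (K ^ l * exp (- 4 * real m * real l / K)) * planch m (indicator ?G) \<le> row_total n l k"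
  proof -
    have "B\<^sup>2 * exp (- 4 * real m / real k) * (K ^ l * exp (- 4 * real m * real l / K)) * planch m (indicator ?G)
      = (\<Sum>q\<in>young m. B\<^sup>2 * exp (- 4 * real m / real k) * (K ^ l * exp (- 4 * real m * real l / K)) * ((fdim q)\<^sup>2 * indicator ?G q))"
      by (simp add: planch_def sum_distrib_left)
    also have "\<dots> \<le> (\<Sum>q\<in>young m. if q 0 \<le> k then weight l (case_nat k q) else 0)"
      by (intro sum_mono term_ge)
    also have "\<dots> = (\<Sum>q\<in>{q \<in> young m. q 0 \<le> k}. weight l (case_nat k q))"
      using finite_young by (simp add: sum.inter_filter)
    also have "\<dots> = row_total n l k" unfolding row_total_def m using sum_young_first_row[OF k(2), of "weight l"] by simp
    finally show ?thesis .
  qed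
  moreover have "B\<^sup>2 * exp (- 4 * real m / real k) * (K ^ l * exp (- 4 * real m * real l / K)) * (fact m / 2) \<le>
     B\<^sup>2 * exp (- 4 * real m / real k) * (K ^ l * exp (- 4 * real m * real l / K)) * planch m (indicator ?G)"
    using mass K0 by (intro mult_left_mono) auto
  moreover have "B\<^sup>2 * fact m * K ^ l * exp (- 1 - 4 * real m / real k - 4 * real m * real l / K) \<le>
     B\<^sup>2 * exp (- 4 * real m / real k) * (K ^ l * exp (- 4 * real m * real l / K)) * (fact m / 2)"
  proof -
    have "exp (- 1 :: real) \<le> 1 / 2" using exp_ge_add_one_self[of "1::real"] by (simp add: exp_minus field_simps)
    have "exp (- 1 - 4 * real m / real k - 4 * real m * real l / K) = exp (- 1) * (exp (- 4 * real m / real k) * exp (- 4 * real m * real l / K))"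
      by (simp add: exp_add[symmetric])
    also have "\<dots> \<le> 1 / 2 * (exp (- 4 * real m / real k) * exp (- 4 * real m * real l / K))"
      using \<open>exp (- 1) \<le> 1 / 2\<close> by (intro mult_right_mono) auto
    finally have "(B\<^sup>2 * fact m * K ^ l) * exp (- 1 - 4 * real m / real k - 4 * real m * real l / K) \<le>
      (B\<^sup>2 * fact m * K ^ l) * (1 / 2 * (exp (- 4 * real m / real k) * exp (- 4 * real m * real l / K)))"
      using K0 by (intro mult_left_mono) auto
    then show ?thesis by (simp add: mult.assoc mult.left_commute mult.commute)
  qed
  ultimately show ?thesis unfolding B_def K_def by linarith
qed

text \<open>The content power satisfies \<open>(K + c)^l \<le> K^l exp (l c / K)\<close>.
  Cauchy-Schwarz then separates the event from the exponential weight, which doubles the exponent to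
  \<open>2 l / K\<close> and leaves the truncated exponential moment of the content sum.\<close>

lemma row_bad_upper:
  assumes k: "k \<le> n" and m: "m = n - k" and K: "0 < row_content k m" and R: "R \<ge> 0"
  shows "(\<Sum>p\<in>{p \<in> young n. p 0 = k}. weight l p * indicator {p. real (p 1) \<le> R \<and> B (p \<circ> Suc)} p)
    \<le> (real (n choose k))\<^sup>2 * row_content k m ^ l * sqrt (planch m (indicator {q. B q}) * (fact m * exp ((2 * real l / row_content k m)\<^sup>2 * exp (2 * real l / row_content k m * R) * (real m)\<^sup>2)))"
proof -
  define K where "K = row_content k m"
  have K0: "K > 0" using K by (simp add: K_def)
  have n: "n = k + m" using k m by simp
  define b where "b = real l / K"
  have b0: "b \<ge> 0" using K0 by (simp add: b_def)
  define C where "C = real (n choose k)"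
  let ?E = "\<lambda>q. if real (q 0) \<le> R then exp (b * csum q) else 0"
  have up: "weight l (case_nat k q) * indicator {p. real (p 1) \<le> R \<and> B (p \<circ> Suc)} (case_nat k q) \<le> C\<^sup>2 * K ^ l * ((fdim q)\<^sup>2 * (indicator {q. B q} q * ?E q))"
    if q: "q \<in> young m" and q0: "q 0 \<le> k" for q
  proof (cases "csum (case_nat k q) > 0 \<and> real (q 0) \<le> R \<and> B q")
    case True
    have cs: "csum (case_nat k q) = K + csum q" using csum_case_nat[OF q, of k] by (simp add: K_def row_content_def)
    have f: "(fdim (case_nat k q))\<^sup>2 \<le> (C * fdim q)\<^sup>2"
      using fdim_case_nat_le[OF q q0] fdim_pos[OF young_case_nat[OF q q0]] by (intro power_mono) (auto simp: C_def n)
    have "csum (case_nat k q) ^ l = K ^ l * (1 + csum q / K) ^ l"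
      unfolding power_mult_distrib[symmetric] cs using K0 by (simp add: distrib_left)
    also have "\<dots> \<le> K ^ l * exp (csum q / K) ^ l"
    proof (intro mult_left_mono power_mono)
      show "1 + csum q / K \<le> exp (csum q / K)" by (rule exp_ge_add_one_self)
      show "0 \<le> 1 + csum q / K" using True cs K0 by (simp add: field_simps)
    qed (use K0 in auto)
    also have "exp (csum q / K) ^ l = exp (b * csum q)" by (simp add: exp_of_nat_mult[symmetric] b_def)
    finally have c: "csum (case_nat k q) ^ l \<le> K ^ l * exp (b * csum q)" .
    have "(fdim (case_nat k q))\<^sup>2 * csum (case_nat k q) ^ l \<le> (C * fdim q)\<^sup>2 * (K ^ l * exp (b * csum q))"
      using f c True by (intro mult_mono) auto
    moreover have "case_nat k q \<circ> Suc = q" by auto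
    ultimately show ?thesis using True by (simp add: weight_def power_mult_distrib mult.assoc mult.left_commute mult.commute)
  next
    case False
    moreover have "case_nat k q \<circ> Suc = q" by auto
    ultimately have "weight l (case_nat k q) * indicator {p. real (p 1) \<le> R \<and> B (p \<circ> Suc)} (case_nat k q) = 0"
      by (auto simp: weight_def indicator_def)
    moreover have "0 \<le> C\<^sup>2 * K ^ l * ((fdim q)\<^sup>2 * (indicator {q. B q} q * ?E q))" using K0 by auto
    ultimately show ?thesis by (rule ord_eq_le_trans)
  qed
  have "(\<Sum>p\<in>{p \<in> young n. p 0 = k}. weight l p * indicator {p. real (p 1) \<le> R \<and> B (p \<circ> Suc)} p)
    = (\<Sum>q\<in>{q \<in> young m. q 0 \<le> k}. weight l (case_nat k q) * indicator {p. real (p 1) \<le> R \<and> B (p \<circ> Suc)} (case_nat k q))"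
    unfolding m by (rule sum_young_first_row[OF k])
  also have "\<dots> \<le> (\<Sum>q\<in>{q \<in> young m. q 0 \<le> k}. C\<^sup>2 * K ^ l * ((fdim q)\<^sup>2 * (indicator {q. B q} q * ?E q)))"
    using up by (intro sum_mono) auto
  also have "\<dots> \<le> (\<Sum>q\<in>young m. C\<^sup>2 * K ^ l * ((fdim q)\<^sup>2 * (indicator {q. B q} q * ?E q)))"
    using K0 finite_young by (intro sum_mono2) auto
  also have "\<dots> = C\<^sup>2 * K ^ l * planch m (\<lambda>q. indicator {q. B q} q * ?E q)"
    by (simp only: planch_def sum_distrib_left)
  also have "\<dots> \<le> C\<^sup>2 * K ^ l * sqrt (planch m (indicator {q. B q}) * (fact m * exp ((2 * b)\<^sup>2 * exp (2 * b * R) * (real m)\<^sup>2)))"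
  proof (rule mult_left_mono)
    have ind: "(\<lambda>q. (indicator {q. B q} q)\<^sup>2) = (indicator {q. B q} :: _ \<Rightarrow> real)" by (auto simp: indicator_def)
    have E2: "(\<lambda>q. (?E q)\<^sup>2) = (\<lambda>q. if real (q 0) \<le> R then exp (2 * b * csum q) else 0)"
      by (auto simp: power2_eq_square exp_add[symmetric])
    have "(planch m (\<lambda>q. indicator {q. B q} q * ?E q))\<^sup>2 \<le> planch m (indicator {q. B q}) * planch m (\<lambda>q. if real (q 0) \<le> R then exp (2 * b * csum q) else 0)"
      using planch_cauchy_schwarz[of m "indicator {q. B q}" ?E] unfolding ind E2 .
    also have "\<dots> \<le> planch m (indicator {q. B q}) * (fact m * exp ((2 * b)\<^sup>2 * exp (2 * b * R) * (real m)\<^sup>2))"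
      using planch_exp_content_bound[of "2 * b" R m] b0 R by (intro mult_left_mono planch_nonneg) auto
    finally show "planch m (\<lambda>q. indicator {q. B q} q * ?E q) \<le> sqrt (planch m (indicator {q. B q}) * (fact m * exp ((2 * b)\<^sup>2 * exp (2 * b * R) * (real m)\<^sup>2)))"
      by (rule real_le_rsqrt)
  qed (use K0 in auto)
  finally show ?thesis by (simp add: C_def K_def b_def)
qed

lemma pow_div_fact_le_exp:
  assumes "y \<ge> 0"
  shows "y ^ k / fact k \<le> exp (y::real)"
proof -
  have "(\<lambda>k. y ^ k / fact k) sums exp y" using exp_converges[of y] by (simp add: divide_inverse mult.commute)
  then show ?thesis using sum_le_suminf[of "\<lambda>k. y ^ k / fact k" "{k}"] assms by (simp add: sums_iff)
qed

text \<open>The first \<open>r\<close> rows are stripped one by one; each costs a squared binomial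
  coefficient, at most \<open>n^k / (fact k)^2\<close> after compensating the factorials. The rest
  is bounded by \<open>fdim_sq_le\<close>.\<close>

lemma fdim_sq_rows:
  assumes "p \<in> young n"
  shows "(fdim p)\<^sup>2 \<le> fact n * (\<Prod>i<r. real n ^ p i / (fact (p i))\<^sup>2)"
  using assms
proof (induction r arbitrary: p n)
  case 0
  then show ?case using fdim_sq_le by simp
next
  case (Suc r)
  define k where "k = p 0"
  define q where "q = p \<circ> Suc"
  define m where "m = n - k"
  have q: "q \<in> young m" and kn: "k \<le> n" and p: "p = case_nat k q"
    using young_tail[OF Suc.prems] by (simp_all add: q_def m_def k_def)
  have qk: "q 0 \<le> k" using young_antimono[OF Suc.prems, of 0 1] by (simp add: q_def k_def)
  have n: "n = k + m" using kn by (simp add: m_def)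
  have "(fdim p)\<^sup>2 \<le> (real (n choose k) * fdim q)\<^sup>2"
    using fdim_case_nat_le[OF q qk] fdim_pos[OF Suc.prems] unfolding p n by (intro power_mono) auto
  also have "\<dots> = (real (n choose k))\<^sup>2 * (fdim q)\<^sup>2" by (simp add: power_mult_distrib)
  also have "\<dots> \<le> (real (n choose k))\<^sup>2 * (fact m * (\<Prod>i<r. real m ^ q i / (fact (q i))\<^sup>2))"
    by (intro mult_left_mono Suc.IH[OF q]) auto
  also have "\<dots> \<le> (real (n choose k))\<^sup>2 * (fact m * (\<Prod>i<r. real n ^ q i / (fact (q i))\<^sup>2))"
    by (intro mult_left_mono prod_mono conjI divide_right_mono power_mono) (auto simp: m_def)
  also have "\<dots> = ((real (n choose k))\<^sup>2 * fact m) * (\<Prod>i<r. real n ^ q i / (fact (q i))\<^sup>2)" by simp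
  also have "\<dots> \<le> (fact n * (real n ^ k / (fact k)\<^sup>2)) * (\<Prod>i<r. real n ^ q i / (fact (q i))\<^sup>2)"
  proof (intro mult_right_mono prod_nonneg)
    have b: "real (n choose k) = fact n / (fact k * fact m)" using binomial_fact[OF kn, where 'a = real] by (simp add: m_def)
    have "fact n \<le> real n ^ k * fact m"
    proof -
      have "fact n div fact (n - k) \<le> n ^ k" by (rule fact_div_fact_le_pow[OF kn])
      moreover have "fact (n - k) dvd (fact n :: nat)" by (rule fact_dvd) simp
      ultimately have "(fact n :: nat) \<le> n ^ k * fact (n - k)" by (metis dvd_div_mult_self mult_le_mono1)
      then have "real (fact n) \<le> real (n ^ k * fact (n - k))" by (simp only: of_nat_le_iff)
      then show ?thesis by (simp add: m_def)
    qed
    then have "fact n * fact n / ((fact k)\<^sup>2 * fact m) \<le> fact n * (real n ^ k * fact m) / ((fact k)\<^sup>2 * fact m)"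
      by (intro divide_right_mono mult_left_mono) auto
    then show "(real (n choose k))\<^sup>2 * fact m \<le> fact n * (real n ^ k / (fact k)\<^sup>2)"
      unfolding b by (simp add: power_divide power_mult_distrib power2_eq_square)
  qed auto
  also have "\<dots> = fact n * (\<Prod>i<Suc r. real n ^ p i / (fact (p i))\<^sup>2)"
    by (simp add: prod.lessThan_Suc_shift k_def q_def del: prod.lessThan_Suc)
  finally show ?case .
qed

lemma csum_le_sq:
  assumes "p \<in> young n"
  shows "csum p \<le> (\<Sum>i<n. (real (p i))\<^sup>2) / 2"
proof -
  have "csum p = (\<Sum>i<n. \<Sum>j<p i. real_of_int (int j - int i))"
    unfolding csum_def by (rule box_sum_eq) (use young_zero[OF assms] in auto)
  also have "\<dots> \<le> (\<Sum>i<n. \<Sum>j<p i. real j)" by (intro sum_mono) auto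
  also have "\<dots> \<le> (\<Sum>i<n. (real (p i))\<^sup>2 / 2)"
  proof (rule sum_mono)
    fix i
    have "(\<Sum>j<k. real j) = real k * (real k - 1) / 2" for k by (induction k) (auto simp: field_simps)
    then show "(\<Sum>j<p i. real j) \<le> (real (p i))\<^sup>2 / 2" by (simp add: power2_eq_square right_diff_distrib)
  qed
  finally show ?thesis by (simp add: sum_divide_distrib)
qed

section \<open>Orders of magnitude and total weight for a fixed first row\<close>

definition Lsc :: "nat \<Rightarrow> nat \<Rightarrow> real" where
  "Lsc n l = 2 * real l / ln (real n)"

lemma sum_by_first_row:
  "(\<Sum>p\<in>young n. f p) = (\<Sum>k\<le>n. \<Sum>p\<in>{p \<in> young n. p 0 = k}. f p)"
  by (rule sum.group[symmetric]) (auto simp: finite_young young_le)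

lemma ph_total_eq_rows: "ph_total n l = (\<Sum>k\<le>n. row_total n l k)"
  unfolding ph_total_def row_total_def by (rule sum_by_first_row)

lemma row_total_nonneg: "row_total n l k \<ge> 0"
  unfolding row_total_def by (intro sum_nonneg weight_nonneg)

lemma row_total_le_ph_total: "k \<le> n \<Longrightarrow> row_total n l k \<le> ph_total n l"
  unfolding ph_total_eq_rows using row_total_nonneg by (intro member_le_sum) auto

text \<open>All sizes are compared with \<kappa>, of order \<open>n / ln n\<close>, through
  \<open>2 \<kappa> \<le> L \<le> 6 \<kappa>\<close>. The last estimate is the origin of 64: as
  \<open>K \<ge> L^2 / 16\<close>, it makes the remainder factor in the exponential moment at most
  \<open>n^(1/4)\<close>.\<close>

lemma scale_facts:
  assumes \<theta>: "\<theta> > 0"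
  shows "eventually (\<lambda>n. \<forall>l k. \<theta> * real n \<le> real l \<and> real l \<le> 3 * \<theta> * real n \<and> Lsc n l / 2 \<le> real k \<and> real k \<le> 2 * Lsc n l \<longrightarrow>
     1 \<le> k \<and> 2 * k \<le> n \<and> 6 * sqrt (real n) \<le> real k \<and> (real k)\<^sup>2 / 4 \<le> row_content k (n - k) \<and>
     4 * real (n - k) \<le> row_content k (n - k) \<and> 0 < row_content k (n - k) \<and> 0 < Lsc n l \<and>
     real (n - k) / real k \<le> ln (real n) / \<theta> \<and>
     real (n - k) * real l / row_content k (n - k) \<le> 12 * (ln (real n))\<^sup>2 / \<theta> \<and>
     2 * real l / row_content k (n - k) * (Lsc n l / 64) \<le> ln (real n) / 4) sequentially"
proof -
  have "eventually (\<lambda>n. ln (real n) \<ge> 1) sequentially" by real_asymp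
  moreover have "eventually (\<lambda>n. 24 * (\<theta> * real n / ln (real n)) \<le> real n) sequentially" using \<theta> by real_asymp
  moreover have "eventually (\<lambda>n. 6 * sqrt (real n) \<le> \<theta> * real n / ln (real n)) sequentially" using \<theta> by real_asymp
  moreover have "eventually (\<lambda>n. 16 * real n \<le> (\<theta> * real n / ln (real n))\<^sup>2) sequentially" using \<theta> by real_asymp
  moreover have "eventually (\<lambda>n. 4 \<le> \<theta> * real n / ln (real n)) sequentially" using \<theta> by real_asymp
  ultimately show ?thesis
  proof eventually_elim
    case (elim n)
    define x where "x = real n"
    define y where "y = ln x"
    define \<kappa> where "\<kappa> = \<theta> * x / y"
    have y: "y \<ge> 1" and k24: "24 * \<kappa> \<le> x" and k6: "6 * sqrt x \<le> \<kappa>" and k16: "16 * x \<le> \<kappa>\<^sup>2" and k4: "4 \<le> \<kappa>"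
      using elim by (simp_all add: x_def y_def \<kappa>_def)
    show ?case
    proof (intro allI impI)
      fix l k :: nat
      assume a: "\<theta> * real n \<le> real l \<and> real l \<le> 3 * \<theta> * real n \<and> Lsc n l / 2 \<le> real k \<and> real k \<le> 2 * Lsc n l"
      define L where "L = Lsc n l"
      define m where "m = n - k"
      define K where "K = row_content k m"
      have Ly: "L * y = 2 * real l" using y by (simp add: L_def Lsc_def y_def x_def)
      have L1: "2 * \<kappa> \<le> L" unfolding \<kappa>_def L_def Lsc_def x_def[symmetric] y_def[symmetric]
        using a y by (simp add: x_def divide_right_mono)
      have L2: "L \<le> 6 * \<kappa>" unfolding \<kappa>_def L_def Lsc_def x_def[symmetric] y_def[symmetric]
        using a y by (simp add: x_def divide_right_mono)
      have kk: "\<kappa> \<le> real k" "real k \<le> 12 * \<kappa>" "L / 2 \<le> real k" using a L1 L2 by (auto simp: L_def)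
      have k1: "real k \<ge> 4" using kk k4 by simp
      have kn: "2 * real k \<le> x" using kk k24 by simp
      have mx: "real m \<le> x" by (simp add: m_def x_def)
      have sqk: "\<kappa>\<^sup>2 \<le> (real k)\<^sup>2" using kk k4 by (intro power_mono) auto
      have "4 * real k \<le> (real k)\<^sup>2" using mult_right_mono[OF k1, of "real k"] by (simp add: power2_eq_square)
      moreover have "K = (real k)\<^sup>2 / 2 - real k / 2 - real m"
        by (simp add: K_def row_content_def power2_eq_square right_diff_distrib diff_divide_distrib)
      ultimately have K4: "(real k)\<^sup>2 / 4 \<le> K" "4 * real m \<le> K"
        using k16 sqk mx by linarith+
      have k0: "(real k)\<^sup>2 > 0" using k1 by simp
      have K0: "K > 0" using K4(1) k0 by linarith
      have th: "\<theta> * x = \<kappa> * y" using y by (simp add: \<kappa>_def)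
      have f1: "real m / real k \<le> y / \<theta>"
      proof -
        have "real m / real k \<le> x / \<kappa>" using mx kk k4 by (intro frac_le) auto
        also have "x / \<kappa> = y / \<theta>" using th \<theta> k4 by (simp add: field_simps)
        finally show ?thesis .
      qed
      have x0: "x > 0" using kn k1 by simp
      have f2: "real m * real l / K \<le> 12 * y\<^sup>2 / \<theta>"
      proof -
        have kK: "\<kappa>\<^sup>2 / 4 \<le> K" using K4(1) sqk by linarith
        have "real m * real l / K \<le> x * (3 * \<theta> * x) / (\<kappa>\<^sup>2 / 4)"
          by (intro frac_le mult_mono kK) (use mx a \<theta> k4 x0 in \<open>auto simp: x_def\<close>)
        also have "\<dots> = 12 * (\<theta> * x)\<^sup>2 / \<theta> / \<kappa>\<^sup>2" using \<theta> by (simp add: power2_eq_square)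
        also have "\<dots> = 12 * y\<^sup>2 / \<theta>" unfolding th using k4 by (simp add: power_mult_distrib)
        finally show ?thesis .
      qed
      have L0: "L > 0" using L1 k4 by simp
      have f3: "2 * real l / K * (L / 64) \<le> y / 4"
      proof -
        have "(L / 2)\<^sup>2 \<le> (real k)\<^sup>2" using kk L0 by (intro power_mono) auto
        then have LK: "L\<^sup>2 / 16 \<le> K" using K4(1) by (simp add: power_divide)
        have "2 * real l / K * (L / 64) = L * y * L / 64 / K" unfolding Ly[symmetric] by simp
        also have "\<dots> \<le> L * y * L / 64 / (L\<^sup>2 / 16)" using LK L0 y K0 by (intro divide_left_mono) auto
        also have "\<dots> = y / 4" using L0 by (simp add: power2_eq_square)
        finally show ?thesis .
      qed
      have "1 \<le> k" "2 * k \<le> n" "6 * sqrt (real n) \<le> real k" using k1 kn k6 kk by (auto simp: x_def)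
      then show "1 \<le> k \<and> 2 * k \<le> n \<and> 6 * sqrt (real n) \<le> real k \<and> (real k)\<^sup>2 / 4 \<le> row_content k (n - k) \<and>
        4 * real (n - k) \<le> row_content k (n - k) \<and> 0 < row_content k (n - k) \<and> 0 < Lsc n l \<and>
        real (n - k) / real k \<le> ln (real n) / \<theta> \<and>
        real (n - k) * real l / row_content k (n - k) \<le> 12 * (ln (real n))\<^sup>2 / \<theta> \<and>
        2 * real l / row_content k (n - k) * (Lsc n l / 64) \<le> ln (real n) / 4"
        using K4 K0 L0 f1 f2 f3 by (simp add: K_def m_def L_def x_def y_def)
    qed
  qed
qed

text \<open>Each condition fails with probability at most \<open>1 / 4\<close>: the first row by
  \<open>planch_outlier\<close>, the content sum by Chebyshev from its exact second moment.\<close>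

lemma planch_moderate_mass:
  "eventually (\<lambda>m. \<forall>k. 6 * sqrt (real m) \<le> real k \<longrightarrow> planch m (indicator {q. 2 * q 0 \<le> k \<and> - 2 * real m \<le> csum q}) \<ge> fact m / 2) sequentially"
proof -
  obtain c where c: "c > 0" "eventually (\<lambda>m. planch m (indicator {p. outlier ((2 + 1) * sqrt (real m)) p}) \<le> fact m * exp (- c * sqrt (real m))) sequentially"
    by (rule planch_outlier[of 1]) auto
  have "eventually (\<lambda>m. exp (- c * sqrt (real m)) \<le> 1 / 4) sequentially" using c(1) by real_asymp
  then show ?thesis using c(2) eventually_ge_at_top[of 1]
  proof eventually_elim
    case (elim m)
    let ?O = "{p. outlier ((2 + 1) * sqrt (real m)) p}"
    let ?N = "{q. csum q < - 2 * real m}"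
    have O: "planch m (indicator ?O) \<le> fact m * (1 / 4)"
      by (rule order_trans[OF elim(2) mult_left_mono[OF elim(1)]]) simp
    have N: "planch m (indicator ?N) \<le> fact m * (1 / 4)"
    proof -
      have m0: "(real m)\<^sup>2 > 0" using elim(3) by simp
      have "4 * (real m)\<^sup>2 * planch m (indicator ?N) = planch m (\<lambda>q. 4 * (real m)\<^sup>2 * indicator ?N q)"
        by (rule planch_cmult[symmetric])
      also have "\<dots> \<le> planch m (\<lambda>q. (csum q)\<^sup>2)"
      proof (rule planch_mono)
        fix q
        show "4 * (real m)\<^sup>2 * indicator ?N q \<le> (csum q)\<^sup>2"
        proof (cases "csum q < - 2 * real m")
          case True
          then have "(2 * real m)\<^sup>2 \<le> (- csum q)\<^sup>2" by (intro power_mono) auto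
          then show ?thesis using True by (simp add: power_mult_distrib)
        qed simp
      qed
      also have "\<dots> = fact m * (real m * (real m - 1) / 2)" by (rule planch_content_sq)
      also have "\<dots> \<le> fact m * ((real m)\<^sup>2)"
      proof (intro mult_left_mono)
        have "0 \<le> real m * real m" "0 \<le> real m" by simp_all
        then show "real m * (real m - 1) / 2 \<le> (real m)\<^sup>2" by (simp add: power2_eq_square right_diff_distrib, linarith)
      qed simp
      finally show ?thesis using m0 by (simp add: field_simps)
    qed
    show ?case
    proof (intro allI impI)
      fix k :: nat assume k: "6 * sqrt (real m) \<le> real k"
      let ?G = "{q. 2 * q 0 \<le> k \<and> - 2 * real m \<le> csum q}"
      have "fact m = planch m (indicator UNIV)" using planch_one[of m] by (simp add: indicator_def)
      also have "\<dots> \<le> planch m (indicator ?G) + planch m (indicator (?O \<union> ?N))"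
      proof (rule planch_union)
        fix q assume "q \<in> young m"
        show "q \<in> ?G \<or> q \<in> ?O \<union> ?N"
        proof (cases "outlier ((2 + 1) * sqrt (real m)) q")
          case False
          then have "real (q 0) \<le> 3 * sqrt (real m)" by (auto simp: outlier_def not_less)
          then have "2 * real (q 0) \<le> real k" using k by linarith
          then show ?thesis by auto
        qed auto
      qed
      also have "planch m (indicator (?O \<union> ?N)) \<le> planch m (indicator ?O) + planch m (indicator ?N)"
        by (rule planch_union) auto
      finally show "planch m (indicator ?G) \<ge> fact m / 2" using O N by linarith
    qed
  qed
qed

text \<open>A bracket around \<open>2 \<theta> n\<close>; the estimates below are uniform over
  it.\<close>

definition lrange :: "real \<Rightarrow> nat \<Rightarrow> nat \<Rightarrow> bool" where
  "lrange \<theta> n l \<longleftrightarrow> \<theta> * real n \<le> real l \<and> real l \<le> 3 * \<theta> * real n"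

lemma eventually_half:
  assumes "eventually P sequentially"
  shows "eventually (\<lambda>n. \<forall>m. n \<le> 2 * m \<longrightarrow> P m) sequentially"
proof -
  obtain N where N: "\<And>m. m \<ge> N \<Longrightarrow> P m" using assms by (auto simp: eventually_sequentially)
  show ?thesis unfolding eventually_sequentially by (rule exI[of _ "2 * N"]) (use N in auto)
qed

text \<open>For first rows of order \<open>L\<close> the total losses one only a factor
  \<open>exp (O((ln n)^2))\<close> against the leading term, which is negligible beside
  \<open>exp (c sqrt n)\<close>.\<close>

lemma row_total_ge:
  assumes \<theta>: "\<theta> > 0"
  shows "eventually (\<lambda>n. \<forall>l k. lrange \<theta> n l \<and> Lsc n l / 2 \<le> real k \<and> real k \<le> 2 * Lsc n l \<longrightarrow>
     (real (n choose k))\<^sup>2 * fact (n - k) * row_content k (n - k) ^ l * exp (- 1 - 4 * (ln (real n) / \<theta>) - 4 * (12 * (ln (real n))\<^sup>2 / \<theta>)) \<le> row_total n l k) sequentially"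
  using scale_facts[OF \<theta>] eventually_half[OF planch_moderate_mass]
proof eventually_elim
  case (elim n)
  show ?case
  proof (intro allI impI)
    fix l k assume a: "lrange \<theta> n l \<and> Lsc n l / 2 \<le> real k \<and> real k \<le> 2 * Lsc n l"
    define m where "m = n - k"
    have sf: "1 \<le> k" "2 * k \<le> n" "6 * sqrt (real n) \<le> real k" "4 * real m \<le> row_content k m" "0 < row_content k m"
      "real m / real k \<le> ln (real n) / \<theta>" "real m * real l / row_content k m \<le> 12 * (ln (real n))\<^sup>2 / \<theta>"
      using elim(1)[rule_format, of l k] a by (auto simp: lrange_def m_def)
    have "n \<le> 2 * m" using sf(2) by (simp add: m_def)
    moreover have "6 * sqrt (real m) \<le> real k"
      using sf(3) by (rule order_trans[rotated]) (simp add: m_def)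
    ultimately have mass: "planch m (indicator {q. 2 * q 0 \<le> k \<and> - 2 * real m \<le> csum q}) \<ge> fact m / 2" using elim(2) by blast
    have kn: "k \<le> n" using sf(2) by simp
    have "(real (n choose k))\<^sup>2 * fact m * row_content k m ^ l * exp (- 1 - 4 * (ln (real n) / \<theta>) - 4 * (12 * (ln (real n))\<^sup>2 / \<theta>))
      \<le> (real (n choose k))\<^sup>2 * fact m * row_content k m ^ l * exp (- 1 - 4 * real m / real k - 4 * real m * real l / row_content k m)"
      using sf by (intro mult_left_mono) auto
    also have "\<dots> \<le> row_total n l k" by (rule row_total_lower[OF sf(1) kn m_def sf(4,5) mass])
    finally show "(real (n choose k))\<^sup>2 * fact (n - k) * row_content k (n - k) ^ l * exp (- 1 - 4 * (ln (real n) / \<theta>) - 4 * (12 * (ln (real n))\<^sup>2 / \<theta>)) \<le> row_total n l k"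
      by (simp add: m_def)
  qed
qed

text \<open>A rare event for the Plancherel measure stays rare for the remaining rows, because for every
  fixed first row of the right order both measures differ by a subexponential factor.\<close>

lemma rare_tail_event:
  assumes \<theta>: "\<theta> > 0" and B: "rare B"
  shows "\<exists>c>0. eventually (\<lambda>n. \<forall>l. lrange \<theta> n l \<longrightarrow>
     (\<Sum>p\<in>young n. weight l p * indicator {p. Lsc n l / 2 \<le> real (p 0) \<and> real (p 0) \<le> 2 * Lsc n l \<and> real (p 1) \<le> Lsc n l / 64 \<and> B (n - p 0) (p \<circ> Suc)} p)
     \<le> exp (- c * sqrt (real n)) * ph_total n l) sequentially"
proof -
  obtain c0 where c0: "c0 > 0" "eventually (\<lambda>m. planch m (indicator {p. B m p}) \<le> fact m * exp (- c0 * sqrt (real m))) sequentially"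
    using B by (auto simp: rare_def)
  \<comment> \<open>Cauchy-Schwarz halves the rate \<open>c0\<close>, and
    \<open>sqrt m \<ge> sqrt n / 2\<close> halves it again; half of the remaining
    \<open>c0 / 4\<close> absorbs the subexponential errors.\<close>
  define c where "c = c0 / 8"
  have c: "c > 0" using c0(1) by (simp add: c_def)
  \<comment> \<open>The decisive comparison: the exponential moment contributes
    \<open>n^(1/4)\<close> times powers of \<open>ln n\<close>, which is
    \<open>o(sqrt n)\<close>.\<close>
  have ev: "eventually (\<lambda>n. (4 * (12 * (ln (real n))\<^sup>2 / \<theta>)\<^sup>2 * exp (ln (real n) / 4)) / 2
      + (1 + 4 * (ln (real n) / \<theta>) + 4 * (12 * (ln (real n))\<^sup>2 / \<theta>)) \<le> c * sqrt (real n)) sequentially"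
    using \<theta> c by real_asymp
  have "eventually (\<lambda>n. \<forall>l. lrange \<theta> n l \<longrightarrow>
     (\<Sum>p\<in>young n. weight l p * indicator {p. Lsc n l / 2 \<le> real (p 0) \<and> real (p 0) \<le> 2 * Lsc n l \<and> real (p 1) \<le> Lsc n l / 64 \<and> B (n - p 0) (p \<circ> Suc)} p)
     \<le> exp (- c * sqrt (real n)) * ph_total n l) sequentially"
    using scale_facts[OF \<theta>] row_total_ge[OF \<theta>] ev eventually_half[OF c0(2)]
  proof eventually_elim
    case (elim n)
    show ?case
    proof (intro allI impI)
      fix l assume l: "lrange \<theta> n l"
      let ?I = "{p. Lsc n l / 2 \<le> real (p 0) \<and> real (p 0) \<le> 2 * Lsc n l \<and> real (p 1) \<le> Lsc n l / 64 \<and> B (n - p 0) (p \<circ> Suc)}"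
      have row: "(\<Sum>p\<in>{p \<in> young n. p 0 = k}. weight l p * indicator ?I p) \<le> exp (- c * sqrt (real n)) * row_total n l k" if kn: "k \<le> n" for k
      proof (cases "Lsc n l / 2 \<le> real k \<and> real k \<le> 2 * Lsc n l")
        case False
        then have "(\<Sum>p\<in>{p \<in> young n. p 0 = k}. weight l p * indicator ?I p) = 0"
          by (intro sum.neutral) (auto simp: indicator_def)
        then show ?thesis using row_total_nonneg by simp
      next
        case True
        define m where "m = n - k"
        define K where "K = row_content k m"
        define R where "R = Lsc n l / 64"
        have sf: "2 * k \<le> n" "0 < K" "0 < Lsc n l" "real m * real l / K \<le> 12 * (ln (real n))\<^sup>2 / \<theta>" "2 * real l / K * R \<le> ln (real n) / 4"
          using elim(1)[rule_format, of l k] True l by (auto simp: lrange_def m_def K_def R_def)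
        have nm: "n \<le> 2 * m" using sf(1) by (simp add: m_def)
        have PB: "planch m (indicator {q. B m q}) \<le> fact m * exp (- c0 * sqrt (real m))" using elim(4) nm by blast
        define E where "E = (2 * real l / K)\<^sup>2 * exp (2 * real l / K * R) * (real m)\<^sup>2"
        have E: "E \<le> 4 * (12 * (ln (real n))\<^sup>2 / \<theta>)\<^sup>2 * exp (ln (real n) / 4)"
        proof -
          have "E = 4 * (real m * real l / K)\<^sup>2 * exp (2 * real l / K * R)"
            by (simp add: E_def power_mult_distrib power_divide)
          also have "\<dots> \<le> 4 * (12 * (ln (real n))\<^sup>2 / \<theta>)\<^sup>2 * exp (ln (real n) / 4)"
            using sf by (intro mult_mono power_mono) auto
          finally show ?thesis .
        qed
        have "sqrt (real n / 4) \<le> sqrt (real m)" using nm by (intro real_sqrt_le_mono) simp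
        then have sq: "sqrt (real n) / 2 \<le> sqrt (real m)" by (simp add: real_sqrt_divide)
        have "(\<Sum>p\<in>{p \<in> young n. p 0 = k}. weight l p * indicator ?I p) \<le> (\<Sum>p\<in>{p \<in> young n. p 0 = k}. weight l p * indicator {p. real (p 1) \<le> R \<and> B m (p \<circ> Suc)} p)"
          by (intro sum_mono mult_left_mono weight_nonneg) (auto simp: indicator_def R_def m_def)
        also have "\<dots> \<le> (real (n choose k))\<^sup>2 * K ^ l * sqrt (planch m (indicator {q. B m q}) * (fact m * exp E))"
          unfolding E_def K_def by (rule row_bad_upper[OF kn m_def]) (use sf in \<open>auto simp: K_def R_def\<close>)
        also have "\<dots> \<le> (real (n choose k))\<^sup>2 * K ^ l * sqrt ((fact m * exp (- c0 * sqrt (real m))) * (fact m * exp E))"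
          using PB sf by (intro mult_left_mono real_sqrt_le_mono mult_right_mono) auto
        also have "(fact m * exp (- c0 * sqrt (real m))) * (fact m * exp E) = (fact m * exp ((E - c0 * sqrt (real m)) / 2))\<^sup>2"
          by (simp add: power2_eq_square exp_add[symmetric] mult.assoc mult.left_commute)
        also have "sqrt \<dots> = fact m * exp ((E - c0 * sqrt (real m)) / 2)" by simp
        also have "(real (n choose k))\<^sup>2 * K ^ l * (fact m * exp ((E - c0 * sqrt (real m)) / 2)) \<le>
           (real (n choose k))\<^sup>2 * K ^ l * (fact m * (exp (- c * sqrt (real n)) * exp (- 1 - 4 * (ln (real n) / \<theta>) - 4 * (12 * (ln (real n))\<^sup>2 / \<theta>))))"
        proof (intro mult_left_mono)
          have "c0 * (sqrt (real n) / 2) \<le> c0 * sqrt (real m)" using sq c0(1) by (intro mult_left_mono) auto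
          then have "2 * c * sqrt (real n) \<le> c0 * sqrt (real m) / 2" by (simp add: c_def)
          moreover have "(E - c0 * sqrt (real m)) / 2 = E / 2 - c0 * sqrt (real m) / 2" by (simp add: diff_divide_distrib)
          moreover have "E / 2 \<le> (4 * (12 * (ln (real n))\<^sup>2 / \<theta>)\<^sup>2 * exp (ln (real n) / 4)) / 2"
            using E by (intro divide_right_mono) auto
          ultimately have "(E - c0 * sqrt (real m)) / 2 \<le> - c * sqrt (real n) + (- 1 - 4 * (ln (real n) / \<theta>) - 4 * (12 * (ln (real n))\<^sup>2 / \<theta>))"
            using elim(3) by linarith
          then show "exp ((E - c0 * sqrt (real m)) / 2) \<le> exp (- c * sqrt (real n)) * exp (- 1 - 4 * (ln (real n) / \<theta>) - 4 * (12 * (ln (real n))\<^sup>2 / \<theta>))"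
            unfolding exp_add[symmetric] by (simp only: exp_le_cancel_iff)
        qed (use sf in auto)
        also have "\<dots> = exp (- c * sqrt (real n)) * ((real (n choose k))\<^sup>2 * fact m * K ^ l * exp (- 1 - 4 * (ln (real n) / \<theta>) - 4 * (12 * (ln (real n))\<^sup>2 / \<theta>)))"
          by (simp only: mult_ac)
        also have "\<dots> \<le> exp (- c * sqrt (real n)) * row_total n l k"
          using elim(2)[rule_format, of l k] l True by (intro mult_left_mono) (auto simp: m_def K_def)
        finally show ?thesis .
      qed
      have "(\<Sum>p\<in>young n. weight l p * indicator ?I p) = (\<Sum>k\<le>n. \<Sum>p\<in>{p \<in> young n. p 0 = k}. weight l p * indicator ?I p)"
        by (rule sum_by_first_row)
      also have "\<dots> \<le> (\<Sum>k\<le>n. exp (- c * sqrt (real n)) * row_total n l k)"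
        using row by (intro sum_mono) auto
      also have "\<dots> = exp (- c * sqrt (real n)) * ph_total n l" by (simp add: ph_total_eq_rows sum_distrib_left)
      finally show "(\<Sum>p\<in>young n. weight l p * indicator ?I p) \<le> exp (- c * sqrt (real n)) * ph_total n l" .
    qed
  qed
  then show ?thesis using c0(1) by (intro exI[of _ c]) (auto simp: c_def)
qed

section \<open>Concentration of the first row\<close>

text \<open>If the large rows are \<open>a\<^sub>i L\<close>, the weight is \<open>exp (l (- 2 \<Sum> a\<^sub>i + ln \<Sum> a\<^sub>i\<^sup>2))\<close> up to a common factor. As
  \<open>\<Sum> a\<^sub>i\<^sup>2 \<le> a\<^sub>1 \<Sum> a\<^sub>i\<close>, the exponent stays below \<open>- 2 l\<close>, with equality only for a single row \<open>a\<^sub>1 = 1\<close>.\<close>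

lemma entropy_maximiser_stable:
  fixes t \<eta> \<delta> a a1 q2 :: real
  assumes t: "0 < t" "t \<le> 1 / 100" and \<eta>: "0 \<le> \<eta>" "\<eta> \<le> t\<^sup>2" and \<delta>: "0 < \<delta>" "\<delta> \<le> t ^ 4"
    and a: "0 \<le> a" and q: "0 \<le> q2" "q2 \<le> a\<^sup>2" "q2 \<le> a1 * a" and a1: "0 \<le> a1" "a1 \<le> a"
    and big: "- 2 * (1 - \<eta>) * a + ln (q2 + \<delta>) > - 2 - t\<^sup>2"
  shows "\<bar>a1 - 1\<bar> \<le> 17 * t" "a \<le> 1 + 8 * t"
proof -
  define s where "s = t\<^sup>2"
  have st: "s = t * t" by (simp add: s_def power2_eq_square)
  have s: "0 < s" "s \<le> t / 100" using t mult_left_mono[of t "1/100" t] by (auto simp: st)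
  have \<eta>s: "\<eta> \<le> s" using \<eta> by (simp add: s_def)
  have s1: "s \<le> 1 / 10000" using s t by linarith
  have \<delta>s: "\<delta> \<le> s\<^sup>2" using \<delta> by (simp add: s_def power_mult[symmetric])
  \<comment> \<open>The bound \<open>q2 \<le> a^2\<close> gives \<open>u \<le> a + s\<close>, which
    reduces the two-variable exponent to \<open>ln v - v\<close> in the single variable
    \<open>v = (1 - \<eta>) u\<close>, maximal at 1.\<close>
  define u where "u = sqrt (q2 + \<delta>)"
  have u0: "u > 0" using q \<delta> by (simp add: u_def)
  have u2: "u\<^sup>2 = q2 + \<delta>" using q \<delta> by (simp add: u_def)
  have "0 \<le> 2 * a * s" using a s by simp
  then have "u\<^sup>2 \<le> (a + s)\<^sup>2" using u2 q(2) \<delta>s unfolding power2_sum by linarith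
  then have ua: "u \<le> a + s" by (rule power2_le_imp_le) (use a s in simp)
  have lu: "ln (q2 + \<delta>) = 2 * ln u" unfolding u2[symmetric] using u0 by (simp add: ln_realpow)
  define v where "v = (1 - \<eta>) * u"
  have e1: "1 - \<eta> > 0" using \<eta>s s1 by linarith
  have v0: "v > 0" using e1 u0 by (simp add: v_def)
  have lv: "ln v = ln (1 - \<eta>) + ln u" using e1 u0 by (simp add: v_def ln_mult)
  have le: "- 2 * \<eta> \<le> ln (1 - \<eta>)"
  proof -
    have "- \<eta> - 2 * \<eta>\<^sup>2 \<le> ln (1 - \<eta>)" using \<eta> \<eta>s s1 by (intro ln_one_minus_pos_lower_bound) auto
    moreover have "2 * \<eta>\<^sup>2 \<le> \<eta>" using mult_left_mono[of "2 * \<eta>" 1 \<eta>] \<eta> \<eta>s s1 by (simp add: power2_eq_square)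
    ultimately show ?thesis by linarith
  qed
  have main: "(1 - \<eta>) * a \<le> 1 + s / 2 + ln u" using big unfolding lu s_def[symmetric] by (simp add: algebra_simps)
  have "(1 - \<eta>) * u \<le> (1 - \<eta>) * (a + s)" using ua e1 by (intro mult_left_mono) auto
  also have "\<dots> \<le> (1 - \<eta>) * a + s" using \<eta> s by (simp add: distrib_left left_diff_distrib)
  finally have "v \<le> (1 - \<eta>) * a + s" by (simp add: v_def)
  then have h: "v - 1 - ln v \<le> 4 * s" using main lv le \<eta>s s(1) by linarith
  \<comment> \<open>A quadratic lower bound for \<open>v - 1 - ln v\<close> valid for all
    \<open>v > 0\<close>, from \<open>ln x \<le> x - 1\<close> at \<open>x = sqrt v\<close>; it
    turns a deficit of order \<open>t^2\<close> into a deviation of order \<open>t\<close>.\<close>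
  have "(sqrt v - 1)\<^sup>2 \<le> v - 1 - ln v"
  proof -
    have "ln v = 2 * ln (sqrt v)" using v0 by (simp add: ln_sqrt)
    also have "\<dots> \<le> 2 * (sqrt v - 1)" using v0 by (intro mult_left_mono ln_le_minus_one) auto
    finally have "ln v \<le> 2 * sqrt v - 2" by simp
    moreover have "(sqrt v - 1)\<^sup>2 = v - 2 * sqrt v + 1" using v0 by (simp add: power2_diff)
    ultimately show ?thesis by linarith
  qed
  also have "\<dots> \<le> (2 * t)\<^sup>2" using h by (simp add: s_def power_mult_distrib)
  finally have "\<bar>sqrt v - 1\<bar> \<le> \<bar>2 * t\<bar>" by (rule abs_le_square_iff[THEN iffD2])
  then have sv: "1 - 2 * t \<le> sqrt v" "sqrt v \<le> 1 + 2 * t" using t by auto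
  have vv: "v = sqrt v * sqrt v" using v0 by simp
  have "(1 - 2 * t) * (1 - 2 * t) \<le> sqrt v * sqrt v" using sv t v0 by (intro mult_mono) auto
  then have v1: "1 - 4 * t \<le> v" unfolding vv[symmetric] using s by (simp add: algebra_simps st)
  have "sqrt v * sqrt v \<le> (1 + 2 * t) * (1 + 2 * t)" using sv t v0 by (intro mult_mono) auto
  moreover have "(1 + 2 * t) * (1 + 2 * t) = 1 + 4 * t + 4 * s" by (simp add: st algebra_simps)
  ultimately have v2: "v \<le> 1 + 5 * t" unfolding vv[symmetric] using s t by linarith
  have inv: "x \<le> y * (1 + 2 * s)" if "(1 - \<eta>) * x \<le> y" "y \<ge> 0" for x y
  proof -
    have "x \<le> y / (1 - \<eta>)" using that e1 by (simp add: field_simps)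
    also have "\<dots> = y * (1 / (1 - \<eta>))" by simp
    also have "\<dots> \<le> y * (1 + 2 * s)"
    proof (rule mult_left_mono[OF _ that(2)])
      have "s * s \<le> s / 100" using s s1 mult_left_mono[of s "1/100" s] by simp
      moreover have "\<eta> * (1 + 2 * s) \<le> s * (1 + 2 * s)" using \<eta>s s by (intro mult_right_mono) auto
      ultimately have "\<eta> * (1 + 2 * s) \<le> 2 * s" using s unfolding distrib_left by linarith
      then have "1 \<le> (1 + 2 * s) * (1 - \<eta>)" by (simp add: algebra_simps)
      then show "1 / (1 - \<eta>) \<le> 1 + 2 * s" using e1 by (simp add: field_simps)
    qed
    finally show ?thesis .
  qed
  have ts: "t * s \<le> t / 100" "0 \<le> t * s" using t s s1 mult_left_mono[of s "1/100" t] by auto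
  have u1: "1 - 4 * t \<le> u"
  proof -
    have "v \<le> u" using \<eta> u0 by (simp add: v_def left_diff_distrib)
    then show ?thesis using v1 by linarith
  qed
  have "u \<le> (1 + 5 * t) * (1 + 2 * s)" by (rule inv) (use v2 t in \<open>auto simp: v_def\<close>)
  also have "\<dots> = 1 + 5 * t + 2 * s + 10 * (t * s)" by (simp add: algebra_simps)
  also have "\<dots> \<le> 1 + 6 * t" using ts s t by linarith
  finally have u3: "u \<le> 1 + 6 * t" .
  have "ln u \<le> 6 * t" using u3 u0 ln_le_minus_one[of u] by linarith
  then have "(1 - \<eta>) * a \<le> 1 + 7 * t" using main s by linarith
  then have "a \<le> (1 + 7 * t) * (1 + 2 * s)" using t by (intro inv) auto
  also have "\<dots> = 1 + 7 * t + 2 * s + 14 * (t * s)" by (simp add: algebra_simps)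
  also have "\<dots> \<le> 1 + 8 * t" using ts s t by linarith
  finally show a8: "a \<le> 1 + 8 * t" .
  \<comment> \<open>Only now does \<open>q2 \<le> a1 * a\<close> enter: with both \<open>q2\<close>
    and \<open>a\<close> near 1 it forces the largest row \<open>a1\<close> to be near 1.\<close>
  have "(1 - 4 * t)\<^sup>2 \<le> u\<^sup>2" using u1 t by (intro power_mono) auto
  then have "1 - 8 * t \<le> q2 + \<delta>" unfolding u2 using s by (simp add: power2_eq_square algebra_simps st)
  moreover have "\<delta> \<le> t"
  proof -
    have "s\<^sup>2 \<le> s" using s s1 mult_left_mono[of s 1 s] by (simp add: power2_eq_square)
    then show ?thesis using \<delta>s s t by linarith
  qed
  ultimately have q9: "1 - 9 * t \<le> a1 * a" using q by linarith
  have "a1 * a \<le> a1 * (1 + 8 * t)" using a8 a1 by (intro mult_left_mono) auto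
  then have "1 - 9 * t \<le> a1 * (1 + 8 * t)" using q9 by linarith
  moreover have "(1 - 17 * t) * (1 + 8 * t) \<le> 1 - 9 * t" using s by (simp add: algebra_simps st)
  ultimately have "(1 - 17 * t) * (1 + 8 * t) \<le> a1 * (1 + 8 * t)" by linarith
  then have "1 - 17 * t \<le> a1" using t by (simp add: mult_le_cancel_right)
  then show "\<bar>a1 - 1\<bar> \<le> 17 * t" using a1 a8 t by (simp add: abs_le_iff)
qed

text \<open>Only the order \<open>- k ln n\<close> of the exponent matters, so \<open>fact k\<close>
  is bounded crudely by \<open>n^k\<close>; the other loss comes from
  \<open>fact n / fact m \<ge> m^k\<close>. For \<open>k\<close> of order \<open>n / ln n\<close>
  both losses are \<open>exp (o(n))\<close>.\<close>

lemma binom_sq_fact_lower: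
  assumes k: "1 \<le> k" "2 * k \<le> n"
  shows "fact n * exp (- real k * ln (real n) - 2 * (real k)\<^sup>2 / real n) \<le> (real (n choose k))\<^sup>2 * fact (n - k)"
proof -
  define m where "m = n - k"
  have n: "n = m + k" and n0: "real n > 0" using k by (auto simp: m_def)
  have fm: "real m ^ k * fact m \<le> fact n" unfolding n
  proof (induction k)
    case (Suc k)
    have "real m ^ Suc k * fact m = real m * (real m ^ k * fact m)" by simp
    also have "\<dots> \<le> real (Suc (m + k)) * fact (m + k)" using Suc by (intro mult_mono) auto
    finally show ?case by simp
  qed simp
  define x where "x = real k / real n"
  have x: "0 \<le> x" "x \<le> 1 / 2" using k n0 by (auto simp: x_def field_simps)
  have "- 2 * x \<le> - x - 2 * x\<^sup>2" using mult_left_mono[OF x(2) x(1)] by (simp add: power2_eq_square)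
  also have "\<dots> \<le> ln (1 - x)" using x by (rule ln_one_minus_pos_lower_bound)
  finally have "exp (- 2 * x) \<le> exp (ln (1 - x))" by (simp only: exp_le_cancel_iff)
  then have ex: "exp (- 2 * x) \<le> 1 - x" using x by simp
  have "real m = real n * (1 - x)" using n0 k by (simp add: x_def m_def right_diff_distrib of_nat_diff)
  then have "real n * exp (- 2 * x) \<le> real m" using ex n0 by simp
  then have "(real n * exp (- 2 * x)) ^ k \<le> real m ^ k" by (intro power_mono) auto
  moreover have "(real n * exp (- 2 * x)) ^ k = real n ^ k * exp (- 2 * (real k)\<^sup>2 / real n)"
    by (simp add: power_mult_distrib exp_of_nat_mult[symmetric] x_def power2_eq_square mult.commute mult.left_commute)
  ultimately have "real n ^ k * exp (- 2 * (real k)\<^sup>2 / real n) * fact m \<le> real m ^ k * fact m" by (intro mult_right_mono) auto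
  then have A: "real n ^ k * exp (- 2 * (real k)\<^sup>2 / real n) * fact m \<le> fact n" using fm by linarith
  have fk: "fact k \<le> real n ^ k"
  proof -
    have "fact k \<le> real (k ^ k)" using fact_le_power[of k, where 'a = real] by simp
    also have "\<dots> \<le> real n ^ k" using k by (simp add: power_mono)
    finally show ?thesis .
  qed
  have b: "real (n choose k) = fact n / (fact k * fact m)" using binomial_fact[of k n, where 'a = real] k by (simp add: m_def)
  have e: "exp (- real k * ln (real n)) = 1 / real n ^ k"
    using n0 by (simp add: exp_minus exp_of_nat_mult field_simps)
  have "fact n * exp (- real k * ln (real n) - 2 * (real k)\<^sup>2 / real n) = fact n * (exp (- real k * ln (real n)) * exp (- 2 * (real k)\<^sup>2 / real n))"
    by (simp add: exp_add[symmetric])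
  also have "\<dots> = fact n * (real n ^ k * exp (- 2 * (real k)\<^sup>2 / real n) * fact m) / (real n ^ k * real n ^ k * fact m)"
    unfolding e using n0 by (simp add: field_simps)
  also have "\<dots> \<le> fact n * fact n / (real n ^ k * real n ^ k * fact m)"
    using A by (intro divide_right_mono mult_left_mono) auto
  also have "\<dots> \<le> fact n * fact n / (fact k * fact k * fact m)"
    by (intro divide_left_mono mult_right_mono mult_mono mult_pos_pos fk) (use n0 in auto)
  also have "\<dots> = (real (n choose k))\<^sup>2 * fact m" unfolding b by (simp add: power2_eq_square)
  finally show ?thesis by (simp add: m_def)
qed

text \<open>A single first row, \<open>L\<close> rounded down, suffices: there
  \<open>k ln n \<le> 2 l\<close>, and all other losses are \<open>o(n)\<close> in the exponent,
  hence below \<open>s l\<close>.\<close>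

lemma ph_total_lower:
  assumes \<theta>: "\<theta> > 0" and s: "s > 0"
  shows "eventually (\<lambda>n. \<forall>l. lrange \<theta> n l \<longrightarrow>
    fact n * ((Lsc n l)\<^sup>2 / 2) ^ l * exp (- 2 * real l - s * real l) \<le> ph_total n l) sequentially"
proof -
  have "eventually (\<lambda>n. ln (real n) \<ge> 1) sequentially" by real_asymp
  moreover have "eventually (\<lambda>n. 16 * real n \<le> (\<theta> * real n / ln (real n))\<^sup>2) sequentially" using \<theta> by real_asymp
  moreover have "eventually (\<lambda>n. 4 \<le> \<theta> * real n / ln (real n)) sequentially" using \<theta> by real_asymp
  moreover have "eventually (\<lambda>n. 72 * \<theta>\<^sup>2 * real n / (ln (real n))\<^sup>2 + (3 * ln (real n) + (ln (real n))\<^sup>2 / \<theta>)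
      + (1 + 4 * (ln (real n) / \<theta>) + 4 * (12 * (ln (real n))\<^sup>2 / \<theta>)) \<le> s * \<theta> * real n) sequentially" using \<theta> s by real_asymp
  ultimately show ?thesis using scale_facts[OF \<theta>] row_total_ge[OF \<theta>]
  proof eventually_elim
    case (elim n)
    show ?case
    proof (intro allI impI)
      fix l assume l: "lrange \<theta> n l"
      define x where "x = real n"
      define y where "y = ln x"
      define \<kappa> where "\<kappa> = \<theta> * x / y"
      define L where "L = Lsc n l"
      have y: "y \<ge> 1" and k16: "16 * x \<le> \<kappa>\<^sup>2" and k4: "4 \<le> \<kappa>" using elim by (simp_all add: x_def y_def \<kappa>_def)
      have ll: "\<theta> * x \<le> real l" "real l \<le> 3 * \<theta> * x" using l by (auto simp: lrange_def x_def)
      have Ly: "L * y = 2 * real l" using y by (simp add: L_def Lsc_def y_def x_def)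
      have L1: "2 * \<kappa> \<le> L" unfolding \<kappa>_def L_def Lsc_def x_def[symmetric] y_def[symmetric]
        using ll y by (simp add: divide_right_mono)
      have L2: "L \<le> 6 * \<kappa>" unfolding \<kappa>_def L_def Lsc_def x_def[symmetric] y_def[symmetric]
        using ll y by (simp add: divide_right_mono)
      have L8: "L \<ge> 8" using L1 k4 by simp
      define k where "k = nat \<lfloor>L\<rfloor>"
      have kL: "real k \<le> L" "L - 1 < real k" using L8 unfolding k_def by linarith+
      have kr: "Lsc n l / 2 \<le> real k \<and> real k \<le> 2 * Lsc n l" using kL L8 unfolding L_def[symmetric] by linarith
      define m where "m = n - k"
      define K where "K = row_content k m"
      have sf: "1 \<le> k" "2 * k \<le> n" "0 < K" using elim(5)[rule_format, of l k] l kr by (auto simp: lrange_def K_def m_def)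
      have x0: "x > 0" using sf by (simp add: x_def)
      define C where "C = 1 + 4 * (ln (real n) / \<theta>) + 4 * (12 * (ln (real n))\<^sup>2 / \<theta>)"
      have row: "(real (n choose k))\<^sup>2 * fact m * K ^ l * exp (- C) \<le> row_total n l k"
      proof -
        have "- C = - 1 - 4 * (ln (real n) / \<theta>) - 4 * (12 * (ln (real n))\<^sup>2 / \<theta>)" by (simp add: C_def)
        then show ?thesis using elim(6)[rule_format, of l k] l kr by (simp add: K_def m_def)
      qed
      \<comment> \<open>Relative loss of \<open>K\<close> against \<open>L^2 / 2\<close>: the term
        \<open>3 L\<close> covers rounding \<open>L\<close> down and the linear part of the row
        content, \<open>2 x\<close> covers the boxes below the first row.\<close>
      define w where "w = (3 * L + 2 * x) / L\<^sup>2"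
      have L0: "L\<^sup>2 > 0" using L8 by simp
      have w0: "w \<ge> 0" using L8 x0 by (simp add: w_def)
      have w2: "w \<le> 1 / 2"
      proof -
        have "(2 * \<kappa>)\<^sup>2 \<le> L\<^sup>2" using L1 k4 by (intro power_mono) auto
        then have "64 * x \<le> L\<^sup>2" using k16 by (simp add: power_mult_distrib)
        moreover have "8 * L \<le> L\<^sup>2" using L8 mult_right_mono[OF L8, of L] by (simp add: power2_eq_square)
        ultimately have "3 * L + 2 * x \<le> L\<^sup>2 / 2" using L0 by linarith
        then show ?thesis using L0 by (simp add: w_def field_simps)
      qed
      have "- 2 * w \<le> - w - 2 * w\<^sup>2" using mult_left_mono[OF w2 w0] by (simp add: power2_eq_square)
      also have "\<dots> \<le> ln (1 - w)" using w0 w2 by (rule ln_one_minus_pos_lower_bound)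
      finally have "exp (- 2 * w) \<le> exp (ln (1 - w))" by (simp only: exp_le_cancel_iff)
      then have ew: "exp (- 2 * w) \<le> 1 - w" using w2 by simp
      have KL: "L\<^sup>2 / 2 * (1 - w) \<le> K"
      proof -
        have "L\<^sup>2 / 2 * (1 - w) = L\<^sup>2 / 2 - (3 * L + 2 * x) / 2" using L0 by (simp add: w_def right_diff_distrib)
        also have "\<dots> \<le> (L - 1)\<^sup>2 / 2 - L / 2 - x" 
        proof -
          have "(L - 1)\<^sup>2 = L\<^sup>2 - 2 * L + 1" by (simp add: power2_diff)
          then show ?thesis by (simp add: diff_divide_distrib add_divide_distrib)
        qed
        also have "\<dots> \<le> (real k)\<^sup>2 / 2 - real k / 2 - real m"
        proof -
          have "(L - 1)\<^sup>2 \<le> (real k)\<^sup>2" using kL L8 by (intro power_mono) auto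
          moreover have "real m \<le> x" by (simp add: m_def x_def)
          ultimately show ?thesis using kL by linarith
        qed
        also have "\<dots> = K" by (simp add: K_def row_content_def power2_eq_square right_diff_distrib diff_divide_distrib)
        finally show ?thesis .
      qed
      have Kl: "(L\<^sup>2 / 2) ^ l * exp (- 2 * w * real l) \<le> K ^ l"
      proof -
        have "(L\<^sup>2 / 2) ^ l * exp (- 2 * w * real l) = (L\<^sup>2 / 2 * exp (- 2 * w)) ^ l"
          by (simp only: power_mult_distrib exp_of_nat_mult[symmetric] mult.commute)
        also have "\<dots> \<le> K ^ l"
        proof (rule power_mono)
          have "L\<^sup>2 / 2 * exp (- 2 * w) \<le> L\<^sup>2 / 2 * (1 - w)" using ew by (intro mult_left_mono) auto
          then show "L\<^sup>2 / 2 * exp (- 2 * w) \<le> K" using KL by linarith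
        qed simp
        finally show ?thesis .
      qed
      have wl: "2 * w * real l \<le> 3 * y + y\<^sup>2 / \<theta>"
      proof -
        have rl: "real l = L * y / 2" using Ly by simp
        have "2 * w * real l = w * (L * y)" by (simp add: rl)
        also have "\<dots> = (3 * L + 2 * x) * (L * y) / L\<^sup>2" by (simp add: w_def)
        also have "\<dots> = 3 * y + 2 * x * y / L" using L8 by (simp add: power2_eq_square field_simps)
        also have "2 * x * y / L \<le> 2 * x * y / (2 * \<kappa>)" using L1 k4 x0 y L8 by (intro divide_left_mono mult_pos_pos) auto
        also have "\<dots> = y\<^sup>2 / \<theta>" using x0 y \<theta> by (simp add: \<kappa>_def power2_eq_square)
        finally show ?thesis by simp
      qed
      have kk: "2 * (real k)\<^sup>2 / real n \<le> 72 * \<theta>\<^sup>2 * x / y\<^sup>2"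
      proof -
        have "(real k)\<^sup>2 \<le> (6 * \<kappa>)\<^sup>2" using kL L2 by (intro power_mono) auto
        then have "2 * (real k)\<^sup>2 / x \<le> 2 * (6 * \<kappa>)\<^sup>2 / x" using x0 by (intro divide_right_mono) auto
        also have "\<dots> = 72 * \<theta>\<^sup>2 * x / y\<^sup>2" using x0 by (simp add: \<kappa>_def power_mult_distrib power_divide power2_eq_square)
        finally show ?thesis by (simp add: x_def)
      qed
      have kly: "real k * ln (real n) \<le> 2 * real l"
        using mult_right_mono[OF kL(1), of y] y Ly by (simp add: y_def x_def)
      have "fact n * (L\<^sup>2 / 2) ^ l * exp (- 2 * real l - s * real l) \<le>
        fact n * (L\<^sup>2 / 2) ^ l * exp ((- real k * ln (real n) - 2 * (real k)\<^sup>2 / real n) + (- 2 * w * real l) + (- C))"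
      proof -
        have "s * \<theta> * x \<le> s * real l" using ll s mult_left_mono[of "\<theta> * x" "real l" s] by simp
        then have "- 2 * real l - s * real l \<le> (- real k * ln (real n) - 2 * (real k)\<^sup>2 / real n) + (- 2 * w * real l) + (- C)"
          using elim(4) kly kk wl unfolding C_def x_def y_def by linarith
        then show ?thesis by (intro mult_left_mono) auto
      qed
      also have "\<dots> = (fact n * exp (- real k * ln (real n) - 2 * (real k)\<^sup>2 / real n)) * ((L\<^sup>2 / 2) ^ l * exp (- 2 * w * real l)) * exp (- C)"
        unfolding exp_add by (simp only: mult_ac)
      also have "\<dots> \<le> ((real (n choose k))\<^sup>2 * fact m) * K ^ l * exp (- C)"
        by (intro mult_right_mono[OF mult_mono[OF _ Kl]]) (use binom_sq_fact_lower[OF sf(1,2)] in \<open>auto simp: m_def\<close>)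
      also have "\<dots> \<le> row_total n l k" using row by simp
      also have "\<dots> \<le> ph_total n l" using sf by (intro row_total_le_ph_total) simp
      finally show "fact n * ((Lsc n l)\<^sup>2 / 2) ^ l * exp (- 2 * real l - s * real l) \<le> ph_total n l" by (simp add: L_def)
    qed
  qed
qed

text \<open>A row \<open>v\<close> above the threshold contributes at most
  \<open>n^v / (fact v)^2\<close>, and \<open>ln v \<ge> y - 3 ln y\<close> turns this into
  \<open>exp (- v (y - 6 ln y - 2))\<close>; this is the origin of \<open>(6 ln y + 2) / y\<close>.
  Smaller rows are dropped from the dimension and add at most \<open>n T\<close> to the sum of
  squares.\<close>

lemma weight_upper:
  assumes p: "p \<in> young n" and y: "y = ln (real n)" "y \<ge> 1" and T: "T = real n / y ^ 3" "T \<ge> 1"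
    and L: "L = Lsc n l" "L > 0"
    and r: "\<And>i. i < r \<Longrightarrow> real (p i) > T" "\<And>i. r \<le> i \<Longrightarrow> real (p i) \<le> T" "r \<le> n"
    and A: "A = (\<Sum>i<r. real (p i))" and Q: "Q = (\<Sum>i<r. (real (p i))\<^sup>2)"
  shows "weight l p \<le> fact n * (L\<^sup>2 / 2) ^ l * exp (real l * (- 2 * (1 - (6 * ln y + 2) / y) * (A / L) + ln (Q / L\<^sup>2 + real n * T / L\<^sup>2)))"
proof (cases "csum p > 0")
  case False
  then show ?thesis by (simp add: weight_def)
next
  case True
  have n0: "real n > 0" using T y by (cases "n = 0") auto
  define D where "D = y - 6 * ln y - 2"
  have lnT: "ln T = y - 3 * ln y" using y n0 by (simp add: T(1) ln_div ln_realpow)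
  have row: "real n ^ p i / (fact (p i))\<^sup>2 \<le> exp (- real (p i) * D)" if "i < r" for i
  proof -
    define v where "v = p i"
    have v: "real v > T" "real v \<ge> 1" using r(1)[OF that] T(2) by (auto simp: v_def)
    have v0: "real v > 0" using v by simp
    have "real v ^ v / fact v \<le> exp (real v)" by (rule pow_div_fact_le_exp) simp
    then have f: "1 / fact v \<le> exp (real v) / real v ^ v" using v0 by (simp add: field_simps)
    have "real n ^ v / (fact v)\<^sup>2 = real n ^ v * (1 / fact v)\<^sup>2" by (simp add: power_divide)
    also have "\<dots> \<le> real n ^ v * (exp (real v) / real v ^ v)\<^sup>2" using f by (intro mult_left_mono power_mono) auto
    also have "\<dots> = exp (real v * y) * exp (2 * real v) / exp (2 * real v * ln (real v))"
    proof -
      have "real n ^ v = exp (real v * y)" using n0 by (simp add: y exp_of_nat_mult)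
      moreover have "(exp (real v))\<^sup>2 = exp (2 * real v)" by (simp add: exp_double)
      moreover have "(real v ^ v)\<^sup>2 = exp (2 * real v * ln (real v))"
      proof -
        have "exp (2 * real v * ln (real v)) = (exp (real v * ln (real v)))\<^sup>2" by (simp add: exp_double[symmetric] mult.assoc)
        then show ?thesis using v0 by (simp add: exp_of_nat_mult)
      qed
      ultimately show ?thesis by (simp add: power_divide)
    qed
    also have "\<dots> = exp (real v * (y + 2 - 2 * ln (real v)))"
      by (simp add: exp_add[symmetric] exp_diff[symmetric] algebra_simps)
    also have "\<dots> \<le> exp (- real v * D)"
    proof -
      have "ln T \<le> ln (real v)" using v T(2) by (subst ln_le_cancel_iff) auto
      then have "y + 2 - 2 * ln (real v) \<le> - D" unfolding lnT D_def by linarith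
      then have "real v * (y + 2 - 2 * ln (real v)) \<le> real v * (- D)" by (intro mult_left_mono) auto
      then show ?thesis by simp
    qed
    finally show ?thesis by (simp add: v_def)
  qed
  have f: "(fdim p)\<^sup>2 \<le> fact n * exp (- A * D)"
  proof -
    have "(fdim p)\<^sup>2 \<le> fact n * (\<Prod>i<r. real n ^ p i / (fact (p i))\<^sup>2)" by (rule fdim_sq_rows[OF p])
    also have "\<dots> \<le> fact n * (\<Prod>i<r. exp (- real (p i) * D))"
      using row by (intro mult_left_mono prod_mono) auto
    also have "(\<Prod>i<r. exp (- real (p i) * D)) = exp (- A * D)"
      by (simp add: exp_sum[symmetric] A sum_distrib_right sum_negf)
    finally show ?thesis .
  qed
  have Q0: "Q \<ge> 0" unfolding Q by (intro sum_nonneg) auto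
  have cs: "csum p \<le> (Q + real n * T) / 2"
  proof -
    have "(\<Sum>i\<in>{r..<n}. (real (p i))\<^sup>2) \<le> (\<Sum>i\<in>{r..<n}. real (p i) * T)"
      using r(2) by (intro sum_mono) (auto simp: power2_eq_square intro!: mult_left_mono)
    also have "\<dots> \<le> (\<Sum>i<n. real (p i) * T)" using T(2) by (intro sum_mono2) auto
    also have "\<dots> = real (\<Sum>i<n. p i) * T" by (simp add: sum_distrib_right)
    also have "(\<Sum>i<n. p i) = n" using p by (simp add: young_def)
    finally have R: "(\<Sum>i\<in>{r..<n}. (real (p i))\<^sup>2) \<le> real n * T" .
    have "(\<Sum>i<n. (real (p i))\<^sup>2) = Q + (\<Sum>i\<in>{r..<n}. (real (p i))\<^sup>2)"
      unfolding Q using sum.atLeastLessThan_concat[of 0 r n "\<lambda>i. (real (p i))\<^sup>2"] r(3) by (simp add: atLeast0LessThan)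
    also have "\<dots> \<le> Q + real n * T" using R by (rule add_left_mono)
    finally have S: "(\<Sum>i<n. (real (p i))\<^sup>2) / 2 \<le> (Q + real n * T) / 2" by (rule divide_right_mono) simp
    show ?thesis by (rule order_trans[OF csum_le_sq[OF p] S])
  qed
  define z where "z = Q / L\<^sup>2 + real n * T / L\<^sup>2"
  have z0: "z > 0" using Q0 n0 T(2) L(2) by (auto simp: z_def intro!: add_nonneg_pos divide_pos_pos)
  have "csum p ^ l \<le> ((Q + real n * T) / 2) ^ l" using cs True by (intro power_mono) auto
  also have "(Q + real n * T) / 2 = L\<^sup>2 / 2 * z" using L(2) by (simp add: z_def field_simps)
  also have "(L\<^sup>2 / 2 * z) ^ l = (L\<^sup>2 / 2) ^ l * exp (real l * ln z)"
    unfolding power_mult_distrib[of "L\<^sup>2 / 2"] using z0 by (simp add: exp_of_nat_mult)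
  finally have c: "csum p ^ l \<le> (L\<^sup>2 / 2) ^ l * exp (real l * ln z)" .
  have "weight l p = (fdim p)\<^sup>2 * csum p ^ l" using True by (simp add: weight_def)
  also have "\<dots> \<le> (fact n * exp (- A * D)) * ((L\<^sup>2 / 2) ^ l * exp (real l * ln z))"
    using f c True by (intro mult_mono) auto
  also have "\<dots> = fact n * (L\<^sup>2 / 2) ^ l * (exp (- A * D) * exp (real l * ln z))" by (simp only: mult_ac)
  also have "exp (- A * D) * exp (real l * ln z) = exp (real l * (- 2 * (1 - (6 * ln y + 2) / y) * (A / L) + ln z))"
  proof -
    have ly: "real l = L * y / 2" using y by (simp add: L(1) Lsc_def)
    have Dy: "1 - (6 * ln y + 2) / y = D / y" using y by (simp add: D_def field_simps)
    have "y \<noteq> 0" "L \<noteq> 0" using y L(2) by auto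
    then have "real l * (- 2 * (1 - (6 * ln y + 2) / y) * (A / L)) = - A * D" unfolding ly Dy by (simp add: field_simps)
    then show ?thesis by (simp add: exp_add[symmetric] distrib_left)
  qed
  finally show ?thesis by (simp add: z_def)
qed

text \<open>By contraposition of \<open>entropy_maximiser_stable\<close>, each bad diagram loses
  \<open>exp (- t^2 l)\<close> against the optimum, whereas \<open>ph_total_lower\<close> loses only
  half that exponent. The surplus, linear in \<open>n\<close>, outweighs the number of
  partitions.\<close>

lemma first_row_deviation:
  assumes \<theta>: "\<theta> > 0" and \<epsilon>: "\<epsilon> > 0"
  shows "eventually (\<lambda>n. \<forall>l. lrange \<theta> n l \<longrightarrow>
     (\<Sum>p\<in>young n. weight l p * indicator {p. \<bar>real (p 0) / Lsc n l - 1\<bar> > \<epsilon> \<or> real (p 1) > \<epsilon> * Lsc n l} p)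
     \<le> exp (- 1 * sqrt (real n)) * ph_total n l) sequentially"
proof -
  \<comment> \<open>Stability gives a first row of at least \<open>1 - 17 t\<close> and a sum of at
    most \<open>1 + 8 t\<close> in units of \<open>L\<close>, so the second row has at most
    \<open>25 t\<close>.\<close>
  define t where "t = min (1 / 100) (\<epsilon> / 25)"
  have t: "0 < t" "t \<le> 1 / 100" "25 * t \<le> \<epsilon>" using \<epsilon> by (auto simp: t_def)
  have t2: "t\<^sup>2 > 0" "t ^ 4 > 0" using t by auto
  have "eventually (\<lambda>n. ln (real n) \<ge> 1) sequentially" by real_asymp
  moreover have "eventually (\<lambda>n. real n / ln (real n) ^ 3 \<ge> 1) sequentially" by real_asymp
  moreover have "eventually (\<lambda>n. (6 * ln (ln (real n)) + 2) / ln (real n) \<le> t\<^sup>2) sequentially" using t2 by real_asymp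
  moreover have "eventually (\<lambda>n. 1 / (4 * \<theta>\<^sup>2 * ln (real n)) \<le> t ^ 4) sequentially" using t2 \<theta> by real_asymp
  moreover have "eventually (\<lambda>n. 1 / (2 * \<theta> * (ln (real n))\<^sup>2) \<le> \<epsilon>) sequentially" using \<epsilon> \<theta> by real_asymp
  moreover have "eventually (\<lambda>n. 2 * (sqrt (real n) + 1) * ln (real n + 1) - t\<^sup>2 / 2 * (\<theta> * real n) \<le> - 1 * sqrt (real n)) sequentially"
    using t2 \<theta> by real_asymp
  moreover have "eventually (\<lambda>n. \<forall>l. lrange \<theta> n l \<longrightarrow> fact n * ((Lsc n l)\<^sup>2 / 2) ^ l * exp (- 2 * real l - t\<^sup>2 / 2 * real l) \<le> ph_total n l) sequentially"
    using t2 by (intro ph_total_lower[OF \<theta>]) auto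
  ultimately show ?thesis using eventually_ge_at_top[of 2]
  proof eventually_elim
    case (elim n)
    show ?case
    proof (intro allI impI)
      fix l assume l: "lrange \<theta> n l"
      define y where "y = ln (real n)"
      define L where "L = Lsc n l"
      define T where "T = real n / y ^ 3"
      have y: "y \<ge> 1" using elim(1) by (simp add: y_def)
      have T1: "T \<ge> 1" using elim(2) by (simp add: T_def y_def)
      have n0: "real n > 0" using elim(8) by simp
      have L1: "2 * \<theta> * real n / y \<le> L" unfolding L_def Lsc_def y_def[symmetric]
        using l y by (simp add: lrange_def divide_right_mono)
      have pos: "2 * \<theta> * real n / y > 0" using \<theta> n0 y by simp
      have L0: "L > 0" using L1 pos by linarith
      define \<eta> where "\<eta> = (6 * ln y + 2) / y"
      have \<eta>: "0 \<le> \<eta>" "\<eta> \<le> t\<^sup>2" using elim(3) y by (simp_all add: \<eta>_def y_def)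
      define \<delta> where "\<delta> = real n * T / L\<^sup>2"
      have \<delta>0: "0 < \<delta>" using n0 T1 L0 by (simp add: \<delta>_def)
      have \<delta>1: "\<delta> \<le> t ^ 4"
      proof -
        have "(2 * \<theta> * real n / y)\<^sup>2 \<le> L\<^sup>2" using L1 pos by (intro power_mono) auto
        then have "\<delta> \<le> real n * T / (2 * \<theta> * real n / y)\<^sup>2"
          unfolding \<delta>_def using n0 T1 pos L0 by (intro divide_left_mono mult_pos_pos) auto
        also have "\<dots> = 1 / (4 * \<theta>\<^sup>2 * y)"
          using n0 y \<theta> by (simp add: T_def power_divide power_mult_distrib power2_eq_square power3_eq_cube field_simps)
        finally show ?thesis using elim(4) by (simp add: y_def)
      qed
      have TL: "T / L \<le> \<epsilon>"
      proof -
        have "T / L \<le> T / (2 * \<theta> * real n / y)" using L1 pos T1 L0 by (intro divide_left_mono mult_pos_pos) auto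
        also have "\<dots> = 1 / (2 * \<theta> * y\<^sup>2)" using n0 y \<theta> by (simp add: T_def power2_eq_square power3_eq_cube field_simps)
        finally show ?thesis using elim(5) by (simp add: y_def)
      qed
      let ?Bad = "{p. \<bar>real (p 0) / L - 1\<bar> > \<epsilon> \<or> real (p 1) > \<epsilon> * L}"
      define U where "U = fact n * (L\<^sup>2 / 2) ^ l * exp (real l * (- 2 - t\<^sup>2))"
      have bad: "weight l p \<le> U" if p: "p \<in> young n" and b: "p \<in> ?Bad" for p
      proof -
        define r where "r = (LEAST i. real (p i) \<le> T)"
        have "real (p n) \<le> T" using young_zero[OF p, of n] T1 by simp
        then have r1: "real (p r) \<le> T" "r \<le> n" unfolding r_def by (rule LeastI, rule Least_le)
        have r2: "real (p i) > T" if "i < r" for i using not_less_Least[of i "\<lambda>i. real (p i) \<le> T"] that by (simp add: r_def)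
        have r3: "real (p i) \<le> T" if "r \<le> i" for i using r1(1) young_antimono[OF p that] by linarith
        define A where "A = (\<Sum>i<r. real (p i))"
        define Q where "Q = (\<Sum>i<r. (real (p i))\<^sup>2)"
        define a1 where "a1 = (if r = 0 then 0 else real (p 0) / L)"
        have A0: "A \<ge> 0" unfolding A_def by (intro sum_nonneg) auto
        have Q0: "Q \<ge> 0" unfolding Q_def by (intro sum_nonneg) auto
        have QA: "Q \<le> real (p 0) * A"
          unfolding Q_def A_def sum_distrib_left power2_eq_square
          using young_antimono[OF p, of 0] by (intro sum_mono mult_right_mono) auto
        have pA: "real (p 0) \<le> A" if "r > 0"
          unfolding A_def using that by (intro member_le_sum[of 0 "{..<r}" "\<lambda>i. real (p i)"]) auto
        have q2a: "Q / L\<^sup>2 \<le> a1 * (A / L)"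
        proof (cases "r = 0")
          case True then show ?thesis by (simp add: Q_def a1_def)
        next
          case False
          have "Q / L\<^sup>2 \<le> real (p 0) * A / L\<^sup>2" using QA by (intro divide_right_mono) auto
          then show ?thesis using False by (simp add: a1_def power2_eq_square)
        qed
        have a1a: "0 \<le> a1" "a1 \<le> A / L" using pA L0 A0 by (auto simp: a1_def divide_right_mono)
        have aa: "0 \<le> A / L" using A0 L0 by simp
        have q2b: "Q / L\<^sup>2 \<le> (A / L)\<^sup>2" using q2a mult_right_mono[OF a1a(2) aa] by (simp add: power2_eq_square)
        have "- 2 * (1 - \<eta>) * (A / L) + ln (Q / L\<^sup>2 + \<delta>) \<le> - 2 - t\<^sup>2"
        proof (rule ccontr)
          assume "\<not> ?thesis"
          then have big: "- 2 * (1 - \<eta>) * (A / L) + ln (Q / L\<^sup>2 + \<delta>) > - 2 - t\<^sup>2" by simp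
          have q0: "0 \<le> Q / L\<^sup>2" using Q0 by simp
          note da = entropy_maximiser_stable[OF t(1,2) \<eta> \<delta>0 \<delta>1 aa q0 q2b q2a a1a big]
          have "r > 0"
          proof (rule ccontr)
            assume "\<not> r > 0"
            then have "a1 = 0" by (simp add: a1_def)
            then show False using da(1) t(2) by simp
          qed
          then have a1: "a1 = real (p 0) / L" by (simp add: a1_def)
          have "\<bar>real (p 0) / L - 1\<bar> \<le> \<epsilon>" using da(1) t(1,3) unfolding a1 by linarith
          then have p1: "real (p 1) > \<epsilon> * L" using b by auto
          show False
          \<comment> \<open>Either the second row is below the threshold \<open>T\<close>, which is
            at most \<open>\<epsilon> L\<close>, or it is one of the large rows and their total
            leaves no room for it.\<close>
          proof (cases "r = 1")
            case True
            then have "real (p 1) \<le> T" using r3[of 1] by simp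
            also have "T \<le> \<epsilon> * L" using TL L0 by (simp add: field_simps)
            finally show False using p1 by simp
          next
            case False
            then have "{0, 1} \<subseteq> {..<r}" using \<open>r > 0\<close> by auto
            then have "(\<Sum>i\<in>{0, 1}. real (p i)) \<le> A" unfolding A_def by (intro sum_mono2) auto
            then have "real (p 0) / L + real (p 1) / L \<le> A / L" using L0 by (simp add: add_divide_distrib[symmetric] divide_right_mono)
            moreover have "real (p 1) / L > \<epsilon>" using p1 L0 by (simp add: field_simps)
            moreover have "real (p 0) / L \<ge> 1 - 17 * t" using da(1) unfolding a1 by linarith
            ultimately show False using da(2) t(3) by linarith
          qed
        qed
        then have "real l * (- 2 * (1 - \<eta>) * (A / L) + ln (Q / L\<^sup>2 + \<delta>)) \<le> real l * (- 2 - t\<^sup>2)" by (intro mult_left_mono) auto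
        then have "fact n * (L\<^sup>2 / 2) ^ l * exp (real l * (- 2 * (1 - \<eta>) * (A / L) + ln (Q / L\<^sup>2 + \<delta>))) \<le> U"
          unfolding U_def by (intro mult_left_mono) auto
        moreover have "weight l p \<le> fact n * (L\<^sup>2 / 2) ^ l * exp (real l * (- 2 * (1 - \<eta>) * (A / L) + ln (Q / L\<^sup>2 + \<delta>)))"
          unfolding \<eta>_def \<delta>_def by (rule weight_upper[OF p y_def y T_def T1 L_def L0 r2 r3 r1(2) A_def Q_def])
        ultimately show ?thesis by linarith
      qed
      have U0: "U \<ge> 0" by (simp add: U_def)
      have "(\<Sum>p\<in>young n. weight l p * indicator ?Bad p) \<le> (\<Sum>p\<in>young n. U)"
        using bad U0 by (intro sum_mono) (auto simp: indicator_def)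
      also have "\<dots> = real (card (young n)) * U" by simp
      also have "\<dots> \<le> exp (2 * (sqrt (real n) + 1) * ln (real n + 1)) * U"
      proof (rule mult_right_mono[OF _ U0])
        define s where "s = nat \<lceil>sqrt (real n)\<rceil>"
        have s: "sqrt (real n) \<le> real s" "real s \<le> sqrt (real n) + 1" unfolding s_def by (auto simp: of_nat_nat ceiling_correct)
        have "real n = sqrt (real n) * sqrt (real n)" by simp
        also have "\<dots> \<le> real s * real s" using s by (intro mult_mono) auto
        finally have "n \<le> s * s" by (simp flip: of_nat_mult)
        then have "real (card (young n)) \<le> (real n + 1) ^ (2 * s)"
          using card_young_le[of n s] by (metis of_nat_1 of_nat_add of_nat_le_iff of_nat_power)
        also have "\<dots> = exp (real (2 * s) * ln (real n + 1))" by (subst exp_of_nat_mult) simp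
        also have "\<dots> \<le> exp (2 * (sqrt (real n) + 1) * ln (real n + 1))" using s by (auto intro!: mult_right_mono)
        finally show "real (card (young n)) \<le> exp (2 * (sqrt (real n) + 1) * ln (real n + 1))" .
      qed
      also have "\<dots> = exp (2 * (sqrt (real n) + 1) * ln (real n + 1) + (- (t\<^sup>2 / 2) * real l)) * (fact n * (L\<^sup>2 / 2) ^ l * exp (- 2 * real l - t\<^sup>2 / 2 * real l))"
        unfolding U_def by (simp add: exp_add[symmetric] algebra_simps)
      also have "\<dots> \<le> exp (- 1 * sqrt (real n)) * ph_total n l"
      proof (rule mult_mono)
        have "t\<^sup>2 / 2 * (\<theta> * real n) \<le> t\<^sup>2 / 2 * real l" using l by (intro mult_left_mono) (auto simp: lrange_def)
        then show "exp (2 * (sqrt (real n) + 1) * ln (real n + 1) + (- (t\<^sup>2 / 2) * real l)) \<le> exp (- 1 * sqrt (real n))"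
          using elim(6) unfolding exp_le_cancel_iff by linarith
        show "fact n * (L\<^sup>2 / 2) ^ l * exp (- 2 * real l - t\<^sup>2 / 2 * real l) \<le> ph_total n l" using elim(7) l by (simp add: L_def)
      qed auto
      finally show "(\<Sum>p\<in>young n. weight l p * indicator {p. \<bar>real (p 0) / Lsc n l - 1\<bar> > \<epsilon> \<or> real (p 1) > \<epsilon> * Lsc n l} p) \<le> exp (- 1 * sqrt (real n)) * ph_total n l"
        by (simp add: L_def)
    qed
  qed
qed

section \<open>Transfer to the probability measure\<close>

lemma russian_region_iff:
  assumes \<mu>: "\<mu> \<in> partitions m" and m: "m > 0"
  shows "(x, y) \<in> russian_region \<mu> \<longleftrightarrow> (x * sqrt (real m), y * sqrt (real m)) \<in> uregion (pfun \<mu>)"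
proof -
  define r where "r = sqrt (real m)"
  have r: "r > 0" using m by (simp add: r_def)
  have sm: "sum_list \<mu> = m" using \<mu> by (simp add: partitions_def)
  let ?U = "\<Union>(i, j)\<in>young_diagram \<mu>. {(a, b). \<bar>a - (real j - real i)\<bar> + \<bar>b - (real j + real i - 1)\<bar> \<le> 1}"
  have U: "?U = uregion (pfun \<mu>)"
  proof (intro equalityI subsetI)
    fix ab assume "ab \<in> ?U"
    then obtain i j where ij: "(i, j) \<in> dg (pfun \<mu>)" and ab: "\<bar>fst ab - (real j - real i)\<bar> + \<bar>snd ab - (real j + real i - 1)\<bar> \<le> 1"
      unfolding young_diagram_eq by (auto simp: case_prod_unfold)
    obtain i' where i': "i = Suc i'" using ij by (cases i) (auto simp: dg_def)
    have "1 \<le> j \<and> j \<le> pfun \<mu> i'" using ij by (simp add: dg_def i')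
    moreover have "\<bar>fst ab - (real j - real i' - 1)\<bar> + \<bar>snd ab - (real j + real i')\<bar> \<le> 1" using ab by (simp add: i' diff_diff_eq add.commute)
    ultimately show "ab \<in> uregion (pfun \<mu>)" unfolding uregion_def case_prod_unfold by blast
  next
    fix ab assume "ab \<in> uregion (pfun \<mu>)"
    then obtain i j where ij: "1 \<le> j" "j \<le> pfun \<mu> i" and ab: "\<bar>fst ab - (real j - real i - 1)\<bar> + \<bar>snd ab - (real j + real i)\<bar> \<le> 1"
      unfolding uregion_def case_prod_unfold by blast
    have "(Suc i, j) \<in> young_diagram \<mu>" unfolding young_diagram_eq using ij by (simp add: dg_def)
    moreover have "\<bar>fst ab - (real j - real (Suc i))\<bar> + \<bar>snd ab - (real j + real (Suc i) - 1)\<bar> \<le> 1" using ab by (simp add: diff_diff_eq add.commute)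
    ultimately show "ab \<in> ?U" by (intro UN_I[of "(Suc i, j)"]) (auto simp: case_prod_unfold)
  qed
  have "(x, y) \<in> russian_region \<mu> \<longleftrightarrow> (\<exists>a b. (a, b) \<in> uregion (pfun \<mu>) \<and> x = a / r \<and> y = b / r)"
    unfolding russian_region_def U sm r_def[symmetric] by (force simp: image_iff)
  also have "\<dots> \<longleftrightarrow> (x * r, y * r) \<in> uregion (pfun \<mu>)"
  proof
    assume "\<exists>a b. (a, b) \<in> uregion (pfun \<mu>) \<and> x = a / r \<and> y = b / r"
    then show "(x * r, y * r) \<in> uregion (pfun \<mu>)" using r by auto
  next
    assume "(x * r, y * r) \<in> uregion (pfun \<mu>)"
    then show "\<exists>a b. (a, b) \<in> uregion (pfun \<mu>) \<and> x = a / r \<and> y = b / r"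
      using r by (intro exI[of _ "x * r"] exI[of _ "y * r"]) auto
  qed
  finally show ?thesis by (simp add: r_def)
qed

text \<open>The supremum in \<open>profile\<close> is a maximum: \<open>uregion_le\<close> and
  \<open>rpro_ge\<close> bound it from above, and \<open>rpro_attained\<close> supplies a point of
  the set.\<close>

lemma profile_eq:
  assumes \<mu>: "\<mu> \<in> partitions m" and m: "m > 0"
  shows "profile \<mu> x = rpro (pfun \<mu>) (x * sqrt (real m)) / sqrt (real m)"
proof -
  define r where "r = sqrt (real m)"
  have r: "r > 0" using m by (simp add: r_def)
  note p = pfun_young[OF \<mu>]
  let ?S = "insert \<bar>x\<bar> {y. (x, y) \<in> russian_region \<mu>}"
  let ?v = "rpro (pfun \<mu>) (x * r) / r"
  have ax: "\<bar>x * r\<bar> / r = \<bar>x\<bar>" using r by (simp add: abs_mult)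
  have "Sup ?S = ?v"
  proof (rule cSup_eq_maximum)
    show "?v \<in> ?S"
    proof (cases "rpro (pfun \<mu>) (x * r) = \<bar>x * r\<bar>")
      case True
      then show ?thesis using ax by simp
    next
      case False
      then have "(x * r, rpro (pfun \<mu>) (x * r)) \<in> uregion (pfun \<mu>)" using rpro_attained[OF p, of "x * r"] by simp
      moreover have "?v * r = rpro (pfun \<mu>) (x * r)" using r by simp
      ultimately have "(x, ?v) \<in> russian_region \<mu>" using russian_region_iff[OF \<mu> m, of x ?v] by (simp add: r_def)
      then show ?thesis by simp
    qed
    fix y assume "y \<in> ?S"
    then consider "y = \<bar>x\<bar>" | "(x * r, y * r) \<in> uregion (pfun \<mu>)" using russian_region_iff[OF \<mu> m, of x y] by (auto simp: r_def)
    then show "y \<le> ?v"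
    proof cases
      case 1
      then show ?thesis using divide_right_mono[OF rpro_ge[OF p, of "x * r"], of r] r ax by simp
    next
      case 2
      then show ?thesis using uregion_le[OF p 2] r by (simp add: field_simps)
    qed
  qed
  then show ?thesis by (simp add: profile_def r_def)
qed

lemma measure_pos_le:
  assumes impl: "\<And>\<mu>. \<mu> \<in> partitions n \<Longrightarrow> P \<mu> \<Longrightarrow> P' (pfun \<mu>)"
  shows "measure (plancherel_hurwitz_pos n l) {\<mu> \<in> space (plancherel_hurwitz_pos n l). P \<mu>}
    \<le> (\<Sum>p\<in>young n. weight l p * indicator {p. P' p} p) / ph_total n l"
proof -
  let ?f = "\<lambda>\<mu>. real (num_syt \<mu>) ^ 2 * real_of_int (content_sum \<mu>) ^ l / (fact n * real (hurwitz_number n l))"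
  let ?M = "plancherel_hurwitz n l"
  let ?A = "{\<mu> \<in> partitions n. content_sum \<mu> > 0}"
  let ?B = "{\<mu> \<in> partitions n. P \<mu>}"
  define h where "h = fact n * real (hurwitz_number n l)"
  have h0: "h \<ge> 0" by (simp add: h_def)
  have fin: "finite (partitions n)" by (rule finite_partitions)
  have sp: "space (plancherel_hurwitz_pos n l) = partitions n"
    by (simp add: plancherel_hurwitz_pos_def plancherel_hurwitz_def space_point_measure)
  have w: "?f \<mu> = weight l (pfun \<mu>) / h" if "\<mu> \<in> ?A" for \<mu>
  proof -
    have "\<mu> \<in> partitions n" "0 < content_sum \<mu>" using that by auto
    then have "csum (pfun \<mu>) > 0" using content_sum_eq[of \<mu> n] by (metis of_int_0_less_iff)
    then show ?thesis using num_syt_eq[of \<mu> n] content_sum_eq[of \<mu> n] that by (simp add: weight_def h_def)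
  qed
  have em: "emeasure ?M X = ennreal ((\<Sum>\<mu>\<in>X. weight l (pfun \<mu>)) / h)" if X: "X \<subseteq> ?A" for X
  proof -
    have "emeasure ?M X = (\<Sum>\<mu>\<in>X. ennreal (?f \<mu>))"
      unfolding plancherel_hurwitz_def using X fin by (intro emeasure_point_measure_finite) auto
    also have "\<dots> = (\<Sum>\<mu>\<in>X. ennreal (weight l (pfun \<mu>) / h))" using w X by (intro sum.cong) auto
    also have "\<dots> = ennreal (\<Sum>\<mu>\<in>X. weight l (pfun \<mu>) / h)" using h0 weight_nonneg by (intro sum_ennreal) auto
    finally show ?thesis by (simp add: sum_divide_distrib)
  qed
  have sets: "?A \<in> sets ?M" "?B \<in> sets ?M" by (auto simp: plancherel_hurwitz_def sets_point_measure)
  define a where "a = (\<Sum>\<mu>\<in>?A. weight l (pfun \<mu>))"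
  define b where "b = (\<Sum>\<mu>\<in>?A \<inter> ?B. weight l (pfun \<mu>))"
  have ba: "b \<le> a" unfolding a_def b_def using fin weight_nonneg by (intro sum_mono2) auto
  have b0: "b \<ge> 0" unfolding b_def using weight_nonneg by (intro sum_nonneg) auto
  have "emeasure (uniform_measure ?M ?A) ?B = ennreal (b / h) / ennreal (a / h)"
    using emeasure_uniform_measure[OF sets] em[of ?A] em[of "?A \<inter> ?B"] by (simp add: a_def b_def)
  then have meas: "measure (plancherel_hurwitz_pos n l) ?B = enn2real (ennreal (b / h) / ennreal (a / h))"
    by (simp add: plancherel_hurwitz_pos_def measure_def)
  have frac: "enn2real (ennreal (b / h) / ennreal (a / h)) \<le> b / a"
  proof (cases "a / h > 0")
    case True
    then have "ennreal (b / h) / ennreal (a / h) = ennreal ((b / h) / (a / h))" using b0 h0 by (intro divide_ennreal) auto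
    moreover have "(b / h) / (a / h) = b / a" using True by (cases "h = 0") auto
    ultimately show ?thesis using b0 ba by simp
  next
    \<comment> \<open>The conditioning event has no mass or \<open>h\<close> is 0. In both cases
      \<open>b / h\<close> is not positive, so the numerator in the extended reals is 0 and the
      bound holds trivially.\<close>
    case False
    have "b / h \<le> a / h" using ba h0 by (intro divide_right_mono) auto
    then have "b / h \<le> 0" using False by linarith
    then have "ennreal (b / h) = 0" by (rule ennreal_neg)
    then show ?thesis using b0 ba by simp
  qed
  have "a = ph_total n l"
  proof -
    have "a = (\<Sum>\<mu>\<in>partitions n. weight l (pfun \<mu>))" unfolding a_def
    proof (rule sum.mono_neutral_left[OF fin])
      show "\<forall>\<mu>\<in>partitions n - ?A. weight l (pfun \<mu>) = 0"
      proof
        fix \<mu> assume m: "\<mu> \<in> partitions n - ?A"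
        then have "real_of_int (content_sum \<mu>) \<le> 0" by auto
        then show "weight l (pfun \<mu>) = 0" using content_sum_eq[of \<mu> n] m by (simp add: weight_def)
      qed
    qed auto
    then show ?thesis unfolding ph_total_def by (simp add: sum_partitions)
  qed
  then have 1: "measure (plancherel_hurwitz_pos n l) ?B \<le> b / ph_total n l" using frac meas by simp
  have "b \<le> (\<Sum>\<mu>\<in>partitions n. weight l (pfun \<mu>) * indicator {p. P' p} (pfun \<mu>))"
  proof -
    have "b = (\<Sum>\<mu>\<in>?A \<inter> ?B. weight l (pfun \<mu>) * indicator {p. P' p} (pfun \<mu>))"
      unfolding b_def using impl by (intro sum.cong) auto
    also have "\<dots> \<le> (\<Sum>\<mu>\<in>partitions n. weight l (pfun \<mu>) * indicator {p. P' p} (pfun \<mu>))"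
      using fin weight_nonneg by (intro sum_mono2) auto
    finally show ?thesis .
  qed
  also have "\<dots> = (\<Sum>p\<in>young n. weight l p * indicator {p. P' p} p)"
    by (rule sum_partitions[of "\<lambda>p. weight l p * indicator {p. P' p} p"])
  finally have "b / ph_total n l \<le> (\<Sum>p\<in>young n. weight l p * indicator {p. P' p} p) / ph_total n l"
    using weight_nonneg by (intro divide_right_mono) (auto simp: ph_total_def intro: sum_nonneg)
  then show ?thesis using 1 by (simp add: sp)
qed

section \<open>Good diagrams and convergence in probability\<close>

definition good :: "real \<Rightarrow> nat \<Rightarrow> nat \<Rightarrow> (nat \<Rightarrow> nat) \<Rightarrow> bool" where
  "good \<epsilon> n l p \<longleftrightarrow> \<bar>real (p 0) / Lsc n l - 1\<bar> \<le> \<epsilon> \<and> real (p 1) \<le> \<epsilon> * Lsc n l \<and> typical \<epsilon> (n - p 0) (p \<circ> Suc)"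

text \<open>The bound \<open>\<epsilon> \<le> 1 / 64\<close> ensures that a diagram passing
  \<open>first_row_deviation\<close> has its first row between \<open>L / 2\<close> and
  \<open>2 L\<close> and its second below \<open>L / 64\<close>, which is the range of
  \<open>rare_tail_event\<close>.\<close>

lemma prob_not_good:
  assumes \<theta>: "\<theta> > 0" and \<epsilon>: "0 < \<epsilon>" "\<epsilon> \<le> 1 / 64" and l: "eventually (\<lambda>n. lrange \<theta> n (l n)) sequentially"
  shows "(\<lambda>n. (\<Sum>p\<in>young n. weight (l n) p * indicator {p. \<not> good \<epsilon> n (l n) p} p) / ph_total n (l n)) \<longlonglongrightarrow> 0"
proof -
  have "rare (\<lambda>m p. \<not> typical \<epsilon> m p)" using \<epsilon> by (intro rare_not_typical) auto
  from rare_tail_event[OF \<theta> this] obtain c where c: "c > 0" and ev: "eventually (\<lambda>n. \<forall>l. lrange \<theta> n l \<longrightarrow>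
     (\<Sum>p\<in>young n. weight l p * indicator {p. Lsc n l / 2 \<le> real (p 0) \<and> real (p 0) \<le> 2 * Lsc n l \<and> real (p 1) \<le> Lsc n l / 64 \<and> \<not> typical \<epsilon> (n - p 0) (p \<circ> Suc)} p)
     \<le> exp (- c * sqrt (real n)) * ph_total n l) sequentially" by blast
  have lim: "(\<lambda>n. exp (- 1 * sqrt (real n)) + exp (- c * sqrt (real n))) \<longlonglongrightarrow> 0"
    using c by (intro tendsto_add_zero; real_asymp)
  have tot0: "ph_total n k \<ge> 0" for n k unfolding ph_total_def by (intro sum_nonneg weight_nonneg)
  show ?thesis
  proof (rule tendsto_sandwich[OF _ _ tendsto_const lim])
    show "eventually (\<lambda>n. 0 \<le> (\<Sum>p\<in>young n. weight (l n) p * indicator {p. \<not> good \<epsilon> n (l n) p} p) / ph_total n (l n)) sequentially"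
      using tot0 weight_nonneg by (intro always_eventually allI divide_nonneg_nonneg sum_nonneg mult_nonneg_nonneg) auto
    show "eventually (\<lambda>n. (\<Sum>p\<in>young n. weight (l n) p * indicator {p. \<not> good \<epsilon> n (l n) p} p) / ph_total n (l n) \<le> exp (- 1 * sqrt (real n)) + exp (- c * sqrt (real n))) sequentially"
      using ev first_row_deviation[OF \<theta> \<epsilon>(1)] l scale_facts[OF \<theta>] eventually_ge_at_top[of 3]
    proof eventually_elim
      case (elim n)
      define L where "L = Lsc n (l n)"
      have lr: "\<theta> * real n \<le> real (l n)" using elim(3) by (simp add: lrange_def)
      have "real n > 1" using elim(5) by simp
      moreover from this have "real (l n) > 0" using lr \<theta> by (intro less_le_trans[OF _ lr] mult_pos_pos) auto
      ultimately have L0: "L > 0" unfolding L_def Lsc_def by (intro divide_pos_pos) auto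
      let ?B1 = "{p. \<bar>real (p 0) / L - 1\<bar> > \<epsilon> \<or> real (p 1) > \<epsilon> * L}"
      let ?B2 = "{p. L / 2 \<le> real (p 0) \<and> real (p 0) \<le> 2 * L \<and> real (p 1) \<le> L / 64 \<and> \<not> typical \<epsilon> (n - p 0) (p \<circ> Suc)}"
      have cover: "indicator {p. \<not> good \<epsilon> n (l n) p} p \<le> indicator ?B1 p + (indicator ?B2 p :: real)" for p
      proof (cases "p \<in> ?B1")
        case False
        then have a: "\<bar>real (p 0) / L - 1\<bar> \<le> \<epsilon>" "real (p 1) \<le> \<epsilon> * L" by auto
        have "1 / 2 \<le> real (p 0) / L" "real (p 0) / L \<le> 2" using a(1) \<epsilon> by linarith+
        then have "L / 2 \<le> real (p 0)" "real (p 0) \<le> 2 * L" using L0 by (simp_all add: field_simps)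
        moreover have "\<epsilon> * L \<le> 1 / 64 * L" using \<epsilon> L0 by (intro mult_right_mono) auto
        then have "real (p 1) \<le> L / 64" using a(2) by simp
        ultimately show ?thesis using a by (auto simp: good_def L_def indicator_def)
      qed (auto simp: indicator_def)
      have "(\<Sum>p\<in>young n. weight (l n) p * indicator {p. \<not> good \<epsilon> n (l n) p} p) \<le> (\<Sum>p\<in>young n. weight (l n) p * (indicator ?B1 p + indicator ?B2 p))"
        by (intro sum_mono mult_left_mono cover weight_nonneg)
      also have "\<dots> = (\<Sum>p\<in>young n. weight (l n) p * indicator ?B1 p) + (\<Sum>p\<in>young n. weight (l n) p * indicator ?B2 p)"
        by (simp add: distrib_left sum.distrib)
      also have "\<dots> \<le> exp (- 1 * sqrt (real n)) * ph_total n (l n) + exp (- c * sqrt (real n)) * ph_total n (l n)"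
        using elim(1,2,3) unfolding L_def by (intro add_mono) blast+
      also have "\<dots> = (exp (- 1 * sqrt (real n)) + exp (- c * sqrt (real n))) * ph_total n (l n)" by (simp only: distrib_right)
      finally have le: "(\<Sum>p\<in>young n. weight (l n) p * indicator {p. \<not> good \<epsilon> n (l n) p} p) \<le> (exp (- 1 * sqrt (real n)) + exp (- c * sqrt (real n))) * ph_total n (l n)" .
      show ?case
      proof (cases "ph_total n (l n) = 0")
        case False
        then have "ph_total n (l n) > 0" using tot0[of n "l n"] by simp
        then show ?thesis using le by (simp only: pos_divide_le_eq)
      qed (simp add: add_nonneg_nonneg)
    qed
  qed
qed

text \<open>The margin \<open>3 * \<epsilon>\<close> leaves room for passing from
  \<open>sqrt m\<close> to \<open>sqrt n\<close> and for the bounded discrepancies in counting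
  rows.\<close>

lemma tendsto_in_prob_good:
  assumes \<theta>: "\<theta> > 0" and l: "eventually (\<lambda>n. lrange \<theta> n (l n)) sequentially"
    and imp: "\<And>\<epsilon>. 0 < \<epsilon> \<Longrightarrow> \<epsilon> \<le> 1 / 64 \<Longrightarrow> eventually (\<lambda>n. \<forall>\<mu>\<in>partitions n. good \<epsilon> n (l n) (pfun \<mu>) \<longrightarrow> \<bar>X n \<mu> - c\<bar> \<le> 3 * \<epsilon>) sequentially"
  shows "tendsto_in_prob (\<lambda>n. plancherel_hurwitz_pos n (l n)) X c"
  unfolding tendsto_in_prob_def
proof (intro allI impI)
  fix e :: real assume e: "e > 0"
  define \<epsilon> where "\<epsilon> = min (1 / 64) (e / 3)"
  have \<epsilon>: "0 < \<epsilon>" "\<epsilon> \<le> 1 / 64" "3 * \<epsilon> \<le> e" using e by (auto simp: \<epsilon>_def)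
  show "(\<lambda>n. measure (plancherel_hurwitz_pos n (l n)) {\<omega> \<in> space (plancherel_hurwitz_pos n (l n)). e < \<bar>X n \<omega> - c\<bar>}) \<longlonglongrightarrow> 0"
  proof (rule tendsto_sandwich[OF _ _ tendsto_const prob_not_good[OF \<theta> \<epsilon>(1,2) l]])
    show "eventually (\<lambda>n. 0 \<le> measure (plancherel_hurwitz_pos n (l n)) {\<omega> \<in> space (plancherel_hurwitz_pos n (l n)). e < \<bar>X n \<omega> - c\<bar>}) sequentially"
      by simp
    show "eventually (\<lambda>n. measure (plancherel_hurwitz_pos n (l n)) {\<omega> \<in> space (plancherel_hurwitz_pos n (l n)). e < \<bar>X n \<omega> - c\<bar>}
      \<le> (\<Sum>p\<in>young n. weight (l n) p * indicator {p. \<not> good \<epsilon> n (l n) p} p) / ph_total n (l n)) sequentially"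
      using imp[OF \<epsilon>(1,2)]
    proof eventually_elim
      case (elim n)
      show ?case
        by (rule measure_pos_le) (use elim \<epsilon>(3) in force)
    qed
  qed
qed

text \<open>The first row is at most \<open>2 L\<close>, of order \<open>n / ln n\<close>, so
  removing it changes the size by a factor tending to 1.\<close>

lemma good_size:
  assumes \<theta>: "\<theta> > 0" and l: "eventually (\<lambda>n. lrange \<theta> n (l n)) sequentially" and \<epsilon>: "0 < \<epsilon>" "\<epsilon> \<le> 1 / 64"
  shows "eventually (\<lambda>n. \<forall>p. good \<epsilon> n (l n) p \<longrightarrow> n \<le> 2 * (n - p 0) \<and> (1 - \<epsilon> / 4) * real n \<le> real (n - p 0)) sequentially"
proof -
  have "eventually (\<lambda>n. 12 * \<theta> / ln (real n) \<le> \<epsilon> / 4) sequentially" using \<theta> \<epsilon> by real_asymp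
  moreover have "eventually (\<lambda>n. ln (real n) \<ge> 1) sequentially" by real_asymp
  ultimately show ?thesis using l
  proof eventually_elim
    case (elim n)
    show ?case
    proof (intro allI impI)
      fix p assume g: "good \<epsilon> n (l n) p"
      define L where "L = Lsc n (l n)"
      have "real (l n) \<le> 3 * \<theta> * real n" using elim(3) by (simp add: lrange_def)
      then have L6: "L \<le> 6 * \<theta> * real n / ln (real n)" unfolding L_def Lsc_def using elim(2) by (intro divide_right_mono) auto
      have "real (p 0) / L \<le> 2" using g \<epsilon> unfolding good_def L_def by linarith
      moreover have "L \<ge> 0" using elim(2) by (simp add: L_def Lsc_def)
      ultimately have "real (p 0) \<le> 2 * L"
      proof (cases "L = 0")
        case True
        then show ?thesis using g \<epsilon> by (simp add: good_def L_def)
      qed (simp add: field_simps)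
      also have "\<dots> \<le> (12 * \<theta> / ln (real n)) * real n" using L6 by simp
      also have "\<dots> \<le> \<epsilon> / 4 * real n" using elim(1) by (intro mult_right_mono) auto
      finally have p0: "real (p 0) \<le> \<epsilon> / 4 * real n" .
      then have "real (p 0) \<le> 1 / 2 * real n" using \<epsilon> mult_right_mono[of "\<epsilon> / 4" "1 / 2" "real n"] by linarith
      then have "2 * p 0 \<le> n" by linarith
      then show "n \<le> 2 * (n - p 0) \<and> (1 - \<epsilon> / 4) * real n \<le> real (n - p 0)"
        using p0 by (simp add: of_nat_diff left_diff_distrib)
    qed
  qed
qed

lemma rescale_sqrt:
  assumes n: "n > 0" and m: "m \<le> n" "(1 - h) * real n \<le> real m" "m > 0" and h: "0 \<le> h" "h \<le> 1"
    and z: "\<bar>z / sqrt (real m) - 2\<bar> \<le> e"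
  shows "\<bar>z / sqrt (real n) - 2\<bar> \<le> e + 2 * h"
proof -
  define \<rho> where "\<rho> = sqrt (real m) / sqrt (real n)"
  have \<rho>1: "\<rho> \<le> 1" "\<rho> \<ge> 0" using n m by (auto simp: \<rho>_def)
  have "\<rho>\<^sup>2 = real m / real n" by (simp add: \<rho>_def power_divide)
  moreover have "1 - h \<le> real m / real n" using m(2) n by (simp add: pos_le_divide_eq)
  ultimately have "1 - h \<le> \<rho>\<^sup>2" by simp
  also have "\<dots> \<le> \<rho>" using \<rho>1 mult_left_mono[OF \<rho>1(1) \<rho>1(2)] by (simp add: power2_eq_square)
  finally have \<rho>h: "1 - h \<le> \<rho>" .
  define w where "w = z / sqrt (real m) - 2"
  have "z / sqrt (real n) - 2 = \<rho> * w + 2 * (\<rho> - 1)" using m by (simp add: \<rho>_def w_def right_diff_distrib)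
  also have "\<bar>\<dots>\<bar> \<le> \<bar>\<rho> * w\<bar> + \<bar>2 * (\<rho> - 1)\<bar>" by (rule abs_triangle_ineq)
  also have "\<bar>\<rho> * w\<bar> \<le> 1 * e" unfolding abs_mult using \<rho>1 z by (intro mult_mono) (auto simp: w_def)
  also have "\<bar>2 * (\<rho> - 1)\<bar> \<le> 2 * h" using \<rho>1 \<rho>h by (simp add: abs_le_iff)
  finally show ?thesis by simp
qed

theorem theorem1p2:
  fixes \<theta> :: real and l :: "nat \<Rightarrow> nat"
  assumes "\<theta> > 0"
    and "\<And>n. n \<ge> 1 \<Longrightarrow> even (l n)"
    and "(\<lambda>n. real (l n)) \<sim>[at_top] (\<lambda>n. 2 * \<theta> * real n)"
  shows
    "tendsto_in_prob (\<lambda>n. plancherel_hurwitz_pos n (l n))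
       (\<lambda>n \<mu>. real (nth_part \<mu> 1) * inverse (2 * real (l n) / ln (real n))) 1
     \<and> tendsto_in_prob (\<lambda>n. plancherel_hurwitz_pos n (l n))
       (\<lambda>n \<mu>. SUP x. \<bar>profile (tl \<mu>) x - limit_shape x\<bar>) 0
     \<and> tendsto_in_prob (\<lambda>n. plancherel_hurwitz_pos n (l n))
       (\<lambda>n \<mu>. real (nth_part \<mu> 2) / sqrt (real n)) 2
     \<and> tendsto_in_prob (\<lambda>n. plancherel_hurwitz_pos n (l n))
       (\<lambda>n \<mu>. real (length \<mu>) / sqrt (real n)) 2"
proof -
  note \<theta> = assms(1)
  have l: "eventually (\<lambda>n. lrange \<theta> n (l n)) sequentially"
  proof -
    have "((\<lambda>n. real (l n) / (2 * \<theta> * real n)) \<longlongrightarrow> 1) at_top"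
      using assms(3) by (rule asymp_equivD_strong) (use \<theta> in \<open>auto simp: eventually_at_top_linorder intro!: exI[of _ 1]\<close>)
    from order_tendstoD(1)[OF this, of "1 / 2"] order_tendstoD(2)[OF this, of "3 / 2"]
    have "eventually (\<lambda>n. 1 / 2 < real (l n) / (2 * \<theta> * real n)) sequentially"
      "eventually (\<lambda>n. real (l n) / (2 * \<theta> * real n) < 3 / 2) sequentially" by simp_all
    then show ?thesis using eventually_gt_at_top[of 0]
    proof eventually_elim
      case (elim n)
      then show ?case using \<theta> by (simp add: lrange_def field_simps)
    qed
  qed
  have first: "nth_part \<mu> 1 = pfun \<mu> 0" "nth_part \<mu> 2 = (pfun \<mu> \<circ> Suc) 0" for \<mu> by (simp_all add: nth_part_def pfun_def)
  have tail: "tl \<mu> \<in> partitions (n - pfun \<mu> 0)" "pfun (tl \<mu>) = pfun \<mu> \<circ> Suc" if "\<mu> \<in> partitions n" for \<mu> n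
    using tl_partitions[OF that] pfun_tl by auto
  have 1: "tendsto_in_prob (\<lambda>n. plancherel_hurwitz_pos n (l n)) (\<lambda>n \<mu>. real (nth_part \<mu> 1) * inverse (2 * real (l n) / ln (real n))) 1"
  proof (rule tendsto_in_prob_good[OF \<theta> l])
    fix \<epsilon> :: real assume "0 < \<epsilon>" "\<epsilon> \<le> 1 / 64"
    then show "eventually (\<lambda>n. \<forall>\<mu>\<in>partitions n. good \<epsilon> n (l n) (pfun \<mu>) \<longrightarrow> \<bar>real (nth_part \<mu> 1) * inverse (2 * real (l n) / ln (real n)) - 1\<bar> \<le> 3 * \<epsilon>) sequentially"
      by (intro always_eventually allI ballI impI) (auto simp only: good_def Lsc_def first divide_inverse[symmetric])
  qed
  have 2: "tendsto_in_prob (\<lambda>n. plancherel_hurwitz_pos n (l n)) (\<lambda>n \<mu>. SUP x. \<bar>profile (tl \<mu>) x - limit_shape x\<bar>) 0"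
  proof (rule tendsto_in_prob_good[OF \<theta> l])
    fix \<epsilon> :: real assume \<epsilon>: "0 < \<epsilon>" "\<epsilon> \<le> 1 / 64"
    show "eventually (\<lambda>n. \<forall>\<mu>\<in>partitions n. good \<epsilon> n (l n) (pfun \<mu>) \<longrightarrow> \<bar>(SUP x. \<bar>profile (tl \<mu>) x - limit_shape x\<bar>) - 0\<bar> \<le> 3 * \<epsilon>) sequentially"
      using good_size[OF \<theta> l \<epsilon>] eventually_gt_at_top[of 0]
    proof eventually_elim
      case (elim n)
      show ?case
      proof (intro ballI impI)
        fix \<mu> assume \<mu>: "\<mu> \<in> partitions n" and g: "good \<epsilon> n (l n) (pfun \<mu>)"
        define m where "m = n - pfun \<mu> 0"
        have m: "m > 0" using elim g by (auto simp: m_def)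
        have b: "\<bar>profile (tl \<mu>) x - limit_shape x\<bar> \<le> \<epsilon>" for x
          using g profile_eq[OF tail(1)[OF \<mu>, folded m_def] m, of x] by (simp add: good_def typical_def m_def tail(2)[OF \<mu>])
        have "(SUP x. \<bar>profile (tl \<mu>) x - limit_shape x\<bar>) \<le> \<epsilon>" by (rule cSUP_least) (use b in auto)
        \<comment> \<open>The value at one point shows that the supremum is nonnegative;
          boundedness, needed for this, comes from the uniform bound.\<close>
        moreover have "\<bar>profile (tl \<mu>) 0 - limit_shape 0\<bar> \<le> (SUP x. \<bar>profile (tl \<mu>) x - limit_shape x\<bar>)"
          by (rule cSUP_upper) (use b in \<open>auto intro!: bdd_aboveI[of _ \<epsilon>]\<close>)
        ultimately show "\<bar>(SUP x. \<bar>profile (tl \<mu>) x - limit_shape x\<bar>) - 0\<bar> \<le> 3 * \<epsilon>" using \<epsilon> by linarith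
      qed
    qed
  qed
  have 3: "tendsto_in_prob (\<lambda>n. plancherel_hurwitz_pos n (l n)) (\<lambda>n \<mu>. real (nth_part \<mu> 2) / sqrt (real n)) 2"
  proof (rule tendsto_in_prob_good[OF \<theta> l])
    fix \<epsilon> :: real assume \<epsilon>: "0 < \<epsilon>" "\<epsilon> \<le> 1 / 64"
    show "eventually (\<lambda>n. \<forall>\<mu>\<in>partitions n. good \<epsilon> n (l n) (pfun \<mu>) \<longrightarrow> \<bar>real (nth_part \<mu> 2) / sqrt (real n) - 2\<bar> \<le> 3 * \<epsilon>) sequentially"
      using good_size[OF \<theta> l \<epsilon>] eventually_gt_at_top[of 0]
    proof eventually_elim
      case (elim n)
      show ?case
      proof (intro ballI impI)
        fix \<mu> assume \<mu>: "\<mu> \<in> partitions n" and g: "good \<epsilon> n (l n) (pfun \<mu>)"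
        define m where "m = n - pfun \<mu> 0"
        have m: "m > 0" "m \<le> n" "(1 - \<epsilon> / 4) * real n \<le> real m" using elim g by (auto simp: m_def)
        have "\<bar>real ((pfun \<mu> \<circ> Suc) 0) / sqrt (real m) - 2\<bar> \<le> \<epsilon>" using g by (simp add: good_def typical_def m_def)
        then have "\<bar>real ((pfun \<mu> \<circ> Suc) 0) / sqrt (real n) - 2\<bar> \<le> \<epsilon> + 2 * (\<epsilon> / 4)"
          using \<epsilon> by (intro rescale_sqrt[OF elim(2) m(2,3,1)]) auto
        then show "\<bar>real (nth_part \<mu> 2) / sqrt (real n) - 2\<bar> \<le> 3 * \<epsilon>" unfolding first using \<epsilon> by linarith
      qed
    qed
  qed
  have 4: "tendsto_in_prob (\<lambda>n. plancherel_hurwitz_pos n (l n)) (\<lambda>n \<mu>. real (length \<mu>) / sqrt (real n)) 2"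
  proof (rule tendsto_in_prob_good[OF \<theta> l])
    fix \<epsilon> :: real assume \<epsilon>: "0 < \<epsilon>" "\<epsilon> \<le> 1 / 64"
    \<comment> \<open>Two extra rows, the first row itself and one from rounding the number of rows
      below it, become negligible after division by \<open>sqrt m\<close>.\<close>
    have "eventually (\<lambda>n. 2 / sqrt (real n / 2) \<le> \<epsilon>) sequentially" using \<epsilon> by real_asymp
    then show "eventually (\<lambda>n. \<forall>\<mu>\<in>partitions n. good \<epsilon> n (l n) (pfun \<mu>) \<longrightarrow> \<bar>real (length \<mu>) / sqrt (real n) - 2\<bar> \<le> 3 * \<epsilon>) sequentially"
      using good_size[OF \<theta> l \<epsilon>] eventually_gt_at_top[of 0]
    proof eventually_elim
      case (elim n)
      show ?case
      proof (intro ballI impI)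
        fix \<mu> assume \<mu>: "\<mu> \<in> partitions n" and g: "good \<epsilon> n (l n) (pfun \<mu>)"
        define m where "m = n - pfun \<mu> 0"
        have m: "m > 0" "m \<le> n" "(1 - \<epsilon> / 4) * real n \<le> real m" "n \<le> 2 * m" using elim g by (auto simp: m_def)
        define r where "r = sqrt (real m)"
        have r: "r > 0" using m by (simp add: r_def)
        have r2: "2 / r \<le> \<epsilon>"
        proof -
          have "2 / r \<le> 2 / sqrt (real n / 2)" unfolding r_def using m elim(3) by (intro divide_left_mono real_sqrt_le_mono mult_pos_pos) auto
          then show ?thesis using elim(1) by linarith
        qed
        let ?q = "pfun \<mu> \<circ> Suc"
        define d where "d = length (tl \<mu>)"
        have \<mu>0: "\<mu> \<noteq> []" using \<mu> elim(3) by (auto simp: partitions_def)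
        have len: "length \<mu> = d + 1" using \<mu>0 by (cases \<mu>) (auto simp: d_def)
        have qd: "0 < ?q i \<longleftrightarrow> i < d" for i
          using pfun_pos_iff[OF tail(1)[OF \<mu>], of i] by (simp add: tail(2)[OF \<mu>] d_def)
        have ty: "\<And>i. real i \<ge> (2 + \<epsilon>) * r \<Longrightarrow> ?q i = 0" "\<exists>i. real i + 1 \<ge> (2 - \<epsilon>) * r \<and> ?q i \<noteq> 0"
          using g by (auto simp: good_def typical_def m_def r_def)
        have up: "real d \<le> (2 + \<epsilon>) * r + 1"
        proof (cases "d = 0")
          case True
          then show ?thesis using r \<epsilon> by simp
        next
          case False
          then have "?q (d - 1) \<noteq> 0" using qd[of "d - 1"] by simp
          then have "real (d - 1) < (2 + \<epsilon>) * r" using ty(1)[of "d - 1"] by (meson not_le)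
          then show ?thesis using False by (simp add: of_nat_diff)
        qed
        have low: "real d \<ge> (2 - \<epsilon>) * r"
        proof -
          obtain i where i: "real i + 1 \<ge> (2 - \<epsilon>) * r" "?q i \<noteq> 0" using ty(2) by blast
          then have "i < d" using qd[of i] by simp
          then have "real i + 1 \<le> real d" by simp
          then show ?thesis using i(1) by linarith
        qed
        have z: "\<bar>real (length \<mu>) / r - 2\<bar> \<le> 2 * \<epsilon>"
        proof -
          have "real (length \<mu>) / r \<le> ((2 + \<epsilon>) * r + 2) / r" using up r unfolding len by (intro divide_right_mono) auto
          also have "\<dots> = 2 + \<epsilon> + 2 / r" using r by (simp add: add_divide_distrib)
          finally have a: "real (length \<mu>) / r \<le> 2 + 2 * \<epsilon>" using r2 by linarith
          have "(2 - \<epsilon>) * r / r \<le> real (length \<mu>) / r" using low r unfolding len by (intro divide_right_mono) auto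
          then have "2 - \<epsilon> \<le> real (length \<mu>) / r" using r by simp
          then show ?thesis using a \<epsilon> by (simp add: abs_le_iff)
        qed
        then have "\<bar>real (length \<mu>) / sqrt (real n) - 2\<bar> \<le> 2 * \<epsilon> + 2 * (\<epsilon> / 4)"
          unfolding r_def using \<epsilon> by (intro rescale_sqrt[OF elim(3) m(2,3,1)]) auto
        then show "\<bar>real (length \<mu>) / sqrt (real n) - 2\<bar> \<le> 3 * \<epsilon>" using \<epsilon> by linarith
      qed
    qed
  qed
  show ?thesis using 1 2 3 4 by blast
qed

end
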